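(* Let $\mathcal{E}$ be an extensive category with pullbacks and pullback-stable coequalisers in which the forgetful functor $\mathcal{U}: \mathbf{Cat}(\mathcal{E})_1 \to \mathbf{Gph}(\mathcal{E})$ has a left adjoint. Then the $2$-category $\mathbf{Cat}(\mathcal{E})$ has finite $2$-colimits.
   Context: For a category $\mathcal{E}$ with pullbacks, $\mathbf{Cat}(\mathcal{E})$ is the $2$-category of categories internal to $\mathcal{E}$, internal functors and internal natural transformations; $\mathbf{Cat}(\mathcal{E})_1$ is its underlying $1$-category. $\mathbf{Gph}(\mathcal{E})$ is the category of internal graphs in $\mathcal{E}$, i.e. of parallel pairs $s,t: G_1 \rightrightarrows G_0$ in $\mathcal{E}$, with the evident morphisms; $\mathcal{U}$ sends an internal category to its underlying graph of objects, morphisms, source and target. A category is extensive if it has finite coproducts and, for all objects $A,B$, the canonical functor $\mathcal{E}/A \times \mathcal{E}/B \to \mathcal{E}/(A+B)$ is an equivalence. A category $\mathcal{E}$ with pullbacks has pullback-stable coequalisers if it has coequalisers and for every morphism $f: X \to Y$ in $\mathcal{E}$ the pullback functor $f^{*}: \mathcal{E}/Y \to \mathcal{E}/X$ preserves coequalisers. Finite $2$-colimits are finite $\mathbf{Cat}$-weighted colimits in the strict ($\mathbf{Cat}$-enriched) sense. *)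

theory Defs
  imports Main "HOL-Library.FuncSet"
begin

section \<open>Categories, functors, natural transformations\<close>

record ('o, 'a) cat =
  Obj :: "'o set"
  Arr :: "'a set"
  Dom :: "'a \<Rightarrow> 'o"
  Cod :: "'a \<Rightarrow> 'o"
  Ide :: "'o \<Rightarrow> 'a"
  Cmp :: "'a \<Rightarrow> 'a \<Rightarrow> 'a"  (infixl "\<cdot>\<index>" 70)

definition hom :: "('o, 'a) cat \<Rightarrow> 'o \<Rightarrow> 'o \<Rightarrow> 'a set" where
  "hom C a b = {f \<in> Arr C. Dom C f = a \<and> Cod C f = b}"

definition category :: "('o, 'a) cat \<Rightarrow> bool" where
  "category C \<longleftrightarrow>
     (\<forall>f \<in> Arr C. Dom C f \<in> Obj C \<and> Cod C f \<in> Obj C) \<and>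
     (\<forall>a \<in> Obj C. Ide C a \<in> hom C a a) \<and>
     (\<forall>f \<in> Arr C. \<forall>g \<in> Arr C. Cod C f = Dom C g \<longrightarrow> g \<cdot>\<^bsub>C\<^esub> f \<in> hom C (Dom C f) (Cod C g)) \<and>
     (\<forall>f \<in> Arr C. f \<cdot>\<^bsub>C\<^esub> Ide C (Dom C f) = f \<and> Ide C (Cod C f) \<cdot>\<^bsub>C\<^esub> f = f) \<and>
     (\<forall>f \<in> Arr C. \<forall>g \<in> Arr C. \<forall>h \<in> Arr C. Cod C f = Dom C g \<longrightarrow> Cod C g = Dom C h \<longrightarrow>
        (h \<cdot>\<^bsub>C\<^esub> g) \<cdot>\<^bsub>C\<^esub> f = h \<cdot>\<^bsub>C\<^esub> (g \<cdot>\<^bsub>C\<^esub> f))"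

definition is_iso :: "('o, 'a) cat \<Rightarrow> 'a \<Rightarrow> bool" where
  "is_iso C f \<longleftrightarrow> f \<in> Arr C \<and>
     (\<exists>g \<in> hom C (Cod C f) (Dom C f). g \<cdot>\<^bsub>C\<^esub> f = Ide C (Dom C f) \<and> f \<cdot>\<^bsub>C\<^esub> g = Ide C (Cod C f))"

record ('o, 'a, 'p, 'b) func =
  fo :: "'o \<Rightarrow> 'p"
  fa :: "'a \<Rightarrow> 'b"

definition is_functor ::
    "('o, 'a) cat \<Rightarrow> ('p, 'b) cat \<Rightarrow> ('o, 'a, 'p, 'b) func \<Rightarrow> bool" where
  "is_functor C D F \<longleftrightarrow>
     (\<forall>x \<in> Obj C. fo F x \<in> Obj D) \<and>
     (\<forall>f \<in> Arr C. fa F f \<in> hom D (fo F (Dom C f)) (fo F (Cod C f))) \<and>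
     (\<forall>x \<in> Obj C. fa F (Ide C x) = Ide D (fo F x)) \<and>
     (\<forall>f \<in> Arr C. \<forall>g \<in> Arr C. Cod C f = Dom C g \<longrightarrow> fa F (g \<cdot>\<^bsub>C\<^esub> f) = fa F g \<cdot>\<^bsub>D\<^esub> fa F f)"

definition id_func :: "('o, 'a) cat \<Rightarrow> ('o, 'a, 'o, 'a) func" where
  "id_func C = \<lparr>fo = (\<lambda>x \<in> Obj C. x), fa = (\<lambda>f \<in> Arr C. f)\<rparr>"

definition comp_func ::
    "('o, 'a) cat \<Rightarrow> ('p, 'b, 'q, 'd) func \<Rightarrow> ('o, 'a, 'p, 'b) func \<Rightarrow> ('o, 'a, 'q, 'd) func" where
  "comp_func C G F = \<lparr>fo = (\<lambda>x \<in> Obj C. fo G (fo F x)), fa = (\<lambda>f \<in> Arr C. fa G (fa F f))\<rparr>"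

definition is_nat_trans ::
    "('o, 'a) cat \<Rightarrow> ('p, 'b) cat \<Rightarrow> ('o, 'a, 'p, 'b) func \<Rightarrow> ('o, 'a, 'p, 'b) func \<Rightarrow> ('o \<Rightarrow> 'b) \<Rightarrow> bool" where
  "is_nat_trans C D F G t \<longleftrightarrow>
     is_functor C D F \<and> is_functor C D G \<and>
     (\<forall>x \<in> Obj C. t x \<in> hom D (fo F x) (fo G x)) \<and>
     (\<forall>f \<in> Arr C. t (Cod C f) \<cdot>\<^bsub>D\<^esub> fa F f = fa G f \<cdot>\<^bsub>D\<^esub> t (Dom C f))"

definition naturally_isomorphic ::
    "('o, 'a) cat \<Rightarrow> ('p, 'b) cat \<Rightarrow> ('o, 'a, 'p, 'b) func \<Rightarrow> ('o, 'a, 'p, 'b) func \<Rightarrow> bool" where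
  "naturally_isomorphic C D F G \<longleftrightarrow>
     (\<exists>t. is_nat_trans C D F G t \<and> (\<forall>x \<in> Obj C. is_iso D (t x)))"

definition is_equivalence ::
    "('o, 'a) cat \<Rightarrow> ('p, 'b) cat \<Rightarrow> ('o, 'a, 'p, 'b) func \<Rightarrow> bool" where
  "is_equivalence C D F \<longleftrightarrow> is_functor C D F \<and>
     (\<exists>G. is_functor D C G \<and>
        naturally_isomorphic C C (id_func C) (comp_func C G F) \<and>
        naturally_isomorphic D D (comp_func D F G) (id_func D))"

definition is_isomorphism ::
    "('o, 'a) cat \<Rightarrow> ('p, 'b) cat \<Rightarrow> ('o, 'a, 'p, 'b) func \<Rightarrow> bool" where
  "is_isomorphism C D F \<longleftrightarrow> is_functor C D F \<and>
     (\<exists>G. is_functor D C G \<and> comp_func C G F = id_func C \<and> comp_func D F G = id_func D)"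

text \<open>\<open>U : C \<rightarrow> D\<close> has a left adjoint \<open>F\<close>, with unit \<open>\<eta>\<close> and counit \<open>\<epsilon>\<close>.\<close>

definition has_left_adjoint ::
    "('o, 'a) cat \<Rightarrow> ('p, 'b) cat \<Rightarrow> ('o, 'a, 'p, 'b) func \<Rightarrow> bool" where
  "has_left_adjoint C D U \<longleftrightarrow> is_functor C D U \<and>
     (\<exists>F \<eta> \<epsilon>. is_functor D C F \<and>
        is_nat_trans D D (id_func D) (comp_func D U F) \<eta> \<and>
        is_nat_trans C C (comp_func C F U) (id_func C) \<epsilon> \<and>
        (\<forall>y \<in> Obj D. \<epsilon> (fo F y) \<cdot>\<^bsub>C\<^esub> fa F (\<eta> y) = Ide C (fo F y)) \<and>
        (\<forall>x \<in> Obj C. fa U (\<epsilon> x) \<cdot>\<^bsub>D\<^esub> \<eta> (fo U x) = Ide D (fo U x)))"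

definition prod_cat :: "('o, 'a) cat \<Rightarrow> ('p, 'b) cat \<Rightarrow> ('o \<times> 'p, 'a \<times> 'b) cat" where
  "prod_cat C D =
     \<lparr>Obj = Obj C \<times> Obj D, Arr = Arr C \<times> Arr D,
      Dom = (\<lambda>(f, g). (Dom C f, Dom D g)), Cod = (\<lambda>(f, g). (Cod C f, Cod D g)),
      Ide = (\<lambda>(x, y). (Ide C x, Ide D y)),
      Cmp = (\<lambda>(f', g') (f, g). (f' \<cdot>\<^bsub>C\<^esub> f, g' \<cdot>\<^bsub>D\<^esub> g))\<rparr>"

text \<open>The arrow \<open>(f, h, g)\<close> of the slice category is \<open>h : f \<rightarrow> g\<close>.\<close>

definition slice :: "('o, 'a) cat \<Rightarrow> 'o \<Rightarrow> ('a, 'a \<times> 'a \<times> 'a) cat" where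
  "slice C A =
     \<lparr>Obj = {f \<in> Arr C. Cod C f = A},
      Arr = {(f, h, g). f \<in> Arr C \<and> Cod C f = A \<and> g \<in> Arr C \<and> Cod C g = A \<and>
                        h \<in> hom C (Dom C f) (Dom C g) \<and> g \<cdot>\<^bsub>C\<^esub> h = f},
      Dom = (\<lambda>(f, h, g). f), Cod = (\<lambda>(f, h, g). g),
      Ide = (\<lambda>f. (f, Ide C (Dom C f), f)),
      Cmp = (\<lambda>(g, k, g') (f, h, f'). (f, k \<cdot>\<^bsub>C\<^esub> h, g'))\<rparr>"


section \<open>Limits and colimits in the base category\<close>

definition is_pullback :: "('o, 'a) cat \<Rightarrow> 'a \<Rightarrow> 'a \<Rightarrow> 'o \<Rightarrow> 'a \<Rightarrow> 'a \<Rightarrow> bool" where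
  "is_pullback C f g P p q \<longleftrightarrow>
     f \<in> Arr C \<and> g \<in> Arr C \<and> Cod C f = Cod C g \<and> P \<in> Obj C \<and>
     p \<in> hom C P (Dom C f) \<and> q \<in> hom C P (Dom C g) \<and> f \<cdot>\<^bsub>C\<^esub> p = g \<cdot>\<^bsub>C\<^esub> q \<and>
     (\<forall>X \<in> Obj C. \<forall>x \<in> hom C X (Dom C f). \<forall>y \<in> hom C X (Dom C g). f \<cdot>\<^bsub>C\<^esub> x = g \<cdot>\<^bsub>C\<^esub> y \<longrightarrow>
        (\<exists>!h. h \<in> hom C X P \<and> p \<cdot>\<^bsub>C\<^esub> h = x \<and> q \<cdot>\<^bsub>C\<^esub> h = y))"

definition has_pullbacks :: "('o, 'a) cat \<Rightarrow> bool" where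
  "has_pullbacks C \<longleftrightarrow>
     (\<forall>f \<in> Arr C. \<forall>g \<in> Arr C. Cod C f = Cod C g \<longrightarrow> (\<exists>P p q. is_pullback C f g P p q))"

text \<open>Chosen pullbacks, with projections \<open>pb1\<close>, \<open>pb2\<close>, and the induced arrow \<open>\<langle>x, y\<rangle>\<close> into the
  chosen pullback of \<open>f\<close> and \<open>g\<close>.\<close>

definition pb :: "('o, 'a) cat \<Rightarrow> 'a \<Rightarrow> 'a \<Rightarrow> 'o \<times> 'a \<times> 'a" where
  "pb C f g = (SOME (P, p, q). is_pullback C f g P p q)"

definition pb0 :: "('o, 'a) cat \<Rightarrow> 'a \<Rightarrow> 'a \<Rightarrow> 'o" where
  "pb0 C f g = fst (pb C f g)"

definition pb1 :: "('o, 'a) cat \<Rightarrow> 'a \<Rightarrow> 'a \<Rightarrow> 'a" where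
  "pb1 C f g = fst (snd (pb C f g))"

definition pb2 :: "('o, 'a) cat \<Rightarrow> 'a \<Rightarrow> 'a \<Rightarrow> 'a" where
  "pb2 C f g = snd (snd (pb C f g))"

definition pb_pair :: "('o, 'a) cat \<Rightarrow> 'a \<Rightarrow> 'a \<Rightarrow> 'a \<Rightarrow> 'a \<Rightarrow> 'a" where
  "pb_pair C f g x y =
     (THE h. h \<in> hom C (Dom C x) (pb0 C f g) \<and> pb1 C f g \<cdot>\<^bsub>C\<^esub> h = x \<and> pb2 C f g \<cdot>\<^bsub>C\<^esub> h = y)"

text \<open>The pullback functor \<open>f\<^sup>* : C/Y \<rightarrow> C/X\<close> for \<open>f : X \<rightarrow> Y\<close>.\<close>

definition pullback_functor ::
    "('o, 'a) cat \<Rightarrow> 'a \<Rightarrow> ('a, 'a \<times> 'a \<times> 'a, 'a, 'a \<times> 'a \<times> 'a) func" where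
  "pullback_functor C f =
     \<lparr>fo = (\<lambda>g. pb1 C f g),
      fa = (\<lambda>(g, h, g'). (pb1 C f g, pb_pair C f g' (pb1 C f g) (h \<cdot>\<^bsub>C\<^esub> pb2 C f g), pb1 C f g'))\<rparr>"

definition is_coequaliser :: "('o, 'a) cat \<Rightarrow> 'a \<Rightarrow> 'a \<Rightarrow> 'a \<Rightarrow> bool" where
  "is_coequaliser C u v q \<longleftrightarrow>
     u \<in> Arr C \<and> v \<in> Arr C \<and> Dom C u = Dom C v \<and> Cod C u = Cod C v \<and>
     q \<in> Arr C \<and> Dom C q = Cod C u \<and> q \<cdot>\<^bsub>C\<^esub> u = q \<cdot>\<^bsub>C\<^esub> v \<and>
     (\<forall>k \<in> Arr C. Dom C k = Cod C u \<longrightarrow> k \<cdot>\<^bsub>C\<^esub> u = k \<cdot>\<^bsub>C\<^esub> v \<longrightarrow>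
        (\<exists>!h. h \<in> hom C (Cod C q) (Cod C k) \<and> h \<cdot>\<^bsub>C\<^esub> q = k))"

definition has_coequalisers :: "('o, 'a) cat \<Rightarrow> bool" where
  "has_coequalisers C \<longleftrightarrow>
     (\<forall>u \<in> Arr C. \<forall>v \<in> Arr C. Dom C u = Dom C v \<longrightarrow> Cod C u = Cod C v \<longrightarrow>
        (\<exists>q. is_coequaliser C u v q))"

definition preserves_coequalisers ::
    "('o, 'a) cat \<Rightarrow> ('p, 'b) cat \<Rightarrow> ('o, 'a, 'p, 'b) func \<Rightarrow> bool" where
  "preserves_coequalisers C D F \<longleftrightarrow>
     (\<forall>u v q. is_coequaliser C u v q \<longrightarrow> is_coequaliser D (fa F u) (fa F v) (fa F q))"

definition has_pullback_stable_coequalisers :: "('o, 'a) cat \<Rightarrow> bool" where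
  "has_pullback_stable_coequalisers C \<longleftrightarrow> has_coequalisers C \<and>
     (\<forall>f \<in> Arr C. preserves_coequalisers (slice C (Cod C f)) (slice C (Dom C f)) (pullback_functor C f))"

definition is_coproduct ::
    "('o, 'a) cat \<Rightarrow> 'i set \<Rightarrow> ('i \<Rightarrow> 'o) \<Rightarrow> 'o \<Rightarrow> ('i \<Rightarrow> 'a) \<Rightarrow> bool" where
  "is_coproduct C I A P \<iota> \<longleftrightarrow>
     P \<in> Obj C \<and> (\<forall>i \<in> I. A i \<in> Obj C \<and> \<iota> i \<in> hom C (A i) P) \<and>
     (\<forall>X \<in> Obj C. \<forall>x. (\<forall>i \<in> I. x i \<in> hom C (A i) X) \<longrightarrow>
        (\<exists>!h. h \<in> hom C P X \<and> (\<forall>i \<in> I. h \<cdot>\<^bsub>C\<^esub> \<iota> i = x i)))"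

definition has_finite_coproducts :: "('o, 'a) cat \<Rightarrow> bool" where
  "has_finite_coproducts C \<longleftrightarrow>
     (\<forall>(I :: nat set) A. finite I \<longrightarrow> (\<forall>i \<in> I. A i \<in> Obj C) \<longrightarrow> (\<exists>P \<iota>. is_coproduct C I A P \<iota>))"

text \<open>Chosen binary coproducts, with injections \<open>inj1\<close>, \<open>inj2\<close>, and the sum \<open>f + g\<close> of two arrows.\<close>

definition copr :: "('o, 'a) cat \<Rightarrow> 'o \<Rightarrow> 'o \<Rightarrow> 'o \<times> 'a \<times> 'a" where
  "copr C A B = (SOME (P, i, j). is_coproduct C UNIV (case_bool A B) P (case_bool i j))"

definition copr0 :: "('o, 'a) cat \<Rightarrow> 'o \<Rightarrow> 'o \<Rightarrow> 'o" where
  "copr0 C A B = fst (copr C A B)"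

definition inj1 :: "('o, 'a) cat \<Rightarrow> 'o \<Rightarrow> 'o \<Rightarrow> 'a" where
  "inj1 C A B = fst (snd (copr C A B))"

definition inj2 :: "('o, 'a) cat \<Rightarrow> 'o \<Rightarrow> 'o \<Rightarrow> 'a" where
  "inj2 C A B = snd (snd (copr C A B))"

definition sum_arr :: "('o, 'a) cat \<Rightarrow> 'a \<Rightarrow> 'a \<Rightarrow> 'a" where
  "sum_arr C f g =
     (THE h. h \<in> hom C (copr0 C (Dom C f) (Dom C g)) (copr0 C (Cod C f) (Cod C g)) \<and>
             h \<cdot>\<^bsub>C\<^esub> inj1 C (Dom C f) (Dom C g) = inj1 C (Cod C f) (Cod C g) \<cdot>\<^bsub>C\<^esub> f \<and>
             h \<cdot>\<^bsub>C\<^esub> inj2 C (Dom C f) (Dom C g) = inj2 C (Cod C f) (Cod C g) \<cdot>\<^bsub>C\<^esub> g)"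

text \<open>The canonical functor \<open>C/A \<times> C/B \<rightarrow> C/(A + B)\<close>, \<open>(f, g) \<mapsto> f + g\<close>.\<close>

definition sum_functor ::
    "('o, 'a) cat \<Rightarrow> ('a \<times> 'a, ('a \<times> 'a \<times> 'a) \<times> ('a \<times> 'a \<times> 'a), 'a, 'a \<times> 'a \<times> 'a) func" where
  "sum_functor C =
     \<lparr>fo = (\<lambda>(f, g). sum_arr C f g),
      fa = (\<lambda>((f, h, f'), (g, k, g')). (sum_arr C f g, sum_arr C h k, sum_arr C f' g'))\<rparr>"

definition extensive :: "('o, 'a) cat \<Rightarrow> bool" where
  "extensive C \<longleftrightarrow> has_finite_coproducts C \<and>
     (\<forall>A \<in> Obj C. \<forall>B \<in> Obj C.
        is_equivalence (prod_cat (slice C A) (slice C B)) (slice C (copr0 C A B)) (sum_functor C))"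


section \<open>Strict 2-categories and 2-functors\<close>

text \<open>A 2-category is presented as a \<open>Cat\<close>-enriched category: \<open>Hom K a b\<close> is the hom-category, whose
  objects are the 1-cells and whose arrows are the 2-cells \<open>a \<rightarrow> b\<close>; \<open>comp1\<close> and \<open>comp2\<close> are the object
  and arrow part of the composition functor \<open>Hom K b c \<times> Hom K a b \<rightarrow> Hom K a c\<close>. Cells do not determine
  the 0-cells between which they live, so the compositions are indexed by \<open>a b c\<close>.\<close>

record ('o, 'm, 'c) twocat =
  Ob :: "'o set"
  Hom :: "'o \<Rightarrow> 'o \<Rightarrow> ('m, 'c) cat"
  id1 :: "'o \<Rightarrow> 'm"
  comp1 :: "'o \<Rightarrow> 'o \<Rightarrow> 'o \<Rightarrow> 'm \<Rightarrow> 'm \<Rightarrow> 'm"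
  comp2 :: "'o \<Rightarrow> 'o \<Rightarrow> 'o \<Rightarrow> 'c \<Rightarrow> 'c \<Rightarrow> 'c"

definition id2 :: "('o, 'm, 'c) twocat \<Rightarrow> 'o \<Rightarrow> 'o \<Rightarrow> 'm \<Rightarrow> 'c" where
  "id2 K a b f = Ide (Hom K a b) f"

definition two_category :: "('o, 'm, 'c) twocat \<Rightarrow> bool" where
  "two_category K \<longleftrightarrow>
     (\<forall>a \<in> Ob K. \<forall>b \<in> Ob K. category (Hom K a b)) \<and>
     (\<forall>a \<in> Ob K. id1 K a \<in> Obj (Hom K a a)) \<and>
     (\<forall>a \<in> Ob K. \<forall>b \<in> Ob K. \<forall>c \<in> Ob K.
        is_functor (prod_cat (Hom K b c) (Hom K a b)) (Hom K a c)
          \<lparr>fo = (\<lambda>(g, f). comp1 K a b c g f), fa = (\<lambda>(\<beta>, \<alpha>). comp2 K a b c \<beta> \<alpha>)\<rparr>) \<and>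
     (\<forall>a \<in> Ob K. \<forall>b \<in> Ob K. \<forall>f \<in> Obj (Hom K a b).
        comp1 K a a b f (id1 K a) = f \<and> comp1 K a b b (id1 K b) f = f) \<and>
     (\<forall>a \<in> Ob K. \<forall>b \<in> Ob K. \<forall>\<alpha> \<in> Arr (Hom K a b).
        comp2 K a a b \<alpha> (id2 K a a (id1 K a)) = \<alpha> \<and> comp2 K a b b (id2 K b b (id1 K b)) \<alpha> = \<alpha>) \<and>
     (\<forall>a \<in> Ob K. \<forall>b \<in> Ob K. \<forall>c \<in> Ob K. \<forall>d \<in> Ob K.
        \<forall>f \<in> Obj (Hom K a b). \<forall>g \<in> Obj (Hom K b c). \<forall>h \<in> Obj (Hom K c d).
        comp1 K a b d (comp1 K b c d h g) f = comp1 K a c d h (comp1 K a b c g f)) \<and>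
     (\<forall>a \<in> Ob K. \<forall>b \<in> Ob K. \<forall>c \<in> Ob K. \<forall>d \<in> Ob K.
        \<forall>\<alpha> \<in> Arr (Hom K a b). \<forall>\<beta> \<in> Arr (Hom K b c). \<forall>\<gamma> \<in> Arr (Hom K c d).
        comp2 K a b d (comp2 K b c d \<gamma> \<beta>) \<alpha> = comp2 K a c d \<gamma> (comp2 K a b c \<beta> \<alpha>))"

definition op2 :: "('o, 'm, 'c) twocat \<Rightarrow> ('o, 'm, 'c) twocat" where
  "op2 K =
     \<lparr>Ob = Ob K, Hom = (\<lambda>a b. Hom K b a), id1 = id1 K,
      comp1 = (\<lambda>a b c g f. comp1 K c b a f g), comp2 = (\<lambda>a b c \<beta> \<alpha>. comp2 K c b a \<alpha> \<beta>)\<rparr>"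

definition underlying_cat :: "('o, 'm, 'c) twocat \<Rightarrow> ('o, 'o \<times> 'm \<times> 'o) cat" where
  "underlying_cat K =
     \<lparr>Obj = Ob K,
      Arr = {(a, f, b). a \<in> Ob K \<and> b \<in> Ob K \<and> f \<in> Obj (Hom K a b)},
      Dom = (\<lambda>(a, f, b). a), Cod = (\<lambda>(a, f, b). b),
      Ide = (\<lambda>a. (a, id1 K a, a)),
      Cmp = (\<lambda>(b, g, c) (a, f, b'). (a, comp1 K a b c g f, c))\<rparr>"

record ('i, 'f, 'd, 'o, 'm, 'c) twofunc =
  F0 :: "'i \<Rightarrow> 'o"
  F1 :: "'i \<Rightarrow> 'i \<Rightarrow> 'f \<Rightarrow> 'm"
  F2 :: "'i \<Rightarrow> 'i \<Rightarrow> 'd \<Rightarrow> 'c"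

definition two_functor ::
    "('i, 'f, 'd) twocat \<Rightarrow> ('o, 'm, 'c) twocat \<Rightarrow> ('i, 'f, 'd, 'o, 'm, 'c) twofunc \<Rightarrow> bool" where
  "two_functor J K D \<longleftrightarrow>
     (\<forall>i \<in> Ob J. F0 D i \<in> Ob K) \<and>
     (\<forall>i \<in> Ob J. \<forall>j \<in> Ob J.
        is_functor (Hom J i j) (Hom K (F0 D i) (F0 D j)) \<lparr>fo = F1 D i j, fa = F2 D i j\<rparr>) \<and>
     (\<forall>i \<in> Ob J. F1 D i i (id1 J i) = id1 K (F0 D i)) \<and>
     (\<forall>i \<in> Ob J. \<forall>j \<in> Ob J. \<forall>k \<in> Ob J. \<forall>f \<in> Obj (Hom J i j). \<forall>g \<in> Obj (Hom J j k).
        F1 D i k (comp1 J i j k g f) = comp1 K (F0 D i) (F0 D j) (F0 D k) (F1 D j k g) (F1 D i j f)) \<and>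
     (\<forall>i \<in> Ob J. \<forall>j \<in> Ob J. \<forall>k \<in> Ob J. \<forall>\<alpha> \<in> Arr (Hom J i j). \<forall>\<beta> \<in> Arr (Hom J j k).
        F2 D i k (comp2 J i j k \<beta> \<alpha>) = comp2 K (F0 D i) (F0 D j) (F0 D k) (F2 D j k \<beta>) (F2 D i j \<alpha>))"


section \<open>The 2-category of categories\<close>

text \<open>Natural transformations as 2-cells carry their source and target functor. Functors and
  transformations occurring as 1- and 2-cells are extensional, i.e. \<open>undefined\<close> off their domain, so that
  HOL equality of cells is the mathematical equality.\<close>

type_synonym ('o, 'a, 'p, 'b) ntrans =
  "('o, 'a, 'p, 'b) func \<times> ('o \<Rightarrow> 'b) \<times> ('o, 'a, 'p, 'b) func"

definition fun_cat ::
    "('o, 'a) cat \<Rightarrow> ('p, 'b) cat \<Rightarrow> (('o, 'a, 'p, 'b) func, ('o, 'a, 'p, 'b) ntrans) cat" where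
  "fun_cat C D =
     (let Fs = {F. is_functor C D F \<and> fo F \<in> extensional (Obj C) \<and> fa F \<in> extensional (Arr C)} in
     \<lparr>Obj = Fs,
      Arr = {(F, t, G). F \<in> Fs \<and> G \<in> Fs \<and> is_nat_trans C D F G t \<and> t \<in> extensional (Obj C)},
      Dom = (\<lambda>(F, t, G). F), Cod = (\<lambda>(F, t, G). G),
      Ide = (\<lambda>F. (F, (\<lambda>x \<in> Obj C. Ide D (fo F x)), F)),
      Cmp = (\<lambda>(G, s, H) (F, t, G'). (F, (\<lambda>x \<in> Obj C. s x \<cdot>\<^bsub>D\<^esub> t x), H))\<rparr>)"

text \<open>Horizontal composition of \<open>\<alpha> : F \<Rightarrow> F' : A \<rightarrow> B\<close> and \<open>\<beta> : G \<Rightarrow> G' : B \<rightarrow> C\<close>.\<close>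

definition hcomp ::
    "('o, 'a) cat \<Rightarrow> ('q, 'd) cat \<Rightarrow> ('p, 'b, 'q, 'd) ntrans \<Rightarrow> ('o, 'a, 'p, 'b) ntrans \<Rightarrow>
     ('o, 'a, 'q, 'd) ntrans" where
  "hcomp A C = (\<lambda>(G, \<beta>, G') (F, \<alpha>, F').
     (comp_func A G F, (\<lambda>x \<in> Obj A. \<beta> (fo F' x) \<cdot>\<^bsub>C\<^esub> fa G (\<alpha> x)), comp_func A G' F'))"

definition CAT ::
    "(('o, 'a) cat, ('o, 'a, 'o, 'a) func, ('o, 'a, 'o, 'a) ntrans) twocat" where
  "CAT =
     \<lparr>Ob = {C. category C}, Hom = fun_cat, id1 = id_func,
      comp1 = (\<lambda>A B C G F. comp_func A G F), comp2 = (\<lambda>A B C \<beta> \<alpha>. hcomp A C \<beta> \<alpha>)\<rparr>"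


section \<open>Weighted 2-colimits\<close>

type_synonym ('i, 'f, 'd, 'o, 'a) catvalued =
  "('i, 'f, 'd, ('o, 'a) cat, ('o, 'a, 'o, 'a) func, ('o, 'a, 'o, 'a) ntrans) twofunc"

text \<open>The category \<open>[S, Cat](W, H)\<close> of 2-natural transformations and modifications between 2-functors
  \<open>W, H : S \<rightarrow> Cat\<close>. The categories \<open>W i\<close> and \<open>H i\<close> may have different HOL types.\<close>

definition two_nat ::
    "('i, 'f, 'd) twocat \<Rightarrow> ('i, 'f, 'd, 'o, 'a) catvalued \<Rightarrow> ('i, 'f, 'd, 'p, 'b) catvalued \<Rightarrow>
     ('i \<Rightarrow> ('o, 'a, 'p, 'b) func) \<Rightarrow> bool" where
  "two_nat S W H T \<longleftrightarrow>
     T \<in> extensional (Ob S) \<and>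
     (\<forall>i \<in> Ob S. T i \<in> Obj (fun_cat (F0 W i) (F0 H i))) \<and>
     (\<forall>i \<in> Ob S. \<forall>j \<in> Ob S. \<forall>f \<in> Obj (Hom S i j).
        comp_func (F0 W i) (T j) (F1 W i j f) = comp_func (F0 W i) (F1 H i j f) (T i)) \<and>
     (\<forall>i \<in> Ob S. \<forall>j \<in> Ob S. \<forall>\<alpha> \<in> Arr (Hom S i j).
        hcomp (F0 W i) (F0 H j) (Ide (fun_cat (F0 W j) (F0 H j)) (T j)) (F2 W i j \<alpha>) =
        hcomp (F0 W i) (F0 H j) (F2 H i j \<alpha>) (Ide (fun_cat (F0 W i) (F0 H i)) (T i)))"

definition modification ::
    "('i, 'f, 'd) twocat \<Rightarrow> ('i, 'f, 'd, 'o, 'a) catvalued \<Rightarrow> ('i, 'f, 'd, 'p, 'b) catvalued \<Rightarrow>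
     ('i \<Rightarrow> ('o, 'a, 'p, 'b) func) \<Rightarrow> ('i \<Rightarrow> ('o, 'a, 'p, 'b) func) \<Rightarrow>
     ('i \<Rightarrow> ('o, 'a, 'p, 'b) ntrans) \<Rightarrow> bool" where
  "modification S W H T T' m \<longleftrightarrow>
     m \<in> extensional (Ob S) \<and>
     (\<forall>i \<in> Ob S. m i \<in> hom (fun_cat (F0 W i) (F0 H i)) (T i) (T' i)) \<and>
     (\<forall>i \<in> Ob S. \<forall>j \<in> Ob S. \<forall>f \<in> Obj (Hom S i j).
        hcomp (F0 W i) (F0 H j) (m j) (Ide (fun_cat (F0 W i) (F0 W j)) (F1 W i j f)) =
        hcomp (F0 W i) (F0 H j) (Ide (fun_cat (F0 H i) (F0 H j)) (F1 H i j f)) (m i))"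

definition two_nat_cat ::
    "('i, 'f, 'd) twocat \<Rightarrow> ('i, 'f, 'd, 'o, 'a) catvalued \<Rightarrow> ('i, 'f, 'd, 'p, 'b) catvalued \<Rightarrow>
     ('i \<Rightarrow> ('o, 'a, 'p, 'b) func,
      ('i \<Rightarrow> ('o, 'a, 'p, 'b) func) \<times> ('i \<Rightarrow> ('o, 'a, 'p, 'b) ntrans) \<times> ('i \<Rightarrow> ('o, 'a, 'p, 'b) func)) cat" where
  "two_nat_cat S W H =
     \<lparr>Obj = {T. two_nat S W H T},
      Arr = {(T, m, T'). two_nat S W H T \<and> two_nat S W H T' \<and> modification S W H T T' m},
      Dom = (\<lambda>(T, m, T'). T), Cod = (\<lambda>(T, m, T'). T'),
      Ide = (\<lambda>T. (T, (\<lambda>i \<in> Ob S. Ide (fun_cat (F0 W i) (F0 H i)) (T i)), T)),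
      Cmp = (\<lambda>(T', n, T'') (T, m, T1). (T, (\<lambda>i \<in> Ob S. n i \<cdot>\<^bsub>fun_cat (F0 W i) (F0 H i)\<^esub> m i), T''))\<rparr>"

text \<open>The 2-functor \<open>K(D-, Y) : J\<^sup>o\<^sup>p \<rightarrow> Cat\<close>; an arrow \<open>i \<rightarrow> j\<close> of \<open>J\<^sup>o\<^sup>p\<close> is an arrow \<open>j \<rightarrow> i\<close> of \<open>J\<close>.\<close>

definition hom_into ::
    "('i, 'f, 'd) twocat \<Rightarrow> ('o, 'm, 'c) twocat \<Rightarrow> ('i, 'f, 'd, 'o, 'm, 'c) twofunc \<Rightarrow> 'o \<Rightarrow>
     ('i, 'f, 'd, 'm, 'c) catvalued" where
  "hom_into J K D Y =
     (let H0 = (\<lambda>i. Hom K (F0 D i) Y);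
          H1 = (\<lambda>i j f. \<lparr>fo = (\<lambda>g \<in> Obj (H0 i). comp1 K (F0 D j) (F0 D i) Y g (F1 D j i f)),
                        fa = (\<lambda>\<gamma> \<in> Arr (H0 i). comp2 K (F0 D j) (F0 D i) Y \<gamma>
                                                 (id2 K (F0 D j) (F0 D i) (F1 D j i f)))\<rparr>)
      in \<lparr>F0 = H0, F1 = H1,
          F2 = (\<lambda>i j \<alpha>. (H1 i j (Dom (Hom J j i) \<alpha>),
                         (\<lambda>g \<in> Obj (H0 i). comp2 K (F0 D j) (F0 D i) Y (id2 K (F0 D i) Y g) (F2 D j i \<alpha>)),
                         H1 i j (Cod (Hom J j i) \<alpha>)))\<rparr>)"

text \<open>For a cocone \<open>\<lambda> : W \<Rightarrow> K(D-, L)\<close>, the functor \<open>K(L, Y) \<rightarrow> [J\<^sup>o\<^sup>p, Cat](W, K(D-, Y))\<close> sending \<open>u\<close> to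
  \<open>K(D-, u) \<circ> \<lambda>\<close>.\<close>

definition post_cocone ::
    "('i, 'f, 'd) twocat \<Rightarrow> ('i, 'f, 'd, 'w, 'v) catvalued \<Rightarrow> ('o, 'm, 'c) twocat \<Rightarrow>
     ('i, 'f, 'd, 'o, 'm, 'c) twofunc \<Rightarrow> 'o \<Rightarrow> ('i \<Rightarrow> ('w, 'v, 'm, 'c) func) \<Rightarrow> 'o \<Rightarrow>
     ('m, 'c, 'i \<Rightarrow> ('w, 'v, 'm, 'c) func,
      ('i \<Rightarrow> ('w, 'v, 'm, 'c) func) \<times> ('i \<Rightarrow> ('w, 'v, 'm, 'c) ntrans) \<times> ('i \<Rightarrow> ('w, 'v, 'm, 'c) func)) func" where
  "post_cocone J W K D L l Y =
     (let po = (\<lambda>u. \<lambda>i \<in> Ob J.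
                  \<lparr>fo = (\<lambda>x \<in> Obj (F0 W i). comp1 K (F0 D i) L Y u (fo (l i) x)),
                   fa = (\<lambda>a \<in> Arr (F0 W i). comp2 K (F0 D i) L Y (id2 K L Y u) (fa (l i) a))\<rparr>)
      in \<lparr>fo = (\<lambda>u \<in> Obj (Hom K L Y). po u),
          fa = (\<lambda>\<beta> \<in> Arr (Hom K L Y).
                  (po (Dom (Hom K L Y) \<beta>),
                   (\<lambda>i \<in> Ob J. (po (Dom (Hom K L Y) \<beta>) i,
                               (\<lambda>x \<in> Obj (F0 W i). comp2 K (F0 D i) L Y \<beta> (id2 K (F0 D i) L (fo (l i) x))),
                               po (Cod (Hom K L Y) \<beta>) i)),
                   po (Cod (Hom K L Y) \<beta>)))\<rparr>)"

definition is_weighted_colimit ::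
    "('i, 'f, 'd) twocat \<Rightarrow> ('i, 'f, 'd, 'w, 'v) catvalued \<Rightarrow> ('o, 'm, 'c) twocat \<Rightarrow>
     ('i, 'f, 'd, 'o, 'm, 'c) twofunc \<Rightarrow> 'o \<Rightarrow> ('i \<Rightarrow> ('w, 'v, 'm, 'c) func) \<Rightarrow> bool" where
  "is_weighted_colimit J W K D L l \<longleftrightarrow>
     L \<in> Ob K \<and> two_nat (op2 J) W (hom_into J K D L) l \<and>
     (\<forall>Y \<in> Ob K. is_isomorphism (Hom K L Y) (two_nat_cat (op2 J) W (hom_into J K D Y))
                    (post_cocone J W K D L l Y))"


section \<open>Finite weights\<close>

text \<open>Presentation of a category by generators and relations. The set \<open>Q\<close> of edges is labelled by
  arrows of \<open>C\<close> through \<open>\<phi>\<close>, which makes \<open>Q\<close> a graph on the objects of \<open>C\<close>; \<open>gpath C Q \<phi> a p b\<close> says that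
  \<open>p\<close> (edges listed in the order of traversal) is a path from \<open>a\<close> to \<open>b\<close>, i.e. an arrow of the free category
  on this graph, and \<open>peval\<close> is the functor from the free category to \<open>C\<close>.\<close>

primrec gpath :: "('o, 'a) cat \<Rightarrow> 'e set \<Rightarrow> ('e \<Rightarrow> 'a) \<Rightarrow> 'o \<Rightarrow> 'e list \<Rightarrow> 'o \<Rightarrow> bool" where
  "gpath C Q \<phi> a [] b \<longleftrightarrow> a \<in> Obj C \<and> a = b"
| "gpath C Q \<phi> a (e # p) b \<longleftrightarrow> e \<in> Q \<and> Dom C (\<phi> e) = a \<and> gpath C Q \<phi> (Cod C (\<phi> e)) p b"

primrec peval :: "('o, 'a) cat \<Rightarrow> ('e \<Rightarrow> 'a) \<Rightarrow> 'o \<Rightarrow> 'e list \<Rightarrow> 'a" where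
  "peval C \<phi> a [] = Ide C a"
| "peval C \<phi> a (e # p) = peval C \<phi> (Cod C (\<phi> e)) p \<cdot>\<^bsub>C\<^esub> \<phi> e"

text \<open>The congruence on the free category generated by the relations \<open>R\<close>.\<close>

inductive pcong ::
    "('o, 'a) cat \<Rightarrow> 'e set \<Rightarrow> ('e \<Rightarrow> 'a) \<Rightarrow> ('o \<times> 'e list \<times> 'e list \<times> 'o) set \<Rightarrow>
     'o \<Rightarrow> 'e list \<Rightarrow> 'e list \<Rightarrow> 'o \<Rightarrow> bool"
  for C Q \<phi> R where
  pcong_rel: "(a, p, q, b) \<in> R \<Longrightarrow> pcong C Q \<phi> R a p q b"
| pcong_refl: "gpath C Q \<phi> a p b \<Longrightarrow> pcong C Q \<phi> R a p p b"
| pcong_sym: "pcong C Q \<phi> R a p q b \<Longrightarrow> pcong C Q \<phi> R a q p b"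
| pcong_trans: "pcong C Q \<phi> R a p q b \<Longrightarrow> pcong C Q \<phi> R a q r b \<Longrightarrow> pcong C Q \<phi> R a p r b"
| pcong_comp: "pcong C Q \<phi> R a p q b \<Longrightarrow> pcong C Q \<phi> R b r s c \<Longrightarrow> pcong C Q \<phi> R a (p @ r) (q @ s) c"

definition presents ::
    "('o, 'a) cat \<Rightarrow> 'e set \<Rightarrow> ('e \<Rightarrow> 'a) \<Rightarrow> ('o \<times> 'e list \<times> 'e list \<times> 'o) set \<Rightarrow> bool" where
  "presents C Q \<phi> R \<longleftrightarrow>
     (\<forall>e \<in> Q. \<phi> e \<in> Arr C) \<and>
     (\<forall>(a, p, q, b) \<in> R. gpath C Q \<phi> a p b \<and> gpath C Q \<phi> a q b) \<and>
     (\<forall>f \<in> Arr C. \<exists>p. gpath C Q \<phi> (Dom C f) p (Cod C f) \<and> peval C \<phi> (Dom C f) p = f) \<and>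
     (\<forall>a p q b. gpath C Q \<phi> a p b \<longrightarrow> gpath C Q \<phi> a q b \<longrightarrow>
        (peval C \<phi> a p = peval C \<phi> a q \<longleftrightarrow> pcong C Q \<phi> R a p q b))"

definition finitely_presentable :: "('o, 'a) cat \<Rightarrow> bool" where
  "finitely_presentable C \<longleftrightarrow> finite (Obj C) \<and>
     (\<exists>(Q :: nat set) \<phi> R. finite Q \<and> finite R \<and> presents C Q \<phi> R)"

text \<open>Finiteness of a weight \<open>W : J\<^sup>o\<^sup>p \<rightarrow> Cat\<close> in Kelly's sense. In particular this covers all weights
  for which \<open>J\<close> and all \<open>W i\<close> have only finitely many cells.\<close>

definition finite_weight ::
    "('i, 'f, 'd) twocat \<Rightarrow> ('i, 'f, 'd, 'w, 'v) catvalued \<Rightarrow> bool" where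
  "finite_weight J W \<longleftrightarrow>
     two_category J \<and> two_functor (op2 J) CAT W \<and> finite (Ob J) \<and>
     (\<forall>i \<in> Ob J. \<forall>j \<in> Ob J. finitely_presentable (Hom J i j)) \<and>
     (\<forall>i \<in> Ob J. finitely_presentable (F0 W i))"

text \<open>The type argument fixes the HOL types of the cells of \<open>J\<close> (\<open>'i\<close>, \<open>'f\<close>, \<open>'d\<close>) and of the objects and
  arrows of the categories \<open>W i\<close> (\<open>'w\<close>, \<open>'v\<close>). As categories with a finite presentation are countable,
  taking all five to be \<open>nat\<close> gives every finite weight up to isomorphism.\<close>

definition has_finite_2colimits ::
    "('i \<times> 'f \<times> 'd \<times> 'w \<times> 'v) itself \<Rightarrow> ('o, 'm, 'c) twocat \<Rightarrow> bool" where
  "has_finite_2colimits T K \<longleftrightarrow>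
     (\<forall>(J :: ('i, 'f, 'd) twocat) (W :: ('i, 'f, 'd, 'w, 'v) catvalued) D.
        finite_weight J W \<longrightarrow> two_functor J K D \<longrightarrow> (\<exists>L l. is_weighted_colimit J W K D L l))"


section \<open>Internal graphs and internal categories\<close>

record ('o, 'a) igraph =
  ob :: 'o
  mor :: 'o
  src :: 'a
  tgt :: 'a

text \<open>\<open>mul\<close> is defined on the chosen pullback of \<open>tgt\<close> and \<open>src\<close>, so \<open>mul \<circ> \<langle>x, y\<rangle>\<close> is
  ``first \<open>x\<close>, then \<open>y\<close>''.\<close>

record ('o, 'a) icat = "('o, 'a) igraph" +
  unt :: 'a
  mul :: 'a

definition internal_graph :: "('o, 'a) cat \<Rightarrow> ('o, 'a, 'z) igraph_scheme \<Rightarrow> bool" where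
  "internal_graph E G \<longleftrightarrow> ob G \<in> Obj E \<and> mor G \<in> Obj E \<and>
     src G \<in> hom E (mor G) (ob G) \<and> tgt G \<in> hom E (mor G) (ob G)"

definition graph_morphism ::
    "('o, 'a) cat \<Rightarrow> ('o, 'a, 'z) igraph_scheme \<Rightarrow> ('o, 'a, 'z) igraph_scheme \<Rightarrow> 'a \<times> 'a \<Rightarrow> bool" where
  "graph_morphism E G H = (\<lambda>(f0, f1).
     f0 \<in> hom E (ob G) (ob H) \<and> f1 \<in> hom E (mor G) (mor H) \<and>
     src H \<cdot>\<^bsub>E\<^esub> f1 = f0 \<cdot>\<^bsub>E\<^esub> src G \<and> tgt H \<cdot>\<^bsub>E\<^esub> f1 = f0 \<cdot>\<^bsub>E\<^esub> tgt G)"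

definition Gph :: "('o, 'a) cat \<Rightarrow>
    (('o, 'a) igraph, ('o, 'a) igraph \<times> ('a \<times> 'a) \<times> ('o, 'a) igraph) cat" where
  "Gph E =
     \<lparr>Obj = {G. internal_graph E G},
      Arr = {(G, f, H). internal_graph E G \<and> internal_graph E H \<and> graph_morphism E G H f},
      Dom = (\<lambda>(G, f, H). G), Cod = (\<lambda>(G, f, H). H),
      Ide = (\<lambda>G. (G, (Ide E (ob G), Ide E (mor G)), G)),
      Cmp = (\<lambda>(H, (g0, g1), H') (G, (f0, f1), H''). (G, (g0 \<cdot>\<^bsub>E\<^esub> f0, g1 \<cdot>\<^bsub>E\<^esub> f1), H'))\<rparr>"

text \<open>The object of composable pairs with its projections, and \<open>x ; y = mul \<circ> \<langle>x, y\<rangle>\<close> for a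
  composable pair of generalised elements \<open>x\<close>, \<open>y\<close> of \<open>mor A\<close>.\<close>

definition cpairs :: "('o, 'a) cat \<Rightarrow> ('o, 'a) icat \<Rightarrow> 'o" where
  "cpairs E A = pb0 E (tgt A) (src A)"

definition cp1 :: "('o, 'a) cat \<Rightarrow> ('o, 'a) icat \<Rightarrow> 'a" where
  "cp1 E A = pb1 E (tgt A) (src A)"

definition cp2 :: "('o, 'a) cat \<Rightarrow> ('o, 'a) icat \<Rightarrow> 'a" where
  "cp2 E A = pb2 E (tgt A) (src A)"

definition icomp :: "('o, 'a) cat \<Rightarrow> ('o, 'a) icat \<Rightarrow> 'a \<Rightarrow> 'a \<Rightarrow> 'a" where
  "icomp E A x y = mul A \<cdot>\<^bsub>E\<^esub> pb_pair E (tgt A) (src A) x y"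

text \<open>Associativity is stated on the object of composable triples, the pullback of \<open>cp2\<close> and \<open>cp1\<close>.\<close>

definition internal_category :: "('o, 'a) cat \<Rightarrow> ('o, 'a) icat \<Rightarrow> bool" where
  "internal_category E A \<longleftrightarrow>
     internal_graph E A \<and>
     unt A \<in> hom E (ob A) (mor A) \<and>
     src A \<cdot>\<^bsub>E\<^esub> unt A = Ide E (ob A) \<and> tgt A \<cdot>\<^bsub>E\<^esub> unt A = Ide E (ob A) \<and>
     mul A \<in> hom E (cpairs E A) (mor A) \<and>
     src A \<cdot>\<^bsub>E\<^esub> mul A = src A \<cdot>\<^bsub>E\<^esub> cp1 E A \<and> tgt A \<cdot>\<^bsub>E\<^esub> mul A = tgt A \<cdot>\<^bsub>E\<^esub> cp2 E A \<and>
     icomp E A (unt A \<cdot>\<^bsub>E\<^esub> src A) (Ide E (mor A)) = Ide E (mor A) \<and>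
     icomp E A (Ide E (mor A)) (unt A \<cdot>\<^bsub>E\<^esub> tgt A) = Ide E (mor A) \<and>
     (let r1 = pb1 E (cp2 E A) (cp1 E A);
          r2 = pb2 E (cp2 E A) (cp1 E A);
          x = cp1 E A \<cdot>\<^bsub>E\<^esub> r1; y = cp2 E A \<cdot>\<^bsub>E\<^esub> r1; z = cp2 E A \<cdot>\<^bsub>E\<^esub> r2
      in icomp E A (icomp E A x y) z = icomp E A x (icomp E A y z))"

definition internal_functor ::
    "('o, 'a) cat \<Rightarrow> ('o, 'a) icat \<Rightarrow> ('o, 'a) icat \<Rightarrow> 'a \<times> 'a \<Rightarrow> bool" where
  "internal_functor E A B = (\<lambda>(f0, f1).
     graph_morphism E A B (f0, f1) \<and>
     f1 \<cdot>\<^bsub>E\<^esub> unt A = unt B \<cdot>\<^bsub>E\<^esub> f0 \<and>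
     f1 \<cdot>\<^bsub>E\<^esub> mul A = icomp E B (f1 \<cdot>\<^bsub>E\<^esub> cp1 E A) (f1 \<cdot>\<^bsub>E\<^esub> cp2 E A))"

definition internal_nat_trans ::
    "('o, 'a) cat \<Rightarrow> ('o, 'a) icat \<Rightarrow> ('o, 'a) icat \<Rightarrow> 'a \<times> 'a \<Rightarrow> 'a \<Rightarrow> 'a \<times> 'a \<Rightarrow> bool" where
  "internal_nat_trans E A B = (\<lambda>(f0, f1) t (g0, g1).
     internal_functor E A B (f0, f1) \<and> internal_functor E A B (g0, g1) \<and>
     t \<in> hom E (ob A) (mor B) \<and> src B \<cdot>\<^bsub>E\<^esub> t = f0 \<and> tgt B \<cdot>\<^bsub>E\<^esub> t = g0 \<and>
     icomp E B (t \<cdot>\<^bsub>E\<^esub> src A) g1 = icomp E B f1 (t \<cdot>\<^bsub>E\<^esub> tgt A))"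

definition ifun_cat :: "('o, 'a) cat \<Rightarrow> ('o, 'a) icat \<Rightarrow> ('o, 'a) icat \<Rightarrow>
    ('a \<times> 'a, ('a \<times> 'a) \<times> 'a \<times> ('a \<times> 'a)) cat" where
  "ifun_cat E A B =
     \<lparr>Obj = {F. internal_functor E A B F},
      Arr = {(F, t, G). internal_nat_trans E A B F t G},
      Dom = (\<lambda>(F, t, G). F), Cod = (\<lambda>(F, t, G). G),
      Ide = (\<lambda>(f0, f1). ((f0, f1), unt B \<cdot>\<^bsub>E\<^esub> f0, (f0, f1))),
      Cmp = (\<lambda>(G, s, H) (F, t, G'). (F, icomp E B t s, H))\<rparr>"

definition ifun_comp :: "('o, 'a) cat \<Rightarrow> 'a \<times> 'a \<Rightarrow> 'a \<times> 'a \<Rightarrow> 'a \<times> 'a" where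
  "ifun_comp E = (\<lambda>(g0, g1) (f0, f1). (g0 \<cdot>\<^bsub>E\<^esub> f0, g1 \<cdot>\<^bsub>E\<^esub> f1))"

text \<open>The 2-category \<open>Cat(E)\<close>. The horizontal composite of \<open>\<alpha> : F \<Rightarrow> F' : A \<rightarrow> B\<close> and \<open>\<beta> : G \<Rightarrow> G' : B \<rightarrow> C\<close>
  has components \<open>G(\<alpha>)\<close> followed by \<open>\<beta>\<close> at \<open>F'\<close>.\<close>

definition Cat :: "('o, 'a) cat \<Rightarrow>
    (('o, 'a) icat, 'a \<times> 'a, ('a \<times> 'a) \<times> 'a \<times> ('a \<times> 'a)) twocat" where
  "Cat E =
     \<lparr>Ob = {A. internal_category E A}, Hom = ifun_cat E,
      id1 = (\<lambda>A. (Ide E (ob A), Ide E (mor A))),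
      comp1 = (\<lambda>A B C. ifun_comp E),
      comp2 = (\<lambda>A B C (G, \<beta>, G') (F, \<alpha>, F').
         (ifun_comp E G F, icomp E C (snd G \<cdot>\<^bsub>E\<^esub> \<alpha>) (\<beta> \<cdot>\<^bsub>E\<^esub> fst F'), ifun_comp E G' F'))\<rparr>"

definition forgetful :: "(('o, 'a) icat, ('o, 'a) icat \<times> ('a \<times> 'a) \<times> ('o, 'a) icat,
    ('o, 'a) igraph, ('o, 'a) igraph \<times> ('a \<times> 'a) \<times> ('o, 'a) igraph) func" where
  "forgetful =
     \<lparr>fo = igraph.truncate,
      fa = (\<lambda>(A, f, B). (igraph.truncate A, f, igraph.truncate B))\<rparr>"

end

theory Submission
  imports Defs
begin

text \<open>A cocone under \<open>D\<close> weighted by \<open>W\<close> with vertex \<open>Y\<close> consists of finitely many graph morphisms into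
  \<open>Y\<close> (the functors \<open>D i \<rightarrow> Y\<close>) and of finitely many families of arrows of \<open>Y\<close> (the transformations given by
  the generating arrows of \<open>W i\<close>), subject to finitely many equations between composites. The data without
  the equations between arrows are classified by a graph, built from coproducts and coequalisers in \<open>E\<close>, and
  so by the free internal category on it. The equations are then imposed by a quotient of internal
  categories that is the identity on objects: the relation is whiskered on both sides and its coequaliser
  taken, and stability of coequalisers under pullback makes composition descend to the quotient. This gives
  the one-dimensional universal property. Since \<open>Cat(E)\<close> has powers by the arrow category, a 2-cell into
  \<open>Y\<close> is a 1-cell into the arrow category of \<open>Y\<close>, and the two-dimensional universal property follows.\<close>

section \<open>Categories with pullbacks\<close>

text \<open>The equations between objects and those between arrows are treated differently for a
  reason. Identifying objects of an internal category creates new composable pairs, whose composites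
  no coequaliser of the arrows alone can supply; identifying parallel arrows creates none. So the
  equations between objects are built into the graph, and every relation left for the quotient is
  between parallel arrows.

  A finitely presentable category may have infinitely many arrows. Only generators and relators
  enter the construction, and other arrows get their values by evaluating words in
  \<open>points\<close>; once the relations hold, the choice of the word is immaterial.

  Objects of \<open>E\<close> have no elements, so the laws are checked on generalised elements.
  Such an element of a coequaliser need not have a representative, but it has one after restriction
  along an epimorphism, and epimorphisms cancel.

  The data of a cocone form one finite list for any finite weight, so the colimit is built at once,
  without a reduction to special weights.\<close>

lemma hom_iff [simp]: "f \<in> hom C a b \<longleftrightarrow> f \<in> Arr C \<and> Dom C f = a \<and> Cod C f = b"
  by (auto simp: hom_def)

lemma category_simps:
  assumes "category C"
  shows "f \<in> Arr C \<Longrightarrow> Dom C f \<in> Obj C"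
    and "f \<in> Arr C \<Longrightarrow> Cod C f \<in> Obj C"
    and "a \<in> Obj C \<Longrightarrow> Ide C a \<in> Arr C"
    and "a \<in> Obj C \<Longrightarrow> Dom C (Ide C a) = a"
    and "a \<in> Obj C \<Longrightarrow> Cod C (Ide C a) = a"
    and "f \<in> Arr C \<Longrightarrow> g \<in> Arr C \<Longrightarrow> Cod C f = Dom C g \<Longrightarrow> g \<cdot>\<^bsub>C\<^esub> f \<in> Arr C"
    and "f \<in> Arr C \<Longrightarrow> g \<in> Arr C \<Longrightarrow> Cod C f = Dom C g \<Longrightarrow> Dom C (g \<cdot>\<^bsub>C\<^esub> f) = Dom C f"
    and "f \<in> Arr C \<Longrightarrow> g \<in> Arr C \<Longrightarrow> Cod C f = Dom C g \<Longrightarrow> Cod C (g \<cdot>\<^bsub>C\<^esub> f) = Cod C g"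
    and "f \<in> Arr C \<Longrightarrow> Dom C f = a \<Longrightarrow> f \<cdot>\<^bsub>C\<^esub> Ide C a = f"
    and "f \<in> Arr C \<Longrightarrow> Cod C f = a \<Longrightarrow> Ide C a \<cdot>\<^bsub>C\<^esub> f = f"
    and "f \<in> Arr C \<Longrightarrow> g \<in> Arr C \<Longrightarrow> h \<in> Arr C \<Longrightarrow> Cod C f = Dom C g \<Longrightarrow> Cod C g = Dom C h \<Longrightarrow>
         (h \<cdot>\<^bsub>C\<^esub> g) \<cdot>\<^bsub>C\<^esub> f = h \<cdot>\<^bsub>C\<^esub> (g \<cdot>\<^bsub>C\<^esub> f)"
  using assms unfolding category_def hom_def by blast+

lemma categoryI:
  assumes "\<And>f. f \<in> Arr C \<Longrightarrow> Dom C f \<in> Obj C \<and> Cod C f \<in> Obj C"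
    and "\<And>a. a \<in> Obj C \<Longrightarrow> Ide C a \<in> Arr C \<and> Dom C (Ide C a) = a \<and> Cod C (Ide C a) = a"
    and "\<And>f g. f \<in> Arr C \<Longrightarrow> g \<in> Arr C \<Longrightarrow> Cod C f = Dom C g \<Longrightarrow>
           g \<cdot>\<^bsub>C\<^esub> f \<in> Arr C \<and> Dom C (g \<cdot>\<^bsub>C\<^esub> f) = Dom C f \<and> Cod C (g \<cdot>\<^bsub>C\<^esub> f) = Cod C g"
    and "\<And>f. f \<in> Arr C \<Longrightarrow> f \<cdot>\<^bsub>C\<^esub> Ide C (Dom C f) = f \<and> Ide C (Cod C f) \<cdot>\<^bsub>C\<^esub> f = f"
    and "\<And>f g h. f \<in> Arr C \<Longrightarrow> g \<in> Arr C \<Longrightarrow> h \<in> Arr C \<Longrightarrow> Cod C f = Dom C g \<Longrightarrow> Cod C g = Dom C h \<Longrightarrow>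
           (h \<cdot>\<^bsub>C\<^esub> g) \<cdot>\<^bsub>C\<^esub> f = h \<cdot>\<^bsub>C\<^esub> (g \<cdot>\<^bsub>C\<^esub> f)"
  shows "category C"
  unfolding category_def using assms by simp

lemma functorD:
  assumes "is_functor C D F"
  shows "x \<in> Obj C \<Longrightarrow> fo F x \<in> Obj D"
    and "f \<in> Arr C \<Longrightarrow> fa F f \<in> Arr D"
    and "f \<in> Arr C \<Longrightarrow> Dom D (fa F f) = fo F (Dom C f)"
    and "f \<in> Arr C \<Longrightarrow> Cod D (fa F f) = fo F (Cod C f)"
    and "x \<in> Obj C \<Longrightarrow> fa F (Ide C x) = Ide D (fo F x)"
    and "f \<in> Arr C \<Longrightarrow> g \<in> Arr C \<Longrightarrow> Cod C f = Dom C g \<Longrightarrow> fa F (g \<cdot>\<^bsub>C\<^esub> f) = fa F g \<cdot>\<^bsub>D\<^esub> fa F f"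
  using assms unfolding is_functor_def by auto

lemma functorI:
  assumes "\<And>x. x \<in> Obj C \<Longrightarrow> fo F x \<in> Obj D"
    and "\<And>f. f \<in> Arr C \<Longrightarrow> fa F f \<in> Arr D \<and> Dom D (fa F f) = fo F (Dom C f) \<and> Cod D (fa F f) = fo F (Cod C f)"
    and "\<And>x. x \<in> Obj C \<Longrightarrow> fa F (Ide C x) = Ide D (fo F x)"
    and "\<And>f g. f \<in> Arr C \<Longrightarrow> g \<in> Arr C \<Longrightarrow> Cod C f = Dom C g \<Longrightarrow> fa F (g \<cdot>\<^bsub>C\<^esub> f) = fa F g \<cdot>\<^bsub>D\<^esub> fa F f"
  shows "is_functor C D F"
  using assms unfolding is_functor_def by auto

text \<open>The inverse maps are functorial because the structure of \<open>D\<close> on images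
  under \<open>F\<close> is the image of that of \<open>C\<close>. The composites equal the
  identities strictly, since \<open>comp_func\<close> and \<open>id_func\<close> are restricted to
  the same domain. Asking of \<open>D\<close> only that arrows end in objects spares a proof of the
  category laws for \<open>two_nat_cat\<close>, the target in the application.\<close>

lemma is_isomorphismI:
  assumes F: "is_functor C D F" and C: "category C"
    and D: "\<And>f. f \<in> Arr D \<Longrightarrow> Dom D f \<in> Obj D" "\<And>f. f \<in> Arr D \<Longrightarrow> Cod D f \<in> Obj D"
    and "bij_betw (fo F) (Obj C) (Obj D)" and "bij_betw (fa F) (Arr C) (Arr D)"
  shows "is_isomorphism C D F"
proof -
  define G where "G = \<lparr>fo = inv_into (Obj C) (fo F), fa = inv_into (Arr C) (fa F)\<rparr>"
  have o: "x \<in> Obj C \<Longrightarrow> fo G (fo F x) = x" "y \<in> Obj D \<Longrightarrow> fo G y \<in> Obj C" "y \<in> Obj D \<Longrightarrow> fo F (fo G y) = y" for x y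
    using assms(5) by (auto simp: G_def bij_betw_def inv_into_into f_inv_into_f)
  have a: "x \<in> Arr C \<Longrightarrow> fa G (fa F x) = x" "y \<in> Arr D \<Longrightarrow> fa G y \<in> Arr C" "y \<in> Arr D \<Longrightarrow> fa F (fa G y) = y" for x y
    using assms(6) by (auto simp: G_def bij_betw_def inv_into_into f_inv_into_f)
  note [simp] = category_simps[OF C] D functorD[OF F] o a
  have dc: "Dom C (fa G f) = fo G (Dom D f)" "Cod C (fa G f) = fo G (Cod D f)" if "f \<in> Arr D" for f
    using that o(1)[of "Dom C (fa G f)"] o(1)[of "Cod C (fa G f)"]
      functorD(3)[OF F, of "fa G f"] functorD(4)[OF F, of "fa G f"] by simp_all
  have "is_functor D C G"
  proof (rule functorI)
    show "fa G (Ide D x) = Ide C (fo G x)" if "x \<in> Obj D" for x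
      using that a(1)[of "Ide C (fo G x)"] by simp
    show "fa G (g \<cdot>\<^bsub>D\<^esub> f) = fa G g \<cdot>\<^bsub>C\<^esub> fa G f" if "f \<in> Arr D" "g \<in> Arr D" "Cod D f = Dom D g" for f g
      using that a(1)[of "fa G g \<cdot>\<^bsub>C\<^esub> fa G f"] by (simp add: dc)
  qed (use dc in auto)
  moreover have "comp_func C G F = id_func C" "comp_func D F G = id_func D"
    by (auto simp: comp_func_def id_func_def)
  ultimately show ?thesis
    using F unfolding is_isomorphism_def by blast
qed

section \<open>Calculation with chosen pullbacks\<close>

locale category_with_pullbacks =
  fixes E :: "('o, 'a) cat"
  assumes cat: "category E" and pullbacks: "has_pullbacks E"
begin

abbreviation cmp :: "'a \<Rightarrow> 'a \<Rightarrow> 'a" (infixr "\<bullet>" 70)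
  where "g \<bullet> f \<equiv> g \<cdot>\<^bsub>E\<^esub> f"

lemmas cat_simps [simp] = category_simps[OF cat]

text \<open>Simplification nests composites to the right, and then \<open>g \<bullet> f\<close> is
  no longer a subterm of \<open>g \<bullet> f \<bullet> z\<close>. From an equation for
  \<open>g \<bullet> f\<close> this produces the rewrite rule for the nested form.\<close>

lemma reassoc:
  assumes "g \<bullet> f = k" "g \<in> Arr E" "f \<in> Arr E" "z \<in> Arr E" "Cod E f = Dom E g" "Cod E z = Dom E f"
  shows "g \<bullet> f \<bullet> z = k \<bullet> z"
  using assms cat_simps(11)[of z f g] by auto

lemma pb_is_pullback:
  assumes "f \<in> Arr E" "g \<in> Arr E" "Cod E f = Cod E g"
  shows "is_pullback E f g (pb0 E f g) (pb1 E f g) (pb2 E f g)"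
proof -
  have "\<exists>z. (\<lambda>(P, p, q). is_pullback E f g P p q) z"
    using pullbacks assms unfolding has_pullbacks_def by auto
  then have "(\<lambda>(P, p, q). is_pullback E f g P p q) (pb E f g)"
    unfolding pb_def by (rule someI_ex)
  then show ?thesis
    by (simp add: pb0_def pb1_def pb2_def split: prod.splits)
qed

lemma pb_simps [simp]:
  assumes "f \<in> Arr E" "g \<in> Arr E" "Cod E f = Cod E g"
  shows "pb0 E f g \<in> Obj E" "pb1 E f g \<in> Arr E" "pb2 E f g \<in> Arr E"
    "Dom E (pb1 E f g) = pb0 E f g" "Dom E (pb2 E f g) = pb0 E f g"
    "Cod E (pb1 E f g) = Dom E f" "Cod E (pb2 E f g) = Dom E g"
    "f \<bullet> pb1 E f g = g \<bullet> pb2 E f g"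
  using pb_is_pullback[OF assms] unfolding is_pullback_def by auto

lemma pb_square [simp]:
  assumes "f \<in> Arr E" "g \<in> Arr E" "Cod E f = Cod E g" "z \<in> Arr E" "Cod E z = pb0 E f g"
  shows "f \<bullet> pb1 E f g \<bullet> z = g \<bullet> pb2 E f g \<bullet> z"
  using assms reassoc[OF pb_simps(8)] by simp

lemma pb_pair_simps [simp]:
  assumes "f \<in> Arr E" "g \<in> Arr E" "Cod E f = Cod E g" "x \<in> Arr E" "y \<in> Arr E" "Dom E x = Dom E y"
    "Cod E x = Dom E f" "Cod E y = Dom E g" "f \<bullet> x = g \<bullet> y"
  shows "pb_pair E f g x y \<in> Arr E" "Dom E (pb_pair E f g x y) = Dom E x"
    "Cod E (pb_pair E f g x y) = pb0 E f g"
    "pb1 E f g \<bullet> pb_pair E f g x y = x" "pb2 E f g \<bullet> pb_pair E f g x y = y"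
proof -
  have "\<exists>!h. h \<in> hom E (Dom E x) (pb0 E f g) \<and> pb1 E f g \<bullet> h = x \<and> pb2 E f g \<bullet> h = y"
    using pb_is_pullback[OF assms(1-3)] assms(4-) unfolding is_pullback_def by simp
  from theI'[OF this]
  show "pb_pair E f g x y \<in> Arr E" "Dom E (pb_pair E f g x y) = Dom E x"
    "Cod E (pb_pair E f g x y) = pb0 E f g"
    "pb1 E f g \<bullet> pb_pair E f g x y = x" "pb2 E f g \<bullet> pb_pair E f g x y = y"
    unfolding pb_pair_def by auto
qed

lemma pb_pair_simps' [simp]:
  assumes "f \<in> Arr E" "g \<in> Arr E" "Cod E f = Cod E g" "x \<in> Arr E" "y \<in> Arr E" "Dom E x = Dom E y"
    "Cod E x = Dom E f" "Cod E y = Dom E g" "f \<bullet> x = g \<bullet> y" "z \<in> Arr E" "Cod E z = Dom E x"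
  shows "pb1 E f g \<bullet> pb_pair E f g x y \<bullet> z = x \<bullet> z" "pb2 E f g \<bullet> pb_pair E f g x y \<bullet> z = y \<bullet> z"
  using assms reassoc[OF pb_pair_simps(4)] reassoc[OF pb_pair_simps(5)] by simp_all

lemma pb_eqI:
  assumes "f \<in> Arr E" "g \<in> Arr E" "Cod E f = Cod E g" "h \<in> Arr E" "k \<in> Arr E" "Dom E h = Dom E k"
    "Cod E h = pb0 E f g" "Cod E k = pb0 E f g"
    "pb1 E f g \<bullet> h = pb1 E f g \<bullet> k" "pb2 E f g \<bullet> h = pb2 E f g \<bullet> k"
  shows "h = k"
proof -
  have "\<exists>!l. l \<in> hom E (Dom E h) (pb0 E f g) \<and> pb1 E f g \<bullet> l = pb1 E f g \<bullet> h \<and> pb2 E f g \<bullet> l = pb2 E f g \<bullet> h"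
    using pb_is_pullback[OF assms(1-3)] assms(1-7) unfolding is_pullback_def
    by (auto dest!: bspec[where x="Dom E h"] bspec[where x="pb1 E f g \<bullet> h"] bspec[where x="pb2 E f g \<bullet> h"])
  then show ?thesis
    using assms by auto
qed

lemma pb_pair_comp:
  assumes "f \<in> Arr E" "g \<in> Arr E" "Cod E f = Cod E g" "x \<in> Arr E" "y \<in> Arr E" "Dom E x = Dom E y"
    "Cod E x = Dom E f" "Cod E y = Dom E g" "f \<bullet> x = g \<bullet> y" "z \<in> Arr E" "Cod E z = Dom E x"
  shows "pb_pair E f g x y \<bullet> z = pb_pair E f g (x \<bullet> z) (y \<bullet> z)"
proof -
  have [simp]: "f \<bullet> x \<bullet> z = g \<bullet> y \<bullet> z"
    using assms reassoc[OF assms(9)] by simp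
  show ?thesis
    by (rule pb_eqI[of f g]) (use assms in simp_all)
qed

end

section \<open>Internal categories through generalised elements\<close>

context category_with_pullbacks
begin

lemma internal_graph_simps [simp]:
  assumes "internal_graph E G"
  shows "ob G \<in> Obj E" "mor G \<in> Obj E" "src G \<in> Arr E" "tgt G \<in> Arr E"
    "Dom E (src G) = mor G" "Dom E (tgt G) = mor G" "Cod E (src G) = ob G" "Cod E (tgt G) = ob G"
  using assms unfolding internal_graph_def by auto

lemma internal_categoryD [simp]:
  assumes "internal_category E A"
  shows "internal_graph E A"
  using assms unfolding internal_category_def by auto

lemmas internal_category_simps [simp] = internal_graph_simps[OF internal_categoryD]

lemma cp_simps [simp]:
  assumes "internal_graph E A"
  shows "cpairs E A \<in> Obj E" "cp1 E A \<in> Arr E" "cp2 E A \<in> Arr E"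
    "Dom E (cp1 E A) = cpairs E A" "Dom E (cp2 E A) = cpairs E A"
    "Cod E (cp1 E A) = mor A" "Cod E (cp2 E A) = mor A"
    "tgt A \<bullet> cp1 E A = src A \<bullet> cp2 E A"
  using assms unfolding cpairs_def cp1_def cp2_def by simp_all

lemma cp_square [simp]:
  assumes "internal_graph E A" "z \<in> Arr E" "Cod E z = cpairs E A"
  shows "tgt A \<bullet> cp1 E A \<bullet> z = src A \<bullet> cp2 E A \<bullet> z"
  using assms unfolding cpairs_def cp1_def cp2_def by simp

lemmas cp_simps' [simp] = cp_simps[OF internal_categoryD] cp_square[OF internal_categoryD]

text \<open>Generalised elements of \<open>mor A\<close> at the common stage \<open>Dom E x\<close>,
  in the order of traversal. Working with such pairs replaces diagrams over \<open>cpairs\<close> by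
  the ordinary algebra of composition.\<close>

definition composable :: "('o, 'a, 'z) igraph_scheme \<Rightarrow> 'a \<Rightarrow> 'a \<Rightarrow> bool" where
  "composable A x y \<longleftrightarrow> x \<in> Arr E \<and> y \<in> Arr E \<and> Dom E x = Dom E y \<and>
     Cod E x = mor A \<and> Cod E y = mor A \<and> tgt A \<bullet> x = src A \<bullet> y"

lemma composable_comp:
  assumes "internal_graph E A" "composable A x y" "z \<in> Arr E" "Cod E z = Dom E x"
  shows "composable A (x \<bullet> z) (y \<bullet> z)"
  using assms reassoc[of "tgt A" x "src A \<bullet> y" z] by (auto simp: composable_def)

lemma composable_cp [simp]: "internal_graph E A \<Longrightarrow> composable A (cp1 E A) (cp2 E A)"
  by (simp add: composable_def)

lemma cp_pair:
  assumes "internal_graph E A" "composable A x y"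
  obtains h where "h \<in> hom E (Dom E x) (cpairs E A)" "h = pb_pair E (tgt A) (src A) x y"
    "cp1 E A \<bullet> h = x" "cp2 E A \<bullet> h = y"
  using assms unfolding composable_def cpairs_def cp1_def cp2_def by (simp)

lemma unt_simps [simp]:
  assumes "internal_category E A"
  shows "unt A \<in> Arr E" "Dom E (unt A) = ob A" "Cod E (unt A) = mor A"
    "src A \<bullet> unt A = Ide E (ob A)" "tgt A \<bullet> unt A = Ide E (ob A)"
    "x \<in> Arr E \<Longrightarrow> Cod E x = ob A \<Longrightarrow> src A \<bullet> unt A \<bullet> x = x"
    "x \<in> Arr E \<Longrightarrow> Cod E x = ob A \<Longrightarrow> tgt A \<bullet> unt A \<bullet> x = x"
proof -
  show *: "unt A \<in> Arr E" "Dom E (unt A) = ob A" "Cod E (unt A) = mor A"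
    "src A \<bullet> unt A = Ide E (ob A)" "tgt A \<bullet> unt A = Ide E (ob A)"
    using assms unfolding internal_category_def by auto
  show "x \<in> Arr E \<Longrightarrow> Cod E x = ob A \<Longrightarrow> src A \<bullet> unt A \<bullet> x = x"
    "x \<in> Arr E \<Longrightarrow> Cod E x = ob A \<Longrightarrow> tgt A \<bullet> unt A \<bullet> x = x"
    using assms * reassoc[OF *(4)] reassoc[OF *(5)] by auto
qed

lemma mul_simps [simp]:
  assumes "internal_category E A"
  shows "mul A \<in> Arr E" "Dom E (mul A) = cpairs E A" "Cod E (mul A) = mor A"
    "src A \<bullet> mul A = src A \<bullet> cp1 E A" "tgt A \<bullet> mul A = tgt A \<bullet> cp2 E A"
  using assms unfolding internal_category_def by auto

lemma icomp_simps [simp]: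
  assumes "internal_category E A" "composable A x y"
  shows "icomp E A x y \<in> Arr E" "Dom E (icomp E A x y) = Dom E x" "Cod E (icomp E A x y) = mor A"
    "src A \<bullet> icomp E A x y = src A \<bullet> x" "tgt A \<bullet> icomp E A x y = tgt A \<bullet> y"
proof -
  obtain h where h: "h \<in> hom E (Dom E x) (cpairs E A)" "h = pb_pair E (tgt A) (src A) x y"
    "cp1 E A \<bullet> h = x" "cp2 E A \<bullet> h = y"
    using cp_pair assms internal_categoryD by blast
  have ic: "icomp E A x y = mul A \<bullet> h"
    using h by (simp add: icomp_def)
  note [simp] = assms(1) reassoc[OF mul_simps(4), of A h] reassoc[OF mul_simps(5), of A h]
  show "icomp E A x y \<in> Arr E" "Dom E (icomp E A x y) = Dom E x" "Cod E (icomp E A x y) = mor A"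
    "src A \<bullet> icomp E A x y = src A \<bullet> x" "tgt A \<bullet> icomp E A x y = tgt A \<bullet> y"
    using h(1,3,4) unfolding ic by simp_all
qed

lemma composable_icomp [simp]:
  assumes "internal_category E A"
  shows "composable A x y \<Longrightarrow> composable A (icomp E A x y) z \<longleftrightarrow> composable A y z"
    "composable A y z \<Longrightarrow> composable A x (icomp E A y z) \<longleftrightarrow> composable A x y"
proof -
  show "composable A (icomp E A x y) z \<longleftrightarrow> composable A y z" if xy: "composable A x y"
    using icomp_simps[OF assms xy] xy unfolding composable_def by auto
  show "composable A x (icomp E A y z) \<longleftrightarrow> composable A x y" if yz: "composable A y z"
    using icomp_simps[OF assms yz] yz unfolding composable_def by auto
qed

lemma icomp_comp:
  assumes "internal_category E A" "composable A x y" "z \<in> Arr E" "Cod E z = Dom E x"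
  shows "icomp E A x y \<bullet> z = icomp E A (x \<bullet> z) (y \<bullet> z)"
proof -
  have [simp]: "icomp E A x y \<in> Arr E"
    using assms by simp
  have "pb_pair E (tgt A) (src A) x y \<bullet> z = pb_pair E (tgt A) (src A) (x \<bullet> z) (y \<bullet> z)"
    using assms by (intro pb_pair_comp) (auto simp: composable_def)
  moreover have "Cod E (pb_pair E (tgt A) (src A) x y) = cpairs E A" "pb_pair E (tgt A) (src A) x y \<in> Arr E"
      "Dom E (pb_pair E (tgt A) (src A) x y) = Dom E x"
    using assms by (auto simp: composable_def cpairs_def)
  ultimately show ?thesis
    using assms by (simp add: icomp_def)
qed

text \<open>The two projections are the generic composable pair, so statements about
  \<open>mul\<close> are instances of statements about \<open>icomp\<close>.\<close>

lemma icomp_cp: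
  assumes "internal_category E A"
  shows "icomp E A (cp1 E A) (cp2 E A) = mul A"
proof -
  have "pb_pair E (tgt A) (src A) (cp1 E A) (cp2 E A) = Ide E (cpairs E A)"
    by (rule pb_eqI[of "tgt A" "src A"]) (use assms in \<open>simp_all add: cpairs_def cp1_def cp2_def\<close>)
  then show ?thesis
    using assms by (simp add: icomp_def)
qed

lemma icomp_unit [simp]:
  assumes "internal_category E A" "x \<in> Arr E" "Cod E x = mor A"
  shows "a = src A \<bullet> x \<Longrightarrow> icomp E A (unt A \<bullet> a) x = x" "a = tgt A \<bullet> x \<Longrightarrow> icomp E A x (unt A \<bullet> a) = x"
proof -
  have "icomp E A (unt A \<bullet> src A) (Ide E (mor A)) = Ide E (mor A)"
    "icomp E A (Ide E (mor A)) (unt A \<bullet> tgt A) = Ide E (mor A)"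
    using assms unfolding internal_category_def by auto
  from this[THEN arg_cong, of "\<lambda>y. y \<bullet> x"]
  show "a = src A \<bullet> x \<Longrightarrow> icomp E A (unt A \<bullet> a) x = x" "a = tgt A \<bullet> x \<Longrightarrow> icomp E A x (unt A \<bullet> a) = x"
    using assms by (simp_all add: icomp_comp composable_def)
qed

text \<open>The axiom concerns only the generic composable triple. Any other triple is its
  restriction along some \<open>l\<close>, and \<open>icomp\<close> commutes with
  restriction.\<close>

lemma icomp_assoc:
  assumes A: "internal_category E A" and xy: "composable A x y" and yz: "composable A y z"
  shows "icomp E A (icomp E A x y) z = icomp E A x (icomp E A y z)"
proof -
  define r1 where "r1 = pb1 E (cp2 E A) (cp1 E A)"
  define r2 where "r2 = pb2 E (cp2 E A) (cp1 E A)"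
  define T where "T = pb0 E (cp2 E A) (cp1 E A)"
  note [simp] = A
  obtain h where h: "h \<in> hom E (Dom E x) (cpairs E A)" "cp1 E A \<bullet> h = x" "cp2 E A \<bullet> h = y"
    using cp_pair A xy internal_categoryD by blast
  obtain k where k: "k \<in> hom E (Dom E y) (cpairs E A)" "cp1 E A \<bullet> k = y" "cp2 E A \<bullet> k = z"
    using cp_pair A yz internal_categoryD by blast
  define l where "l = pb_pair E (cp2 E A) (cp1 E A) h k"
  have [simp]: "Dom E y = Dom E x" "x \<in> Arr E" "y \<in> Arr E" "z \<in> Arr E" "Dom E z = Dom E x" 
    using xy yz by (auto simp: composable_def)
  have [simp]: "r1 \<in> Arr E" "r2 \<in> Arr E" "Dom E r1 = T" "Dom E r2 = T"
      "Cod E r1 = cpairs E A" "Cod E r2 = cpairs E A" "cp2 E A \<bullet> r1 = cp1 E A \<bullet> r2"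
    unfolding r1_def r2_def T_def by simp_all
  have l [simp]: "l \<in> Arr E" "Dom E l = Dom E x" "Cod E l = T" "r1 \<bullet> l = h" "r2 \<bullet> l = k"
    using h k by (simp_all add: l_def r1_def r2_def T_def)
  have [simp]: "cp1 E A \<bullet> r2 \<bullet> l = y" "cp2 E A \<bullet> r2 \<bullet> l = z" "cp1 E A \<bullet> r1 \<bullet> l = x" "cp2 E A \<bullet> r1 \<bullet> l = y"
    using h k by simp_all
  have c: "composable A (cp1 E A \<bullet> r1) (cp1 E A \<bullet> r2)" "composable A (cp1 E A \<bullet> r2) (cp2 E A \<bullet> r2)"
    using arg_cong[OF \<open>cp2 E A \<bullet> r1 = cp1 E A \<bullet> r2\<close>, of "\<lambda>z. src A \<bullet> z"] by (simp_all add: composable_def)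
  then have c': "composable A (icomp E A (cp1 E A \<bullet> r1) (cp1 E A \<bullet> r2)) (cp2 E A \<bullet> r2)"
    "composable A (cp1 E A \<bullet> r1) (icomp E A (cp1 E A \<bullet> r2) (cp2 E A \<bullet> r2))"
    by (simp_all add: composable_def)
  have "icomp E A (icomp E A (cp1 E A \<bullet> r1) (cp1 E A \<bullet> r2)) (cp2 E A \<bullet> r2) =
      icomp E A (cp1 E A \<bullet> r1) (icomp E A (cp1 E A \<bullet> r2) (cp2 E A \<bullet> r2))"
    using A unfolding internal_category_def r1_def[symmetric] r2_def[symmetric] Let_def by simp
  from arg_cong[OF this, of "\<lambda>u. u \<bullet> l"]
  show ?thesis
    using c c' h k by (simp add: icomp_comp)
qed

text \<open>The Yoneda principle for internal categories: an operation \<open>m\<close> on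
  composable generalised elements that is natural in the stage is determined by its value at the
  generic pair. Structure can thus be defined, and its laws checked, as if \<open>A\<close> had
  elements.\<close>

lemma internal_categoryI:
  fixes A :: "('o, 'a) icat"
  assumes G: "internal_graph E A"
    and u: "unt A \<in> hom E (ob A) (mor A)" "src A \<bullet> unt A = Ide E (ob A)" "tgt A \<bullet> unt A = Ide E (ob A)"
    and mul: "mul A = m (cp1 E A) (cp2 E A)"
    and m: "\<And>x y. composable A x y \<Longrightarrow> m x y \<in> Arr E \<and> Dom E (m x y) = Dom E x \<and> Cod E (m x y) = mor A \<and>
            src A \<bullet> m x y = src A \<bullet> x \<and> tgt A \<bullet> m x y = tgt A \<bullet> y"
    and nat: "\<And>x y z. composable A x y \<Longrightarrow> z \<in> Arr E \<Longrightarrow> Cod E z = Dom E x \<Longrightarrow> m x y \<bullet> z = m (x \<bullet> z) (y \<bullet> z)"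
    and unit: "\<And>x. x \<in> Arr E \<Longrightarrow> Cod E x = mor A \<Longrightarrow> m (unt A \<bullet> src A \<bullet> x) x = x \<and> m x (unt A \<bullet> tgt A \<bullet> x) = x"
    and assoc: "\<And>x y z. composable A x y \<Longrightarrow> composable A y z \<Longrightarrow> m (m x y) z = m x (m y z)"
  shows "internal_category E A" and "\<And>x y. composable A x y \<Longrightarrow> icomp E A x y = m x y"
proof -
  note [simp] = G
  note m' [simp] = conjunct1[OF m] conjunct1[OF conjunct2[OF m]] conjunct1[OF conjunct2[OF conjunct2[OF m]]]
    conjunct1[OF conjunct2[OF conjunct2[OF conjunct2[OF m]]]] conjunct2[OF conjunct2[OF conjunct2[OF conjunct2[OF m]]]]
  have mul_simps: "mul A \<in> hom E (cpairs E A) (mor A)" "src A \<bullet> mul A = src A \<bullet> cp1 E A"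
      "tgt A \<bullet> mul A = tgt A \<bullet> cp2 E A"
    by (simp_all add: mul)
  show ic: "icomp E A x y = m x y" if xy: "composable A x y" for x y
  proof -
    obtain h where h: "h \<in> hom E (Dom E x) (cpairs E A)" "h = pb_pair E (tgt A) (src A) x y"
      "cp1 E A \<bullet> h = x" "cp2 E A \<bullet> h = y"
      using cp_pair[OF G xy] by blast
    then show ?thesis
      unfolding icomp_def using nat[OF composable_cp[OF G], of h] by (simp add: mul)
  qed
  have u' [simp]: "unt A \<in> Arr E" "Dom E (unt A) = ob A" "Cod E (unt A) = mor A"
    using u by auto
  have uc: "composable A (unt A \<bullet> src A) (Ide E (mor A))" "composable A (Ide E (mor A)) (unt A \<bullet> tgt A)"
    using u(3) reassoc[OF u(3), of "src A"] reassoc[OF u(2), of "tgt A"] by (simp_all add: composable_def)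
  define r1 where "r1 = pb1 E (cp2 E A) (cp1 E A)"
  define r2 where "r2 = pb2 E (cp2 E A) (cp1 E A)"
  have [simp]: "r1 \<in> Arr E" "r2 \<in> Arr E" "Dom E r1 = Dom E r2"
      "Cod E r1 = cpairs E A" "Cod E r2 = cpairs E A" and r: "cp2 E A \<bullet> r1 = cp1 E A \<bullet> r2"
    unfolding r1_def r2_def by simp_all
  have c: "composable A (cp1 E A \<bullet> r1) (cp2 E A \<bullet> r1)" "composable A (cp2 E A \<bullet> r1) (cp2 E A \<bullet> r2)"
    using composable_comp[OF G composable_cp[OF G], of r1] composable_comp[OF G composable_cp[OF G], of r2] 
    by (simp_all add: r)
  then have c': "composable A (m (cp1 E A \<bullet> r1) (cp2 E A \<bullet> r1)) (cp2 E A \<bullet> r2)"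
    "composable A (cp1 E A \<bullet> r1) (m (cp2 E A \<bullet> r1) (cp2 E A \<bullet> r2))"
    by (auto simp: composable_def)
  show "internal_category E A"
    unfolding internal_category_def Let_def r1_def[symmetric] r2_def[symmetric]
    using u mul_simps unit[of "Ide E (mor A)"] uc c c' assoc by (simp add: ic)
qed

text \<open>The ordinary category represented by \<open>A\<close> at stage \<open>X\<close>.
  Components of transformations from a category with objects \<open>X\<close> are arrows here, which
  is how presentations of ordinary categories act on internal data.\<close>

definition points :: "('o, 'a) icat \<Rightarrow> 'o \<Rightarrow> ('a, 'a) cat" where
  "points A X = \<lparr>Obj = hom E X (ob A), Arr = hom E X (mor A), Dom = (\<lambda>x. src A \<bullet> x), Cod = (\<lambda>x. tgt A \<bullet> x),
     Ide = (\<lambda>x. unt A \<bullet> x), Cmp = (\<lambda>y x. icomp E A x y)\<rparr>"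

lemma points_simps [simp]:
  "x \<in> Obj (points A X) \<longleftrightarrow> x \<in> hom E X (ob A)" "x \<in> Arr (points A X) \<longleftrightarrow> x \<in> hom E X (mor A)"
  "Dom (points A X) x = src A \<bullet> x" "Cod (points A X) x = tgt A \<bullet> x" "Ide (points A X) x = unt A \<bullet> x"
  "y \<cdot>\<^bsub>points A X\<^esub> x = icomp E A x y"
  by (simp_all add: points_def)

lemma category_points:
  assumes [simp]: "internal_category E A"
  shows "category (points A X)"
proof (rule categoryI)
  fix f g h
  assume "f \<in> Arr (points A X)" "g \<in> Arr (points A X)" "h \<in> Arr (points A X)"
    "Cod (points A X) f = Dom (points A X) g" "Cod (points A X) g = Dom (points A X) h"
  then show "(h \<cdot>\<^bsub>points A X\<^esub> g) \<cdot>\<^bsub>points A X\<^esub> f = h \<cdot>\<^bsub>points A X\<^esub> (g \<cdot>\<^bsub>points A X\<^esub> f)"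
    using icomp_assoc[of A f g h] by (simp add: composable_def)
qed (auto simp: composable_def)

section \<open>Internal functors and transformations on generalised elements\<close>

lemma internal_functorD:
  assumes F: "internal_functor E A B F" and A: "internal_category E A" and B: "internal_category E B"
  shows "fst F \<in> Arr E" "snd F \<in> Arr E" "Dom E (fst F) = ob A" "Cod E (fst F) = ob B"
    "Dom E (snd F) = mor A" "Cod E (snd F) = mor B"
    "src B \<bullet> snd F = fst F \<bullet> src A" "tgt B \<bullet> snd F = fst F \<bullet> tgt A"
    "z \<in> Arr E \<Longrightarrow> Cod E z = mor A \<Longrightarrow> src B \<bullet> snd F \<bullet> z = fst F \<bullet> src A \<bullet> z"
    "z \<in> Arr E \<Longrightarrow> Cod E z = mor A \<Longrightarrow> tgt B \<bullet> snd F \<bullet> z = fst F \<bullet> tgt A \<bullet> z"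
    "snd F \<bullet> unt A = unt B \<bullet> fst F"
    "z \<in> Arr E \<Longrightarrow> Cod E z = ob A \<Longrightarrow> snd F \<bullet> unt A \<bullet> z = unt B \<bullet> fst F \<bullet> z"
    "composable A x y \<Longrightarrow> composable B (snd F \<bullet> x) (snd F \<bullet> y)"
    "composable A x y \<Longrightarrow> snd F \<bullet> icomp E A x y = icomp E B (snd F \<bullet> x) (snd F \<bullet> y)"
proof -
  note [simp] = A B
  show *[simp]: "fst F \<in> Arr E" "snd F \<in> Arr E" "Dom E (fst F) = ob A" "Cod E (fst F) = ob B"
    "Dom E (snd F) = mor A" "Cod E (snd F) = mor B"
    "src B \<bullet> snd F = fst F \<bullet> src A" "tgt B \<bullet> snd F = fst F \<bullet> tgt A" "snd F \<bullet> unt A = unt B \<bullet> fst F"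
    using F by (auto simp: internal_functor_def graph_morphism_def split: prod.splits)
  show **: "z \<in> Arr E \<Longrightarrow> Cod E z = mor A \<Longrightarrow> src B \<bullet> snd F \<bullet> z = fst F \<bullet> src A \<bullet> z"
    "z \<in> Arr E \<Longrightarrow> Cod E z = mor A \<Longrightarrow> tgt B \<bullet> snd F \<bullet> z = fst F \<bullet> tgt A \<bullet> z"
    "z \<in> Arr E \<Longrightarrow> Cod E z = ob A \<Longrightarrow> snd F \<bullet> unt A \<bullet> z = unt B \<bullet> fst F \<bullet> z" for z
    by (simp_all add: reassoc[OF *(7)] reassoc[OF *(8)] reassoc[OF *(9)])
  show c: "composable B (snd F \<bullet> x) (snd F \<bullet> y)" if "composable A x y" for x y
    using that ** by (simp add: composable_def)
  have m: "snd F \<bullet> mul A = icomp E B (snd F \<bullet> cp1 E A) (snd F \<bullet> cp2 E A)"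
    using F by (auto simp: internal_functor_def split: prod.splits)
  show "snd F \<bullet> icomp E A x y = icomp E B (snd F \<bullet> x) (snd F \<bullet> y)" if xy: "composable A x y" for x y
  proof -
    obtain h where h: "h \<in> hom E (Dom E x) (cpairs E A)" "h = pb_pair E (tgt A) (src A) x y"
      "cp1 E A \<bullet> h = x" "cp2 E A \<bullet> h = y"
      using cp_pair A xy internal_categoryD by blast
    have "snd F \<bullet> icomp E A x y = (snd F \<bullet> mul A) \<bullet> h"
      using h by (simp add: icomp_def)
    also have "\<dots> = icomp E B (snd F \<bullet> x) (snd F \<bullet> y)"
      unfolding m using h by (simp add: c icomp_comp internal_categoryD)
    finally show ?thesis .
  qed
qed

lemma internal_functorI:
  assumes A: "internal_category E A" and B: "internal_category E B"
    and F: "f0 \<in> Arr E" "f1 \<in> Arr E" "Dom E f0 = ob A" "Cod E f0 = ob B" "Dom E f1 = mor A" "Cod E f1 = mor B"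
    "src B \<bullet> f1 = f0 \<bullet> src A" "tgt B \<bullet> f1 = f0 \<bullet> tgt A" "f1 \<bullet> unt A = unt B \<bullet> f0"
    "f1 \<bullet> icomp E A (cp1 E A) (cp2 E A) = icomp E B (f1 \<bullet> cp1 E A) (f1 \<bullet> cp2 E A)"
  shows "internal_functor E A B (f0, f1)"
  using assms by (simp add: internal_functor_def graph_morphism_def icomp_cp)

lemma functor_points:
  assumes "internal_functor E A B F" "internal_category E A" "internal_category E B"
  shows "is_functor (points A X) (points B X) \<lparr>fo = \<lambda>x. fst F \<bullet> x, fa = \<lambda>x. snd F \<bullet> x\<rparr>"
proof -
  note [simp] = internal_functorD[OF assms] assms
  show ?thesis
    by (rule functorI) (auto simp: composable_def)
qed

lemma internal_functor_id:
  assumes "internal_category E A"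
  shows "internal_functor E A A (Ide E (ob A), Ide E (mor A))"
  by (rule internal_functorI) (use assms in simp_all)

lemma internal_functor_comp:
  assumes F: "internal_functor E A B F" and G: "internal_functor E B C G"
    and [simp]: "internal_category E A" "internal_category E B" "internal_category E C"
  shows "internal_functor E A C (fst G \<bullet> fst F, snd G \<bullet> snd F)"
proof -
  note [simp] = internal_functorD[OF F] internal_functorD[OF G]
  show ?thesis
    by (rule internal_functorI) (simp_all add: internal_categoryD del: unt_simps(4,5))
qed

lemma internal_nat_transD:
  assumes t: "internal_nat_trans E A B F t G" and A: "internal_category E A" and B: "internal_category E B"
  shows "internal_functor E A B F" "internal_functor E A B G" "t \<in> Arr E" "Dom E t = ob A" "Cod E t = mor B"
    "src B \<bullet> t = fst F" "tgt B \<bullet> t = fst G"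
    "z \<in> Arr E \<Longrightarrow> Cod E z = ob A \<Longrightarrow> src B \<bullet> t \<bullet> z = fst F \<bullet> z"
    "z \<in> Arr E \<Longrightarrow> Cod E z = ob A \<Longrightarrow> tgt B \<bullet> t \<bullet> z = fst G \<bullet> z"
    "e \<in> Arr E \<Longrightarrow> Cod E e = mor A \<Longrightarrow> icomp E B (t \<bullet> src A \<bullet> e) (snd G \<bullet> e) = icomp E B (snd F \<bullet> e) (t \<bullet> tgt A \<bullet> e)"
proof -
  note [simp] = A B
  show *: "internal_functor E A B F" "internal_functor E A B G" and [simp]: "t \<in> Arr E" "Dom E t = ob A" "Cod E t = mor B"
    "src B \<bullet> t = fst F" "tgt B \<bullet> t = fst G"
    using t by (auto simp: internal_nat_trans_def split: prod.splits)
  note [simp] = internal_functorD[OF *(1) A B] internal_functorD[OF *(2) A B]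
  show **: "z \<in> Arr E \<Longrightarrow> Cod E z = ob A \<Longrightarrow> src B \<bullet> t \<bullet> z = fst F \<bullet> z"
    "z \<in> Arr E \<Longrightarrow> Cod E z = ob A \<Longrightarrow> tgt B \<bullet> t \<bullet> z = fst G \<bullet> z" for z
    by (simp_all add: reassoc[OF \<open>src B \<bullet> t = fst F\<close>] reassoc[OF \<open>tgt B \<bullet> t = fst G\<close>])
  have "icomp E B (t \<bullet> src A) (snd G) = icomp E B (snd F) (t \<bullet> tgt A)"
    using t by (auto simp: internal_nat_trans_def split: prod.splits)
  from arg_cong[OF this, of "\<lambda>z. z \<bullet> e"]
  show "e \<in> Arr E \<Longrightarrow> Cod E e = mor A \<Longrightarrow> icomp E B (t \<bullet> src A \<bullet> e) (snd G \<bullet> e) = icomp E B (snd F \<bullet> e) (t \<bullet> tgt A \<bullet> e)"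
    by (simp add: icomp_comp composable_def **)
qed

lemma internal_nat_transI:
  assumes "internal_functor E A B F" "internal_functor E A B G" "t \<in> Arr E" "Dom E t = ob A" "Cod E t = mor B"
    "src B \<bullet> t = fst F" "tgt B \<bullet> t = fst G"
    "icomp E B (t \<bullet> src A) (snd G) = icomp E B (snd F) (t \<bullet> tgt A)"
  shows "internal_nat_trans E A B F t G"
  using assms by (auto simp: internal_nat_trans_def split: prod.splits)

end

section \<open>Pullback-stable coequalisers\<close>

lemma is_coequaliserD:
  assumes "is_coequaliser C u v q"
  shows "u \<in> Arr C" "v \<in> Arr C" "q \<in> Arr C" "Dom C v = Dom C u" "Cod C v = Cod C u" "Dom C q = Cod C u"
    "q \<cdot>\<^bsub>C\<^esub> u = q \<cdot>\<^bsub>C\<^esub> v"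
  using assms unfolding is_coequaliser_def by auto

lemma coequaliser_ex1:
  assumes "is_coequaliser C u v q" "k \<in> Arr C" "Dom C k = Cod C u" "k \<cdot>\<^bsub>C\<^esub> u = k \<cdot>\<^bsub>C\<^esub> v"
  shows "\<exists>!h. h \<in> hom C (Cod C q) (Cod C k) \<and> h \<cdot>\<^bsub>C\<^esub> q = k"
  using assms unfolding is_coequaliser_def by blast

lemma coequaliser_factor:
  assumes "is_coequaliser C u v q" "k \<in> Arr C" "Dom C k = Cod C u" "k \<cdot>\<^bsub>C\<^esub> u = k \<cdot>\<^bsub>C\<^esub> v"
  obtains h where "h \<in> Arr C" "Dom C h = Cod C q" "Cod C h = Cod C k" "h \<cdot>\<^bsub>C\<^esub> q = k"
  using coequaliser_ex1[OF assms] by auto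

definition is_epi :: "('o, 'a) cat \<Rightarrow> 'a \<Rightarrow> bool" where
  "is_epi C e \<longleftrightarrow> e \<in> Arr C \<and> (\<forall>a \<in> Arr C. \<forall>b \<in> Arr C. Dom C a = Cod C e \<longrightarrow> Dom C b = Cod C e \<longrightarrow>
     a \<cdot>\<^bsub>C\<^esub> e = b \<cdot>\<^bsub>C\<^esub> e \<longrightarrow> a = b)"

lemma is_epiD:
  assumes "is_epi C e" "a \<cdot>\<^bsub>C\<^esub> e = b \<cdot>\<^bsub>C\<^esub> e" "a \<in> Arr C" "b \<in> Arr C" "Dom C a = Cod C e" "Dom C b = Cod C e"
  shows "a = b"
  using assms unfolding is_epi_def by blast

lemma coequaliser_is_epi:
  assumes C: "category C" and q: "is_coequaliser C u v q"
  shows "is_epi C q"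
  unfolding is_epi_def
proof (intro conjI ballI impI)
  note [simp] = category_simps[OF C] is_coequaliserD[OF q]
  show "q \<in> Arr C" by simp
  fix a b
  assume ab: "a \<in> Arr C" "b \<in> Arr C" "Dom C a = Cod C q" "Dom C b = Cod C q" "a \<cdot>\<^bsub>C\<^esub> q = b \<cdot>\<^bsub>C\<^esub> q"
  have "(b \<cdot>\<^bsub>C\<^esub> q) \<cdot>\<^bsub>C\<^esub> u = (b \<cdot>\<^bsub>C\<^esub> q) \<cdot>\<^bsub>C\<^esub> v" "Cod C b = Cod C (b \<cdot>\<^bsub>C\<^esub> q)"
    using ab by simp_all
  moreover have "Cod C a = Cod C (b \<cdot>\<^bsub>C\<^esub> q)"
    by (metis ab category_simps(8)[OF C] is_coequaliserD(3)[OF q])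
  moreover have "\<exists>!h. h \<in> hom C (Cod C q) (Cod C (b \<cdot>\<^bsub>C\<^esub> q)) \<and> h \<cdot>\<^bsub>C\<^esub> q = b \<cdot>\<^bsub>C\<^esub> q"
    by (rule coequaliser_ex1[OF q]) (use ab calculation in simp_all)
  ultimately show "a = b"
    using ab by (metis hom_iff)
qed

lemma is_epi_comp:
  assumes C: "category C" and e: "is_epi C e" and f: "is_epi C f" and ef: "Cod C e = Dom C f"
  shows "is_epi C (f \<cdot>\<^bsub>C\<^esub> e)"
  unfolding is_epi_def
proof (intro conjI ballI impI)
  note [simp] = category_simps[OF C]
  have [simp]: "e \<in> Arr C" "f \<in> Arr C"
    using e f unfolding is_epi_def by auto
  show "f \<cdot>\<^bsub>C\<^esub> e \<in> Arr C" using ef by simp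
  fix a b
  assume ab: "a \<in> Arr C" "b \<in> Arr C" "Dom C a = Cod C (f \<cdot>\<^bsub>C\<^esub> e)" "Dom C b = Cod C (f \<cdot>\<^bsub>C\<^esub> e)"
    "a \<cdot>\<^bsub>C\<^esub> (f \<cdot>\<^bsub>C\<^esub> e) = b \<cdot>\<^bsub>C\<^esub> (f \<cdot>\<^bsub>C\<^esub> e)"
  then have "(a \<cdot>\<^bsub>C\<^esub> f) \<cdot>\<^bsub>C\<^esub> e = (b \<cdot>\<^bsub>C\<^esub> f) \<cdot>\<^bsub>C\<^esub> e"
    using ef by simp
  then have "a \<cdot>\<^bsub>C\<^esub> f = b \<cdot>\<^bsub>C\<^esub> f"
    by (rule is_epiD[OF e]) (use ab ef in simp_all)
  then show "a = b"
    by (rule is_epiD[OF f]) (use ab ef in simp_all)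
qed

locale category_with_stable_coequalisers = category_with_pullbacks E for E :: "('o, 'a) cat" +
  assumes stable: "has_pullback_stable_coequalisers E"
begin

text \<open>Stability speaks of coequalisers in slices only, so \<open>q\<close> is first regarded
  as one over its own codomain, with the terminal object of that slice as its target. A
  factorisation found in \<open>E\<close> lies over the base because \<open>q\<close> is
  epi.\<close>

lemma coequaliser_in_slice:
  assumes q: "is_coequaliser E u v q"
  shows "is_coequaliser (slice E (Cod E q)) (q \<bullet> u, u, q) (q \<bullet> v, v, q) (q, q, Ide E (Cod E q))"
proof -
  note [simp] = is_coequaliserD[OF q]
  have "\<exists>!h. h \<in> hom (slice E (Cod E q)) (Ide E (Cod E q)) g \<and>
      h \<cdot>\<^bsub>slice E (Cod E q)\<^esub> (q, q, Ide E (Cod E q)) = (q, k, g)"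
    if k: "k \<in> Arr E" "Dom E k = Dom E q" "Cod E k = Dom E g" "g \<in> Arr E" "Cod E g = Cod E q" "g \<bullet> k = q"
      and kuv: "k \<bullet> u = k \<bullet> v" for k g
  proof -
    obtain h where h: "h \<in> Arr E" "Dom E h = Cod E q" "Cod E h = Cod E k" "h \<bullet> q = k"
      using coequaliser_factor[OF q k(1) _ kuv] k by auto
    have gh: "g \<bullet> h = Ide E (Cod E q)"
      by (rule is_epiD[OF coequaliser_is_epi[OF cat q]]) (use h k in simp_all)
    show ?thesis
    proof (rule ex1I[of _ "(Ide E (Cod E q), h, g)"])
      show "(Ide E (Cod E q), h, g) \<in> hom (slice E (Cod E q)) (Ide E (Cod E q)) g \<and>
        (Ide E (Cod E q), h, g) \<cdot>\<^bsub>slice E (Cod E q)\<^esub> (q, q, Ide E (Cod E q)) = (q, k, g)"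
        using h gh k by (simp add: slice_def)
      fix h'
      assume h': "h' \<in> hom (slice E (Cod E q)) (Ide E (Cod E q)) g \<and>
        h' \<cdot>\<^bsub>slice E (Cod E q)\<^esub> (q, q, Ide E (Cod E q)) = (q, k, g)"
      obtain h1 h2 h3 where [simp]: "h' = (h1, h2, h3)" by (cases h') auto
      have "h2 \<bullet> q = h \<bullet> q" "h1 = Ide E (Cod E q)" "h3 = g" "h2 \<in> Arr E" "Dom E h2 = Cod E q"
        using h' h by (auto simp: slice_def)
      then show "h' = (Ide E (Cod E q), h, g)"
        using is_epiD[OF coequaliser_is_epi[OF cat q], of h2 h] h by simp
    qed
  qed
  then show ?thesis
    unfolding is_coequaliser_def[of "slice E (Cod E q)"] by (auto simp: slice_def)
qed

text \<open>Stability of coequalisers is stated in slices; comparing with the coequaliser in \<open>E\<close> of the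
  pulled back pair turns it into a statement about \<open>E\<close>.\<close>

lemma coequaliser_pullback:
  assumes q: "is_coequaliser E u v q" and f: "f \<in> Arr E" "Cod E f = Cod E q"
  shows "is_epi E (pb1 E f q)"
    and "k \<in> Arr E \<Longrightarrow> Dom E k = pb0 E f q \<Longrightarrow>
      (\<And>a b. a \<in> Arr E \<Longrightarrow> b \<in> Arr E \<Longrightarrow> Dom E a = Dom E b \<Longrightarrow> Cod E a = Dom E f \<Longrightarrow> Cod E b = Dom E u \<Longrightarrow>
         f \<bullet> a = q \<bullet> u \<bullet> b \<Longrightarrow> k \<bullet> pb_pair E f q a (u \<bullet> b) = k \<bullet> pb_pair E f q a (v \<bullet> b)) \<Longrightarrow>
      \<exists>h \<in> hom E (Dom E f) (Cod E k). h \<bullet> pb1 E f q = k"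
proof -
  define X where "X = Dom E f"
  \<comment> \<open>The pullback functor sends the identity of \<open>Cod E q\<close> to its chosen
    pullback \<open>i\<close>, which is invertible but need not be an identity. Its section
    \<open>i'\<close> carries the result back to \<open>X\<close>.\<close>
  define i where "i = pb1 E f (Ide E (Cod E q))"
  define i' where "i' = pb_pair E f (Ide E (Cod E q)) (Ide E X) f"
  define p where "p = pb1 E f q"
  define q' where "q' = pb_pair E f (Ide E (Cod E q)) p (q \<bullet> pb2 E f q)"
  \<comment> \<open>Because \<open>q \<bullet> u = q \<bullet> v\<close>, both members of the pulled
    back pair start at the same chosen pullback, with projections \<open>a\<close> and
    \<open>b\<close>.\<close>
  define a where "a = pb1 E f (q \<bullet> u)"
  define b where "b = pb2 E f (q \<bullet> u)"
  define u' where "u' = pb_pair E f q a (u \<bullet> b)"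
  define v' where "v' = pb_pair E f q a (v \<bullet> b)"
  note [simp] = is_coequaliserD(1-6)[OF q] f
  note quv = is_coequaliserD(7)[OF q]
  have quvz: "q \<bullet> u \<bullet> z = q \<bullet> v \<bullet> z" if "z \<in> Arr E" "Cod E z = Dom E u" for z
    using reassoc[OF quv] that by simp
  have ab: "a \<in> Arr E" "b \<in> Arr E" "Dom E a = Dom E b" "Cod E a = X" "Cod E b = Dom E u"
    "f \<bullet> a = q \<bullet> u \<bullet> b"
    unfolding a_def b_def X_def by (simp_all)
  note [simp] = ab(1-5)
  have fab: "f \<bullet> a = q \<bullet> v \<bullet> b"
    using ab quvz[of b] by simp
  have p [simp]: "p \<in> Arr E" "Dom E p = pb0 E f q" "Cod E p = X"
    by (simp_all add: p_def X_def)
  have [simp]: "X \<in> Obj E" by (simp add: X_def)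
  have u' [simp]: "u' \<in> Arr E" "Dom E u' = Dom E b" "Cod E u' = pb0 E f q" "p \<bullet> u' = a"
    using ab by (simp_all add: u'_def p_def X_def)
  have v' [simp]: "v' \<in> Arr E" "Dom E v' = Dom E b" "Cod E v' = pb0 E f q" "p \<bullet> v' = a"
    using ab(3,4) fab by (simp_all add: v'_def p_def X_def)
  have i [simp]: "i \<in> Arr E" "Dom E i = Cod E i'" "Cod E i = X" "i' \<in> Arr E" "Dom E i' = X"
    "Cod E i' = pb0 E f (Ide E (Cod E q))"
    by (simp_all add: i_def i'_def X_def)
  have [simp]: "q' \<in> Arr E" "Dom E q' = pb0 E f q" "Cod E q' = pb0 E f (Ide E (Cod E q))"
    by (simp_all add: q'_def p_def)
  have i'p: "i' \<bullet> p = q'"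
    by (rule pb_eqI[of f "Ide E (Cod E q)"]) (simp_all add: q'_def i'_def p_def X_def)
  have ip: "i \<bullet> i' = Ide E X"
    by (simp add: i_def i'_def X_def)
  have "is_coequaliser (slice E X) (fa (pullback_functor E f) (q \<bullet> u, u, q)) (fa (pullback_functor E f) (q \<bullet> v, v, q))
      (fa (pullback_functor E f) (q, q, Ide E (Cod E q)))"
    using stable f coequaliser_in_slice[OF q]
    unfolding has_pullback_stable_coequalisers_def preserves_coequalisers_def X_def by auto
  then have sc: "is_coequaliser (slice E X) (a, u', p) (a, v', p) (p, q', i)"
    by (simp add: pullback_functor_def a_def b_def u'_def v'_def p_def q'_def i_def quv)
  \<comment> \<open>The test arrow \<open>k\<close> does not live over \<open>X\<close>, so the
    coequaliser in the slice cannot be applied to it. The coequaliser \<open>c\<close> in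
    \<open>E\<close> can. It lies over \<open>X\<close> through \<open>r\<close>, hence factors
    through \<open>p\<close> by the slice property; this gives \<open>j\<close> with
    \<open>j \<bullet> p = c\<close>, and a factorisation through \<open>c\<close> becomes one
    through \<open>p\<close>.\<close>
  obtain c where c: "is_coequaliser E u' v' c"
    using stable u' v' unfolding has_pullback_stable_coequalisers_def has_coequalisers_def by metis
  note [simp] = is_coequaliserD(1-6)[OF c]
  obtain r where r: "r \<in> Arr E" "Dom E r = Cod E c" "Cod E r = Cod E p" "r \<bullet> c = p"
    using coequaliser_factor[OF c, of p] by auto
  have ks: "(p, c, r) \<in> Arr (slice E X)" "Dom (slice E X) (p, c, r) = p"
    "(p, c, r) \<cdot>\<^bsub>slice E X\<^esub> (a, u', p) = (p, c, r) \<cdot>\<^bsub>slice E X\<^esub> (a, v', p)"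
    using r is_coequaliserD(7)[OF c] by (simp_all add: slice_def)
  obtain j' where "j' \<in> Arr (slice E X)" "Dom (slice E X) j' = i" "Cod (slice E X) j' = r"
    "j' \<cdot>\<^bsub>slice E X\<^esub> (p, q', i) = (p, c, r)"
    using coequaliser_factor[OF sc ks(1) _ ks(3)] ks(2) by (auto simp: slice_def)
  then obtain j0 where j0: "j0 \<in> Arr E" "Dom E j0 = Dom E i" "Cod E j0 = Dom E r" "r \<bullet> j0 = i" "j0 \<bullet> q' = c"
    by (cases j') (auto simp: slice_def)
  define j where "j = j0 \<bullet> i'"
  have j: "j \<in> Arr E" "Dom E j = X" "Cod E j = Dom E r"
    using j0 by (simp_all add: j_def)
  have jp: "j \<bullet> p = c"
    using j0 i'p by (simp add: j_def)
  have rj: "r \<bullet> j = Ide E X"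
    using reassoc[OF j0(4), of i'] j0 r ip by (simp add: j_def)
  show "is_epi E (pb1 E f q)"
    unfolding is_epi_def p_def[symmetric]
  proof (intro conjI ballI impI)
    fix x y
    assume x: "x \<in> Arr E" "y \<in> Arr E" "Dom E x = Cod E p" "Dom E y = Cod E p" "x \<bullet> p = y \<bullet> p"
    then have "(x \<bullet> r) \<bullet> c = (y \<bullet> r) \<bullet> c"
      using r by simp
    then have "x \<bullet> r = y \<bullet> r"
      by (rule is_epiD[OF coequaliser_is_epi[OF cat c]]) (use x r in simp_all)
    then have "(x \<bullet> r) \<bullet> j = (y \<bullet> r) \<bullet> j" by simp
    then show "x = y"
      using x r j rj by simp
  qed simp
  assume k: "k \<in> Arr E" "Dom E k = pb0 E f q"
    and elem: "\<And>a b. a \<in> Arr E \<Longrightarrow> b \<in> Arr E \<Longrightarrow> Dom E a = Dom E b \<Longrightarrow> Cod E a = Dom E f \<Longrightarrow> Cod E b = Dom E u \<Longrightarrow>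
         f \<bullet> a = q \<bullet> u \<bullet> b \<Longrightarrow> k \<bullet> pb_pair E f q a (u \<bullet> b) = k \<bullet> pb_pair E f q a (v \<bullet> b)"
  \<comment> \<open>The projections \<open>a\<close> and \<open>b\<close> of the pullback of
    \<open>q \<bullet> u\<close> are the generic instance of \<open>elem\<close>.\<close>
  have "k \<bullet> u' = k \<bullet> v'"
    unfolding u'_def v'_def using elem[of a b] ab(4,6) by (simp add: X_def)
  then obtain h where h: "h \<in> Arr E" "Dom E h = Cod E c" "Cod E h = Cod E k" "h \<bullet> c = k"
    using coequaliser_factor[OF c k(1)] k by auto
  have "(h \<bullet> j) \<bullet> p = k"
    using h j jp r by simp
  then show "\<exists>h \<in> hom E (Dom E f) (Cod E k). h \<bullet> pb1 E f q = k"
    using h j r by (intro bexI[of _ "h \<bullet> j"]) (auto simp: p_def X_def)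
qed

text \<open>An internal choice of representatives: an element of the quotient object lifts along
  \<open>q\<close> once it is restricted along an epimorphism. Equations between arrows out of the
  quotient can therefore be tested on representatives, the epimorphism being cancelled at the
  end.\<close>

lemma coequaliser_lift:
  assumes q: "is_coequaliser E u v q" and x: "x \<in> Arr E" "Cod E x = Cod E q"
  obtains e c where "is_epi E e" "e \<in> Arr E" "Cod E e = Dom E x" "c \<in> Arr E" "Dom E c = Dom E e" "Cod E c = Dom E q"
    "x \<bullet> e = q \<bullet> c"
  using that[of "pb1 E x q" "pb2 E x q"] coequaliser_pullback(1)[OF assms] is_coequaliserD[OF q] x by simp

end

section \<open>Quotients of internal categories\<close>

context category_with_stable_coequalisers
begin

context
  fixes C :: "('o, 'a) icat" and u v q :: 'a
  assumes C [simp]: "internal_category E C" and q: "is_coequaliser E u v q"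
    and uv: "Cod E u = mor C" "src C \<bullet> u = src C \<bullet> v" "tgt C \<bullet> u = tgt C \<bullet> v"
    and right: "\<And>b c. b \<in> Arr E \<Longrightarrow> Cod E b = Dom E u \<Longrightarrow> composable C (u \<bullet> b) c \<Longrightarrow>
      q \<bullet> icomp E C (u \<bullet> b) c = q \<bullet> icomp E C (v \<bullet> b) c"
    and left: "\<And>b c. b \<in> Arr E \<Longrightarrow> Cod E b = Dom E u \<Longrightarrow> composable C c (u \<bullet> b) \<Longrightarrow>
      q \<bullet> icomp E C c (u \<bullet> b) = q \<bullet> icomp E C c (v \<bullet> b)"
begin

text \<open>Composition descends along \<open>C\<^sub>1 \<times> C\<^sub>1 \<rightarrow> Q\<^sub>1 \<times> C\<^sub>1 \<rightarrow> Q\<^sub>1 \<times> Q\<^sub>1\<close> (fibre products over the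
  objects): by stability each of these two arrows is again a coequaliser.\<close>

lemma quotient_mul:
  obtains s t m where "s \<in> hom E (Cod E q) (ob C)" "t \<in> hom E (Cod E q) (ob C)" "s \<bullet> q = src C" "t \<bullet> q = tgt C"
    "m \<in> hom E (pb0 E t s) (Cod E q)"
    "\<And>c d. composable C c d \<Longrightarrow> m \<bullet> pb_pair E t s (q \<bullet> c) (q \<bullet> d) = q \<bullet> icomp E C c d"
proof -
  note qD [simp] = is_coequaliserD(1-6)[OF q] uv(1)
  have Cq [simp]: "Cod E v = mor C" "Dom E q = mor C"
    by simp_all
  have quv: "q \<bullet> u \<bullet> z = q \<bullet> v \<bullet> z" if "z \<in> Arr E" "Cod E z = Dom E u" for z
    using reassoc[OF is_coequaliserD(7)[OF q]] that by simp
  note q_epi = coequaliser_is_epi[OF cat q]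
  obtain s where s [simp]: "s \<in> Arr E" "Dom E s = Cod E q" "Cod E s = ob C" "s \<bullet> q = src C"
    using coequaliser_factor[OF q, of "src C"] uv by auto
  obtain t where t [simp]: "t \<in> Arr E" "Dom E t = Cod E q" "Cod E t = ob C" "t \<bullet> q = tgt C"
    using coequaliser_factor[OF q, of "tgt C"] uv by auto
  have [simp]: "s \<bullet> q \<bullet> z = src C \<bullet> z" "t \<bullet> q \<bullet> z = tgt C \<bullet> z" if "z \<in> Arr E" "Cod E z = mor C" for z
    using that reassoc[OF s(4)] reassoc[OF t(4)] by auto
  have sv: "src C \<bullet> v \<bullet> z = src C \<bullet> u \<bullet> z" "tgt C \<bullet> v \<bullet> z = tgt C \<bullet> u \<bullet> z"
      if "z \<in> Arr E" "Cod E z = Dom E u" for z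
    using that reassoc[OF uv(2)] reassoc[OF uv(3)] by auto
  define M where "M = pb0 E t (src C)"
  define m1 where "m1 = pb1 E t (src C)"
  define m2 where "m2 = pb2 E t (src C)"
  have M [simp]: "m1 \<in> Arr E" "m2 \<in> Arr E" "Dom E m1 = M" "Dom E m2 = M" "Cod E m1 = Cod E q" "Cod E m2 = mor C"
    "t \<bullet> m1 = src C \<bullet> m2"
    by (simp_all add: M_def m1_def m2_def)
  have [simp]: "t \<bullet> m1 \<bullet> z = src C \<bullet> m2 \<bullet> z" if "z \<in> Arr E" "Cod E z = M" for z
    using that reassoc[OF M(7)] by auto
  \<comment> \<open>The pullback of \<open>q\<close> along \<open>m1\<close> is, up to isomorphism,
    the object of composable pairs of \<open>C\<close>, so \<open>p1\<close> inherits the stability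
    property from \<open>q\<close>. The first descent, along \<open>p1\<close>, replaces the first
    member of a pair by its class and yields \<open>n\<close>.\<close>
  define p1 where "p1 = pb1 E m1 q"
  define p2 where "p2 = pb2 E m1 q"
  define P where "P = pb0 E m1 q"
  have P [simp]: "p1 \<in> Arr E" "p2 \<in> Arr E" "Dom E p1 = P" "Dom E p2 = P" "Cod E p1 = M" "Cod E p2 = mor C"
    and P' [simp]: "q \<bullet> p2 = m1 \<bullet> p1"
    by (simp_all add: P_def p1_def p2_def)
  have cP: "composable C p2 (m2 \<bullet> p1)"
    using arg_cong[OF P', of "\<lambda>z. t \<bullet> z"] by (simp add: composable_def del: P')
  have "\<exists>h \<in> hom E (Dom E m1) (Cod E (q \<bullet> icomp E C p2 (m2 \<bullet> p1))). h \<bullet> pb1 E m1 q = q \<bullet> icomp E C p2 (m2 \<bullet> p1)"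
  proof (rule coequaliser_pullback(2)[OF q])
    fix a b
    assume ab: "a \<in> Arr E" "b \<in> Arr E" "Dom E a = Dom E b" "Cod E a = Dom E m1" "Cod E b = Dom E u"
      "m1 \<bullet> a = q \<bullet> u \<bullet> b"
    have ub: "composable C (u \<bullet> b) (m2 \<bullet> a)"
      using arg_cong[OF ab(6), of "\<lambda>z. t \<bullet> z"] ab(1-5) by (simp add: composable_def)
    note [simp] = ab(1-5) quv[of b]
    have *: "m1 \<bullet> a = q \<bullet> v \<bullet> b"
      using ab(6) quv[of b] by simp
    have vb: "composable C (v \<bullet> b) (m2 \<bullet> a)"
      using ub by (simp add: composable_def sv)
    show "(q \<bullet> icomp E C p2 (m2 \<bullet> p1)) \<bullet> pb_pair E m1 q a (u \<bullet> b) =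
        (q \<bullet> icomp E C p2 (m2 \<bullet> p1)) \<bullet> pb_pair E m1 q a (v \<bullet> b)"
      using ub vb cP right[of b "m2 \<bullet> a"] ab(6) *
      by (simp add: icomp_comp p1_def p2_def P_def M(1-6))
  qed (use cP in \<open>simp_all add: P_def\<close>)
  then obtain n where n: "n \<in> Arr E" "Dom E n = M" "Cod E n = Cod E q" "n \<bullet> p1 = q \<bullet> icomp E C p2 (m2 \<bullet> p1)"
    using cP by (auto simp: p1_def)
  have nel: "n \<bullet> pb_pair E t (src C) (q \<bullet> c) d = q \<bullet> icomp E C c d" if cd: "composable C c d" for c d
  proof -
    have [simp]: "c \<in> Arr E" "d \<in> Arr E" "Dom E c = Dom E d" "Cod E c = mor C" "Cod E d = mor C"
      "tgt C \<bullet> c = src C \<bullet> d"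
      using cd by (auto simp: composable_def)
    let ?x = "pb_pair E t (src C) (q \<bullet> c) d"
    have [simp]: "m1 \<bullet> ?x = q \<bullet> c" "m2 \<bullet> ?x = d" "?x \<in> Arr E" "Dom E ?x = Dom E d" "Cod E ?x = M"
      by (simp_all add: m1_def m2_def M_def)
    let ?y = "pb_pair E m1 q ?x c"
    have [simp]: "p1 \<bullet> ?y = ?x" "p2 \<bullet> ?y = c" "?y \<in> Arr E" "Dom E ?y = Dom E d" "Cod E ?y = P"
      by (simp_all add: p1_def p2_def P_def)
    have "n \<bullet> ?x = (n \<bullet> p1) \<bullet> ?y"
      using n(1-3) by simp
    also have "\<dots> = q \<bullet> icomp E C c d"
      unfolding n(4) using cP by (simp add: icomp_comp)
    finally show ?thesis .
  qed
  define N where "N = pb0 E t s"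
  define n1 where "n1 = pb1 E t s"
  define n2 where "n2 = pb2 E t s"
  have N [simp]: "n1 \<in> Arr E" "n2 \<in> Arr E" "Dom E n1 = N" "Dom E n2 = N" "Cod E n1 = Cod E q" "Cod E n2 = Cod E q"
    "t \<bullet> n1 = s \<bullet> n2"
    by (simp_all add: N_def n1_def n2_def)
  have [simp]: "t \<bullet> n1 \<bullet> z = s \<bullet> n2 \<bullet> z" if "z \<in> Arr E" "Cod E z = N" for z
    using that reassoc[OF N(7)] by auto
  \<comment> \<open>Second descent: \<open>R\<close> consists of pairs of classes together with a
    representative of the second member. There \<open>n\<close> already gives the composite,
    recorded as \<open>k\<close>, and what remains is its independence of that
    representative.\<close>
  define r1 where "r1 = pb1 E n2 q"
  define r2 where "r2 = pb2 E n2 q"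
  define R where "R = pb0 E n2 q"
  have R [simp]: "r1 \<in> Arr E" "r2 \<in> Arr E" "Dom E r1 = R" "Dom E r2 = R" "Cod E r1 = N" "Cod E r2 = mor C"
    and R': "n2 \<bullet> r1 = q \<bullet> r2"
    by (simp_all add: R_def r1_def r2_def)
  define k where "k = n \<bullet> pb_pair E t (src C) (n1 \<bullet> r1) r2"
  have [simp]: "k \<in> Arr E" "Dom E k = R" "Cod E k = Cod E q"
    using n(1-3) R' by (simp_all add: k_def M_def)
  have "\<exists>h \<in> hom E (Dom E n2) (Cod E k). h \<bullet> pb1 E n2 q = k"
  proof (rule coequaliser_pullback(2)[OF q])
    fix a b
    assume ab: "a \<in> Arr E" "b \<in> Arr E" "Dom E a = Dom E b" "Cod E a = Dom E n2" "Cod E b = Dom E u"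
      "n2 \<bullet> a = q \<bullet> u \<bullet> b"
    note [simp] = ab(1-5) n(1-3)
    have *: "n2 \<bullet> a = q \<bullet> v \<bullet> b"
      using ab(6) quv[of b] by simp
    let ?ku = "n \<bullet> pb_pair E t (src C) (n1 \<bullet> a) (u \<bullet> b)"
    let ?kv = "n \<bullet> pb_pair E t (src C) (n1 \<bullet> a) (v \<bullet> b)"
    let ?yu = "pb_pair E n2 q a (u \<bullet> b)"
    let ?yv = "pb_pair E n2 q a (v \<bullet> b)"
    have y [simp]: "?yu \<in> Arr E" "?yv \<in> Arr E" "Dom E ?yu = Dom E b" "Dom E ?yv = Dom E b" "Cod E ?yu = R" "Cod E ?yv = R"
      "r1 \<bullet> ?yu = a" "r2 \<bullet> ?yu = u \<bullet> b" "r1 \<bullet> ?yv = a" "r2 \<bullet> ?yv = v \<bullet> b"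
      using ab(6) * quv[of b] by (simp_all add: r1_def r2_def R_def)
    have tn: "t \<bullet> n1 \<bullet> a = src C \<bullet> u \<bullet> b" "t \<bullet> n1 \<bullet> a = src C \<bullet> v \<bullet> b"
      using ab(6) by (simp_all add: sv)
    have ky: "k \<bullet> ?yu = ?ku" "k \<bullet> ?yv = ?kv"
      using R' by (simp_all add: k_def pb_pair_comp M_def)
    \<comment> \<open>The hypothesis \<open>left\<close> requires a first member in
      \<open>C\<close>, but \<open>n1 \<bullet> a\<close> is only a class. It is represented by
      \<open>c\<close> after restriction along \<open>e\<close>; since \<open>e\<close> is epi, the
      equation holds before restriction as well.\<close>
    obtain e c where e: "is_epi E e" "e \<in> Arr E" "Cod E e = Dom E b" "c \<in> Arr E" "Dom E c = Dom E e" "Cod E c = mor C"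
      "(n1 \<bullet> a) \<bullet> e = q \<bullet> c"
      using coequaliser_lift[OF q, of "n1 \<bullet> a"] by auto
    then have nae: "n1 \<bullet> a \<bullet> e = q \<bullet> c"
      by simp
    have cu: "composable C c (u \<bullet> b \<bullet> e)" "composable C c (v \<bullet> b \<bullet> e)"
      using arg_cong[OF nae, of "\<lambda>z. t \<bullet> z"] reassoc[OF ab(6), of e] e(2-6)
        by (simp_all add: composable_def sv)
    have ku: "?ku \<in> Arr E" "Dom E ?ku = Dom E b" "?kv \<in> Arr E" "Dom E ?kv = Dom E b"
      using tn by (simp_all add: M_def)
    have "?ku \<bullet> e = n \<bullet> pb_pair E t (src C) (n1 \<bullet> a) (u \<bullet> b) \<bullet> e"
      using tn(1) e(2,3) by (simp add: M_def)
    also have "pb_pair E t (src C) (n1 \<bullet> a) (u \<bullet> b) \<bullet> e = pb_pair E t (src C) (q \<bullet> c) (u \<bullet> b \<bullet> e)"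
      using tn(1) e(2,3) nae by (simp add: pb_pair_comp)
    also have "n \<bullet> \<dots> = q \<bullet> icomp E C c (u \<bullet> b \<bullet> e)"
      by (rule nel[OF cu(1)])
    also have "\<dots> = q \<bullet> icomp E C c (v \<bullet> b \<bullet> e)"
      using left[of "b \<bullet> e" c] cu e(2,3) by simp
    also have "\<dots> = n \<bullet> pb_pair E t (src C) (q \<bullet> c) (v \<bullet> b \<bullet> e)"
      by (rule nel[OF cu(2), symmetric])
    also have "pb_pair E t (src C) (q \<bullet> c) (v \<bullet> b \<bullet> e) = pb_pair E t (src C) (n1 \<bullet> a) (v \<bullet> b) \<bullet> e"
      using tn(2) e(2,3) nae by (simp add: pb_pair_comp)
    also have "n \<bullet> \<dots> = ?kv \<bullet> e"
      using tn(2) e(2,3) by (simp add: M_def)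
    finally have "?ku = ?kv"
      by (rule is_epiD[OF e(1)]) (use ku e(3) in simp_all)
    then show "k \<bullet> ?yu = k \<bullet> ?yv"
      by (simp only: ky)
  qed (simp_all add: R_def)
  then obtain m where m: "m \<in> Arr E" "Dom E m = N" "Cod E m = Cod E q" "m \<bullet> r1 = k"
    by (auto simp: r1_def)
  have "m \<bullet> pb_pair E t s (q \<bullet> c) (q \<bullet> d) = q \<bullet> icomp E C c d" if cd: "composable C c d" for c d
  proof -
    have [simp]: "c \<in> Arr E" "d \<in> Arr E" "Dom E c = Dom E d" "Cod E c = mor C" "Cod E d = mor C"
      "tgt C \<bullet> c = src C \<bullet> d"
      using cd by (auto simp: composable_def)
    let ?x = "pb_pair E t s (q \<bullet> c) (q \<bullet> d)"
    have [simp]: "n1 \<bullet> ?x = q \<bullet> c" "n2 \<bullet> ?x = q \<bullet> d" "?x \<in> Arr E" "Dom E ?x = Dom E d" "Cod E ?x = N"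
      by (simp_all add: n1_def n2_def N_def)
    let ?y = "pb_pair E n2 q ?x d"
    have [simp]: "r1 \<bullet> ?y = ?x" "r2 \<bullet> ?y = d" "?y \<in> Arr E" "Dom E ?y = Dom E d" "Cod E ?y = R"
      by (simp_all add: r1_def r2_def R_def)
    have "m \<bullet> ?x = (m \<bullet> r1) \<bullet> ?y"
      using m(1-3) by simp
    also have "\<dots> = q \<bullet> icomp E C c d"
      unfolding m(4) k_def using n(1-3) R' nel[OF cd] by (simp add: pb_pair_comp M_def)
    finally show ?thesis .
  qed
  with that[of s t m] s t m show ?thesis
    by (simp add: N_def)
qed

text \<open>The quotient has the objects of \<open>C\<close>, so composable tuples of classes are
  covered, along an epimorphism, by composable tuples of arrows of \<open>C\<close>. Every law of
  the quotient, and functoriality of every induced arrow out of it, is the corresponding law for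
  representatives with an epimorphism cancelled.\<close>

lemma quotient_exists:
  obtains Q where "internal_category E Q" "internal_functor E C Q (Ide E (ob C), q)"
    "\<And>Y H. internal_category E Y \<Longrightarrow> internal_functor E C Y H \<Longrightarrow> snd H \<bullet> u = snd H \<bullet> v \<Longrightarrow>
       \<exists>!K. internal_functor E Q Y K \<and> fst K \<bullet> Ide E (ob C) = fst H \<and> snd K \<bullet> q = snd H"
proof -
  obtain s t m where st [simp]: "s \<in> Arr E" "Dom E s = Cod E q" "Cod E s = ob C"
      "t \<in> Arr E" "Dom E t = Cod E q" "Cod E t = ob C" "s \<bullet> q = src C" "t \<bullet> q = tgt C"
    and m [simp]: "m \<in> Arr E" "Dom E m = pb0 E t s" "Cod E m = Cod E q"
    and mel: "\<And>c d. composable C c d \<Longrightarrow> m \<bullet> pb_pair E t s (q \<bullet> c) (q \<bullet> d) = q \<bullet> icomp E C c d"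
    using quotient_mul by (metis hom_iff)
  note qD [simp] = is_coequaliserD(1-6)[OF q] uv(1)
  have Cq [simp]: "Cod E v = mor C" "Dom E q = mor C"
    by simp_all
  have [simp]: "s \<bullet> q \<bullet> z = src C \<bullet> z" "t \<bullet> q \<bullet> z = tgt C \<bullet> z" if "z \<in> Arr E" "Cod E z = mor C" for z
    using that reassoc[OF st(7)] reassoc[OF st(8)] by auto
  note q_epi = coequaliser_is_epi[OF cat q]
  define Q where "Q = \<lparr>ob = ob C, mor = Cod E q, src = s, tgt = t, unt = q \<bullet> unt C, mul = m\<rparr>"
  have Q [simp]: "ob Q = ob C" "mor Q = Cod E q" "src Q = s" "tgt Q = t" "unt Q = q \<bullet> unt C" "mul Q = m"
    by (simp_all add: Q_def)
  have QG [simp]: "internal_graph E Q"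
    unfolding internal_graph_def by simp
  define M where "M x y = m \<bullet> pb_pair E t s x y" for x y
  have cQ: "composable Q x y \<longleftrightarrow> x \<in> Arr E \<and> y \<in> Arr E \<and> Dom E x = Dom E y \<and>
     Cod E x = Cod E q \<and> Cod E y = Cod E q \<and> t \<bullet> x = s \<bullet> y" for x y
    by (simp add: composable_def)
  have M [simp]: "M x y \<in> Arr E" "Dom E (M x y) = Dom E x" "Cod E (M x y) = Cod E q" if "composable Q x y" for x y
    using that unfolding cQ M_def by auto
  have Mz: "M x y \<bullet> z = M (x \<bullet> z) (y \<bullet> z)" if "composable Q x y" "z \<in> Arr E" "Cod E z = Dom E x" for x y z
    using that unfolding cQ M_def by (auto simp: pb_pair_comp)
  have Mq: "M (q \<bullet> c) (q \<bullet> d) = q \<bullet> icomp E C c d" if "composable C c d" for c d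
    unfolding M_def by (rule mel[OF that])
  have lift2: "\<exists>e c d. is_epi E e \<and> e \<in> Arr E \<and> Cod E e = Dom E x \<and> c \<in> Arr E \<and> d \<in> Arr E \<and> Dom E c = Dom E e \<and>
      Dom E d = Dom E e \<and> Cod E c = mor C \<and> Cod E d = mor C \<and> x \<bullet> e = q \<bullet> c \<and> y \<bullet> e = q \<bullet> d"
    if xy: "x \<in> Arr E" "y \<in> Arr E" "Dom E x = Dom E y" "Cod E x = Cod E q" "Cod E y = Cod E q" for x y
  proof -
    obtain e c where e: "is_epi E e" "e \<in> Arr E" "Cod E e = Dom E x" "c \<in> Arr E" "Dom E c = Dom E e" "Cod E c = mor C"
      "x \<bullet> e = q \<bullet> c"
      using coequaliser_lift[OF q xy(1,4)] by auto
    obtain f d where f: "is_epi E f" "f \<in> Arr E" "Cod E f = Dom E e" "d \<in> Arr E" "Dom E d = Dom E f" "Cod E d = mor C"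
      "(y \<bullet> e) \<bullet> f = q \<bullet> d"
      using coequaliser_lift[OF q, of "y \<bullet> e"] xy e(2,3) by auto
    show ?thesis
      using e f xy is_epi_comp[OF cat f(1) e(1)] reassoc[OF e(7), of f]
      by (intro exI[of _ "e \<bullet> f"] exI[of _ "c \<bullet> f"] exI[of _ d]) simp
  qed
  \<comment> \<open>Representatives of composable classes are themselves composable:
    \<open>q\<close> respects sources and targets, and no objects have been identified.\<close>
  have comp_liftI: "composable C c d"
    if "x \<bullet> e = q \<bullet> c" "y \<bullet> e = q \<bullet> d" "composable Q x y" "e \<in> Arr E" "Cod E e = Dom E x"
      "c \<in> Arr E" "d \<in> Arr E" "Dom E c = Dom E e" "Dom E d = Dom E e" "Cod E c = mor C" "Cod E d = mor C" for x y c d e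
  proof -
    have "composable Q (x \<bullet> e) (y \<bullet> e)"
      using composable_comp[of Q x y e] that by simp
    then show ?thesis
      using that(4-) unfolding cQ that(1,2) by (simp add: composable_def)
  qed
  have lift_comp: "\<exists>e c d. is_epi E e \<and> e \<in> Arr E \<and> Cod E e = Dom E x \<and> composable C c d \<and> Dom E c = Dom E e \<and>
      x \<bullet> e = q \<bullet> c \<and> y \<bullet> e = q \<bullet> d \<and> M x y \<bullet> e = q \<bullet> icomp E C c d"
    if xy: "composable Q x y" for x y
  proof -
    have "\<exists>e c d. is_epi E e \<and> e \<in> Arr E \<and> Cod E e = Dom E x \<and> c \<in> Arr E \<and> d \<in> Arr E \<and> Dom E c = Dom E e \<and>
      Dom E d = Dom E e \<and> Cod E c = mor C \<and> Cod E d = mor C \<and> x \<bullet> e = q \<bullet> c \<and> y \<bullet> e = q \<bullet> d"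
      by (rule lift2) (use xy in \<open>auto simp: cQ\<close>)
    then obtain e c d where e: "is_epi E e" "e \<in> Arr E" "Cod E e = Dom E x" "c \<in> Arr E" "d \<in> Arr E"
      "Dom E c = Dom E e" "Dom E d = Dom E e" "Cod E c = mor C" "Cod E d = mor C" "x \<bullet> e = q \<bullet> c" "y \<bullet> e = q \<bullet> d"
      by blast
    have "composable C c d"
      by (rule comp_liftI[OF e(10,11) xy e(2-9)])
    then show ?thesis
      using e Mz[OF xy e(2,3)] Mq by metis
  qed
  have M_src: "s \<bullet> M x y = s \<bullet> x \<and> t \<bullet> M x y = t \<bullet> y" if xy: "composable Q x y" for x y
  proof -
    obtain e c d where e: "is_epi E e" "e \<in> Arr E" "Cod E e = Dom E x" "composable C c d" "Dom E c = Dom E e"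
      "x \<bullet> e = q \<bullet> c" "y \<bullet> e = q \<bullet> d" "M x y \<bullet> e = q \<bullet> icomp E C c d"
      using lift_comp[OF xy] by blast
    have [simp]: "x \<in> Arr E" "y \<in> Arr E" "Dom E y = Dom E x" "Cod E x = Cod E q" "Cod E y = Cod E q"
      "c \<in> Arr E" "d \<in> Arr E" "Cod E c = mor C" "Cod E d = mor C"
      using xy e(4) by (auto simp: cQ composable_def)
    have "(s \<bullet> M x y) \<bullet> e = (s \<bullet> x) \<bullet> e" "(t \<bullet> M x y) \<bullet> e = (t \<bullet> y) \<bullet> e"
      using e xy by simp_all
    then show ?thesis
      using is_epiD[OF e(1)] e(2,3) xy by (metis M cat_simps(6,7) st \<open>x \<in> Arr E\<close> \<open>y \<in> Arr E\<close>
        \<open>Dom E y = Dom E x\<close> \<open>Cod E x = Cod E q\<close> \<open>Cod E y = Cod E q\<close>)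
  qed
  have M_assoc: "M (M x y) z = M x (M y z)" if xy: "composable Q x y" and yz: "composable Q y z" for x y z
  proof -
    obtain e c d where e: "is_epi E e" "e \<in> Arr E" "Cod E e = Dom E x" "composable C c d" "Dom E c = Dom E e"
      "x \<bullet> e = q \<bullet> c" "y \<bullet> e = q \<bullet> d" "M x y \<bullet> e = q \<bullet> icomp E C c d"
      using lift_comp[OF xy] by blast
    have [simp]: "x \<in> Arr E" "y \<in> Arr E" "z \<in> Arr E" "Dom E y = Dom E x" "Dom E z = Dom E x"
       "Cod E x = Cod E q" "Cod E y = Cod E q" "Cod E z = Cod E q"
      "c \<in> Arr E" "d \<in> Arr E" "Cod E c = mor C" "Cod E d = mor C" "Dom E d = Dom E c"
      and xyz: "t \<bullet> x = s \<bullet> y" "t \<bullet> y = s \<bullet> z"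
      using xy yz e(4) by (auto simp: cQ composable_def)
    obtain f b where f: "is_epi E f" "f \<in> Arr E" "Cod E f = Dom E e" "b \<in> Arr E" "Dom E b = Dom E f" "Cod E b = mor C"
      "(z \<bullet> e) \<bullet> f = q \<bullet> b"
      using coequaliser_lift[OF q, of "z \<bullet> e"] e(2,3) by auto
    define g where "g = e \<bullet> f"
    have g: "is_epi E g" "g \<in> Arr E" "Cod E g = Dom E x" "Dom E g = Dom E f"
      using is_epi_comp[OF cat f(1) e(1)] e f by (simp_all add: g_def)
    have xg: "x \<bullet> g = q \<bullet> c \<bullet> f" "y \<bullet> g = q \<bullet> d \<bullet> f" "z \<bullet> g = q \<bullet> b"
      using reassoc[OF e(6), of f] reassoc[OF e(7), of f] e f by (simp_all add: g_def)
    have cd: "composable C (c \<bullet> f) (d \<bullet> f)"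
      by (rule composable_comp) (use e f in simp_all)
    have db: "composable C (d \<bullet> f) b"
      by (rule comp_liftI[OF xg(2,3) yz g(2)]) (use e f g in simp_all)
    have c3: "composable C (icomp E C (c \<bullet> f) (d \<bullet> f)) b" "composable C (c \<bullet> f) (icomp E C (d \<bullet> f) b)"
      using cd db by (simp_all add: composable_def)
    have cM: "composable Q (M x y) z" "composable Q x (M y z)" "composable Q y z" "composable Q x y"
      using M_src xyz xy yz by (simp_all add: cQ)
    have "M (M x y) z \<bullet> g = M (M (x \<bullet> g) (y \<bullet> g)) (z \<bullet> g)"
      using cM g by (simp add: Mz)
    also have "\<dots> = q \<bullet> icomp E C (icomp E C (c \<bullet> f) (d \<bullet> f)) b"
      unfolding xg Mq[OF cd] Mq[OF c3(1)] ..
    also have "\<dots> = q \<bullet> icomp E C (c \<bullet> f) (icomp E C (d \<bullet> f) b)"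
      by (simp add: icomp_assoc[OF C cd db])
    also have "\<dots> = M (x \<bullet> g) (M (y \<bullet> g) (z \<bullet> g))"
      unfolding xg Mq[OF db] Mq[OF c3(2)] ..
    also have "\<dots> = M x (M y z) \<bullet> g"
      using cM g by (simp add: Mz)
    finally show ?thesis
      by (rule is_epiD[OF g(1)]) (use cM g in simp_all)
  qed
  have M_unit: "M (unt Q \<bullet> src Q \<bullet> x) x = x \<and> M x (unt Q \<bullet> tgt Q \<bullet> x) = x"
    if x: "x \<in> Arr E" "Cod E x = mor Q" for x
  proof -
    obtain e c where e: "is_epi E e" "e \<in> Arr E" "Cod E e = Dom E x" "c \<in> Arr E" "Dom E c = Dom E e" "Cod E c = mor C"
      "x \<bullet> e = q \<bullet> c"
      using coequaliser_lift[OF q, of x] x by auto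
    have c: "composable C (unt C \<bullet> src C \<bullet> c) c" "composable C c (unt C \<bullet> tgt C \<bullet> c)"
      using e by (simp_all add: composable_def)
    have cx: "composable Q (q \<bullet> unt C \<bullet> s \<bullet> x) x" "composable Q x (q \<bullet> unt C \<bullet> t \<bullet> x)"
      using x by (simp_all add: cQ)
    have eq: "M (q \<bullet> unt C \<bullet> s \<bullet> x) x \<bullet> e = x \<bullet> e" "M x (q \<bullet> unt C \<bullet> t \<bullet> x) \<bullet> e = x \<bullet> e"
      using e x cx c by (simp_all add: Mz Mq)
    have "M (q \<bullet> unt C \<bullet> s \<bullet> x) x = x"
      by (rule is_epiD[OF e(1) eq(1)]) (use cx e(2,3) x in simp_all)
    moreover have "M x (q \<bullet> unt C \<bullet> t \<bullet> x) = x"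
      by (rule is_epiD[OF e(1) eq(2)]) (use cx e(2,3) x in simp_all)
    ultimately show ?thesis
      using x by simp
  qed
  have cpQ: "cpairs E Q = pb0 E t s" "cp1 E Q = pb1 E t s" "cp2 E Q = pb2 E t s"
    by (simp_all add: cpairs_def cp1_def cp2_def)
  have "pb_pair E t s (cp1 E Q) (cp2 E Q) = Ide E (pb0 E t s)"
    by (rule pb_eqI[of t s]) (simp_all add: cpQ)
  then have mulQ: "mul Q = M (cp1 E Q) (cp2 E Q)"
    by (simp add: M_def)
  have uQ: "unt Q \<in> hom E (ob Q) (mor Q)" "src Q \<bullet> unt Q = Ide E (ob Q)" "tgt Q \<bullet> unt Q = Ide E (ob Q)"
    by simp_all
  have icQ [simp]: "internal_category E Q" and icomp: "composable Q x y \<Longrightarrow> icomp E Q x y = M x y" for x y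
    using internal_categoryI[of Q M, OF QG uQ mulQ _ _ M_unit M_assoc] M_src Mz by simp_all
  have qcomp: "composable Q (q \<bullet> c) (q \<bullet> d)" if "composable C c d" for c d
    using that by (auto simp: cQ composable_def)
  have F: "internal_functor E C Q (Ide E (ob C), q)"
    by (rule internal_functorI) (use qcomp Mq in \<open>simp_all add: icomp\<close>)
  have "\<exists>!K. internal_functor E Q Y K \<and> fst K \<bullet> Ide E (ob C) = fst H \<and> snd K \<bullet> q = snd H"
    if Y [simp]: "internal_category E Y" and H: "internal_functor E C Y H" and Huv: "snd H \<bullet> u = snd H \<bullet> v" for Y H
  proof -
    note HD [simp] = internal_functorD[OF H C Y]
    obtain h where h [simp]: "h \<in> Arr E" "Dom E h = Cod E q" "Cod E h = mor Y" "h \<bullet> q = snd H"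
      using coequaliser_factor[OF q, of "snd H"] Huv by auto
    have [simp]: "h \<bullet> q \<bullet> z = snd H \<bullet> z" if "z \<in> Arr E" "Cod E z = mor C" for z
      using that reassoc[OF h(4)] by simp
    have [simp]: "src Y \<bullet> h = fst H \<bullet> s" "tgt Y \<bullet> h = fst H \<bullet> t"
      by (rule is_epiD[OF q_epi]; simp)+
    have hz: "src Y \<bullet> h \<bullet> z = fst H \<bullet> s \<bullet> z" "tgt Y \<bullet> h \<bullet> z = fst H \<bullet> t \<bullet> z" if "z \<in> Arr E" "Cod E z = Cod E q" for z
      using that reassoc[OF \<open>src Y \<bullet> h = fst H \<bullet> s\<close>] reassoc[OF \<open>tgt Y \<bullet> h = fst H \<bullet> t\<close>] by simp_all
    have hc: "composable Y (h \<bullet> x) (h \<bullet> y)" if "composable Q x y" for x y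
      using that hz unfolding cQ by (simp add: composable_def)
    have hM: "h \<bullet> M x y = icomp E Y (h \<bullet> x) (h \<bullet> y)" if xy: "composable Q x y" for x y
    proof -
      obtain e c d where e: "is_epi E e" "e \<in> Arr E" "Cod E e = Dom E x" "composable C c d" "Dom E c = Dom E e"
        "x \<bullet> e = q \<bullet> c" "y \<bullet> e = q \<bullet> d" "M x y \<bullet> e = q \<bullet> icomp E C c d"
        using lift_comp[OF xy] by blast
      have [simp]: "x \<in> Arr E" "y \<in> Arr E" "Dom E y = Dom E x" "Cod E x = Cod E q" "Cod E y = Cod E q"
        "c \<in> Arr E" "d \<in> Arr E" "Cod E c = mor C" "Cod E d = mor C"
        using xy e(4) by (auto simp: cQ composable_def)
      have "(h \<bullet> M x y) \<bullet> e = icomp E Y (h \<bullet> x) (h \<bullet> y) \<bullet> e"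
        using e xy hc[OF xy] by (simp add: icomp_comp)
      then show ?thesis
        by (rule is_epiD[OF e(1)]) (use e xy hc[OF xy] in simp_all)
    qed
    have K: "internal_functor E Q Y (fst H, h)"
      by (rule internal_functorI) (use hM in \<open>simp_all add: icomp\<close>)
    show ?thesis
    proof (rule ex1I[of _ "(fst H, h)"])
      fix K
      assume K: "internal_functor E Q Y K \<and> fst K \<bullet> Ide E (ob C) = fst H \<and> snd K \<bullet> q = snd H"
      note [simp] = internal_functorD[OF conjunct1[OF K] icQ Y]
      have "snd K = h"
        by (rule is_epiD[OF q_epi]) (use K in simp_all)
      moreover have "fst K = fst H"
        using K by simp
      ultimately show "K = (fst H, h)"
        by (simp add: prod_eq_iff)
    qed (use K in simp)
  qed
  with that[OF icQ F] show ?thesis by blast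
qed

end

end

section \<open>Quotients by finitely many parallel pairs\<close>

context category_with_stable_coequalisers
begin

definition parallel :: "('o, 'a) icat \<Rightarrow> 'a \<Rightarrow> 'a \<Rightarrow> bool" where
  "parallel C r s \<longleftrightarrow> r \<in> Arr E \<and> s \<in> Arr E \<and> Dom E r = Dom E s \<and> Cod E r = mor C \<and> Cod E s = mor C \<and>
     src C \<bullet> r = src C \<bullet> s \<and> tgt C \<bullet> r = tgt C \<bullet> s"

definition identifies :: "'a \<times> 'a \<Rightarrow> ('a \<times> 'a) set \<Rightarrow> bool" where
  "identifies H R \<longleftrightarrow> (\<forall>(r, s) \<in> R. snd H \<bullet> r = snd H \<bullet> s)"

definition is_quotient :: "('o, 'a) icat \<Rightarrow> ('a \<times> 'a) set \<Rightarrow> ('o, 'a) icat \<Rightarrow> 'a \<times> 'a \<Rightarrow> bool" where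
  "is_quotient C R Q q \<longleftrightarrow> internal_category E Q \<and> internal_functor E C Q q \<and> identifies q R \<and>
     (\<forall>Y H. internal_category E Y \<longrightarrow> internal_functor E C Y H \<longrightarrow> identifies H R \<longrightarrow>
        (\<exists>!K. internal_functor E Q Y K \<and> fst K \<bullet> fst q = fst H \<and> snd K \<bullet> snd q = snd H))"

lemma identifies_insert: "identifies H (insert (r, s) R) \<longleftrightarrow> snd H \<bullet> r = snd H \<bullet> s \<and> identifies H R"
  by (simp add: identifies_def)

lemma is_quotientD:
  assumes "is_quotient C R Q q"
  shows "internal_category E Q" "internal_functor E C Q q" "identifies q R"
  using assms unfolding is_quotient_def by auto

lemma is_quotient_factor:
  assumes "is_quotient C R Q q" "internal_category E Y" "internal_functor E C Y H" "identifies H R"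
  shows "\<exists>!K. internal_functor E Q Y K \<and> fst K \<bullet> fst q = fst H \<and> snd K \<bullet> snd q = snd H"
  using assms unfolding is_quotient_def by blast

text \<open>The generic whiskering of \<open>r\<close>: one pullback attaches an arrow in front of
  \<open>r\<close>, a second one an arrow behind it. The stage \<open>Dom E y\<close> serves as the
  domain of the whiskered relation.\<close>

lemma composable_triples:
  assumes C [simp]: "internal_category E C" and r: "r \<in> Arr E" "Cod E r = mor C"
  obtains x \<rho> y where "x \<in> Arr E" "\<rho> \<in> Arr E" "y \<in> Arr E" "Dom E x = Dom E y" "Dom E \<rho> = Dom E y"
    "Cod E x = mor C" "Cod E \<rho> = Dom E r" "Cod E y = mor C" "composable C x (r \<bullet> \<rho>)" "composable C (r \<bullet> \<rho>) y"
    "\<And>x' \<rho>' y'. composable C x' (r \<bullet> \<rho>') \<Longrightarrow> composable C (r \<bullet> \<rho>') y' \<Longrightarrow> \<rho>' \<in> Arr E \<Longrightarrow> Cod E \<rho>' = Dom E r \<Longrightarrow>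
       \<exists>l. l \<in> Arr E \<and> Dom E l = Dom E \<rho>' \<and> Cod E l = Dom E y \<and> x \<bullet> l = x' \<and> \<rho> \<bullet> l = \<rho>' \<and> y \<bullet> l = y'"
proof -
  note [simp] = r
  define a where "a = pb1 E (tgt C) (src C \<bullet> r)"
  define b where "b = pb2 E (tgt C) (src C \<bullet> r)"
  have ab [simp]: "a \<in> Arr E" "b \<in> Arr E" "Dom E a = Dom E b" "Cod E a = mor C" "Cod E b = Dom E r"
    "tgt C \<bullet> a = src C \<bullet> r \<bullet> b"
    by (simp_all add: a_def b_def)
  define w where "w = pb1 E (tgt C \<bullet> r \<bullet> b) (src C)"
  define y where "y = pb2 E (tgt C \<bullet> r \<bullet> b) (src C)"
  have w [simp]: "w \<in> Arr E" "y \<in> Arr E" "Dom E w = Dom E y" "Cod E w = Dom E b" "Cod E y = mor C"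
    by (simp_all add: w_def y_def)
  have wy: "(tgt C \<bullet> r \<bullet> b) \<bullet> w = src C \<bullet> y"
    unfolding w_def y_def by (rule pb_simps(8)) simp_all
  then have [simp]: "src C \<bullet> y = tgt C \<bullet> r \<bullet> b \<bullet> w"
    by simp
  have aw: "tgt C \<bullet> a \<bullet> w = src C \<bullet> r \<bullet> b \<bullet> w"
    using reassoc[OF ab(6), of w] by simp
  show ?thesis
  proof (rule that[of "a \<bullet> w" "b \<bullet> w" y])
    show "composable C (a \<bullet> w) (r \<bullet> b \<bullet> w)" "composable C (r \<bullet> b \<bullet> w) y"
      using aw by (simp_all add: composable_def)
    fix x' \<rho>' y'
    assume c: "composable C x' (r \<bullet> \<rho>')" "composable C (r \<bullet> \<rho>') y'" and \<rho>' [simp]: "\<rho>' \<in> Arr E" "Cod E \<rho>' = Dom E r"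
    have [simp]: "x' \<in> Arr E" "y' \<in> Arr E" "Dom E x' = Dom E \<rho>'" "Dom E y' = Dom E \<rho>'" "Cod E x' = mor C" "Cod E y' = mor C"
      "tgt C \<bullet> x' = src C \<bullet> r \<bullet> \<rho>'" "src C \<bullet> y' = tgt C \<bullet> r \<bullet> \<rho>'"
      using c by (auto simp: composable_def)
    define k where "k = pb_pair E (tgt C) (src C \<bullet> r) x' \<rho>'"
    have k [simp]: "k \<in> Arr E" "Dom E k = Dom E \<rho>'" "Cod E k = Dom E b" "a \<bullet> k = x'" "b \<bullet> k = \<rho>'"
      by (simp_all add: k_def a_def b_def)
    define l where "l = pb_pair E (tgt C \<bullet> r \<bullet> b) (src C) k y'"
    have l [simp]: "l \<in> Arr E" "Dom E l = Dom E \<rho>'" "Cod E l = Dom E y" "w \<bullet> l = k" "y \<bullet> l = y'"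
      by (simp_all add: l_def w_def y_def)
    show "\<exists>l. l \<in> Arr E \<and> Dom E l = Dom E \<rho>' \<and> Cod E l = Dom E y \<and> (a \<bullet> w) \<bullet> l = x' \<and> (b \<bullet> w) \<bullet> l = \<rho>' \<and> y \<bullet> l = y'"
      by (rule exI[of _ l]) simp
  qed simp_all
qed

text \<open>The coequaliser is taken of the whiskered relation \<open>x ; r ; y\<close>, \<open>x ; s ; y\<close>, which unlike \<open>r\<close>, \<open>s\<close> is
  compatible with composition on both sides.\<close>

lemma quotient_by_pair:
  assumes C [simp]: "internal_category E C" and rs: "parallel C r s"
  obtains Q q where "is_quotient C {(r, s)} Q q"
proof -
  have r [simp]: "r \<in> Arr E" "Cod E r = mor C" "s \<in> Arr E" "Cod E s = mor C" "Dom E s = Dom E r"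
    "src C \<bullet> s = src C \<bullet> r" "tgt C \<bullet> s = tgt C \<bullet> r"
    using rs by (auto simp: parallel_def)
  have sz: "src C \<bullet> s \<bullet> z = src C \<bullet> r \<bullet> z" "tgt C \<bullet> s \<bullet> z = tgt C \<bullet> r \<bullet> z" if "z \<in> Arr E" "Cod E z = Dom E r" for z
    using that reassoc[OF r(6), of z] reassoc[OF r(7), of z] by simp_all
  obtain x \<rho> y where W [simp]: "x \<in> Arr E" "\<rho> \<in> Arr E" "y \<in> Arr E" "Dom E x = Dom E y" "Dom E \<rho> = Dom E y"
    "Cod E x = mor C" "Cod E \<rho> = Dom E r" "Cod E y = mor C"
    and cr [simp]: "composable C x (r \<bullet> \<rho>)" "composable C (r \<bullet> \<rho>) y"
    and univ: "\<And>x' \<rho>' y'. composable C x' (r \<bullet> \<rho>') \<Longrightarrow> composable C (r \<bullet> \<rho>') y' \<Longrightarrow> \<rho>' \<in> Arr E \<Longrightarrow> Cod E \<rho>' = Dom E r \<Longrightarrow>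
       \<exists>l. l \<in> Arr E \<and> Dom E l = Dom E \<rho>' \<and> Cod E l = Dom E y \<and> x \<bullet> l = x' \<and> \<rho> \<bullet> l = \<rho>' \<and> y \<bullet> l = y'"
    by (rule composable_triples[OF C r(1,2)]) (rule that, assumption+)
  have s_iff: "composable C a (s \<bullet> b) \<longleftrightarrow> composable C a (r \<bullet> b)" "composable C (s \<bullet> b) a \<longleftrightarrow> composable C (r \<bullet> b) a"
    if "b \<in> Arr E" "Cod E b = Dom E r" for a b
    using that by (simp_all add: composable_def sz)
  have rc: "composable C (icomp E C a (r \<bullet> b)) c" "composable C (icomp E C a (s \<bullet> b)) c"
    if "composable C a (r \<bullet> b)" "composable C (r \<bullet> b) c" "b \<in> Arr E" "Cod E b = Dom E r" for a b c
    using that s_iff[OF that(3,4)] by (simp_all add: composable_def sz)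
  define u where "u = icomp E C (icomp E C x (r \<bullet> \<rho>)) y"
  define v where "v = icomp E C (icomp E C x (s \<bullet> \<rho>)) y"
  have [simp]: "composable C x (s \<bullet> \<rho>)" "composable C (s \<bullet> \<rho>) y"
    "composable C (icomp E C x (r \<bullet> \<rho>)) y" "composable C (icomp E C x (s \<bullet> \<rho>)) y"
    using rc[of x \<rho> y] s_iff[of \<rho>] by simp_all
  have uv [simp]: "u \<in> Arr E" "v \<in> Arr E" "Dom E u = Dom E y" "Dom E v = Dom E y" "Cod E u = mor C" "Cod E v = mor C"
    "src C \<bullet> v = src C \<bullet> u" "tgt C \<bullet> v = tgt C \<bullet> u"
    by (simp_all add: u_def v_def)
  have uv_el: "u \<bullet> l = icomp E C (icomp E C (x \<bullet> l) (r \<bullet> \<rho> \<bullet> l)) (y \<bullet> l)"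
      "v \<bullet> l = icomp E C (icomp E C (x \<bullet> l) (s \<bullet> \<rho> \<bullet> l)) (y \<bullet> l)"
    if "l \<in> Arr E" "Cod E l = Dom E y" for l
    using that by (simp_all add: u_def v_def icomp_comp)
  obtain q where q: "is_coequaliser E u v q"
    using stable uv unfolding has_pullback_stable_coequalisers_def has_coequalisers_def by metis
  note qD [simp] = is_coequaliserD(1-6)[OF q]
  have quv: "q \<bullet> u \<bullet> l = q \<bullet> v \<bullet> l" if "l \<in> Arr E" "Cod E l = Dom E y" for l
    using that reassoc[OF is_coequaliserD(7)[OF q], of l] by simp
  have q_cong: "q \<bullet> icomp E C (icomp E C a (r \<bullet> b)) c = q \<bullet> icomp E C (icomp E C a (s \<bullet> b)) c"
    if abc: "composable C a (r \<bullet> b)" "composable C (r \<bullet> b) c" "b \<in> Arr E" "Cod E b = Dom E r" for a b c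
  proof -
    obtain l where l: "l \<in> Arr E" "Dom E l = Dom E b" "Cod E l = Dom E y" "x \<bullet> l = a" "\<rho> \<bullet> l = b" "y \<bullet> l = c"
      using univ[OF abc] by blast
    then show ?thesis
      using quv[of l] uv_el[of l] by simp
  qed
  have cl: "composable C (x \<bullet> b) (r \<bullet> \<rho> \<bullet> b)" "composable C (r \<bullet> \<rho> \<bullet> b) (y \<bullet> b)"
     "composable C (x \<bullet> b) (s \<bullet> \<rho> \<bullet> b)" "composable C (s \<bullet> \<rho> \<bullet> b) (y \<bullet> b)"
    if "b \<in> Arr E" "Cod E b = Dom E y" for b
    using that composable_comp[of C x "r \<bullet> \<rho>" b] composable_comp[of C "r \<bullet> \<rho>" y b] s_iff[of "\<rho> \<bullet> b"] by simp_all
  have right: "q \<bullet> icomp E C (u \<bullet> b) c = q \<bullet> icomp E C (v \<bullet> b) c"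
    if b: "b \<in> Arr E" "Cod E b = Dom E u" and c: "composable C (u \<bullet> b) c" for b c
  proof -
    have [simp]: "c \<in> Arr E" "Cod E c = mor C" "Dom E c = Dom E b" "b \<in> Arr E" "Cod E b = Dom E y"
      using b c by (auto simp: composable_def)
    have "tgt C \<bullet> u = tgt C \<bullet> y"
      by (simp add: u_def)
    then have cc: "tgt C \<bullet> y \<bullet> b = src C \<bullet> c"
      using reassoc[of "tgt C" u "tgt C \<bullet> y" b] c by (simp add: composable_def)
    note cl = cl[of b, simplified]
    have cyc: "composable C (y \<bullet> b) c"
      using cc by (simp add: composable_def)
    have *: "composable C (r \<bullet> \<rho> \<bullet> b) (icomp E C (y \<bullet> b) c)"
      using cyc cl by (simp add: composable_def)
    \<comment> \<open>Associativity absorbs \<open>c\<close> into the right whisker, so the result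
      is again a whiskering of the pair and \<open>q_cong\<close> applies. The left-hand case is
      symmetric.\<close>
    have "icomp E C (u \<bullet> b) c = icomp E C (icomp E C (x \<bullet> b) (r \<bullet> \<rho> \<bullet> b)) (icomp E C (y \<bullet> b) c)"
      "icomp E C (v \<bullet> b) c = icomp E C (icomp E C (x \<bullet> b) (s \<bullet> \<rho> \<bullet> b)) (icomp E C (y \<bullet> b) c)"
      using cl cyc by (simp_all add: uv_el icomp_assoc)
    then show ?thesis
      using q_cong[of "x \<bullet> b" "\<rho> \<bullet> b" "icomp E C (y \<bullet> b) c"] cl * by simp
  qed
  have left: "q \<bullet> icomp E C c (u \<bullet> b) = q \<bullet> icomp E C c (v \<bullet> b)"
    if b: "b \<in> Arr E" "Cod E b = Dom E u" and c: "composable C c (u \<bullet> b)" for b c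
  proof -
    have [simp]: "c \<in> Arr E" "Cod E c = mor C" "Dom E c = Dom E b" "b \<in> Arr E" "Cod E b = Dom E y"
      using b c by (auto simp: composable_def)
    have "src C \<bullet> u = src C \<bullet> x"
      by (simp add: u_def)
    then have cc: "tgt C \<bullet> c = src C \<bullet> x \<bullet> b"
      using reassoc[of "src C" u "src C \<bullet> x" b] c by (simp add: composable_def)
    note cl = cl[of b, simplified]
    have cxc: "composable C c (x \<bullet> b)"
      using cc by (simp add: composable_def)
    have *: "composable C (icomp E C c (x \<bullet> b)) (r \<bullet> \<rho> \<bullet> b)"
      using cxc cl by (simp add: composable_def)
    have **: "composable C c (icomp E C (x \<bullet> b) (r \<bullet> \<rho> \<bullet> b))" "composable C c (icomp E C (x \<bullet> b) (s \<bullet> \<rho> \<bullet> b))"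
      using cxc cl by (simp_all add: composable_def)
    have "icomp E C c (u \<bullet> b) = icomp E C (icomp E C (icomp E C c (x \<bullet> b)) (r \<bullet> \<rho> \<bullet> b)) (y \<bullet> b)"
      "icomp E C c (v \<bullet> b) = icomp E C (icomp E C (icomp E C c (x \<bullet> b)) (s \<bullet> \<rho> \<bullet> b)) (y \<bullet> b)"
      using cl cxc by (simp_all add: uv_el icomp_assoc)
    then show ?thesis
      using q_cong[of "icomp E C c (x \<bullet> b)" "\<rho> \<bullet> b" "y \<bullet> b"] cl * by simp
  qed
  obtain Q where Q: "internal_category E Q" "internal_functor E C Q (Ide E (ob C), q)"
    "\<And>Y H. internal_category E Y \<Longrightarrow> internal_functor E C Y H \<Longrightarrow> snd H \<bullet> u = snd H \<bullet> v \<Longrightarrow>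
       \<exists>!K. internal_functor E Q Y K \<and> fst K \<bullet> Ide E (ob C) = fst H \<and> snd K \<bullet> q = snd H"
    using quotient_exists[OF C q _ _ _ right left] by auto
  have cu: "composable C (unt C \<bullet> src C \<bullet> r) r" "composable C r (unt C \<bullet> tgt C \<bullet> r)"
     "composable C (unt C \<bullet> src C \<bullet> r) s" "composable C s (unt C \<bullet> tgt C \<bullet> r)"
    by (simp_all add: composable_def)
  \<comment> \<open>Whiskering with units on both sides returns \<open>r\<close> and
    \<open>s\<close> themselves.\<close>
  have qrs: "q \<bullet> r = q \<bullet> s"
    using q_cong[of "unt C \<bullet> src C \<bullet> r" "Ide E (Dom E r)" "unt C \<bullet> tgt C \<bullet> r"] cu by simp
  have Huv: "snd H \<bullet> u = snd H \<bullet> v"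
    if Y: "internal_category E Y" and H: "internal_functor E C Y H" and rs: "snd H \<bullet> r = snd H \<bullet> s" for Y H
  proof -
    note [simp] = internal_functorD[OF H C Y]
    have "snd H \<bullet> r \<bullet> \<rho> = snd H \<bullet> s \<bullet> \<rho>"
      using reassoc[OF rs, of \<rho>] by simp
    then show ?thesis
      by (simp add: u_def v_def)
  qed
  have "is_quotient C {(r, s)} Q (Ide E (ob C), q)"
    unfolding is_quotient_def identifies_def using Q qrs Huv by simp
  then show ?thesis by (rule that)
qed

text \<open>Pairs are imposed one at a time. A new pair is first transported along the quotient
  already formed, where it is still parallel because functors preserve ends; the two universal
  properties then compose.\<close>

lemma quotient_by_finite_relation:
  assumes "finite R" and C: "internal_category E C" and "\<And>r s. (r, s) \<in> R \<Longrightarrow> parallel C r s"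
  obtains Q q where "is_quotient C R Q q"
proof -
  have "\<exists>Q q. is_quotient C R Q q"
    using assms(1,3)
  proof (induction R)
    case empty
    have "is_quotient C {} C (Ide E (ob C), Ide E (mor C))"
      unfolding is_quotient_def
    proof (intro conjI allI impI)
      fix Y H
      assume Y: "internal_category E Y" and H: "internal_functor E C Y H"
      show "\<exists>!K. internal_functor E C Y K \<and> fst K \<bullet> fst (Ide E (ob C), Ide E (mor C)) = fst H \<and>
          snd K \<bullet> snd (Ide E (ob C), Ide E (mor C)) = snd H"
      proof (rule ex1I[of _ H])
        fix K
        assume K: "internal_functor E C Y K \<and> fst K \<bullet> fst (Ide E (ob C), Ide E (mor C)) = fst H \<and>
          snd K \<bullet> snd (Ide E (ob C), Ide E (mor C)) = snd H"
        show "K = H"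
          using K internal_functorD[OF conjunct1[OF K] C Y] by (simp add: prod_eq_iff)
      qed (use H internal_functorD[OF H C Y] in simp)
    qed (use C internal_functor_id in \<open>auto simp: identifies_def\<close>)
    then show ?case by blast
  next
    case (insert rs R)
    obtain r s where [simp]: "rs = (r, s)" by (cases rs)
    obtain Q q where Qq: "is_quotient C R Q q"
      using insert by auto
    then have Q [simp]: "internal_category E Q" and q: "internal_functor E C Q q"
      and qR: "identifies q R"
      unfolding is_quotient_def by auto
    note [simp] = internal_functorD[OF q C Q]
    have "parallel C r s"
      using insert by simp
    then have par: "parallel Q (snd q \<bullet> r) (snd q \<bullet> s)" and rs: "r \<in> Arr E" "s \<in> Arr E" "Cod E r = mor C" "Cod E s = mor C"
      using C by (auto simp: parallel_def)
    obtain P p where Pp: "is_quotient Q {(snd q \<bullet> r, snd q \<bullet> s)} P p"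
      using quotient_by_pair[OF Q par] by blast
    then have P: "internal_category E P" and p: "internal_functor E Q P p" "identifies p {(snd q \<bullet> r, snd q \<bullet> s)}"
      unfolding is_quotient_def by auto
    note [simp] = internal_functorD[OF p(1) Q P]
    have "is_quotient C (insert rs R) P (fst p \<bullet> fst q, snd p \<bullet> snd q)"
      unfolding is_quotient_def
    proof (intro conjI allI impI)
      show "internal_functor E C P (fst p \<bullet> fst q, snd p \<bullet> snd q)"
        by (rule internal_functor_comp[OF q p(1) C Q P])
      have "snd p \<bullet> snd q \<bullet> a = snd p \<bullet> snd q \<bullet> b" if "(a, b) \<in> R" for a b
        using that qR by (auto simp: identifies_def)
      moreover have "a \<in> Arr E \<and> b \<in> Arr E \<and> Cod E a = mor C \<and> Cod E b = mor C" if "(a, b) \<in> R" for a b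
        using insert.prems[of a b] that by (auto simp: parallel_def)
      ultimately show "identifies (fst p \<bullet> fst q, snd p \<bullet> snd q) (insert rs R)"
        using p(2) rs by (auto simp: identifies_def)
      fix Y H
      assume Y: "internal_category E Y" and H: "internal_functor E C Y H" and HR: "identifies H (insert rs R)"
      obtain K where K: "internal_functor E Q Y K" "fst K \<bullet> fst q = fst H" "snd K \<bullet> snd q = snd H"
        and Ku: "\<And>K'. internal_functor E Q Y K' \<Longrightarrow> fst K' \<bullet> fst q = fst H \<Longrightarrow> snd K' \<bullet> snd q = snd H \<Longrightarrow> K' = K"
        using is_quotient_factor[OF Qq Y H] HR unfolding \<open>rs = (r, s)\<close> identifies_insert by (elim conjE ex1E) blast
      note KD [simp] = internal_functorD[OF K(1) Q Y]
      have "snd K \<bullet> snd q \<bullet> r = snd K \<bullet> snd q \<bullet> s"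
        using HR reassoc[OF K(3), of r] reassoc[OF K(3), of s] rs by (simp add: identifies_def)
      then have idK: "identifies K {(snd q \<bullet> r, snd q \<bullet> s)}"
        by (simp add: identifies_def)
      obtain L where L: "internal_functor E P Y L" "fst L \<bullet> fst p = fst K" "snd L \<bullet> snd p = snd K"
        and Lu: "\<And>L'. internal_functor E P Y L' \<Longrightarrow> fst L' \<bullet> fst p = fst K \<Longrightarrow> snd L' \<bullet> snd p = snd K \<Longrightarrow> L' = L"
        by (rule ex1E[OF is_quotient_factor[OF Pp Y K(1) idK]]) (use that in blast)
      note [simp] = internal_functorD[OF L(1) P Y]
      show "\<exists>!L. internal_functor E P Y L \<and> fst L \<bullet> fst (fst p \<bullet> fst q, snd p \<bullet> snd q) = fst H \<and>
          snd L \<bullet> snd (fst p \<bullet> fst q, snd p \<bullet> snd q) = snd H"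
      proof (rule ex1I[of _ L])
        show "internal_functor E P Y L \<and> fst L \<bullet> fst (fst p \<bullet> fst q, snd p \<bullet> snd q) = fst H \<and>
          snd L \<bullet> snd (fst p \<bullet> fst q, snd p \<bullet> snd q) = snd H"
          using L reassoc[OF L(2), of "fst q"] reassoc[OF L(3), of "snd q"] K by simp
        fix L'
        assume L': "internal_functor E P Y L' \<and> fst L' \<bullet> fst (fst p \<bullet> fst q, snd p \<bullet> snd q) = fst H \<and>
          snd L' \<bullet> snd (fst p \<bullet> fst q, snd p \<bullet> snd q) = snd H"
        note [simp] = internal_functorD[OF conjunct1[OF L'] P Y]
        have "(fst L' \<bullet> fst p, snd L' \<bullet> snd p) = K"
          by (rule Ku) (use L' internal_functor_comp[OF p(1) conjunct1[OF L'] Q P Y] in simp_all)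
        then show "L' = L"
          using L' by (intro Lu) auto
      qed
    qed (fact P)
    then show ?case by blast
  qed
  then show ?thesis using that by blast
qed

end

section \<open>Coproducts, joint coequalisers and free internal categories\<close>

lemma ex1_unique: "\<exists>!x. P x \<Longrightarrow> P a \<Longrightarrow> P b \<Longrightarrow> a = b"
  by blast

lemma is_coproductD:
  assumes "is_coproduct C I A P \<iota>"
  shows "P \<in> Obj C" "i \<in> I \<Longrightarrow> \<iota> i \<in> Arr C" "i \<in> I \<Longrightarrow> Dom C (\<iota> i) = A i" "i \<in> I \<Longrightarrow> Cod C (\<iota> i) = P"
  using assms unfolding is_coproduct_def by auto

lemma coproduct_ex1:
  assumes "is_coproduct C I A P \<iota>" "X \<in> Obj C" "\<And>i. i \<in> I \<Longrightarrow> x i \<in> hom C (A i) X"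
  shows "\<exists>!h. h \<in> hom C P X \<and> (\<forall>i \<in> I. h \<cdot>\<^bsub>C\<^esub> \<iota> i = x i)"
  using assms unfolding is_coproduct_def by blast

lemma coproduct_factor:
  assumes "is_coproduct C I A P \<iota>" "X \<in> Obj C" "\<And>i. i \<in> I \<Longrightarrow> x i \<in> hom C (A i) X"
  obtains h where "h \<in> Arr C" "Dom C h = P" "Cod C h = X" "\<And>i. i \<in> I \<Longrightarrow> h \<cdot>\<^bsub>C\<^esub> \<iota> i = x i"
  using coproduct_ex1[OF assms] by auto

lemma coproduct_eqI:
  assumes C: "category C" and P: "is_coproduct C I A P \<iota>" and h: "h \<in> Arr C" "k \<in> Arr C" "Dom C h = P" "Dom C k = P"
    "Cod C h = Cod C k" "\<And>i. i \<in> I \<Longrightarrow> h \<cdot>\<^bsub>C\<^esub> \<iota> i = k \<cdot>\<^bsub>C\<^esub> \<iota> i"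
  shows "h = k"
proof -
  note [simp] = category_simps[OF C] is_coproductD[OF P] h
  show ?thesis
    by (rule ex1_unique[OF coproduct_ex1[OF P, of "Cod C k" "\<lambda>i. k \<cdot>\<^bsub>C\<^esub> \<iota> i"]]) simp_all
qed

text \<open>\<open>has_finite_coproducts\<close> speaks of index sets of natural numbers, while the
  index sets needed later consist of pairs and tagged pairs. An injection into \<open>nat\<close>
  transfers the coproduct.\<close>

lemma finite_coproduct_exists:
  fixes I :: "'i set"
  assumes C: "has_finite_coproducts C" and I: "finite I" "\<And>i. i \<in> I \<Longrightarrow> A i \<in> Obj C"
  obtains P \<iota> where "is_coproduct C I A P \<iota>"
proof -
  obtain f :: "'i \<Rightarrow> nat" where f: "inj_on f I"
    using finite_imp_inj_to_nat_seg[OF I(1)] by blast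
  define g where "g = inv_into I f"
  have g [simp]: "i \<in> I \<Longrightarrow> g (f i) = i" for i
    using f by (simp add: g_def)
  obtain P \<iota> where P: "is_coproduct C (f ` I) (\<lambda>n. A (g n)) P \<iota>"
    using C I unfolding has_finite_coproducts_def
    by (elim allE[of _ "f ` I"] allE[of _ "\<lambda>n. A (g n)"]) auto
  have "is_coproduct C I A P (\<lambda>i. \<iota> (f i))"
    unfolding is_coproduct_def
  proof (intro conjI ballI allI impI)
    show "P \<in> Obj C" using is_coproductD[OF P] by simp
    show "i \<in> I \<Longrightarrow> A i \<in> Obj C" for i using I by simp
    show "i \<in> I \<Longrightarrow> \<iota> (f i) \<in> hom C (A i) P" for i
      using is_coproductD(2-4)[OF P, of "f i"] by simp
    fix X x
    assume "X \<in> Obj C" "\<forall>i \<in> I. x i \<in> hom C (A i) X"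
    then have "\<exists>!h. h \<in> hom C P X \<and> (\<forall>n \<in> f ` I. h \<cdot>\<^bsub>C\<^esub> \<iota> n = x (g n))"
      using P unfolding is_coproduct_def by (elim conjE allE[of _ "\<lambda>n. x (g n)"] ballE[of _ _ X]) auto
    then show "\<exists>!h. h \<in> hom C P X \<and> (\<forall>i \<in> I. h \<cdot>\<^bsub>C\<^esub> \<iota> (f i) = x i)"
      by simp
  qed
  then show ?thesis by (rule that)
qed

text \<open>The pairs may have different domains, so they are coequalised one after another. A
  composite of coequalisers need not be a coequaliser of a single pair; being epi and admitting
  factorisations is what survives, and it suffices for existence and uniqueness.\<close>

lemma joint_coequaliser_exists:
  assumes C: "category C" and coeq: "has_coequalisers C" and A: "A \<in> Obj C" and "finite S"
    and "\<And>u v. (u, v) \<in> S \<Longrightarrow> u \<in> Arr C \<and> v \<in> Arr C \<and> Dom C u = Dom C v \<and> Cod C u = A \<and> Cod C v = A"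
  obtains q where "is_epi C q" "Dom C q = A" "\<And>u v. (u, v) \<in> S \<Longrightarrow> q \<cdot>\<^bsub>C\<^esub> u = q \<cdot>\<^bsub>C\<^esub> v"
    "\<And>k. k \<in> Arr C \<Longrightarrow> Dom C k = A \<Longrightarrow> (\<And>u v. (u, v) \<in> S \<Longrightarrow> k \<cdot>\<^bsub>C\<^esub> u = k \<cdot>\<^bsub>C\<^esub> v) \<Longrightarrow>
       \<exists>h \<in> hom C (Cod C q) (Cod C k). h \<cdot>\<^bsub>C\<^esub> q = k"
proof -
  note [simp] = category_simps[OF C]
  have "\<exists>q. is_epi C q \<and> Dom C q = A \<and> (\<forall>(u, v) \<in> S. q \<cdot>\<^bsub>C\<^esub> u = q \<cdot>\<^bsub>C\<^esub> v) \<and>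
    (\<forall>k \<in> Arr C. Dom C k = A \<longrightarrow> (\<forall>(u, v) \<in> S. k \<cdot>\<^bsub>C\<^esub> u = k \<cdot>\<^bsub>C\<^esub> v) \<longrightarrow>
       (\<exists>h \<in> hom C (Cod C q) (Cod C k). h \<cdot>\<^bsub>C\<^esub> q = k))"
    using assms(4,5)
  proof (induction S)
    case empty
    have "is_epi C (Ide C A)"
      unfolding is_epi_def using A by simp
    then show ?case
      using A by (intro exI[of _ "Ide C A"]) auto
  next
    case (insert uv S)
    obtain u v where [simp]: "uv = (u, v)" by (cases uv)
    obtain q where q: "is_epi C q" "Dom C q = A" "\<forall>(u, v) \<in> S. q \<cdot>\<^bsub>C\<^esub> u = q \<cdot>\<^bsub>C\<^esub> v"
      "\<And>k. k \<in> Arr C \<Longrightarrow> Dom C k = A \<Longrightarrow> (\<forall>(u, v) \<in> S. k \<cdot>\<^bsub>C\<^esub> u = k \<cdot>\<^bsub>C\<^esub> v) \<Longrightarrow>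
       \<exists>h \<in> hom C (Cod C q) (Cod C k). h \<cdot>\<^bsub>C\<^esub> q = k"
      using insert.IH[OF insert.prems[OF insertI2]] by blast
    have [simp]: "q \<in> Arr C" "Dom C q = A" using q(1,2) by (auto simp: is_epi_def)
    have uv [simp]: "u \<in> Arr C" "v \<in> Arr C" "Dom C v = Dom C u" "Cod C u = A" "Cod C v = A"
      using insert.prems[of u v] by auto
    have S: "a \<in> Arr C" "b \<in> Arr C" "Dom C b = Dom C a" "Cod C a = A" "Cod C b = A" if "(a, b) \<in> S" for a b
      using insert.prems[of a b] that by auto
    obtain p where p: "is_coequaliser C (q \<cdot>\<^bsub>C\<^esub> u) (q \<cdot>\<^bsub>C\<^esub> v) p"
      using coeq unfolding has_coequalisers_def by fastforce
    note [simp] = is_coequaliserD(1-6)[OF p, simplified]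
    have "p \<cdot>\<^bsub>C\<^esub> (q \<cdot>\<^bsub>C\<^esub> u) = p \<cdot>\<^bsub>C\<^esub> (q \<cdot>\<^bsub>C\<^esub> v)"
      by (rule is_coequaliserD(7)[OF p])
    moreover have "p \<cdot>\<^bsub>C\<^esub> (q \<cdot>\<^bsub>C\<^esub> a) = p \<cdot>\<^bsub>C\<^esub> (q \<cdot>\<^bsub>C\<^esub> b)" if "(a, b) \<in> S" for a b
      using q(3) that by auto
    ultimately have eqs: "\<forall>(u, v) \<in> insert uv S. (p \<cdot>\<^bsub>C\<^esub> q) \<cdot>\<^bsub>C\<^esub> u = (p \<cdot>\<^bsub>C\<^esub> q) \<cdot>\<^bsub>C\<^esub> v"
      using S by auto
    have fac: "\<exists>h \<in> hom C (Cod C (p \<cdot>\<^bsub>C\<^esub> q)) (Cod C k). h \<cdot>\<^bsub>C\<^esub> (p \<cdot>\<^bsub>C\<^esub> q) = k"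
      if k: "k \<in> Arr C" "Dom C k = A" "\<forall>(u, v) \<in> insert uv S. k \<cdot>\<^bsub>C\<^esub> u = k \<cdot>\<^bsub>C\<^esub> v" for k
    proof -
      have "\<forall>(u, v) \<in> S. k \<cdot>\<^bsub>C\<^esub> u = k \<cdot>\<^bsub>C\<^esub> v"
        using k(3) by blast
      then obtain h where h: "h \<in> Arr C" "Dom C h = Cod C q" "Cod C h = Cod C k" "h \<cdot>\<^bsub>C\<^esub> q = k"
        using q(4)[OF k(1,2)] by (meson hom_iff)
      have "(h \<cdot>\<^bsub>C\<^esub> q) \<cdot>\<^bsub>C\<^esub> u = (h \<cdot>\<^bsub>C\<^esub> q) \<cdot>\<^bsub>C\<^esub> v"
        using k(3) h(4) by simp
      then have "h \<cdot>\<^bsub>C\<^esub> (q \<cdot>\<^bsub>C\<^esub> u) = h \<cdot>\<^bsub>C\<^esub> (q \<cdot>\<^bsub>C\<^esub> v)"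
        using h(1,2) by simp
      then obtain l where l: "l \<in> Arr C" "Dom C l = Cod C p" "Cod C l = Cod C h" "l \<cdot>\<^bsub>C\<^esub> p = h"
        using coequaliser_factor[OF p, of h] h by auto
      have "l \<cdot>\<^bsub>C\<^esub> (p \<cdot>\<^bsub>C\<^esub> q) = h \<cdot>\<^bsub>C\<^esub> q"
        using l category_simps(11)[OF C, of q p l] by simp
      then show ?thesis
        using l h by (intro bexI[of _ l]) auto
    qed
    have "is_epi C (p \<cdot>\<^bsub>C\<^esub> q)"
      by (rule is_epi_comp[OF C q(1) coequaliser_is_epi[OF C p]]) simp
    then show ?case
      using eqs fac by (intro exI[of _ "p \<cdot>\<^bsub>C\<^esub> q"]) auto
  qed
  then obtain q where q: "is_epi C q" "Dom C q = A" "\<forall>(u, v) \<in> S. q \<cdot>\<^bsub>C\<^esub> u = q \<cdot>\<^bsub>C\<^esub> v"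
    "\<forall>k \<in> Arr C. Dom C k = A \<longrightarrow> (\<forall>(u, v) \<in> S. k \<cdot>\<^bsub>C\<^esub> u = k \<cdot>\<^bsub>C\<^esub> v) \<longrightarrow>
       (\<exists>h \<in> hom C (Cod C q) (Cod C k). h \<cdot>\<^bsub>C\<^esub> q = k)"
    by blast
  show ?thesis
    by (rule that[of q]) (use q in \<open>auto simp del: hom_iff\<close>)
qed

text \<open>Converts the unit-counit form of the adjunction into the universal property of the unit,
  the form in which freeness is applied.\<close>

lemma universal_arrow_of_left_adjoint:
  assumes C: "category C" and D: "category D" and U: "has_left_adjoint C D U" and y: "y \<in> Obj D"
  obtains x \<eta> where "x \<in> Obj C" "\<eta> \<in> hom D y (fo U x)"
    "\<And>z g. z \<in> Obj C \<Longrightarrow> g \<in> hom D y (fo U z) \<Longrightarrow> \<exists>!h. h \<in> hom C x z \<and> fa U h \<cdot>\<^bsub>D\<^esub> \<eta> = g"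
proof -
  obtain F \<eta> \<epsilon> where F: "is_functor D C F" and U: "is_functor C D U"
    and \<eta>: "is_nat_trans D D (id_func D) (comp_func D U F) \<eta>"
    and \<epsilon>: "is_nat_trans C C (comp_func C F U) (id_func C) \<epsilon>"
    and tri: "\<And>y. y \<in> Obj D \<Longrightarrow> \<epsilon> (fo F y) \<cdot>\<^bsub>C\<^esub> fa F (\<eta> y) = Ide C (fo F y)"
      "\<And>x. x \<in> Obj C \<Longrightarrow> fa U (\<epsilon> x) \<cdot>\<^bsub>D\<^esub> \<eta> (fo U x) = Ide D (fo U x)"
    using U unfolding has_left_adjoint_def by blast
  note [simp] = category_simps[OF C] category_simps[OF D] functorD[OF F] functorD[OF U]
  have \<eta>' [simp]: "\<eta> y \<in> Arr D" "Dom D (\<eta> y) = y" "Cod D (\<eta> y) = fo U (fo F y)" if "y \<in> Obj D" for y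
    using \<eta> that unfolding is_nat_trans_def by (auto simp: id_func_def comp_func_def)
  have \<epsilon>' [simp]: "\<epsilon> x \<in> Arr C" "Dom C (\<epsilon> x) = fo F (fo U x)" "Cod C (\<epsilon> x) = x" if "x \<in> Obj C" for x
    using \<epsilon> that unfolding is_nat_trans_def by (auto simp: id_func_def comp_func_def)
  have \<eta>n: "\<eta> (Cod D f) \<cdot>\<^bsub>D\<^esub> f = fa U (fa F f) \<cdot>\<^bsub>D\<^esub> \<eta> (Dom D f)" if "f \<in> Arr D" for f
    using \<eta> that unfolding is_nat_trans_def by (simp add: id_func_def comp_func_def)
  have \<epsilon>n: "\<epsilon> (Cod C f) \<cdot>\<^bsub>C\<^esub> fa F (fa U f) = f \<cdot>\<^bsub>C\<^esub> \<epsilon> (Dom C f)" if "f \<in> Arr C" for f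
    using \<epsilon> that unfolding is_nat_trans_def by (simp add: id_func_def comp_func_def)
  show ?thesis
  proof (rule that[of "fo F y" "\<eta> y"])
    fix z g
    assume z: "z \<in> Obj C" and g: "g \<in> hom D y (fo U z)"
    define h where "h = \<epsilon> z \<cdot>\<^bsub>C\<^esub> fa F g"
    have g' [simp]: "g \<in> Arr D" "Dom D g = y" "Cod D g = fo U z" using g by auto
    show "\<exists>!h. h \<in> hom C (fo F y) z \<and> fa U h \<cdot>\<^bsub>D\<^esub> \<eta> y = g"
    proof (rule ex1I[of _ h])
      have "fa U h \<cdot>\<^bsub>D\<^esub> \<eta> y = fa U (\<epsilon> z) \<cdot>\<^bsub>D\<^esub> (fa U (fa F g) \<cdot>\<^bsub>D\<^esub> \<eta> y)"
        using y z by (simp add: h_def)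
      also have "\<dots> = (fa U (\<epsilon> z) \<cdot>\<^bsub>D\<^esub> \<eta> (fo U z)) \<cdot>\<^bsub>D\<^esub> g"
        using \<eta>n[of g] y z by simp
      also have "\<dots> = g"
        using tri(2) y z by simp
      finally show "h \<in> hom C (fo F y) z \<and> fa U h \<cdot>\<^bsub>D\<^esub> \<eta> y = g"
        using y z by (simp add: h_def)
    next
      fix k
      assume k: "k \<in> hom C (fo F y) z \<and> fa U k \<cdot>\<^bsub>D\<^esub> \<eta> y = g"
      then have k' [simp]: "k \<in> Arr C" "Dom C k = fo F y" "Cod C k = z" by auto
      have "h = \<epsilon> z \<cdot>\<^bsub>C\<^esub> (fa F (fa U k) \<cdot>\<^bsub>C\<^esub> fa F (\<eta> y))"
        using k y z functorD(6)[OF F, of "\<eta> y" "fa U k"] by (simp add: h_def)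
      also have "\<dots> = (\<epsilon> z \<cdot>\<^bsub>C\<^esub> fa F (fa U k)) \<cdot>\<^bsub>C\<^esub> fa F (\<eta> y)"
        using y z by simp
      also have "\<dots> = k \<cdot>\<^bsub>C\<^esub> (\<epsilon> (fo F y) \<cdot>\<^bsub>C\<^esub> fa F (\<eta> y))"
        using \<epsilon>n[of k] y z by simp
      also have "\<dots> = k"
        using tri(1) y by simp
      finally show "k = h" ..
    qed
  qed (use y in simp_all)
qed

section \<open>Free internal categories on graphs\<close>

context category_with_pullbacks
begin

lemma category_Gph: "category (Gph E)"
proof (rule categoryI)
  fix f g
  assume fg: "f \<in> Arr (Gph E)" "g \<in> Arr (Gph E)" "Cod (Gph E) f = Dom (Gph E) g"
  obtain G f0 f1 H where [simp]: "f = (G, (f0, f1), H)" by (metis prod_cases3 prod.exhaust)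
  obtain H' g0 g1 K where [simp]: "g = (H', (g0, g1), K)" by (metis prod_cases3 prod.exhaust)
  have [simp]: "H' = H" "internal_graph E G" "internal_graph E H" "internal_graph E K"
    "f0 \<in> Arr E" "f1 \<in> Arr E" "g0 \<in> Arr E" "g1 \<in> Arr E" "Dom E f0 = ob G" "Dom E f1 = mor G" "Cod E f0 = ob H" "Cod E f1 = mor H"
    "Dom E g0 = ob H" "Dom E g1 = mor H" "Cod E g0 = ob K" "Cod E g1 = mor K"
    and eq: "src H \<bullet> f1 = f0 \<bullet> src G" "tgt H \<bullet> f1 = f0 \<bullet> tgt G" "src K \<bullet> g1 = g0 \<bullet> src H" "tgt K \<bullet> g1 = g0 \<bullet> tgt H"
    using fg by (auto simp: Gph_def graph_morphism_def)
  show "g \<cdot>\<^bsub>Gph E\<^esub> f \<in> Arr (Gph E) \<and> Dom (Gph E) (g \<cdot>\<^bsub>Gph E\<^esub> f) = Dom (Gph E) f \<and>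
      Cod (Gph E) (g \<cdot>\<^bsub>Gph E\<^esub> f) = Cod (Gph E) g"
    using eq(1,2) reassoc[OF eq(3), of f1] reassoc[OF eq(4), of f1] by (simp add: Gph_def graph_morphism_def)
qed (auto simp: Gph_def graph_morphism_def)

lemma ifun_cat_simps [simp]:
  "F \<in> Obj (ifun_cat E A B) \<longleftrightarrow> internal_functor E A B F"
  "(F, t, G) \<in> Arr (ifun_cat E A B) \<longleftrightarrow> internal_nat_trans E A B F t G"
  "Dom (ifun_cat E A B) \<alpha> = fst \<alpha>" "Cod (ifun_cat E A B) \<alpha> = snd (snd \<alpha>)"
  "Ide (ifun_cat E A B) F = (F, unt B \<bullet> fst F, F)"
  "\<beta> \<cdot>\<^bsub>ifun_cat E A B\<^esub> \<alpha> = (fst \<alpha>, icomp E B (fst (snd \<alpha>)) (fst (snd \<beta>)), snd (snd \<beta>))"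
  by (simp_all add: ifun_cat_def split: prod.splits)

lemma Cat_simps [simp]:
  "A \<in> Ob (Cat E) \<longleftrightarrow> internal_category E A" "Hom (Cat E) = ifun_cat E"
  "id1 (Cat E) A = (Ide E (ob A), Ide E (mor A))"
  "comp1 (Cat E) A B C G F = (fst G \<bullet> fst F, snd G \<bullet> snd F)"
  "comp2 (Cat E) A B C \<beta> \<alpha> = ((fst (fst \<beta>) \<bullet> fst (fst \<alpha>), snd (fst \<beta>) \<bullet> snd (fst \<alpha>)),
     icomp E C (snd (fst \<beta>) \<bullet> fst (snd \<alpha>)) (fst (snd \<beta>) \<bullet> fst (snd (snd \<alpha>))),
     (fst (snd (snd \<beta>)) \<bullet> fst (snd (snd \<alpha>)), snd (snd (snd \<beta>)) \<bullet> snd (snd (snd \<alpha>))))"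
  by (simp_all add: Cat_def ifun_comp_def split: prod.splits)

lemma category_underlying_Cat: "category (underlying_cat (Cat E))"
proof (rule categoryI)
  let ?K = "underlying_cat (Cat E)"
  fix f g h
  assume fg: "f \<in> Arr ?K" "g \<in> Arr ?K" "h \<in> Arr ?K" "Cod ?K f = Dom ?K g" "Cod ?K g = Dom ?K h"
  obtain A F B where [simp]: "f = (A, F, B)" by (cases f)
  obtain B' G C where [simp]: "g = (B', G, C)" by (cases g)
  obtain C' H D where [simp]: "h = (C', H, D)" by (cases h)
  have [simp]: "B' = B" "C' = C" "internal_category E A" "internal_category E B" "internal_category E C" "internal_category E D"
    and F: "internal_functor E A B F" and G: "internal_functor E B C G" and H: "internal_functor E C D H"
    using fg by (auto simp: underlying_cat_def)
  show "(h \<cdot>\<^bsub>?K\<^esub> g) \<cdot>\<^bsub>?K\<^esub> f = h \<cdot>\<^bsub>?K\<^esub> (g \<cdot>\<^bsub>?K\<^esub> f)"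
    using internal_functorD[OF F] internal_functorD[OF G] internal_functorD[OF H] by (simp add: underlying_cat_def)
next
  let ?K = "underlying_cat (Cat E)"
  fix f
  assume f: "f \<in> Arr ?K"
  obtain A F B where [simp]: "f = (A, F, B)" by (cases f)
  have [simp]: "internal_category E A" "internal_category E B" and F: "internal_functor E A B F"
    using f by (auto simp: underlying_cat_def)
  show "f \<cdot>\<^bsub>?K\<^esub> Ide ?K (Dom ?K f) = f \<and> Ide ?K (Cod ?K f) \<cdot>\<^bsub>?K\<^esub> f = f"
    using internal_functorD[OF F] by (simp add: underlying_cat_def)
qed (auto simp: underlying_cat_def internal_functor_id dest: internal_functor_comp)

lemma truncate_simps [simp]: "ob (igraph.truncate A) = ob A" "mor (igraph.truncate A) = mor A"
    "src (igraph.truncate A) = src A" "tgt (igraph.truncate A) = tgt A"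
  by (simp_all add: igraph.defs)

text \<open>Freeness with the source and target tags of arrows in \<open>Gph\<close> and
  \<open>underlying_cat\<close> stripped off. The object part \<open>fst \<eta>\<close> of the unit
  is kept as an arbitrary arrow: the adjunction does not state that it is an identity.\<close>

lemma free_category_exists:
  assumes U: "has_left_adjoint (underlying_cat (Cat E)) (Gph E) forgetful" and G: "internal_graph E (G :: ('o, 'a) igraph)"
  obtains C \<eta> where "internal_category E C" "graph_morphism E G (igraph.truncate C) \<eta>"
    "\<And>Y g. internal_category E Y \<Longrightarrow> graph_morphism E G (igraph.truncate Y) g \<Longrightarrow>
       \<exists>!H. internal_functor E C Y H \<and> fst H \<bullet> fst \<eta> = fst g \<and> snd H \<bullet> snd \<eta> = snd g"
proof -
  let ?K = "underlying_cat (Cat E)"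
  have "G \<in> Obj (Gph E)" using G by (simp add: Gph_def)
  from universal_arrow_of_left_adjoint[OF category_underlying_Cat category_Gph U this]
  obtain C \<eta>' where C: "C \<in> Obj ?K" and \<eta>': "\<eta>' \<in> hom (Gph E) G (fo forgetful C)"
    and univ: "\<And>z g. z \<in> Obj ?K \<Longrightarrow> g \<in> hom (Gph E) G (fo forgetful z) \<Longrightarrow>
        \<exists>!h. h \<in> hom ?K C z \<and> fa forgetful h \<cdot>\<^bsub>Gph E\<^esub> \<eta>' = g"
    by metis
  obtain \<eta> where \<eta> [simp]: "\<eta>' = (G, \<eta>, igraph.truncate C)"
    using \<eta>' by (cases \<eta>') (auto simp: forgetful_def Gph_def)
  have tg: "internal_graph E (igraph.truncate Y) \<longleftrightarrow> internal_graph E Y" for Y :: "('o, 'a) icat"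
    unfolding internal_graph_def by simp
  have C' [simp]: "internal_category E C" using C by (simp add: underlying_cat_def)
  show ?thesis
  proof (rule that[of C \<eta>])
    show "graph_morphism E G (igraph.truncate C) \<eta>"
      using \<eta>' by (auto simp: Gph_def)
    fix Y g
    assume Y [simp]: "internal_category E Y" and g: "graph_morphism E G (igraph.truncate Y) g"
    have "\<exists>!h. h \<in> hom ?K C Y \<and> fa forgetful h \<cdot>\<^bsub>Gph E\<^esub> \<eta>' = (G, g, igraph.truncate Y)"
      by (rule univ) (use g G in \<open>simp_all add: underlying_cat_def Gph_def forgetful_def tg\<close>)
    then obtain h where h: "h \<in> hom ?K C Y" "fa forgetful h \<cdot>\<^bsub>Gph E\<^esub> \<eta>' = (G, g, igraph.truncate Y)"
      and hu: "\<And>k. k \<in> hom ?K C Y \<Longrightarrow> fa forgetful k \<cdot>\<^bsub>Gph E\<^esub> \<eta>' = (G, g, igraph.truncate Y) \<Longrightarrow> k = h"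
      by (elim ex1E) blast
    have "(C, H, Y) \<in> hom ?K C Y \<longleftrightarrow> internal_functor E C Y H" for H
      by (auto simp: underlying_cat_def)
    moreover have "fa forgetful (C, H, Y) \<cdot>\<^bsub>Gph E\<^esub> \<eta>' = (G, g, igraph.truncate Y) \<longleftrightarrow>
        fst H \<bullet> fst \<eta> = fst g \<and> snd H \<bullet> snd \<eta> = snd g" for H
      by (simp add: forgetful_def Gph_def prod_eq_iff split: prod.splits)
    moreover obtain H where "h = (C, H, Y)"
      using h(1) by (cases h) (auto simp: underlying_cat_def)
    ultimately show "\<exists>!H. internal_functor E C Y H \<and> fst H \<bullet> fst \<eta> = fst g \<and> snd H \<bullet> snd \<eta> = snd g"
      using h hu by (intro ex1I[of _ H]) (simp, metis prod.inject)
  qed simp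
qed

end

section \<open>Arrow categories\<close>

context category_with_pullbacks
begin

text \<open>The power of an internal category by the arrow category \<open>2\<close>. A generalised element of its object of
  morphisms is a commutative square \<open>sq A x g f y\<close>, that is \<open>x ; g = f ; y\<close>, from \<open>x\<close> to \<open>y\<close>.\<close>

definition squares :: "('o, 'a) icat \<Rightarrow> 'o" where
  "squares A = pb0 E (mul A) (mul A)"

definition sqx :: "('o, 'a) icat \<Rightarrow> 'a" where
  "sqx A = cp1 E A \<bullet> pb1 E (mul A) (mul A)"

definition sqg :: "('o, 'a) icat \<Rightarrow> 'a" where
  "sqg A = cp2 E A \<bullet> pb1 E (mul A) (mul A)"

definition sqf :: "('o, 'a) icat \<Rightarrow> 'a" where
  "sqf A = cp1 E A \<bullet> pb2 E (mul A) (mul A)"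

definition sqy :: "('o, 'a) icat \<Rightarrow> 'a" where
  "sqy A = cp2 E A \<bullet> pb2 E (mul A) (mul A)"

definition sq :: "('o, 'a) icat \<Rightarrow> 'a \<Rightarrow> 'a \<Rightarrow> 'a \<Rightarrow> 'a \<Rightarrow> 'a" where
  "sq A x g f y = pb_pair E (mul A) (mul A) (pb_pair E (tgt A) (src A) x g) (pb_pair E (tgt A) (src A) f y)"

definition commutes :: "('o, 'a) icat \<Rightarrow> 'a \<Rightarrow> 'a \<Rightarrow> 'a \<Rightarrow> 'a \<Rightarrow> bool" where
  "commutes A x g f y \<longleftrightarrow> composable A x g \<and> composable A f y \<and> icomp E A x g = icomp E A f y"

lemma sq_proj [simp]:
  assumes "internal_category E A"
  shows "squares A \<in> Obj E" "sqx A \<in> Arr E" "sqg A \<in> Arr E" "sqf A \<in> Arr E" "sqy A \<in> Arr E"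
    "Dom E (sqx A) = squares A" "Dom E (sqg A) = squares A" "Dom E (sqf A) = squares A" "Dom E (sqy A) = squares A"
    "Cod E (sqx A) = mor A" "Cod E (sqg A) = mor A" "Cod E (sqf A) = mor A" "Cod E (sqy A) = mor A"
  using assms by (simp_all add: squares_def sqx_def sqg_def sqf_def sqy_def)

lemma sq_commutes:
  assumes [simp]: "internal_category E A" "w \<in> Arr E" and w: "Cod E w = squares A"
  shows "commutes A (sqx A \<bullet> w) (sqg A \<bullet> w) (sqf A \<bullet> w) (sqy A \<bullet> w)"
proof -
  let ?p = "pb1 E (mul A) (mul A)" and ?q = "pb2 E (mul A) (mul A)"
  have [simp]: "Cod E w = pb0 E (mul A) (mul A)"
    using w by (simp add: squares_def)
  have "icomp E A (cp1 E A \<bullet> ?p \<bullet> w) (cp2 E A \<bullet> ?p \<bullet> w) = mul A \<bullet> ?p \<bullet> w"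
    by (subst icomp_comp[symmetric]) (simp_all add: icomp_cp)
  moreover have "icomp E A (cp1 E A \<bullet> ?q \<bullet> w) (cp2 E A \<bullet> ?q \<bullet> w) = mul A \<bullet> ?q \<bullet> w"
    by (subst icomp_comp[symmetric]) (simp_all add: icomp_cp)
  moreover have "mul A \<bullet> ?p \<bullet> w = mul A \<bullet> ?q \<bullet> w"
    by (rule pb_square) simp_all
  ultimately show ?thesis
    using composable_comp[OF _ composable_cp, of A "?p \<bullet> w"] composable_comp[OF _ composable_cp, of A "?q \<bullet> w"]
    by (simp add: commutes_def sqx_def sqg_def sqf_def sqy_def)
qed

lemma sq_simps [simp]:
  assumes A: "internal_category E A" and c: "commutes A x g f y"
  shows "sq A x g f y \<in> Arr E" "Dom E (sq A x g f y) = Dom E x" "Cod E (sq A x g f y) = squares A"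
    "sqx A \<bullet> sq A x g f y = x" "sqg A \<bullet> sq A x g f y = g" "sqf A \<bullet> sq A x g f y = f" "sqy A \<bullet> sq A x g f y = y"
proof -
  let ?a = "pb_pair E (tgt A) (src A) x g" and ?b = "pb_pair E (tgt A) (src A) f y"
  have xg: "composable A x g" and fy: "composable A f y" and eq: "icomp E A x g = icomp E A f y"
    using c by (auto simp: commutes_def)
  have [simp]: "x \<in> Arr E" "g \<in> Arr E" "f \<in> Arr E" "y \<in> Arr E" "Dom E g = Dom E x" "Dom E f = Dom E x" "Dom E y = Dom E x"
    "Cod E x = mor A" "Cod E g = mor A" "Cod E f = mor A" "Cod E y = mor A" "tgt A \<bullet> x = src A \<bullet> g" "tgt A \<bullet> f = src A \<bullet> y"
    using xg fy arg_cong[OF eq, of "Dom E"] A by (auto simp: composable_def icomp_simps(2)[OF A xg] icomp_simps(2)[OF A fy])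
  note [simp] = A
  have ab [simp]: "?a \<in> Arr E" "?b \<in> Arr E" "Dom E ?a = Dom E x" "Dom E ?b = Dom E x" "Cod E ?a = cpairs E A" "Cod E ?b = cpairs E A"
    "cp1 E A \<bullet> ?a = x" "cp2 E A \<bullet> ?a = g" "cp1 E A \<bullet> ?b = f" "cp2 E A \<bullet> ?b = y"
    by (simp_all add: cpairs_def cp1_def cp2_def)
  have [simp]: "mul A \<bullet> ?a = mul A \<bullet> ?b"
    using eq by (simp add: icomp_def)
  show "sq A x g f y \<in> Arr E" "Dom E (sq A x g f y) = Dom E x" "Cod E (sq A x g f y) = squares A"
    "sqx A \<bullet> sq A x g f y = x" "sqg A \<bullet> sq A x g f y = g" "sqf A \<bullet> sq A x g f y = f" "sqy A \<bullet> sq A x g f y = y"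
    by (simp_all add: sq_def squares_def sqx_def sqg_def sqf_def sqy_def)
qed

lemma sq_eqI:
  assumes [simp]: "internal_category E A" and w: "w \<in> Arr E" "Cod E w = squares A" "w' \<in> Arr E" "Cod E w' = squares A"
    and eq: "sqx A \<bullet> w = sqx A \<bullet> w'" "sqg A \<bullet> w = sqg A \<bullet> w'" "sqf A \<bullet> w = sqf A \<bullet> w'" "sqy A \<bullet> w = sqy A \<bullet> w'"
  shows "w = w'"
proof -
  have [simp]: "w \<in> Arr E" "Cod E w = pb0 E (mul A) (mul A)" "w' \<in> Arr E" "Cod E w' = pb0 E (mul A) (mul A)"
    using w by (simp_all add: squares_def)
  have "Dom E (sqx A \<bullet> w) = Dom E w" "Dom E (sqx A \<bullet> w') = Dom E w'"
    using w by simp_all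
  then have [simp]: "Dom E w' = Dom E w"
    using eq(1) by simp
  have p: "pb1 E (mul A) (mul A) \<bullet> w = pb1 E (mul A) (mul A) \<bullet> w'"
    by (rule pb_eqI[of "tgt A" "src A"])
      (use eq in \<open>simp_all add: cpairs_def[symmetric] cp1_def[symmetric] cp2_def[symmetric] sqx_def sqg_def\<close>)
  have q: "pb2 E (mul A) (mul A) \<bullet> w = pb2 E (mul A) (mul A) \<bullet> w'"
    by (rule pb_eqI[of "tgt A" "src A"])
      (use eq in \<open>simp_all add: cpairs_def[symmetric] cp1_def[symmetric] cp2_def[symmetric] sqf_def sqy_def\<close>)
  show ?thesis
    by (rule pb_eqI[of "mul A" "mul A", OF _ _ _ _ _ _ _ _ p q]) simp_all
qed

lemma commutes_comp:
  assumes "internal_category E A" "commutes A x g f y" "z \<in> Arr E" "Cod E z = Dom E x"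
  shows "commutes A (x \<bullet> z) (g \<bullet> z) (f \<bullet> z) (y \<bullet> z)"
proof -
  have f: "Dom E f = Dom E x"
    using assms(2) icomp_simps(2)[OF assms(1), of x g] icomp_simps(2)[OF assms(1), of f y]
    unfolding commutes_def by auto
  have "icomp E A (x \<bullet> z) (g \<bullet> z) = icomp E A x g \<bullet> z"
    by (rule icomp_comp[symmetric]) (use assms in \<open>simp_all add: commutes_def\<close>)
  moreover have "icomp E A (f \<bullet> z) (y \<bullet> z) = icomp E A f y \<bullet> z"
    by (rule icomp_comp[symmetric]) (use assms f in \<open>simp_all add: commutes_def\<close>)
  ultimately have "icomp E A (x \<bullet> z) (g \<bullet> z) = icomp E A (f \<bullet> z) (y \<bullet> z)"
    using assms by (simp only: commutes_def)
  then show ?thesis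
    using assms f by (simp add: commutes_def composable_comp)
qed

lemma sq_comp:
  assumes "internal_category E A" "commutes A x g f y" "z \<in> Arr E" "Cod E z = Dom E x"
  shows "sq A x g f y \<bullet> z = sq A (x \<bullet> z) (g \<bullet> z) (f \<bullet> z) (y \<bullet> z)"
proof -
  note [simp] = assms commutes_comp[OF assms]
  have c: "composable A x g" "composable A f y" and i: "icomp E A x g = icomp E A f y"
    using assms(2) by (auto simp: commutes_def)
  have [simp]: "x \<in> Arr E" "Cod E x = mor A"
    using c by (auto simp: composable_def)
  have p: "sqx A \<bullet> sq A x g f y \<bullet> z = x \<bullet> z" "sqg A \<bullet> sq A x g f y \<bullet> z = g \<bullet> z"
    "sqf A \<bullet> sq A x g f y \<bullet> z = f \<bullet> z" "sqy A \<bullet> sq A x g f y \<bullet> z = y \<bullet> z"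
    using reassoc[OF sq_simps(4)[OF assms(1,2)], of z] reassoc[OF sq_simps(5)[OF assms(1,2)], of z]
      reassoc[OF sq_simps(6)[OF assms(1,2)], of z] reassoc[OF sq_simps(7)[OF assms(1,2)], of z] by simp_all
  show ?thesis
    by (rule sq_eqI[of A]) (simp_all add: p)
qed

text \<open>Pasting of \<open>v\<close> and \<open>w\<close> along their common side
  \<open>sqy A \<bullet> v = sqx A \<bullet> w\<close>.\<close>

definition sq_mul :: "('o, 'a) icat \<Rightarrow> 'a \<Rightarrow> 'a \<Rightarrow> 'a" where
  "sq_mul A v w = sq A (sqx A \<bullet> v) (icomp E A (sqg A \<bullet> v) (sqg A \<bullet> w)) (icomp E A (sqf A \<bullet> v) (sqf A \<bullet> w)) (sqy A \<bullet> w)"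

text \<open>In \<open>mul\<close> the projections are written out because \<open>cp1\<close> and
  \<open>cp2\<close> take the finished record as an argument.\<close>

definition arrow_icat :: "('o, 'a) icat \<Rightarrow> ('o, 'a) icat" where
  "arrow_icat A = \<lparr>ob = mor A, mor = squares A, src = sqx A, tgt = sqy A,
     unt = sq A (Ide E (mor A)) (unt A \<bullet> tgt A) (unt A \<bullet> src A) (Ide E (mor A)),
     mul = sq_mul A (pb1 E (sqy A) (sqx A)) (pb2 E (sqy A) (sqx A))\<rparr>"

lemma arrow_icat_simps [simp]:
  "ob (arrow_icat A) = mor A" "mor (arrow_icat A) = squares A" "src (arrow_icat A) = sqx A" "tgt (arrow_icat A) = sqy A"
  "unt (arrow_icat A) = sq A (Ide E (mor A)) (unt A \<bullet> tgt A) (unt A \<bullet> src A) (Ide E (mor A))"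
  by (simp_all add: arrow_icat_def)

lemma commutes_unt:
  assumes "internal_category E A" "x \<in> Arr E" "Cod E x = mor A"
  shows "commutes A x (unt A \<bullet> tgt A \<bullet> x) (unt A \<bullet> src A \<bullet> x) x"
  using assms by (simp add: commutes_def composable_def)

text \<open>Pasting: \<open>x ; g ; g' = f ; y ; g' = f ; f' ; z\<close>. That \<open>g\<close>
  composes with \<open>g'\<close> comes from the first square, whose two paths share their target;
  dually, that \<open>f\<close> composes with \<open>f'\<close> comes from the second.\<close>

lemma commutes_mul:
  assumes A [simp]: "internal_category E A" and c: "commutes A x g f y" "commutes A y g' f' z"
  shows "composable A g g'" "composable A f f'" "commutes A x (icomp E A g g') (icomp E A f f') z"
proof -
  have cs [simp]: "composable A x g" "composable A f y" "composable A y g'" "composable A f' z"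
    and eq: "icomp E A x g = icomp E A f y" "icomp E A y g' = icomp E A f' z"
    using c by (auto simp: commutes_def)
  have "composable A (icomp E A f y) g'"
    by simp
  then show gg [simp]: "composable A g g'"
    unfolding eq(1)[symmetric] by simp
  have "composable A f (icomp E A f' z)"
    unfolding eq(2)[symmetric] by simp
  then show ff [simp]: "composable A f f'"
    by simp
  have "icomp E A x (icomp E A g g') = icomp E A (icomp E A f y) g'"
    by (simp add: icomp_assoc flip: eq(1))
  also have "\<dots> = icomp E A f (icomp E A f' z)"
    by (simp add: icomp_assoc flip: eq(2))
  also have "\<dots> = icomp E A (icomp E A f f') z"
    by (simp add: icomp_assoc)
  finally show "commutes A x (icomp E A g g') (icomp E A f f') z"
    by (simp add: commutes_def)
qed

text \<open>A square is determined by its four sides. Pasting keeps the outer two and composes the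
  others, so each law holds because it holds side by side in \<open>A\<close>.\<close>

lemma internal_category_arrow:
  assumes A [simp]: "internal_category E A"
  shows "internal_category E (arrow_icat A)"
    and icomp_arrow: "composable (arrow_icat A) v w \<Longrightarrow> icomp E (arrow_icat A) v w = sq_mul A v w"
proof -
  let ?B = "arrow_icat A"
  have G [simp]: "internal_graph E ?B"
    unfolding internal_graph_def by simp
  have c1: "commutes A (Ide E (mor A)) (unt A \<bullet> tgt A) (unt A \<bullet> src A) (Ide E (mor A))"
    using commutes_unt[of A "Ide E (mor A)"] by simp
  have cB: "composable ?B v w \<longleftrightarrow> v \<in> Arr E \<and> w \<in> Arr E \<and> Dom E v = Dom E w \<and>
     Cod E v = squares A \<and> Cod E w = squares A \<and> sqy A \<bullet> v = sqx A \<bullet> w" for v w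
    by (simp add: composable_def)
  have cm: "commutes A (sqx A \<bullet> v) (icomp E A (sqg A \<bullet> v) (sqg A \<bullet> w)) (icomp E A (sqf A \<bullet> v) (sqf A \<bullet> w)) (sqy A \<bullet> w)"
    "composable A (sqg A \<bullet> v) (sqg A \<bullet> w)" "composable A (sqf A \<bullet> v) (sqf A \<bullet> w)"
    if "composable ?B v w" for v w
    using that commutes_mul[OF A, of "sqx A \<bullet> v" "sqg A \<bullet> v" "sqf A \<bullet> v" "sqy A \<bullet> v" "sqg A \<bullet> w" "sqf A \<bullet> w" "sqy A \<bullet> w"]
      sq_commutes[OF A, of v] sq_commutes[OF A, of w] unfolding cB by auto
  have m: "sq_mul A v w \<in> Arr E \<and> Dom E (sq_mul A v w) = Dom E v \<and> Cod E (sq_mul A v w) = squares A \<and>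
      sqx A \<bullet> sq_mul A v w = sqx A \<bullet> v \<and> sqy A \<bullet> sq_mul A v w = sqy A \<bullet> w \<and>
      sqg A \<bullet> sq_mul A v w = icomp E A (sqg A \<bullet> v) (sqg A \<bullet> w) \<and>
      sqf A \<bullet> sq_mul A v w = icomp E A (sqf A \<bullet> v) (sqf A \<bullet> w)" if "composable ?B v w" for v w
    using cm(1)[OF that] that unfolding sq_mul_def cB by simp
  have mz: "sq_mul A v w \<bullet> z = sq_mul A (v \<bullet> z) (w \<bullet> z)" if "composable ?B v w" "z \<in> Arr E" "Cod E z = Dom E v" for v w z
    using cm[OF that(1)] that unfolding sq_mul_def cB by (simp add: sq_comp icomp_comp)
  have unt: "sq A (Ide E (mor A)) (unt A \<bullet> tgt A) (unt A \<bullet> src A) (Ide E (mor A)) \<bullet> x =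
       sq A x (unt A \<bullet> tgt A \<bullet> x) (unt A \<bullet> src A \<bullet> x) x" if "x \<in> Arr E" "Cod E x = mor A" for x
    using that c1 by (simp add: sq_comp)
  have mu: "sq_mul A (unt ?B \<bullet> src ?B \<bullet> w) w = w \<and> sq_mul A w (unt ?B \<bullet> tgt ?B \<bullet> w) = w"
    if w: "w \<in> Arr E" "Cod E w = mor ?B" for w
  proof -
    have w' [simp]: "w \<in> Arr E" "Cod E w = squares A" using w by simp_all
    have sw: "tgt A \<bullet> sqf A \<bullet> w = src A \<bullet> sqy A \<bullet> w" "tgt A \<bullet> sqx A \<bullet> w = src A \<bullet> sqg A \<bullet> w"
        and i: "icomp E A (sqx A \<bullet> w) (sqg A \<bullet> w) = icomp E A (sqf A \<bullet> w) (sqy A \<bullet> w)"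
        and c: "composable A (sqx A \<bullet> w) (sqg A \<bullet> w)" "composable A (sqf A \<bullet> w) (sqy A \<bullet> w)"
      using sq_commutes[OF A w'] unfolding commutes_def composable_def by auto
    \<comment> \<open>The two paths around a square are equal, hence have equal ends; this makes the
      remaining corners match.\<close>
    have s2: "src A \<bullet> sqx A \<bullet> w = src A \<bullet> sqf A \<bullet> w" "tgt A \<bullet> sqg A \<bullet> w = tgt A \<bullet> sqy A \<bullet> w"
      using arg_cong[OF i, of "\<lambda>u. src A \<bullet> u"] arg_cong[OF i, of "\<lambda>u. tgt A \<bullet> u"] c by simp_all
    define v where "v = unt ?B \<bullet> src ?B \<bullet> w"
    define v' where "v' = unt ?B \<bullet> tgt ?B \<bullet> w"
    have v: "v \<in> Arr E" "Cod E v = squares A" "sqx A \<bullet> v = sqx A \<bullet> w" "sqg A \<bullet> v = unt A \<bullet> tgt A \<bullet> sqx A \<bullet> w"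
       "sqf A \<bullet> v = unt A \<bullet> src A \<bullet> sqx A \<bullet> w" "sqy A \<bullet> v = sqx A \<bullet> w" "Dom E v = Dom E w"
      using commutes_unt[OF A, of "sqx A \<bullet> w"] by (simp_all add: v_def unt)
    have v': "v' \<in> Arr E" "Cod E v' = squares A" "sqx A \<bullet> v' = sqy A \<bullet> w" "sqg A \<bullet> v' = unt A \<bullet> tgt A \<bullet> sqy A \<bullet> w"
       "sqf A \<bullet> v' = unt A \<bullet> src A \<bullet> sqy A \<bullet> w" "sqy A \<bullet> v' = sqy A \<bullet> w" "Dom E v' = Dom E w"
      using commutes_unt[OF A, of "sqy A \<bullet> w"] by (simp_all add: v'_def unt)
    have cc: "composable ?B v w" "composable ?B w v'"
      using v v' by (simp_all add: cB)
    have "sq_mul A v w = w"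
      by (rule sq_eqI[OF A]) (use m[OF cc(1)] v sw s2 in simp_all)
    moreover have "sq_mul A w v' = w"
      by (rule sq_eqI[OF A]) (use m[OF cc(2)] v' sw s2 in simp_all)
    ultimately have "sq_mul A v w = w \<and> sq_mul A w v' = w" ..
    then show ?thesis
      unfolding v_def v'_def .
  qed
  have ma: "sq_mul A (sq_mul A u v) w = sq_mul A u (sq_mul A v w)"
    if uv: "composable ?B u v" and vw: "composable ?B v w" for u v w
  proof -
    have "composable ?B (sq_mul A u v) w" "composable ?B u (sq_mul A v w)"
      using m[OF uv] m[OF vw] uv vw by (simp_all add: cB)
    note mm = m[OF this(1)] m[OF this(2)] m[OF uv] m[OF vw] cm(2,3)[OF uv] cm(2,3)[OF vw]
    show ?thesis
      by (rule sq_eqI[OF A]) (use mm in \<open>simp_all add: icomp_assoc\<close>)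
  qed
  have u: "unt ?B \<in> hom E (ob ?B) (mor ?B)" "src ?B \<bullet> unt ?B = Ide E (ob ?B)" "tgt ?B \<bullet> unt ?B = Ide E (ob ?B)"
    using c1 by simp_all
  have mulB: "mul ?B = sq_mul A (cp1 E ?B) (cp2 E ?B)"
    by (simp add: cp1_def cp2_def arrow_icat_def)
  have m': "sq_mul A v w \<in> Arr E \<and> Dom E (sq_mul A v w) = Dom E v \<and> Cod E (sq_mul A v w) = mor ?B \<and>
      src ?B \<bullet> sq_mul A v w = src ?B \<bullet> v \<and> tgt ?B \<bullet> sq_mul A v w = tgt ?B \<bullet> w" if "composable ?B v w" for v w
    using m[OF that] by simp
  note I = internal_categoryI[of ?B "sq_mul A", OF G u mulB m' mz mu ma]
  show "internal_category E ?B" by (rule I(1))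
  show "composable ?B v w \<Longrightarrow> icomp E ?B v w = sq_mul A v w" by (rule I(2))
qed

text \<open>One half of the power property. The naturality square of \<open>n\<close> at the generic
  arrow of \<open>A\<close> is an arrow into \<open>squares B\<close>; it is the arrow part of a
  functor whose object part is \<open>n\<close> itself.\<close>

lemma functor_into_arrow_icat:
  assumes A [simp]: "internal_category E A" and B [simp]: "internal_category E B" and n: "internal_nat_trans E A B F n G"
  shows "internal_functor E A (arrow_icat B) (n, sq B (n \<bullet> src A) (snd G) (snd F) (n \<bullet> tgt A))"
    and "commutes B (n \<bullet> src A) (snd G) (snd F) (n \<bullet> tgt A)"
proof -
  note nD = internal_nat_transD[OF n A B]
  note [simp] = nD(3-9) internal_functorD[OF nD(1) A B] internal_functorD[OF nD(2) A B]
  have el: "commutes B (n \<bullet> src A \<bullet> e) (snd G \<bullet> e) (snd F \<bullet> e) (n \<bullet> tgt A \<bullet> e)"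
    if "e \<in> Arr E" "Cod E e = mor A" for e
    using nD(10)[of e] that by (simp add: commutes_def composable_def)
  show c: "commutes B (n \<bullet> src A) (snd G) (snd F) (n \<bullet> tgt A)"
    using el[of "Ide E (mor A)"] by simp
  define s where "s = sq B (n \<bullet> src A) (snd G) (snd F) (n \<bullet> tgt A)"
  have s: "s \<in> Arr E" "Dom E s = mor A" "Cod E s = squares B" "sqx B \<bullet> s = n \<bullet> src A" "sqy B \<bullet> s = n \<bullet> tgt A"
    using c by (simp_all add: s_def)
  have sz: "s \<bullet> e = sq B (n \<bullet> src A \<bullet> e) (snd G \<bullet> e) (snd F \<bullet> e) (n \<bullet> tgt A \<bullet> e)"
    if "e \<in> Arr E" "Cod E e = mor A" for e
    using that c by (simp add: s_def sq_comp)
  have u: "commutes B (Ide E (mor B)) (unt B \<bullet> tgt B) (unt B \<bullet> src B) (Ide E (mor B))"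
    using commutes_unt[of B "Ide E (mor B)"] by simp
  have "internal_functor E A (arrow_icat B) (n, s)"
  proof (rule internal_functorI)
    show "s \<bullet> unt A = unt (arrow_icat B) \<bullet> n"
      using u by (simp add: sz sq_comp)
    have "composable (arrow_icat B) (s \<bullet> cp1 E A) (s \<bullet> cp2 E A)"
      using s reassoc[OF s(4)] reassoc[OF s(5)] by (simp add: composable_def)
    moreover have "composable A (cp1 E A) (cp2 E A)" by simp
    ultimately show "s \<bullet> icomp E A (cp1 E A) (cp2 E A) = icomp E (arrow_icat B) (s \<bullet> cp1 E A) (s \<bullet> cp2 E A)"
      using el[of "cp1 E A"] el[of "cp2 E A"] by (simp add: icomp_arrow sz sq_mul_def)
  qed (use s internal_category_arrow in simp_all)
  then show "internal_functor E A (arrow_icat B) (n, sq B (n \<bullet> src A) (snd G) (snd F) (n \<bullet> tgt A))"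
    by (simp add: s_def)
qed

text \<open>The other half of the power property: the sides \<open>sqf\<close> and
  \<open>sqg\<close> supply the arrow parts of the source and target functors, and the commutativity
  of the generic square supplies naturality.\<close>

lemma nat_trans_of_functor_into_arrow_icat:
  assumes A [simp]: "internal_category E A" and B [simp]: "internal_category E B"
    and U: "internal_functor E A (arrow_icat B) U"
  shows "internal_nat_trans E A B (src B \<bullet> fst U, sqf B \<bullet> snd U) (fst U) (tgt B \<bullet> fst U, sqg B \<bullet> snd U)"
proof -
  have C [simp]: "internal_category E (arrow_icat B)"
    by (rule internal_category_arrow) simp
  note UD [simp] = internal_functorD[OF U A C, simplified]
  have c: "commutes B (fst U \<bullet> src A \<bullet> e) (sqg B \<bullet> snd U \<bullet> e) (sqf B \<bullet> snd U \<bullet> e) (fst U \<bullet> tgt A \<bullet> e)"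
    if "e \<in> Arr E" "Cod E e = mor A" for e
    using sq_commutes[OF B, of "snd U \<bullet> e"] that by simp
  have c1: "commutes B (fst U \<bullet> src A) (sqg B \<bullet> snd U) (sqf B \<bullet> snd U) (fst U \<bullet> tgt A)"
    using c[of "Ide E (mor A)"] by simp
  \<comment> \<open>Comparing the ends of the two paths around the square at the generic arrow shows
    that the candidates for source and target functor respect ends.\<close>
  have ends: "src B \<bullet> fst U \<bullet> src A = src B \<bullet> sqf B \<bullet> snd U" "tgt B \<bullet> sqf B \<bullet> snd U = src B \<bullet> fst U \<bullet> tgt A"
    "src B \<bullet> sqg B \<bullet> snd U = tgt B \<bullet> fst U \<bullet> src A" "tgt B \<bullet> sqg B \<bullet> snd U = tgt B \<bullet> fst U \<bullet> tgt A"
  proof -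
    have cs: "composable B (fst U \<bullet> src A) (sqg B \<bullet> snd U)" "composable B (sqf B \<bullet> snd U) (fst U \<bullet> tgt A)"
      and i: "icomp E B (fst U \<bullet> src A) (sqg B \<bullet> snd U) = icomp E B (sqf B \<bullet> snd U) (fst U \<bullet> tgt A)"
      using c1 by (auto simp: commutes_def)
    show "src B \<bullet> fst U \<bullet> src A = src B \<bullet> sqf B \<bullet> snd U" "tgt B \<bullet> sqf B \<bullet> snd U = src B \<bullet> fst U \<bullet> tgt A"
      "src B \<bullet> sqg B \<bullet> snd U = tgt B \<bullet> fst U \<bullet> src A" "tgt B \<bullet> sqg B \<bullet> snd U = tgt B \<bullet> fst U \<bullet> tgt A"
      using arg_cong[OF i, of "\<lambda>u. src B \<bullet> u"] arg_cong[OF i, of "\<lambda>u. tgt B \<bullet> u"] cs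
      by (simp_all add: composable_def)
  qed
  have u: "commutes B (Ide E (mor B)) (unt B \<bullet> tgt B) (unt B \<bullet> src B) (Ide E (mor B))"
    using commutes_unt[of B "Ide E (mor B)"] by simp
  have uz: "commutes B (fst U) (unt B \<bullet> tgt B \<bullet> fst U) (unt B \<bullet> src B \<bullet> fst U) (fst U)"
    by (rule commutes_unt) simp_all
  have unt: "sqf B \<bullet> snd U \<bullet> unt A = unt B \<bullet> src B \<bullet> fst U" "sqg B \<bullet> snd U \<bullet> unt A = unt B \<bullet> tgt B \<bullet> fst U"
    using u uz by (simp_all add: sq_comp)
  have ca: "composable (arrow_icat B) (snd U \<bullet> cp1 E A) (snd U \<bullet> cp2 E A)"
    by (rule internal_functorD(13)[OF U A C]) simp
  have fm: "composable B (sqf B \<bullet> snd U \<bullet> cp1 E A) (sqf B \<bullet> snd U \<bullet> cp2 E A)"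
    "composable B (sqg B \<bullet> snd U \<bullet> cp1 E A) (sqg B \<bullet> snd U \<bullet> cp2 E A)"
    "commutes B (fst U \<bullet> src A \<bullet> cp1 E A) (icomp E B (sqg B \<bullet> snd U \<bullet> cp1 E A) (sqg B \<bullet> snd U \<bullet> cp2 E A))
       (icomp E B (sqf B \<bullet> snd U \<bullet> cp1 E A) (sqf B \<bullet> snd U \<bullet> cp2 E A)) (fst U \<bullet> tgt A \<bullet> cp2 E A)"
    using commutes_mul[OF B c[of "cp1 E A"], of "sqg B \<bullet> snd U \<bullet> cp2 E A" "sqf B \<bullet> snd U \<bullet> cp2 E A" "fst U \<bullet> tgt A \<bullet> cp2 E A"]
      c[of "cp2 E A"] by simp_all
  have mul: "snd U \<bullet> icomp E A (cp1 E A) (cp2 E A) = sq_mul B (snd U \<bullet> cp1 E A) (snd U \<bullet> cp2 E A)"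
    using icomp_arrow[OF B ca] by simp
  have F: "internal_functor E A B (src B \<bullet> fst U, sqf B \<bullet> snd U)"
    by (rule internal_functorI) (use ends unt fm in \<open>simp_all add: mul sq_mul_def del: UD(14)\<close>)
  have G: "internal_functor E A B (tgt B \<bullet> fst U, sqg B \<bullet> snd U)"
    by (rule internal_functorI) (use ends unt fm in \<open>simp_all add: mul sq_mul_def del: UD(14)\<close>)
  show ?thesis
    by (rule internal_nat_transI[OF F G]) (use c1 in \<open>simp_all add: commutes_def\<close>)
qed

end

section \<open>Presentations of categories\<close>

text \<open>An arbitrary choice among the words for \<open>f\<close>. Where the relations hold, all
  of these words have the same value, which is shown inside
  \<open>functor_from_presentation\<close>.\<close>

definition word :: "('o, 'a) cat \<Rightarrow> 'e set \<Rightarrow> ('e \<Rightarrow> 'a) \<Rightarrow> 'a \<Rightarrow> 'e list" where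
  "word C Q \<phi> f = (SOME p. gpath C Q \<phi> (Dom C f) p (Cod C f) \<and> peval C \<phi> (Dom C f) p = f)"

definition is_graph_map ::
  "('o, 'a) cat \<Rightarrow> 'e set \<Rightarrow> ('e \<Rightarrow> 'a) \<Rightarrow> ('p, 'b) cat \<Rightarrow> ('o \<Rightarrow> 'p) \<Rightarrow> ('e \<Rightarrow> 'b) \<Rightarrow> bool" where
  "is_graph_map C Q \<phi> D F \<gamma> \<longleftrightarrow> (\<forall>x \<in> Obj C. F x \<in> Obj D) \<and>
     (\<forall>e \<in> Q. \<phi> e \<in> Arr C \<and> \<gamma> e \<in> hom D (F (Dom C (\<phi> e))) (F (Cod C (\<phi> e))))"

lemma is_graph_map_id: "(\<And>e. e \<in> Q \<Longrightarrow> \<phi> e \<in> Arr C) \<Longrightarrow> is_graph_map C Q \<phi> C (\<lambda>x. x) \<phi>"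
  by (simp add: is_graph_map_def)

lemma gpath_Obj:
  "category C \<Longrightarrow> is_graph_map C Q \<phi> D F \<gamma> \<Longrightarrow> gpath C Q \<phi> a p b \<Longrightarrow> a \<in> Obj C \<and> b \<in> Obj C"
  by (induction p arbitrary: a) (auto simp: is_graph_map_def category_simps)

lemma gpath_append: "gpath C Q \<phi> a p b \<Longrightarrow> gpath C Q \<phi> b q c \<Longrightarrow> gpath C Q \<phi> a (p @ q) c"
  by (induction p arbitrary: a) auto

text \<open>Paths are typed in \<open>C\<close>, but \<open>peval D\<close> recomputes the
  intermediate vertices as codomains in \<open>D\<close>. For a graph map these are the images under
  \<open>F\<close> of the vertices in \<open>C\<close>, so all composites along the path make
  sense.\<close>

lemma peval_hom:
  assumes "category C" "category D" and m: "is_graph_map C Q \<phi> D F \<gamma>"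
  shows "gpath C Q \<phi> a p b \<Longrightarrow> peval D \<gamma> (F a) p \<in> hom D (F a) (F b)"
proof (induction p arbitrary: a)
  case Nil
  then show ?case
    using m category_simps[OF assms(2)] by (auto simp: is_graph_map_def)
next
  case (Cons e p)
  then have "\<gamma> e \<in> hom D (F a) (F (Cod C (\<phi> e)))" and "gpath C Q \<phi> (Cod C (\<phi> e)) p b"
    using m by (auto simp: is_graph_map_def)
  with Cons.IH[OF this(2)] show ?case
    using category_simps[OF assms(2)] by simp
qed

lemma peval_append:
  assumes "category C" "category D" and m: "is_graph_map C Q \<phi> D F \<gamma>" and q: "gpath C Q \<phi> b q c"
  shows "gpath C Q \<phi> a p b \<Longrightarrow> peval D \<gamma> (F a) (p @ q) = peval D \<gamma> (F b) q \<cdot>\<^bsub>D\<^esub> peval D \<gamma> (F a) p"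
proof (induction p arbitrary: a)
  case Nil
  then show ?case
    using peval_hom[OF assms(1-3) q] category_simps[OF assms(2)] by auto
next
  case (Cons e p)
  then have e: "\<gamma> e \<in> hom D (F a) (F (Cod C (\<phi> e)))" and p: "gpath C Q \<phi> (Cod C (\<phi> e)) p b"
    using m by (auto simp: is_graph_map_def)
  have "peval D \<gamma> (F a) ((e # p) @ q) = peval D \<gamma> (F (Cod C (\<phi> e))) (p @ q) \<cdot>\<^bsub>D\<^esub> \<gamma> e"
    using e by simp
  also have "\<dots> = (peval D \<gamma> (F b) q \<cdot>\<^bsub>D\<^esub> peval D \<gamma> (F (Cod C (\<phi> e))) p) \<cdot>\<^bsub>D\<^esub> \<gamma> e"
    using Cons.IH[OF p] by simp
  finally show ?case
    using peval_hom[OF assms(1-3) p] peval_hom[OF assms(1-3) q] e category_simps[OF assms(2)] by simp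
qed

text \<open>Evaluation is natural in the category of values. Applied to the functor given by a
  cocone this becomes \<open>ev_cocone\<close>, and applied to the action of an internal functor on
  points it becomes \<open>ev_push\<close>.\<close>

lemma functor_peval:
  assumes "category C" "category D" and m: "is_graph_map C Q \<phi> D F \<gamma>" and H: "is_functor D D' H"
  shows "gpath C Q \<phi> a p b \<Longrightarrow> peval D' (\<lambda>e. fa H (\<gamma> e)) (fo H (F a)) p = fa H (peval D \<gamma> (F a) p)"
proof (induction p arbitrary: a)
  case Nil
  then show ?case
    using m functorD(5)[OF H] by (auto simp: is_graph_map_def)
next
  case (Cons e p)
  then have e: "\<gamma> e \<in> hom D (F a) (F (Cod C (\<phi> e)))" and p: "gpath C Q \<phi> (Cod C (\<phi> e)) p b"
    using m by (auto simp: is_graph_map_def)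
  then show ?case
    using peval_hom[OF assms(1-3) p] Cons.IH[OF p] functorD[OF H] by simp
qed

lemma peval_cong: "(\<And>e. e \<in> set p \<Longrightarrow> \<gamma> e = \<gamma>' e) \<Longrightarrow> peval D \<gamma> a p = peval D \<gamma>' a p"
  by (induction p arbitrary: a) auto

lemma gpath_edges: "gpath C Q \<phi> a p b \<Longrightarrow> set p \<subseteq> Q"
  by (induction p arbitrary: a) auto

context
  fixes C :: "('o, 'a) cat" and Q :: "'e set" and \<phi> R
  assumes C: "category C" and presents: "presents C Q \<phi> R"
begin

lemma presents_arr: "e \<in> Q \<Longrightarrow> \<phi> e \<in> Arr C"
  using presents unfolding presents_def by blast

lemma word_gpath:
  assumes "f \<in> Arr C"
  shows "gpath C Q \<phi> (Dom C f) (word C Q \<phi> f) (Cod C f)" "peval C \<phi> (Dom C f) (word C Q \<phi> f) = f"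
proof -
  have "\<exists>p. gpath C Q \<phi> (Dom C f) p (Cod C f) \<and> peval C \<phi> (Dom C f) p = f"
    using presents assms unfolding presents_def by blast
  from someI_ex[OF this]
  show "gpath C Q \<phi> (Dom C f) (word C Q \<phi> f) (Cod C f)" "peval C \<phi> (Dom C f) (word C Q \<phi> f) = f"
    unfolding word_def by auto
qed

text \<open>Every arrow is the value of a path, so induction on paths reaches it. This extends to
  all arrows the properties that the relations enforce on the finitely many generators only.\<close>

lemma presents_induct:
  assumes f: "f \<in> Arr C" and id: "\<And>a. a \<in> Obj C \<Longrightarrow> P (Ide C a)" and gen: "\<And>e. e \<in> Q \<Longrightarrow> P (\<phi> e)"
    and comp: "\<And>f g. f \<in> Arr C \<Longrightarrow> g \<in> Arr C \<Longrightarrow> Cod C f = Dom C g \<Longrightarrow> P f \<Longrightarrow> P g \<Longrightarrow> P (g \<cdot>\<^bsub>C\<^esub> f)"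
  shows "P f"
proof -
  have "gpath C Q \<phi> a p b \<Longrightarrow> P (peval C \<phi> a p)" for a p b
  proof (induction p arbitrary: a)
    case (Cons e p)
    then have e: "e \<in> Q" "Dom C (\<phi> e) = a" and p: "gpath C Q \<phi> (Cod C (\<phi> e)) p b"
      by auto
    have "peval C \<phi> (Cod C (\<phi> e)) p \<in> hom C (Cod C (\<phi> e)) b"
      using peval_hom[OF C C is_graph_map_id p] presents_arr by simp
    then show ?case
      using comp[of "\<phi> e" "peval C \<phi> (Cod C (\<phi> e)) p"] presents_arr[OF e(1)] gen[OF e(1)] Cons.IH[OF p] by simp
  qed (use id in auto)
  then show ?thesis
    using word_gpath[OF f] by metis
qed

text \<open>The universal property of a presentation. Equality of values in \<open>C\<close> is the
  congruence \<open>pcong\<close>, and evaluation in \<open>D\<close> respects that congruence as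
  soon as it respects the relators, so the value of an arrow does not depend on the word chosen for
  it.\<close>

lemma functor_from_presentation:
  fixes D :: "('p, 'b) cat"
  assumes D: "category D" and m: "is_graph_map C Q \<phi> D F \<gamma>"
    and rel: "\<And>a p q b. (a, p, q, b) \<in> R \<Longrightarrow> peval D \<gamma> (F a) p = peval D \<gamma> (F a) q"
  shows "is_functor C D \<lparr>fo = F, fa = \<lambda>f. peval D \<gamma> (F (Dom C f)) (word C Q \<phi> f)\<rparr>"
    and "e \<in> Q \<Longrightarrow> peval D \<gamma> (F (Dom C (\<phi> e))) (word C Q \<phi> (\<phi> e)) = \<gamma> e"
proof -
  note CD = category_simps[OF C] category_simps[OF D]
  have id: "is_graph_map C Q \<phi> C (\<lambda>x. x) \<phi>"
    using is_graph_map_id presents_arr by blast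
  \<comment> \<open>The facts about \<open>gpath\<close> are carried through the induction because
    the case \<open>pcong_comp\<close> needs them to split the evaluation of concatenated
    words.\<close>
  have "pcong C Q \<phi> R a p q b \<Longrightarrow> gpath C Q \<phi> a p b \<and> gpath C Q \<phi> a q b \<and> peval D \<gamma> (F a) p = peval D \<gamma> (F a) q" for a p q b
  proof (induction rule: pcong.induct)
    case (pcong_rel a p q b)
    then show ?case
      using presents rel unfolding presents_def by auto
  next
    case (pcong_comp a p q b r s c)
    then show ?case
      using peval_append[OF C D m] gpath_append by metis
  qed auto
  then have eval: "peval D \<gamma> (F a) p = peval D \<gamma> (F a) q"
    if "gpath C Q \<phi> a p b" "gpath C Q \<phi> a q b" "peval C \<phi> a p = peval C \<phi> a q" for a p q b
    using presents that unfolding presents_def by blast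
  have w: "peval D \<gamma> (F (Dom C f)) (word C Q \<phi> f) = peval D \<gamma> (F (Dom C f)) p"
    if "f \<in> Arr C" "gpath C Q \<phi> (Dom C f) p (Cod C f)" "peval C \<phi> (Dom C f) p = f" for f p
    using eval word_gpath that by metis
  show "peval D \<gamma> (F (Dom C (\<phi> e))) (word C Q \<phi> (\<phi> e)) = \<gamma> e" if "e \<in> Q"
    using w[of "\<phi> e" "[e]"] that m CD by (simp add: is_graph_map_def)
  show "is_functor C D \<lparr>fo = F, fa = \<lambda>f. peval D \<gamma> (F (Dom C f)) (word C Q \<phi> f)\<rparr>"
  proof (rule functorI, goal_cases)
    case (1 x)
    then show ?case using m by (simp add: is_graph_map_def)
  next
    case (2 f)
    then show ?case
      using peval_hom[OF C D m word_gpath(1)[OF 2]] by simp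
  next
    case (3 x)
    then show ?case
      using w[of "Ide C x" "[]"] by (simp add: CD)
  next
    case (4 f g)
    have "peval D \<gamma> (F (Dom C f)) (word C Q \<phi> (g \<cdot>\<^bsub>C\<^esub> f)) = peval D \<gamma> (F (Dom C f)) (word C Q \<phi> f @ word C Q \<phi> g)"
      using w[of "g \<cdot>\<^bsub>C\<^esub> f" "word C Q \<phi> f @ word C Q \<phi> g"] 4 word_gpath[of f] word_gpath[of g]
        gpath_append[of C Q \<phi> "Dom C f" "word C Q \<phi> f" "Cod C f" "word C Q \<phi> g" "Cod C g"]
        peval_append[OF C C id, of "Dom C g" "word C Q \<phi> g" "Cod C g" "Dom C f" "word C Q \<phi> f"]
      by (simp add: CD)
    then show ?case
      using 4 word_gpath[of f] word_gpath[of g]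
        peval_append[OF C D m, of "Dom C g" "word C Q \<phi> g" "Cod C g" "Dom C f" "word C Q \<phi> f"]
      by (simp add: CD)
  qed
qed

end

section \<open>Cocones and their generating data\<close>

text \<open>This and the next two definitions project from the same choice term, so together they
  form one finite presentation of \<open>C\<close>.\<close>

definition edges :: "('o, 'a) cat \<Rightarrow> nat set" where
  "edges C = fst (SOME (Q, \<phi>, R). finite Q \<and> finite R \<and> presents C (Q :: nat set) \<phi> R)"

definition edge_arr :: "('o, 'a) cat \<Rightarrow> nat \<Rightarrow> 'a" where
  "edge_arr C = fst (snd (SOME (Q, \<phi>, R). finite Q \<and> finite R \<and> presents C (Q :: nat set) \<phi> R))"

definition rels :: "('o, 'a) cat \<Rightarrow> ('o \<times> nat list \<times> nat list \<times> 'o) set" where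
  "rels C = snd (snd (SOME (Q, \<phi>, R). finite Q \<and> finite R \<and> presents C (Q :: nat set) \<phi> R))"

lemma finite_presentation:
  assumes "finitely_presentable C"
  shows "finite (edges C)" "finite (rels C)" "presents C (edges C) (edge_arr C) (rels C)"
proof -
  have "\<exists>z. (\<lambda>(Q, \<phi>, R). finite Q \<and> finite R \<and> presents C (Q :: nat set) \<phi> R) z"
    using assms unfolding finitely_presentable_def by auto
  from someI_ex[OF this]
  show "finite (edges C)" "finite (rels C)" "presents C (edges C) (edge_arr C) (rels C)"
    unfolding edges_def edge_arr_def rels_def by (simp_all add: case_prod_unfold)
qed

section \<open>The weight and the diagram in components\<close>

locale weighted_diagram = category_with_stable_coequalisers E
  for E :: "('o, 'a) cat" +
  fixes J :: "('i, 'f, 'd) twocat" and W :: "('i, 'f, 'd, 'w, 'v) catvalued"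
    and D :: "('i, 'f, 'd, ('o, 'a) icat, 'a \<times> 'a, ('a \<times> 'a) \<times> 'a \<times> ('a \<times> 'a)) twofunc"
  assumes weight: "finite_weight J W" and diagram: "two_functor J (Cat E) D"
begin

abbreviation D2 :: "'i \<Rightarrow> 'i \<Rightarrow> 'd \<Rightarrow> 'a" where
  "D2 i j \<alpha> \<equiv> fst (snd (F2 D i j \<alpha>))"

abbreviation Wo :: "'i \<Rightarrow> 'i \<Rightarrow> 'f \<Rightarrow> 'w \<Rightarrow> 'w" where
  "Wo i j f x \<equiv> fo (F1 W i j f) x"

abbreviation Wa :: "'i \<Rightarrow> 'i \<Rightarrow> 'f \<Rightarrow> 'v \<Rightarrow> 'v" where
  "Wa i j f a \<equiv> fa (F1 W i j f) a"

abbreviation W2 :: "'i \<Rightarrow> 'i \<Rightarrow> 'd \<Rightarrow> 'w \<Rightarrow> 'v" where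
  "W2 i j \<alpha> x \<equiv> fst (snd (F2 W i j \<alpha>)) x"

abbreviation X :: "'i \<Rightarrow> 'o" where
  "X i \<equiv> ob (F0 D i)"

lemma J_category:
  assumes "i \<in> Ob J" "j \<in> Ob J"
  shows "category (Hom J i j)"
proof -
  have "two_category J"
    using weight unfolding finite_weight_def by (rule conjunct1)
  then show ?thesis
    using assms unfolding two_category_def by (elim conjE) simp
qed

lemma J_presentable: "i \<in> Ob J \<Longrightarrow> j \<in> Ob J \<Longrightarrow> finitely_presentable (Hom J i j)"
  using weight unfolding finite_weight_def by blast

lemma W_presentable: "i \<in> Ob J \<Longrightarrow> finitely_presentable (F0 W i)"
  using weight unfolding finite_weight_def by blast

lemma J_finite: "finite (Ob J)"
  using weight unfolding finite_weight_def by blast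

lemma W_category: "i \<in> Ob J \<Longrightarrow> category (F0 W i)"
  using weight unfolding finite_weight_def two_functor_def by (auto simp: CAT_def op2_def)

lemma D_category: "i \<in> Ob J \<Longrightarrow> internal_category E (F0 D i)"
  using diagram unfolding two_functor_def by auto

lemma D_hom_functor:
  "i \<in> Ob J \<Longrightarrow> j \<in> Ob J \<Longrightarrow>
   is_functor (Hom J i j) (ifun_cat E (F0 D i) (F0 D j)) \<lparr>fo = F1 D i j, fa = F2 D i j\<rparr>"
  using diagram unfolding two_functor_def by auto

lemma D_functor: "i \<in> Ob J \<Longrightarrow> j \<in> Ob J \<Longrightarrow> f \<in> Obj (Hom J i j) \<Longrightarrow> internal_functor E (F0 D i) (F0 D j) (F1 D i j f)"
  using functorD(1)[OF D_hom_functor] by simp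

lemma D2_simps:
  assumes "i \<in> Ob J" "j \<in> Ob J"
  shows "\<alpha> \<in> Arr (Hom J i j) \<Longrightarrow>
      internal_nat_trans E (F0 D i) (F0 D j) (F1 D i j (Dom (Hom J i j) \<alpha>)) (D2 i j \<alpha>) (F1 D i j (Cod (Hom J i j) \<alpha>))"
    and "\<alpha> \<in> Arr (Hom J i j) \<Longrightarrow>
      F2 D i j \<alpha> = (F1 D i j (Dom (Hom J i j) \<alpha>), D2 i j \<alpha>, F1 D i j (Cod (Hom J i j) \<alpha>))"
    and "f \<in> Obj (Hom J i j) \<Longrightarrow> D2 i j (Ide (Hom J i j) f) = unt (F0 D j) \<bullet> fst (F1 D i j f)"
    and "\<alpha> \<in> Arr (Hom J i j) \<Longrightarrow> \<beta> \<in> Arr (Hom J i j) \<Longrightarrow> Cod (Hom J i j) \<alpha> = Dom (Hom J i j) \<beta> \<Longrightarrow>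
      D2 i j (\<beta> \<cdot>\<^bsub>Hom J i j\<^esub> \<alpha>) = icomp E (F0 D j) (D2 i j \<alpha>) (D2 i j \<beta>)"
proof -
  note F = functorD[OF D_hom_functor[OF assms], simplified]
  show "F2 D i j \<alpha> = (F1 D i j (Dom (Hom J i j) \<alpha>), D2 i j \<alpha>, F1 D i j (Cod (Hom J i j) \<alpha>))"
    if "\<alpha> \<in> Arr (Hom J i j)" for \<alpha>
    using F(3,4)[OF that] by (simp add: prod_eq_iff)
  then show "\<alpha> \<in> Arr (Hom J i j) \<Longrightarrow>
      internal_nat_trans E (F0 D i) (F0 D j) (F1 D i j (Dom (Hom J i j) \<alpha>)) (D2 i j \<alpha>) (F1 D i j (Cod (Hom J i j) \<alpha>))"
    using F(2) by (metis ifun_cat_simps(2))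
  show "f \<in> Obj (Hom J i j) \<Longrightarrow> D2 i j (Ide (Hom J i j) f) = unt (F0 D j) \<bullet> fst (F1 D i j f)"
    using F(5) by simp
  show "\<alpha> \<in> Arr (Hom J i j) \<Longrightarrow> \<beta> \<in> Arr (Hom J i j) \<Longrightarrow> Cod (Hom J i j) \<alpha> = Dom (Hom J i j) \<beta> \<Longrightarrow>
      D2 i j (\<beta> \<cdot>\<^bsub>Hom J i j\<^esub> \<alpha>) = icomp E (F0 D j) (D2 i j \<alpha>) (D2 i j \<beta>)"
    using F(6) by simp
qed

lemma W_hom_functor:
  "i \<in> Ob J \<Longrightarrow> j \<in> Ob J \<Longrightarrow>
   is_functor (Hom J j i) (fun_cat (F0 W i) (F0 W j)) \<lparr>fo = F1 W i j, fa = F2 W i j\<rparr>"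
  using weight unfolding finite_weight_def two_functor_def by (auto simp: CAT_def op2_def)

lemma W1_functor:
  "i \<in> Ob J \<Longrightarrow> j \<in> Ob J \<Longrightarrow> f \<in> Obj (Hom J j i) \<Longrightarrow> is_functor (F0 W i) (F0 W j) (F1 W i j f)"
  "i \<in> Ob J \<Longrightarrow> j \<in> Ob J \<Longrightarrow> f \<in> Obj (Hom J j i) \<Longrightarrow> F1 W i j f \<in> Obj (fun_cat (F0 W i) (F0 W j))"
  using functorD(1)[OF W_hom_functor, of i j f] by (simp_all add: fun_cat_def Let_def)

lemma W2_simps:
  assumes ij: "i \<in> Ob J" "j \<in> Ob J"
  shows "\<alpha> \<in> Arr (Hom J j i) \<Longrightarrow>
      F2 W i j \<alpha> = (F1 W i j (Dom (Hom J j i) \<alpha>), W2 i j \<alpha>, F1 W i j (Cod (Hom J j i) \<alpha>))"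
    and "\<alpha> \<in> Arr (Hom J j i) \<Longrightarrow> x \<in> Obj (F0 W i) \<Longrightarrow> W2 i j \<alpha> x \<in> Arr (F0 W j) \<and>
      Dom (F0 W j) (W2 i j \<alpha> x) = Wo i j (Dom (Hom J j i) \<alpha>) x \<and> Cod (F0 W j) (W2 i j \<alpha> x) = Wo i j (Cod (Hom J j i) \<alpha>) x"
    and "f \<in> Obj (Hom J j i) \<Longrightarrow> x \<in> Obj (F0 W i) \<Longrightarrow> W2 i j (Ide (Hom J j i) f) x = Ide (F0 W j) (Wo i j f x)"
    and "\<alpha> \<in> Arr (Hom J j i) \<Longrightarrow> \<beta> \<in> Arr (Hom J j i) \<Longrightarrow> Cod (Hom J j i) \<alpha> = Dom (Hom J j i) \<beta> \<Longrightarrow> x \<in> Obj (F0 W i) \<Longrightarrow>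
      W2 i j (\<beta> \<cdot>\<^bsub>Hom J j i\<^esub> \<alpha>) x = W2 i j \<beta> x \<cdot>\<^bsub>F0 W j\<^esub> W2 i j \<alpha> x"
proof -
  note F = functorD[OF W_hom_functor[OF assms], simplified]
  show F2: "F2 W i j \<alpha> = (F1 W i j (Dom (Hom J j i) \<alpha>), W2 i j \<alpha>, F1 W i j (Cod (Hom J j i) \<alpha>))"
    if "\<alpha> \<in> Arr (Hom J j i)" for \<alpha>
    using F(3,4)[OF that] by (auto simp: fun_cat_def Let_def prod_eq_iff split: prod.splits)
  show "W2 i j \<alpha> x \<in> Arr (F0 W j) \<and>
      Dom (F0 W j) (W2 i j \<alpha> x) = Wo i j (Dom (Hom J j i) \<alpha>) x \<and> Cod (F0 W j) (W2 i j \<alpha> x) = Wo i j (Cod (Hom J j i) \<alpha>) x"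
    if \<alpha>: "\<alpha> \<in> Arr (Hom J j i)" and x: "x \<in> Obj (F0 W i)" for \<alpha> x
    using F(2)[OF \<alpha>] x by (subst (asm) F2[OF \<alpha>]) (simp add: fun_cat_def Let_def is_nat_trans_def)
  show "f \<in> Obj (Hom J j i) \<Longrightarrow> x \<in> Obj (F0 W i) \<Longrightarrow> W2 i j (Ide (Hom J j i) f) x = Ide (F0 W j) (Wo i j f x)"
    using F(5)[of f] by (simp add: fun_cat_def Let_def)
  show "W2 i j (\<beta> \<cdot>\<^bsub>Hom J j i\<^esub> \<alpha>) x = W2 i j \<beta> x \<cdot>\<^bsub>F0 W j\<^esub> W2 i j \<alpha> x"
    if "\<alpha> \<in> Arr (Hom J j i)" "\<beta> \<in> Arr (Hom J j i)" "Cod (Hom J j i) \<alpha> = Dom (Hom J j i) \<beta>" "x \<in> Obj (F0 W i)" for \<alpha> \<beta> x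
    using F(6)[OF that(1-3)] F2[OF that(1)] F2[OF that(2)] that(4) by (simp add: fun_cat_def Let_def split: prod.splits)
qed

text \<open>A cocone \<open>W \<Rightarrow> Cat(E)(D-, Y)\<close>, given by its internal functors \<open>p i x : D i \<rightarrow> Y\<close> and the components
  \<open>t i a\<close> of its internal natural transformations.\<close>

definition cocone :: "('o, 'a) icat \<Rightarrow> ('i \<Rightarrow> 'w \<Rightarrow> 'a \<times> 'a) \<Rightarrow> ('i \<Rightarrow> 'v \<Rightarrow> 'a) \<Rightarrow> bool" where
  "cocone Y p t \<longleftrightarrow>
     (\<forall>i \<in> Ob J. \<forall>x \<in> Obj (F0 W i). internal_functor E (F0 D i) Y (p i x)) \<and>
     (\<forall>i \<in> Ob J. \<forall>a \<in> Arr (F0 W i).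
        internal_nat_trans E (F0 D i) Y (p i (Dom (F0 W i) a)) (t i a) (p i (Cod (F0 W i) a))) \<and>
     (\<forall>i \<in> Ob J. \<forall>x \<in> Obj (F0 W i). t i (Ide (F0 W i) x) = unt Y \<bullet> fst (p i x)) \<and>
     (\<forall>i \<in> Ob J. \<forall>a \<in> Arr (F0 W i). \<forall>b \<in> Arr (F0 W i). Cod (F0 W i) a = Dom (F0 W i) b \<longrightarrow>
        t i (b \<cdot>\<^bsub>F0 W i\<^esub> a) = icomp E Y (t i a) (t i b)) \<and>
     (\<forall>i \<in> Ob J. \<forall>j \<in> Ob J. \<forall>f \<in> Obj (Hom J j i). \<forall>x \<in> Obj (F0 W i).
        p j (Wo i j f x) = (fst (p i x) \<bullet> fst (F1 D j i f), snd (p i x) \<bullet> snd (F1 D j i f))) \<and>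
     (\<forall>i \<in> Ob J. \<forall>j \<in> Ob J. \<forall>f \<in> Obj (Hom J j i). \<forall>a \<in> Arr (F0 W i).
        t j (Wa i j f a) = t i a \<bullet> fst (F1 D j i f)) \<and>
     (\<forall>i \<in> Ob J. \<forall>j \<in> Ob J. \<forall>\<alpha> \<in> Arr (Hom J j i). \<forall>x \<in> Obj (F0 W i).
        t j (W2 i j \<alpha> x) = snd (p i x) \<bullet> D2 j i \<alpha>)"

lemma coconeI:
  assumes "\<And>i x. i \<in> Ob J \<Longrightarrow> x \<in> Obj (F0 W i) \<Longrightarrow> internal_functor E (F0 D i) Y (p i x)"
    and "\<And>i a. i \<in> Ob J \<Longrightarrow> a \<in> Arr (F0 W i) \<Longrightarrow>
        internal_nat_trans E (F0 D i) Y (p i (Dom (F0 W i) a)) (t i a) (p i (Cod (F0 W i) a))"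
    and "\<And>i x. i \<in> Ob J \<Longrightarrow> x \<in> Obj (F0 W i) \<Longrightarrow> t i (Ide (F0 W i) x) = unt Y \<bullet> fst (p i x)"
    and "\<And>i a b. i \<in> Ob J \<Longrightarrow> a \<in> Arr (F0 W i) \<Longrightarrow> b \<in> Arr (F0 W i) \<Longrightarrow> Cod (F0 W i) a = Dom (F0 W i) b \<Longrightarrow>
        t i (b \<cdot>\<^bsub>F0 W i\<^esub> a) = icomp E Y (t i a) (t i b)"
    and "\<And>i j f x. i \<in> Ob J \<Longrightarrow> j \<in> Ob J \<Longrightarrow> f \<in> Obj (Hom J j i) \<Longrightarrow> x \<in> Obj (F0 W i) \<Longrightarrow>
        p j (Wo i j f x) = (fst (p i x) \<bullet> fst (F1 D j i f), snd (p i x) \<bullet> snd (F1 D j i f))"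
    and "\<And>i j f a. i \<in> Ob J \<Longrightarrow> j \<in> Ob J \<Longrightarrow> f \<in> Obj (Hom J j i) \<Longrightarrow> a \<in> Arr (F0 W i) \<Longrightarrow>
        t j (Wa i j f a) = t i a \<bullet> fst (F1 D j i f)"
    and "\<And>i j \<alpha> x. i \<in> Ob J \<Longrightarrow> j \<in> Ob J \<Longrightarrow> \<alpha> \<in> Arr (Hom J j i) \<Longrightarrow> x \<in> Obj (F0 W i) \<Longrightarrow>
        t j (W2 i j \<alpha> x) = snd (p i x) \<bullet> D2 j i \<alpha>"
  shows "cocone Y p t"
  unfolding cocone_def by (intro conjI ballI impI; rule assms; assumption)

lemma coconeD:
  assumes "cocone Y p t"
  shows "i \<in> Ob J \<Longrightarrow> x \<in> Obj (F0 W i) \<Longrightarrow> internal_functor E (F0 D i) Y (p i x)"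
    and "i \<in> Ob J \<Longrightarrow> a \<in> Arr (F0 W i) \<Longrightarrow>
        internal_nat_trans E (F0 D i) Y (p i (Dom (F0 W i) a)) (t i a) (p i (Cod (F0 W i) a))"
    and "i \<in> Ob J \<Longrightarrow> x \<in> Obj (F0 W i) \<Longrightarrow> t i (Ide (F0 W i) x) = unt Y \<bullet> fst (p i x)"
    and "i \<in> Ob J \<Longrightarrow> a \<in> Arr (F0 W i) \<Longrightarrow> b \<in> Arr (F0 W i) \<Longrightarrow> Cod (F0 W i) a = Dom (F0 W i) b \<Longrightarrow>
        t i (b \<cdot>\<^bsub>F0 W i\<^esub> a) = icomp E Y (t i a) (t i b)"
    and "i \<in> Ob J \<Longrightarrow> j \<in> Ob J \<Longrightarrow> f \<in> Obj (Hom J j i) \<Longrightarrow> x \<in> Obj (F0 W i) \<Longrightarrow>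
        p j (Wo i j f x) = (fst (p i x) \<bullet> fst (F1 D j i f), snd (p i x) \<bullet> snd (F1 D j i f))"
    and "i \<in> Ob J \<Longrightarrow> j \<in> Ob J \<Longrightarrow> f \<in> Obj (Hom J j i) \<Longrightarrow> a \<in> Arr (F0 W i) \<Longrightarrow>
        t j (Wa i j f a) = t i a \<bullet> fst (F1 D j i f)"
    and "i \<in> Ob J \<Longrightarrow> j \<in> Ob J \<Longrightarrow> \<alpha> \<in> Arr (Hom J j i) \<Longrightarrow> x \<in> Obj (F0 W i) \<Longrightarrow>
        t j (W2 i j \<alpha> x) = snd (p i x) \<bullet> D2 j i \<alpha>"
  using assms unfolding cocone_def by simp_all

text \<open>The part of the data of a cocone on the generators: \<open>p\<close> as a graph morphism and \<open>g i e\<close> for the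
  generating arrows \<open>e\<close> of \<open>W i\<close>.\<close>

abbreviation ed :: "'i \<Rightarrow> nat set" where
  "ed i \<equiv> edges (F0 W i)"

abbreviation ea :: "'i \<Rightarrow> nat \<Rightarrow> 'v" where
  "ea i \<equiv> edge_arr (F0 W i)"

definition precocone :: "('o, 'a) icat \<Rightarrow> ('i \<Rightarrow> 'w \<Rightarrow> 'a \<times> 'a) \<Rightarrow> ('i \<Rightarrow> nat \<Rightarrow> 'a) \<Rightarrow> bool" where
  "precocone Y p g \<longleftrightarrow>
     (\<forall>i \<in> Ob J. \<forall>x \<in> Obj (F0 W i). graph_morphism E (F0 D i) Y (p i x)) \<and>
     (\<forall>i \<in> Ob J. \<forall>e \<in> ed i. g i e \<in> hom E (X i) (mor Y) \<and>
        src Y \<bullet> g i e = fst (p i (Dom (F0 W i) (ea i e))) \<and> tgt Y \<bullet> g i e = fst (p i (Cod (F0 W i) (ea i e)))) \<and>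
     (\<forall>i \<in> Ob J. \<forall>j \<in> Ob J. \<forall>f \<in> Obj (Hom J j i). \<forall>x \<in> Obj (F0 W i).
        fst (p j (Wo i j f x)) = fst (p i x) \<bullet> fst (F1 D j i f))"

text \<open>Components of transformations between functors from \<open>D i\<close> to
  \<open>Y\<close> are generalised elements of \<open>mor Y\<close> at stage \<open>X i\<close>, so
  words in the generators of \<open>W i\<close> are composed in
  \<open>points Y (X i)\<close>.\<close>

definition ev :: "('o, 'a) icat \<Rightarrow> ('i \<Rightarrow> 'w \<Rightarrow> 'a \<times> 'a) \<Rightarrow> ('i \<Rightarrow> nat \<Rightarrow> 'a) \<Rightarrow> 'i \<Rightarrow> 'w \<Rightarrow> nat list \<Rightarrow> 'a" where
  "ev Y p g i x w = peval (points Y (X i)) (g i) (fst (p i x)) w"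

text \<open>The only possible component at an arbitrary arrow of \<open>W i\<close>, given the
  components at the generators. Until the relations of \<open>W i\<close> hold in \<open>Y\<close>,
  it may depend on the chosen word.\<close>

definition arr_of :: "('o, 'a) icat \<Rightarrow> ('i \<Rightarrow> 'w \<Rightarrow> 'a \<times> 'a) \<Rightarrow> ('i \<Rightarrow> nat \<Rightarrow> 'a) \<Rightarrow> 'i \<Rightarrow> 'v \<Rightarrow> 'a" where
  "arr_of Y p g i a = ev Y p g i (Dom (F0 W i) a) (word (F0 W i) (ed i) (ea i) a)"

text \<open>The equations that turn the generating data into a cocone: \<open>p i x\<close> preserves units and composites,
  \<open>g i e\<close> is natural, the relations of \<open>W i\<close> hold, and the data are 2-natural in \<open>J\<close> on morphism
  components, on generating arrows and on generating 2-cells.\<close>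

definition relations :: "('o, 'a) icat \<Rightarrow> ('i \<Rightarrow> 'w \<Rightarrow> 'a \<times> 'a) \<Rightarrow> ('i \<Rightarrow> nat \<Rightarrow> 'a) \<Rightarrow> ('a \<times> 'a) set" where
  "relations Y p g =
     (\<lambda>(i, x). (snd (p i x) \<bullet> unt (F0 D i), unt Y \<bullet> fst (p i x))) ` (SIGMA i:Ob J. Obj (F0 W i)) \<union>
     (\<lambda>(i, x). (snd (p i x) \<bullet> mul (F0 D i),
        icomp E Y (snd (p i x) \<bullet> cp1 E (F0 D i)) (snd (p i x) \<bullet> cp2 E (F0 D i)))) ` (SIGMA i:Ob J. Obj (F0 W i)) \<union>
     (\<lambda>(i, e). (icomp E Y (g i e \<bullet> src (F0 D i)) (snd (p i (Cod (F0 W i) (ea i e)))),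
        icomp E Y (snd (p i (Dom (F0 W i) (ea i e)))) (g i e \<bullet> tgt (F0 D i)))) ` (SIGMA i:Ob J. ed i) \<union>
     (\<lambda>(i, (a, u, v, b)). (ev Y p g i a u, ev Y p g i a v)) ` (SIGMA i:Ob J. rels (F0 W i)) \<union>
     (\<lambda>(i, j, f, x). (snd (p j (Wo i j f x)), snd (p i x) \<bullet> snd (F1 D j i f))) `
        (SIGMA i:Ob J. SIGMA j:Ob J. Obj (Hom J j i) \<times> Obj (F0 W i)) \<union>
     (\<lambda>(i, j, f, e). (arr_of Y p g j (Wa i j f (ea i e)), g i e \<bullet> fst (F1 D j i f))) `
        (SIGMA i:Ob J. SIGMA j:Ob J. Obj (Hom J j i) \<times> ed i) \<union>
     (\<lambda>(i, j, e, x). (arr_of Y p g j (W2 i j (edge_arr (Hom J j i) e) x), snd (p i x) \<bullet> D2 j i (edge_arr (Hom J j i) e))) `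
        (SIGMA i:Ob J. SIGMA j:Ob J. edges (Hom J j i) \<times> Obj (F0 W i))"

text \<open>Left open in \<open>P\<close>, so that a single case distinction covers three questions
  about the pairs: whether they are parallel, whether they are equal, and whether a functor makes
  them equal.\<close>

lemma relations_all:
  "(\<forall>(r, s) \<in> relations Y p g. P r s) \<longleftrightarrow>
     (\<forall>i \<in> Ob J. \<forall>x \<in> Obj (F0 W i). P (snd (p i x) \<bullet> unt (F0 D i)) (unt Y \<bullet> fst (p i x))) \<and>
     (\<forall>i \<in> Ob J. \<forall>x \<in> Obj (F0 W i). P (snd (p i x) \<bullet> mul (F0 D i))
        (icomp E Y (snd (p i x) \<bullet> cp1 E (F0 D i)) (snd (p i x) \<bullet> cp2 E (F0 D i)))) \<and>
     (\<forall>i \<in> Ob J. \<forall>e \<in> ed i. P (icomp E Y (g i e \<bullet> src (F0 D i)) (snd (p i (Cod (F0 W i) (ea i e)))))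
        (icomp E Y (snd (p i (Dom (F0 W i) (ea i e)))) (g i e \<bullet> tgt (F0 D i)))) \<and>
     (\<forall>i \<in> Ob J. \<forall>(a, u, v, b) \<in> rels (F0 W i). P (ev Y p g i a u) (ev Y p g i a v)) \<and>
     (\<forall>i \<in> Ob J. \<forall>j \<in> Ob J. \<forall>f \<in> Obj (Hom J j i). \<forall>x \<in> Obj (F0 W i).
        P (snd (p j (Wo i j f x))) (snd (p i x) \<bullet> snd (F1 D j i f))) \<and>
     (\<forall>i \<in> Ob J. \<forall>j \<in> Ob J. \<forall>f \<in> Obj (Hom J j i). \<forall>e \<in> ed i.
        P (arr_of Y p g j (Wa i j f (ea i e))) (g i e \<bullet> fst (F1 D j i f))) \<and>
     (\<forall>i \<in> Ob J. \<forall>j \<in> Ob J. \<forall>e \<in> edges (Hom J j i). \<forall>x \<in> Obj (F0 W i).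
        P (arr_of Y p g j (W2 i j (edge_arr (Hom J j i) e) x)) (snd (p i x) \<bullet> D2 j i (edge_arr (Hom J j i) e)))"
  unfolding relations_def ball_Un conj_assoc ball_simps(9) by (intro arg_cong2[where f="(\<and>)"]) (auto simp: split_beta)

text \<open>The arrows of \<open>W i\<close> and the 2-cells of \<open>J\<close>, of which there may
  be infinitely many, enter only through generators and relators; all other indices range over
  finite sets of objects.\<close>

lemma finite_relations: "finite (relations Y p g)"
  using J_finite finite_presentation(1,2)[OF W_presentable] finite_presentation(1,2)[OF J_presentable] W_presentable J_presentable
  unfolding relations_def by (auto simp: finitely_presentable_def intro!: finite_imageI finite_SigmaI)

end

section \<open>From generating data to cocones and back\<close>

context weighted_diagram
begin

lemma W_presents: "i \<in> Ob J \<Longrightarrow> presents (F0 W i) (ed i) (ea i) (rels (F0 W i))"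
  by (rule finite_presentation(3)[OF W_presentable])

lemma J_presents: "i \<in> Ob J \<Longrightarrow> j \<in> Ob J \<Longrightarrow>
    presents (Hom J i j) (edges (Hom J i j)) (edge_arr (Hom J i j)) (rels (Hom J i j))"
  by (rule finite_presentation(3)[OF J_presentable])

lemma ea_Arr: "i \<in> Ob J \<Longrightarrow> e \<in> ed i \<Longrightarrow> ea i e \<in> Arr (F0 W i)"
  using presents_arr[OF W_category W_presents] .

lemma ea_Dom_Cod: 
  assumes "i \<in> Ob J" "e \<in> ed i"
  shows "Dom (F0 W i) (ea i e) \<in> Obj (F0 W i)" "Cod (F0 W i) (ea i e) \<in> Obj (F0 W i)"
  using category_simps(1,2)[OF W_category[OF assms(1)] ea_Arr[OF assms]] .

lemma rels_gpath:
  assumes "i \<in> Ob J" "(a, u, v, b) \<in> rels (F0 W i)"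
  shows "gpath (F0 W i) (ed i) (ea i) a u b" "gpath (F0 W i) (ed i) (ea i) a v b"
    "peval (F0 W i) (ea i) a u = peval (F0 W i) (ea i) a v"
proof -
  note P = W_presents[OF assms(1), unfolded presents_def]
  show *: "gpath (F0 W i) (ed i) (ea i) a u b" "gpath (F0 W i) (ed i) (ea i) a v b"
    using bspec[OF conjunct1[OF conjunct2[OF P]] assms(2)] by simp_all
  show "peval (F0 W i) (ea i) a u = peval (F0 W i) (ea i) a v"
    using conjunct2[OF conjunct2[OF conjunct2[OF P]]] * pcong_rel[OF assms(2)] by blast
qed

context
  fixes Y :: "('o, 'a) icat" and p :: "'i \<Rightarrow> 'w \<Rightarrow> 'a \<times> 'a" and g :: "'i \<Rightarrow> nat \<Rightarrow> 'a"
  assumes Y [simp]: "internal_category E Y" and pre: "precocone Y p g"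
begin

lemma precocone_p:
  assumes i: "i \<in> Ob J" and x: "x \<in> Obj (F0 W i)"
  shows "fst (p i x) \<in> Arr E" "snd (p i x) \<in> Arr E" "Dom E (fst (p i x)) = X i" "Cod E (fst (p i x)) = ob Y"
    "Dom E (snd (p i x)) = mor (F0 D i)" "Cod E (snd (p i x)) = mor Y"
    "src Y \<bullet> snd (p i x) = fst (p i x) \<bullet> src (F0 D i)" "tgt Y \<bullet> snd (p i x) = fst (p i x) \<bullet> tgt (F0 D i)"
    "z \<in> Arr E \<Longrightarrow> Cod E z = mor (F0 D i) \<Longrightarrow> src Y \<bullet> snd (p i x) \<bullet> z = fst (p i x) \<bullet> src (F0 D i) \<bullet> z"
    "z \<in> Arr E \<Longrightarrow> Cod E z = mor (F0 D i) \<Longrightarrow> tgt Y \<bullet> snd (p i x) \<bullet> z = fst (p i x) \<bullet> tgt (F0 D i) \<bullet> z"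
proof -
  have "graph_morphism E (F0 D i) Y (p i x)"
    using pre i x unfolding precocone_def by blast
  then show *: "fst (p i x) \<in> Arr E" "snd (p i x) \<in> Arr E" "Dom E (fst (p i x)) = X i" "Cod E (fst (p i x)) = ob Y"
    "Dom E (snd (p i x)) = mor (F0 D i)" "Cod E (snd (p i x)) = mor Y"
    "src Y \<bullet> snd (p i x) = fst (p i x) \<bullet> src (F0 D i)" "tgt Y \<bullet> snd (p i x) = fst (p i x) \<bullet> tgt (F0 D i)"
    by (auto simp: graph_morphism_def split: prod.splits)
  show "z \<in> Arr E \<Longrightarrow> Cod E z = mor (F0 D i) \<Longrightarrow> src Y \<bullet> snd (p i x) \<bullet> z = fst (p i x) \<bullet> src (F0 D i) \<bullet> z"
    "z \<in> Arr E \<Longrightarrow> Cod E z = mor (F0 D i) \<Longrightarrow> tgt Y \<bullet> snd (p i x) \<bullet> z = fst (p i x) \<bullet> tgt (F0 D i) \<bullet> z"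
    using reassoc[OF *(7), of z] reassoc[OF *(8), of z] * D_category[OF i] by simp_all
qed

lemma precocone_g:
  assumes i: "i \<in> Ob J" and e: "e \<in> ed i"
  shows "g i e \<in> Arr E" "Dom E (g i e) = X i" "Cod E (g i e) = mor Y"
    "src Y \<bullet> g i e = fst (p i (Dom (F0 W i) (ea i e)))" "tgt Y \<bullet> g i e = fst (p i (Cod (F0 W i) (ea i e)))"
    "z \<in> Arr E \<Longrightarrow> Cod E z = X i \<Longrightarrow> src Y \<bullet> g i e \<bullet> z = fst (p i (Dom (F0 W i) (ea i e))) \<bullet> z"
    "z \<in> Arr E \<Longrightarrow> Cod E z = X i \<Longrightarrow> tgt Y \<bullet> g i e \<bullet> z = fst (p i (Cod (F0 W i) (ea i e))) \<bullet> z"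
proof -
  show *: "g i e \<in> Arr E" "Dom E (g i e) = X i" "Cod E (g i e) = mor Y"
    "src Y \<bullet> g i e = fst (p i (Dom (F0 W i) (ea i e)))" "tgt Y \<bullet> g i e = fst (p i (Cod (F0 W i) (ea i e)))"
    using pre i e unfolding precocone_def by auto
  show "z \<in> Arr E \<Longrightarrow> Cod E z = X i \<Longrightarrow> src Y \<bullet> g i e \<bullet> z = fst (p i (Dom (F0 W i) (ea i e))) \<bullet> z"
    "z \<in> Arr E \<Longrightarrow> Cod E z = X i \<Longrightarrow> tgt Y \<bullet> g i e \<bullet> z = fst (p i (Cod (F0 W i) (ea i e))) \<bullet> z"
    using reassoc[OF *(4), of z] reassoc[OF *(5), of z] * by simp_all
qed

lemma precocone_Wo: "i \<in> Ob J \<Longrightarrow> j \<in> Ob J \<Longrightarrow> f \<in> Obj (Hom J j i) \<Longrightarrow> x \<in> Obj (F0 W i) \<Longrightarrow>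
    fst (p j (Wo i j f x)) = fst (p i x) \<bullet> fst (F1 D j i f)"
  using pre unfolding precocone_def by blast

lemma precocone_graph_map:
  "i \<in> Ob J \<Longrightarrow> is_graph_map (F0 W i) (ed i) (ea i) (points Y (X i)) (\<lambda>x. fst (p i x)) (g i)"
  unfolding is_graph_map_def using precocone_p precocone_g ea_Arr by simp

lemma ev_simps:
  assumes i: "i \<in> Ob J" and w: "gpath (F0 W i) (ed i) (ea i) x w y"
  shows "ev Y p g i x w \<in> Arr E" "Dom E (ev Y p g i x w) = X i" "Cod E (ev Y p g i x w) = mor Y"
    "src Y \<bullet> ev Y p g i x w = fst (p i x)" "tgt Y \<bullet> ev Y p g i x w = fst (p i y)"
  using peval_hom[OF W_category[OF i] category_points[OF Y] precocone_graph_map[OF i] w] unfolding ev_def by simp_all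

lemma arr_of_simps:
  assumes i: "i \<in> Ob J" and a: "a \<in> Arr (F0 W i)"
  shows "arr_of Y p g i a \<in> Arr E" "Dom E (arr_of Y p g i a) = X i" "Cod E (arr_of Y p g i a) = mor Y"
    "src Y \<bullet> arr_of Y p g i a = fst (p i (Dom (F0 W i) a))" "tgt Y \<bullet> arr_of Y p g i a = fst (p i (Cod (F0 W i) a))"
  unfolding arr_of_def using ev_simps[OF i word_gpath(1)[OF W_category[OF i] W_presents[OF i] a]] by simp_all

text \<open>A precocone already satisfies the equations between objects: its maps respect ends, the
  generators have the prescribed ends, and 2-naturality holds on objects. These make the ends of
  both sides of every relation agree, as a quotient that is the identity on objects
  requires.\<close>

lemma relations_parallel: "\<forall>(r, s) \<in> relations Y p g. parallel Y r s"
  unfolding relations_all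
proof (intro conjI ballI; clarify?)
  fix i x
  assume i: "i \<in> Ob J" and x: "x \<in> Obj (F0 W i)"
  note [simp] = precocone_p[OF i x] D_category[OF i]
  show "parallel Y (snd (p i x) \<bullet> unt (F0 D i)) (unt Y \<bullet> fst (p i x))"
    by (simp add: parallel_def)
  have "composable Y (snd (p i x) \<bullet> cp1 E (F0 D i)) (snd (p i x) \<bullet> cp2 E (F0 D i))"
    by (simp add: composable_def)
  then show "parallel Y (snd (p i x) \<bullet> mul (F0 D i)) (icomp E Y (snd (p i x) \<bullet> cp1 E (F0 D i)) (snd (p i x) \<bullet> cp2 E (F0 D i)))"
    by (simp add: parallel_def)
next
  fix i e
  assume i: "i \<in> Ob J" and e: "e \<in> ed i"
  note [simp] = precocone_p[OF i ea_Dom_Cod(1)[OF i e]] precocone_p[OF i ea_Dom_Cod(2)[OF i e]]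
    precocone_g[OF i e] D_category[OF i]
  let ?x = "g i e \<bullet> src (F0 D i)" and ?y = "snd (p i (Cod (F0 W i) (ea i e)))"
    and ?z = "snd (p i (Dom (F0 W i) (ea i e)))" and ?w = "g i e \<bullet> tgt (F0 D i)"
  have "composable Y ?x ?y" "composable Y ?z ?w"
    by (simp_all add: composable_def)
  then show "parallel Y (icomp E Y ?x ?y) (icomp E Y ?z ?w)"
    by (simp add: parallel_def)
next
  fix i a u v b
  assume i: "i \<in> Ob J" and r: "(a, u, v, b) \<in> rels (F0 W i)"
  show "parallel Y (ev Y p g i a u) (ev Y p g i a v)"
    using ev_simps[OF i rels_gpath(1)[OF i r]] ev_simps[OF i rels_gpath(2)[OF i r]] by (simp add: parallel_def)
next
  fix i j f x
  assume i: "i \<in> Ob J" and j: "j \<in> Ob J" and f: "f \<in> Obj (Hom J j i)" and x: "x \<in> Obj (F0 W i)"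
  have x': "Wo i j f x \<in> Obj (F0 W j)"
    using functorD(1)[OF W1_functor(1)[OF i j f] x] .
  note [simp] = precocone_p[OF i x] precocone_p[OF j x'] precocone_Wo[OF i j f x] D_category[OF i] D_category[OF j]
    internal_functorD[OF D_functor[OF j i f] D_category[OF j] D_category[OF i]]
  show "parallel Y (snd (p j (Wo i j f x))) (snd (p i x) \<bullet> snd (F1 D j i f))"
    by (simp add: parallel_def)
next
  fix i j f e
  assume i: "i \<in> Ob J" and j: "j \<in> Ob J" and f: "f \<in> Obj (Hom J j i)" and e: "e \<in> ed i"
  note F = functorD[OF W1_functor(1)[OF i j f]]
  note [simp] = precocone_g[OF i e] D_category[OF i] D_category[OF j] ea_Arr[OF i e] F
    internal_functorD[OF D_functor[OF j i f] D_category[OF j] D_category[OF i]]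
    arr_of_simps[OF j F(2)[OF ea_Arr[OF i e]]] precocone_Wo[OF i j f ea_Dom_Cod(1)[OF i e]]
    precocone_Wo[OF i j f ea_Dom_Cod(2)[OF i e]]
  show "parallel Y (arr_of Y p g j (Wa i j f (ea i e))) (g i e \<bullet> fst (F1 D j i f))"
    by (simp add: parallel_def)
next
  fix i j e x
  assume i: "i \<in> Ob J" and j: "j \<in> Ob J" and e: "e \<in> edges (Hom J j i)" and x: "x \<in> Obj (F0 W i)"
  let ?\<alpha> = "edge_arr (Hom J j i) e"
  have \<alpha>: "?\<alpha> \<in> Arr (Hom J j i)"
    by (rule presents_arr[OF J_category[OF j i] J_presents[OF j i] e])
  note dc = category_simps(1,2)[OF J_category[OF j i] \<alpha>]
  note n = internal_nat_transD[OF D2_simps(1)[OF j i \<alpha>] D_category[OF j] D_category[OF i]]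
  note W2 = W2_simps(2)[OF i j \<alpha> x]
  note [simp] = precocone_p[OF i x] n(3-9) D_category[OF i] D_category[OF j] arr_of_simps[OF j conjunct1[OF W2]] W2
    precocone_Wo[OF i j dc(1) x] precocone_Wo[OF i j dc(2) x]
  show "parallel Y (arr_of Y p g j (W2 i j ?\<alpha> x)) (snd (p i x) \<bullet> D2 j i ?\<alpha>)"
    by (simp add: parallel_def)
qed

text \<open>The relations mention generators only. Functoriality in \<open>W i\<close> follows from
  its presentation; naturality and 2-naturality are closed under identities and composition, and so
  spread from generators to all arrows of \<open>W i\<close> and all 2-cells of
  \<open>J\<close>.\<close>

lemma cocone_of_precocone:
  assumes rel: "\<forall>(r, s) \<in> relations Y p g. r = s"
  shows "cocone Y p (arr_of Y p g)" and "i \<in> Ob J \<Longrightarrow> e \<in> ed i \<Longrightarrow> arr_of Y p g i (ea i e) = g i e"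
proof -
  note R = rel[unfolded relations_all]
  note R1 = conjunct1[OF R, rule_format]
    and R2 = conjunct1[OF conjunct2[OF R], rule_format]
    and R3 = conjunct1[OF conjunct2[OF conjunct2[OF R]], rule_format]
    and R4 = bspec[OF bspec[OF conjunct1[OF conjunct2[OF conjunct2[OF conjunct2[OF R]]]]]]
    and R5 = conjunct1[OF conjunct2[OF conjunct2[OF conjunct2[OF conjunct2[OF R]]]], rule_format]
    and R6 = conjunct1[OF conjunct2[OF conjunct2[OF conjunct2[OF conjunct2[OF conjunct2[OF R]]]]], rule_format]
    and R7 = conjunct2[OF conjunct2[OF conjunct2[OF conjunct2[OF conjunct2[OF conjunct2[OF R]]]]], rule_format]
  let ?t = "arr_of Y p g"
  \<comment> \<open>The relators of \<open>W i\<close> hold in \<open>points Y (X i)\<close> by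
    \<open>R4\<close>, so \<open>arr_of\<close> is a functor there and takes the prescribed values
    on generators.\<close>
  have F: "is_functor (F0 W i) (points Y (X i)) \<lparr>fo = \<lambda>x. fst (p i x), fa = ?t i\<rparr>"
    and gen: "e \<in> ed i \<Longrightarrow> ?t i (ea i e) = g i e" if i: "i \<in> Ob J" for i e
  proof -
    have "peval (points Y (X i)) (g i) (fst (p i a)) u = peval (points Y (X i)) (g i) (fst (p i a)) v"
      if "(a, u, v, b) \<in> rels (F0 W i)" for a u v b
      using R4[OF i that] unfolding ev_def by simp
    note fp = functor_from_presentation[OF W_category[OF i] W_presents[OF i] category_points[OF Y] precocone_graph_map[OF i] this]
    show "is_functor (F0 W i) (points Y (X i)) \<lparr>fo = \<lambda>x. fst (p i x), fa = ?t i\<rparr>"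
      using fp(1) unfolding arr_of_def ev_def by simp
    show "e \<in> ed i \<Longrightarrow> ?t i (ea i e) = g i e"
      using fp(2) unfolding arr_of_def ev_def by simp
  qed
  show "i \<in> Ob J \<Longrightarrow> e \<in> ed i \<Longrightarrow> arr_of Y p g i (ea i e) = g i e" by (rule gen)
  have pf: "internal_functor E (F0 D i) Y (p i x)" if i: "i \<in> Ob J" and x: "x \<in> Obj (F0 W i)" for i x
  proof -
    have "snd (p i x) \<bullet> unt (F0 D i) = unt Y \<bullet> fst (p i x)"
      "snd (p i x) \<bullet> mul (F0 D i) = icomp E Y (snd (p i x) \<bullet> cp1 E (F0 D i)) (snd (p i x) \<bullet> cp2 E (F0 D i))"
      by (rule R1[OF i x], rule R2[OF i x])
    then have "internal_functor E (F0 D i) Y (fst (p i x), snd (p i x))"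
      using precocone_p[OF i x] D_category[OF i] by (intro internal_functorI) (simp_all add: icomp_cp)
    then show ?thesis by simp
  qed
  have tc: "composable Y (?t i a \<bullet> z) (?t i b \<bullet> z)"
    if "i \<in> Ob J" "a \<in> Arr (F0 W i)" "b \<in> Arr (F0 W i)" "Cod (F0 W i) a = Dom (F0 W i) b" "z \<in> Arr E" "Cod E z = X i" for i a b z
    using arr_of_simps[OF that(1,2)] arr_of_simps[OF that(1,3)] that reassoc[of "tgt Y" "?t i a" _ z] reassoc[of "src Y" "?t i b" _ z]
    by (simp add: composable_def)
  have tc1: "composable Y (?t i a) (?t i b)"
    if "i \<in> Ob J" "a \<in> Arr (F0 W i)" "b \<in> Arr (F0 W i)" "Cod (F0 W i) a = Dom (F0 W i) b" for i a b
    using arr_of_simps[OF that(1,2)] arr_of_simps[OF that(1,3)] that by (simp add: composable_def)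
  have tid: "?t i (Ide (F0 W i) x) = unt Y \<bullet> fst (p i x)" if "i \<in> Ob J" "x \<in> Obj (F0 W i)" for i x
    using functorD(5)[OF F] that by simp
  have tcomp: "?t i (b \<cdot>\<^bsub>F0 W i\<^esub> a) = icomp E Y (?t i a) (?t i b)"
    if "i \<in> Ob J" "a \<in> Arr (F0 W i)" "b \<in> Arr (F0 W i)" "Cod (F0 W i) a = Dom (F0 W i) b" for i a b
    using functorD(6)[OF F] that by simp
  show "cocone Y p ?t"
  proof (rule coconeI)
    fix i x assume "i \<in> Ob J" "x \<in> Obj (F0 W i)"
    then show "internal_functor E (F0 D i) Y (p i x)" by (rule pf)
  next
    fix i a
    assume i: "i \<in> Ob J" and a: "a \<in> Arr (F0 W i)"
    note Wi = category_simps[OF W_category[OF i]]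
    have "icomp E Y (?t i a \<bullet> src (F0 D i)) (snd (p i (Cod (F0 W i) a))) =
        icomp E Y (snd (p i (Dom (F0 W i) a))) (?t i a \<bullet> tgt (F0 D i))"
    proof (rule presents_induct[OF W_category[OF i] W_presents[OF i] a])
      fix x
      assume x: "x \<in> Obj (F0 W i)"
      note [simp] = precocone_p[OF i x] D_category[OF i]
      show "icomp E Y (?t i (Ide (F0 W i) x) \<bullet> src (F0 D i)) (snd (p i (Cod (F0 W i) (Ide (F0 W i) x)))) =
        icomp E Y (snd (p i (Dom (F0 W i) (Ide (F0 W i) x)))) (?t i (Ide (F0 W i) x) \<bullet> tgt (F0 D i))"
        using x by (simp add: tid[OF i x] Wi)
    next
      fix e
      assume "e \<in> ed i"
      then show "icomp E Y (?t i (ea i e) \<bullet> src (F0 D i)) (snd (p i (Cod (F0 W i) (ea i e)))) =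
        icomp E Y (snd (p i (Dom (F0 W i) (ea i e)))) (?t i (ea i e) \<bullet> tgt (F0 D i))"
        using R3[OF i] i by (simp add: gen)
    next
      fix a b
      assume a: "a \<in> Arr (F0 W i)" and b: "b \<in> Arr (F0 W i)" and ab: "Cod (F0 W i) a = Dom (F0 W i) b"
        and eq: "icomp E Y (?t i a \<bullet> src (F0 D i)) (snd (p i (Cod (F0 W i) a))) =
        icomp E Y (snd (p i (Dom (F0 W i) a))) (?t i a \<bullet> tgt (F0 D i))"
        "icomp E Y (?t i b \<bullet> src (F0 D i)) (snd (p i (Cod (F0 W i) b))) =
        icomp E Y (snd (p i (Dom (F0 W i) b))) (?t i b \<bullet> tgt (F0 D i))"
      note [simp] = D_category[OF i] precocone_p[OF i Wi(1)[OF a]] precocone_p[OF i Wi(2)[OF a]]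
        precocone_p[OF i Wi(1)[OF b]] precocone_p[OF i Wi(2)[OF b]] arr_of_simps[OF i a] arr_of_simps[OF i b]
      have tz: "src Y \<bullet> ?t i a \<bullet> z = fst (p i (Dom (F0 W i) a)) \<bullet> z" "tgt Y \<bullet> ?t i a \<bullet> z = fst (p i (Cod (F0 W i) a)) \<bullet> z"
        "src Y \<bullet> ?t i b \<bullet> z = fst (p i (Dom (F0 W i) b)) \<bullet> z" "tgt Y \<bullet> ?t i b \<bullet> z = fst (p i (Cod (F0 W i) b)) \<bullet> z"
        if "z \<in> Arr E" "Cod E z = X i" for z
        using that reassoc[OF arr_of_simps(4)[OF i a], of z] reassoc[OF arr_of_simps(5)[OF i a], of z]
          reassoc[OF arr_of_simps(4)[OF i b], of z] reassoc[OF arr_of_simps(5)[OF i b], of z] by simp_all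
      let ?s = "src (F0 D i)" and ?r = "tgt (F0 D i)"
      have c: "composable Y (?t i a \<bullet> ?s) (?t i b \<bullet> ?s)" "composable Y (?t i a \<bullet> ?r) (?t i b \<bullet> ?r)"
        "composable Y (?t i b \<bullet> ?s) (snd (p i (Cod (F0 W i) b)))" "composable Y (snd (p i (Cod (F0 W i) a))) (?t i b \<bullet> ?r)"
        "composable Y (snd (p i (Dom (F0 W i) a))) (?t i a \<bullet> ?r)" "composable Y (?t i a \<bullet> ?s) (snd (p i (Cod (F0 W i) a)))"
        using ab by (simp_all add: composable_def tz)
      \<comment> \<open>Naturality for the composite is the pasting of the squares of
        \<open>a\<close> and \<open>b\<close>, which share the arrow part of \<open>p\<close> at the
        middle object.\<close>
      have "icomp E Y (?t i (b \<cdot>\<^bsub>F0 W i\<^esub> a) \<bullet> ?s) (snd (p i (Cod (F0 W i) b))) =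
          icomp E Y (?t i a \<bullet> ?s) (icomp E Y (?t i b \<bullet> ?s) (snd (p i (Cod (F0 W i) b))))"
        using c tc1[OF i a b ab] by (simp add: tcomp[OF i a b ab] icomp_comp icomp_assoc)
      also have "\<dots> = icomp E Y (?t i a \<bullet> ?s) (icomp E Y (snd (p i (Cod (F0 W i) a))) (?t i b \<bullet> ?r))"
        using eq(2) ab by simp
      also have "\<dots> = icomp E Y (icomp E Y (?t i a \<bullet> ?s) (snd (p i (Cod (F0 W i) a)))) (?t i b \<bullet> ?r)"
        using icomp_assoc[OF Y c(6) c(4)] by simp
      also have "\<dots> = icomp E Y (icomp E Y (snd (p i (Dom (F0 W i) a))) (?t i a \<bullet> ?r)) (?t i b \<bullet> ?r)"
        using eq(1) by simp
      also have "\<dots> = icomp E Y (snd (p i (Dom (F0 W i) a))) (?t i (b \<cdot>\<^bsub>F0 W i\<^esub> a) \<bullet> ?r)"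
        using c tc1[OF i a b ab] by (simp add: tcomp[OF i a b ab] icomp_comp icomp_assoc)
      finally show "icomp E Y (?t i (b \<cdot>\<^bsub>F0 W i\<^esub> a) \<bullet> ?s) (snd (p i (Cod (F0 W i) (b \<cdot>\<^bsub>F0 W i\<^esub> a)))) =
        icomp E Y (snd (p i (Dom (F0 W i) (b \<cdot>\<^bsub>F0 W i\<^esub> a)))) (?t i (b \<cdot>\<^bsub>F0 W i\<^esub> a) \<bullet> ?r)"
        using a b ab by (simp add: Wi)
    qed
    then show "internal_nat_trans E (F0 D i) Y (p i (Dom (F0 W i) a)) (?t i a) (p i (Cod (F0 W i) a))"
      using arr_of_simps[OF i a] pf[OF i Wi(1)[OF a]] pf[OF i Wi(2)[OF a]] by (intro internal_nat_transI) simp_all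
  next
    fix i x assume "i \<in> Ob J" "x \<in> Obj (F0 W i)"
    then show "?t i (Ide (F0 W i) x) = unt Y \<bullet> fst (p i x)" by (rule tid)
  next
    fix i a b
    assume "i \<in> Ob J" "a \<in> Arr (F0 W i)" "b \<in> Arr (F0 W i)" "Cod (F0 W i) a = Dom (F0 W i) b"
    then show "?t i (b \<cdot>\<^bsub>F0 W i\<^esub> a) = icomp E Y (?t i a) (?t i b)" by (rule tcomp)
  next
    fix i j f x
    assume "i \<in> Ob J" "j \<in> Ob J" "f \<in> Obj (Hom J j i)" "x \<in> Obj (F0 W i)"
    then show "p j (Wo i j f x) = (fst (p i x) \<bullet> fst (F1 D j i f), snd (p i x) \<bullet> snd (F1 D j i f))"
      using R5 precocone_Wo by (simp add: prod_eq_iff)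
  next
    fix i j f a
    assume i: "i \<in> Ob J" and j: "j \<in> Ob J" and f: "f \<in> Obj (Hom J j i)" and a: "a \<in> Arr (F0 W i)"
    note Wi = category_simps[OF W_category[OF i]]
    note Ff = functorD[OF W1_functor(1)[OF i j f]]
    note [simp] = internal_functorD[OF D_functor[OF j i f] D_category[OF j] D_category[OF i]]
    show "?t j (Wa i j f a) = ?t i a \<bullet> fst (F1 D j i f)"
    proof (rule presents_induct[OF W_category[OF i] W_presents[OF i] a])
      fix x
      assume x: "x \<in> Obj (F0 W i)"
      then show "?t j (Wa i j f (Ide (F0 W i) x)) = ?t i (Ide (F0 W i) x) \<bullet> fst (F1 D j i f)"
        using precocone_p[OF i x] by (simp add: Ff(1,5) tid i j precocone_Wo[OF i j f x])
    next
      fix e assume "e \<in> ed i"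
      then show "?t j (Wa i j f (ea i e)) = ?t i (ea i e) \<bullet> fst (F1 D j i f)"
        using R6[OF i j f] i by (simp add: gen)
    next
      fix a b
      assume ab: "a \<in> Arr (F0 W i)" "b \<in> Arr (F0 W i)" "Cod (F0 W i) a = Dom (F0 W i) b"
        and eq: "?t j (Wa i j f a) = ?t i a \<bullet> fst (F1 D j i f)" "?t j (Wa i j f b) = ?t i b \<bullet> fst (F1 D j i f)"
      show "?t j (Wa i j f (b \<cdot>\<^bsub>F0 W i\<^esub> a)) = ?t i (b \<cdot>\<^bsub>F0 W i\<^esub> a) \<bullet> fst (F1 D j i f)"
        using ab eq tc1[OF i ab] arr_of_simps[OF i ab(1)] tcomp[OF i ab] tcomp[OF j Ff(2)[OF ab(1)] Ff(2)[OF ab(2)]] 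
        by (simp add: Ff icomp_comp)
    qed
  next
    fix i j \<alpha> x
    assume i: "i \<in> Ob J" and j: "j \<in> Ob J" and \<alpha>: "\<alpha> \<in> Arr (Hom J j i)" and x: "x \<in> Obj (F0 W i)"
    note Jj = category_simps[OF J_category[OF j i]]
    note p = precocone_p[OF i x]
    note P = internal_functorD[OF pf[OF i x] D_category[OF i] Y]
    show "?t j (W2 i j \<alpha> x) = snd (p i x) \<bullet> D2 j i \<alpha>"
    proof (rule presents_induct[OF J_category[OF j i] J_presents[OF j i] \<alpha>])
      fix f
      assume f: "f \<in> Obj (Hom J j i)"
      show "?t j (W2 i j (Ide (Hom J j i) f) x) = snd (p i x) \<bullet> D2 j i (Ide (Hom J j i) f)"
        using internal_functorD[OF D_functor[OF j i f] D_category[OF j] D_category[OF i]] P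
        by (simp add: W2_simps(3)[OF i j f x] tid[OF j] functorD(1)[OF W1_functor(1)[OF i j f] x] precocone_Wo[OF i j f x]
            D2_simps(3)[OF j i f])
    next
      fix e assume "e \<in> edges (Hom J j i)"
      then show "?t j (W2 i j (edge_arr (Hom J j i) e) x) = snd (p i x) \<bullet> D2 j i (edge_arr (Hom J j i) e)"
        using R7[OF i j _ x] by simp
    next
      fix \<alpha> \<beta>
      assume ab: "\<alpha> \<in> Arr (Hom J j i)" "\<beta> \<in> Arr (Hom J j i)" "Cod (Hom J j i) \<alpha> = Dom (Hom J j i) \<beta>"
        and eq: "?t j (W2 i j \<alpha> x) = snd (p i x) \<bullet> D2 j i \<alpha>" "?t j (W2 i j \<beta> x) = snd (p i x) \<bullet> D2 j i \<beta>"
      note n = internal_nat_transD[OF D2_simps(1)[OF j i ab(1)] D_category[OF j] D_category[OF i]]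
        internal_nat_transD[OF D2_simps(1)[OF j i ab(2)] D_category[OF j] D_category[OF i]]
      have c: "composable (F0 D i) (D2 j i \<alpha>) (D2 j i \<beta>)"
        using n ab(3) by (simp add: composable_def)
      show "?t j (W2 i j (\<beta> \<cdot>\<^bsub>Hom J j i\<^esub> \<alpha>) x) = snd (p i x) \<bullet> D2 j i (\<beta> \<cdot>\<^bsub>Hom J j i\<^esub> \<alpha>)"
        using W2_simps(2)[OF i j ab(1) x] W2_simps(2)[OF i j ab(2) x] P(14)[OF c] eq ab(3)
        by (simp add: W2_simps(4)[OF i j ab x] D2_simps(4)[OF j i ab] tcomp[OF j])
    qed
  qed
qed

end

text \<open>At a fixed index \<open>i\<close>, a cocone yields an ordinary functor on
  \<open>W i\<close>; this is what allows the presentation of \<open>W i\<close> to be used for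
  internal data.\<close>

lemma cocone_functor:
  assumes [simp]: "internal_category E Y" and c: "cocone Y p t" and i: "i \<in> Ob J"
  shows "is_functor (F0 W i) (points Y (X i)) \<lparr>fo = \<lambda>x. fst (p i x), fa = t i\<rparr>"
proof (rule functorI)
  fix x assume "x \<in> Obj (F0 W i)"
  then show "fo \<lparr>fo = \<lambda>x. fst (p i x), fa = t i\<rparr> x \<in> Obj (points Y (X i))"
    using internal_functorD[OF coconeD(1)[OF c i] D_category[OF i]] by simp
next
  fix a assume a: "a \<in> Arr (F0 W i)"
  show "fa \<lparr>fo = \<lambda>x. fst (p i x), fa = t i\<rparr> a \<in> Arr (points Y (X i)) \<and>
         Dom (points Y (X i)) (fa \<lparr>fo = \<lambda>x. fst (p i x), fa = t i\<rparr> a) =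
         fo \<lparr>fo = \<lambda>x. fst (p i x), fa = t i\<rparr> (Dom (F0 W i) a) \<and>
         Cod (points Y (X i)) (fa \<lparr>fo = \<lambda>x. fst (p i x), fa = t i\<rparr> a) =
         fo \<lparr>fo = \<lambda>x. fst (p i x), fa = t i\<rparr> (Cod (F0 W i) a)"
    using internal_nat_transD[OF coconeD(2)[OF c i a] D_category[OF i]] by simp
qed (use coconeD(3,4)[OF c i] in simp_all)

lemma ev_cocone:
  assumes Y: "internal_category E Y" and c: "cocone Y p t" and i: "i \<in> Ob J"
    and w: "gpath (F0 W i) (ed i) (ea i) x w y"
  shows "ev Y p (\<lambda>i e. t i (ea i e)) i x w = t i (peval (F0 W i) (ea i) x w)"
  using functor_peval[OF W_category[OF i] W_category[OF i] is_graph_map_id cocone_functor[OF Y c i] w] ea_Arr[OF i]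
  unfolding ev_def by simp

text \<open>Functors commute with the evaluation of words, so a cocone is determined by its
  generating data.\<close>

lemma arr_of_cocone:
  assumes Y: "internal_category E Y" and c: "cocone Y p t" and i: "i \<in> Ob J" and a: "a \<in> Arr (F0 W i)"
  shows "arr_of Y p (\<lambda>i e. t i (ea i e)) i a = t i a"
  unfolding arr_of_def using ev_cocone[OF Y c i word_gpath(1)[OF W_category[OF i] W_presents[OF i] a]]
    word_gpath(2)[OF W_category[OF i] W_presents[OF i] a] by simp

text \<open>Converse to \<open>cocone_of_precocone\<close>: cocones amount to precocones whose
  relations hold as equations.\<close>

lemma precocone_of_cocone:
  assumes Y [simp]: "internal_category E Y" and c: "cocone Y p t"
  shows "precocone Y p (\<lambda>i e. t i (ea i e))" "\<forall>(r, s) \<in> relations Y p (\<lambda>i e. t i (ea i e)). r = s"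
proof -
  have "graph_morphism E (F0 D i) Y (p i x)" if "i \<in> Ob J" "x \<in> Obj (F0 W i)" for i x
    using coconeD(1)[OF c that] by (auto simp: internal_functor_def split: prod.splits)
  then show pre: "precocone Y p (\<lambda>i e. t i (ea i e))"
    unfolding precocone_def using coconeD(5)[OF c] internal_nat_transD(3-7)[OF coconeD(2)[OF c _ ea_Arr] D_category Y] by simp
  show "\<forall>(r, s) \<in> relations Y p (\<lambda>i e. t i (ea i e)). r = s"
    unfolding relations_all
  proof (intro conjI ballI; clarify?)
    fix i x
    assume i: "i \<in> Ob J" and x: "x \<in> Obj (F0 W i)"
    note F = internal_functorD[OF coconeD(1)[OF c i x] D_category[OF i] Y]
    show "snd (p i x) \<bullet> unt (F0 D i) = unt Y \<bullet> fst (p i x)"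
      by (rule F)
    show "snd (p i x) \<bullet> mul (F0 D i) = icomp E Y (snd (p i x) \<bullet> cp1 E (F0 D i)) (snd (p i x) \<bullet> cp2 E (F0 D i))"
      using F(14)[of "cp1 E (F0 D i)" "cp2 E (F0 D i)"] D_category[OF i] by (simp add: icomp_cp)
  next
    fix i e
    assume i: "i \<in> Ob J" and e: "e \<in> ed i"
    note n = internal_nat_transD[OF coconeD(2)[OF c i ea_Arr[OF i e]] D_category[OF i] Y]
    show "icomp E Y (t i (ea i e) \<bullet> src (F0 D i)) (snd (p i (Cod (F0 W i) (ea i e)))) =
        icomp E Y (snd (p i (Dom (F0 W i) (ea i e)))) (t i (ea i e) \<bullet> tgt (F0 D i))"
      using n(10)[of "Ide E (mor (F0 D i))"] D_category[OF i]
        internal_functorD(2,5)[OF n(1) D_category[OF i] Y] internal_functorD(2,5)[OF n(2) D_category[OF i] Y] by simp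
  next
    fix i a u v b
    assume i: "i \<in> Ob J" and r: "(a, u, v, b) \<in> rels (F0 W i)"
    show "ev Y p (\<lambda>i e. t i (ea i e)) i a u = ev Y p (\<lambda>i e. t i (ea i e)) i a v"
      using ev_cocone[OF Y c i] rels_gpath[OF i r] by simp
  next
    fix i j f x
    assume i: "i \<in> Ob J" and j: "j \<in> Ob J" and f: "f \<in> Obj (Hom J j i)" and x: "x \<in> Obj (F0 W i)"
    show "snd (p j (Wo i j f x)) = snd (p i x) \<bullet> snd (F1 D j i f)"
      using coconeD(5)[OF c i j f x] by simp
  next
    fix i j f e
    assume i: "i \<in> Ob J" and j: "j \<in> Ob J" and f: "f \<in> Obj (Hom J j i)" and e: "e \<in> ed i"
    show "arr_of Y p (\<lambda>i e. t i (ea i e)) j (Wa i j f (ea i e)) = t i (ea i e) \<bullet> fst (F1 D j i f)"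
      using coconeD(6)[OF c i j f ea_Arr[OF i e]] arr_of_cocone[OF Y c j] functorD(2)[OF W1_functor(1)[OF i j f] ea_Arr[OF i e]]
      by simp
  next
    fix i j e x
    assume i: "i \<in> Ob J" and j: "j \<in> Ob J" and e: "e \<in> edges (Hom J j i)" and x: "x \<in> Obj (F0 W i)"
    note \<alpha> = presents_arr[OF J_category[OF j i] J_presents[OF j i] e]
    show "arr_of Y p (\<lambda>i e. t i (ea i e)) j (W2 i j (edge_arr (Hom J j i) e) x) = snd (p i x) \<bullet> D2 j i (edge_arr (Hom J j i) e)"
      using coconeD(7)[OF c i j \<alpha> x] arr_of_cocone[OF Y c j] W2_simps(2)[OF i j \<alpha> x] by simp
  qed
qed

end

section \<open>The universal cocone\<close>

context weighted_diagram
begin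

definition push :: "'a \<times> 'a \<Rightarrow> ('i \<Rightarrow> 'w \<Rightarrow> 'a \<times> 'a) \<Rightarrow> 'i \<Rightarrow> 'w \<Rightarrow> 'a \<times> 'a" where
  "push H p i x = (fst H \<bullet> fst (p i x), snd H \<bullet> snd (p i x))"

lemma push_simps [simp]: "fst (push H p i x) = fst H \<bullet> fst (p i x)" "snd (push H p i x) = snd H \<bullet> snd (p i x)"
  by (simp_all add: push_def)

context
  fixes Y Z :: "('o, 'a) icat" and p :: "'i \<Rightarrow> 'w \<Rightarrow> 'a \<times> 'a" and g :: "'i \<Rightarrow> nat \<Rightarrow> 'a" and H :: "'a \<times> 'a"
  assumes Y [simp]: "internal_category E Y" and Z [simp]: "internal_category E Z" and pre: "precocone Y p g"
    and H: "internal_functor E Y Z H"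
begin

lemma precocone_push: "precocone Z (push H p) (\<lambda>i e. snd H \<bullet> g i e)"
  unfolding precocone_def
proof (intro conjI ballI)
  note [simp] = internal_functorD[OF H Y Z]
  fix i x
  assume i: "i \<in> Ob J" and x: "x \<in> Obj (F0 W i)"
  show "graph_morphism E (F0 D i) Z (push H p i x)"
    using precocone_p[OF Y pre i x] D_category[OF i] by (simp add: graph_morphism_def push_def)
  fix j f
  assume j: "j \<in> Ob J" and f: "f \<in> Obj (Hom J j i)"
  show "fst (push H p j (Wo i j f x)) = fst (push H p i x) \<bullet> fst (F1 D j i f)"
    using precocone_Wo[OF Y pre i j f x] precocone_p[OF Y pre i x] 
      internal_functorD[OF D_functor[OF j i f] D_category[OF j] D_category[OF i]] by simp
next
  note [simp] = internal_functorD[OF H Y Z]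
  fix i e
  assume i: "i \<in> Ob J" and e: "e \<in> ed i"
  note [simp] = precocone_g[OF Y pre i e]
  show "snd H \<bullet> g i e \<in> hom E (X i) (mor Z)"
    "src Z \<bullet> snd H \<bullet> g i e = fst (push H p i (Dom (F0 W i) (ea i e)))"
    "tgt Z \<bullet> snd H \<bullet> g i e = fst (push H p i (Cod (F0 W i) (ea i e)))"
    by simp_all
qed

lemma ev_push:
  assumes i: "i \<in> Ob J" and w: "gpath (F0 W i) (ed i) (ea i) x w y"
  shows "ev Z (push H p) (\<lambda>i e. snd H \<bullet> g i e) i x w = snd H \<bullet> ev Y p g i x w"
  using functor_peval[OF W_category[OF i] category_points[OF Y] precocone_graph_map[OF Y pre i] functor_points[OF H Y Z] w]
  unfolding ev_def by simp

lemma arr_of_push: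
  assumes i: "i \<in> Ob J" and a: "a \<in> Arr (F0 W i)"
  shows "arr_of Z (push H p) (\<lambda>i e. snd H \<bullet> g i e) i a = snd H \<bullet> arr_of Y p g i a"
  unfolding arr_of_def by (rule ev_push[OF i word_gpath(1)[OF W_category[OF i] W_presents[OF i] a]])

text \<open>Both sides of every relation are built from the data by composition and units, so
  \<open>H\<close> takes them to the same expressions in the pushed data. Hence functors out of the
  quotient of \<open>Y\<close> by these relations are the functors out of \<open>Y\<close> that turn
  the data into a cocone.\<close>

lemma identifies_relations:
  "identifies H (relations Y p g) \<longleftrightarrow> (\<forall>(r, s) \<in> relations Z (push H p) (\<lambda>i e. snd H \<bullet> g i e). r = s)"
  unfolding identifies_def relations_all
proof (intro arg_cong2[where f="(\<and>)"] ball_cong refl)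
  note HD [simp] = internal_functorD[OF H Y Z]
  {
    fix i x
    assume i: "i \<in> Ob J" and x: "x \<in> Obj (F0 W i)"
    note [simp] = precocone_p[OF Y pre i x] D_category[OF i]
    show "(snd H \<bullet> snd (p i x) \<bullet> unt (F0 D i) = snd H \<bullet> unt Y \<bullet> fst (p i x)) \<longleftrightarrow>
        (snd (push H p i x) \<bullet> unt (F0 D i) = unt Z \<bullet> fst (push H p i x))"
      by simp
    have "composable Y (snd (p i x) \<bullet> cp1 E (F0 D i)) (snd (p i x) \<bullet> cp2 E (F0 D i))"
      by (simp add: composable_def)
    then show "(snd H \<bullet> snd (p i x) \<bullet> mul (F0 D i) = snd H \<bullet> icomp E Y (snd (p i x) \<bullet> cp1 E (F0 D i)) (snd (p i x) \<bullet> cp2 E (F0 D i))) \<longleftrightarrow>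
        (snd (push H p i x) \<bullet> mul (F0 D i) = icomp E Z (snd (push H p i x) \<bullet> cp1 E (F0 D i)) (snd (push H p i x) \<bullet> cp2 E (F0 D i)))"
      by simp
  next
    fix i e
    assume i: "i \<in> Ob J" and e: "e \<in> ed i"
    note [simp] = precocone_p[OF Y pre i ea_Dom_Cod(1)[OF i e]] precocone_p[OF Y pre i ea_Dom_Cod(2)[OF i e]]
      precocone_g[OF Y pre i e] D_category[OF i]
    let ?x = "g i e \<bullet> src (F0 D i)" and ?y = "snd (p i (Cod (F0 W i) (ea i e)))"
      and ?z = "snd (p i (Dom (F0 W i) (ea i e)))" and ?w = "g i e \<bullet> tgt (F0 D i)"
    have "composable Y ?x ?y" "composable Y ?z ?w"
      by (simp_all add: composable_def)
    then show "(snd H \<bullet> icomp E Y ?x ?y = snd H \<bullet> icomp E Y ?z ?w) \<longleftrightarrow>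
        (icomp E Z ((snd H \<bullet> g i e) \<bullet> src (F0 D i)) (snd (push H p i (Cod (F0 W i) (ea i e)))) =
         icomp E Z (snd (push H p i (Dom (F0 W i) (ea i e)))) ((snd H \<bullet> g i e) \<bullet> tgt (F0 D i)))"
      by simp
  next
    fix i x
    assume i: "i \<in> Ob J" and x: "x \<in> rels (F0 W i)"
    show "(case x of (a, u, v, b) \<Rightarrow> snd H \<bullet> ev Y p g i a u = snd H \<bullet> ev Y p g i a v) \<longleftrightarrow>
        (case x of (a, u, v, b) \<Rightarrow> ev Z (push H p) (\<lambda>i e. snd H \<bullet> g i e) i a u = ev Z (push H p) (\<lambda>i e. snd H \<bullet> g i e) i a v)"
    proof -
      obtain a u v b where [simp]: "x = (a, u, v, b)" by (cases x)
      show ?thesis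
        using ev_push[OF i rels_gpath(1)[OF i]] ev_push[OF i rels_gpath(2)[OF i]] x by simp
    qed
  next
    fix i j f x
    assume i: "i \<in> Ob J" and j: "j \<in> Ob J" and f: "f \<in> Obj (Hom J j i)" and x: "x \<in> Obj (F0 W i)"
    show "(snd H \<bullet> snd (p j (Wo i j f x)) = snd H \<bullet> snd (p i x) \<bullet> snd (F1 D j i f)) \<longleftrightarrow>
        (snd (push H p j (Wo i j f x)) = snd (push H p i x) \<bullet> snd (F1 D j i f))"
      using precocone_p[OF Y pre i x] internal_functorD[OF D_functor[OF j i f] D_category[OF j] D_category[OF i]] by simp
  next
    fix i j f e
    assume i: "i \<in> Ob J" and j: "j \<in> Ob J" and f: "f \<in> Obj (Hom J j i)" and e: "e \<in> ed i"
    show "(snd H \<bullet> arr_of Y p g j (Wa i j f (ea i e)) = snd H \<bullet> g i e \<bullet> fst (F1 D j i f)) \<longleftrightarrow>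
        (arr_of Z (push H p) (\<lambda>i e. snd H \<bullet> g i e) j (Wa i j f (ea i e)) = (snd H \<bullet> g i e) \<bullet> fst (F1 D j i f))"
      using precocone_g[OF Y pre i e] internal_functorD[OF D_functor[OF j i f] D_category[OF j] D_category[OF i]]
        arr_of_push[OF j functorD(2)[OF W1_functor(1)[OF i j f] ea_Arr[OF i e]]] by simp
  next
    fix i j e x
    assume i: "i \<in> Ob J" and j: "j \<in> Ob J" and e: "e \<in> edges (Hom J j i)" and x: "x \<in> Obj (F0 W i)"
    note \<alpha> = presents_arr[OF J_category[OF j i] J_presents[OF j i] e]
    show "(snd H \<bullet> arr_of Y p g j (W2 i j (edge_arr (Hom J j i) e) x) = snd H \<bullet> snd (p i x) \<bullet> D2 j i (edge_arr (Hom J j i) e)) \<longleftrightarrow>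
        (arr_of Z (push H p) (\<lambda>i e. snd H \<bullet> g i e) j (W2 i j (edge_arr (Hom J j i) e) x) =
         snd (push H p i x) \<bullet> D2 j i (edge_arr (Hom J j i) e))"
      using precocone_p[OF Y pre i x] arr_of_push[OF j conjunct1[OF W2_simps(2)[OF i j \<alpha> x]]]
        internal_nat_transD(3-5)[OF D2_simps(1)[OF j i \<alpha>] D_category[OF j] D_category[OF i]] by simp
  }
qed

end

context
  fixes Y :: "('o, 'a) icat" and p p' :: "'i \<Rightarrow> 'w \<Rightarrow> 'a \<times> 'a" and g g' :: "'i \<Rightarrow> nat \<Rightarrow> 'a"
  assumes p: "\<And>i x. i \<in> Ob J \<Longrightarrow> x \<in> Obj (F0 W i) \<Longrightarrow> p i x = p' i x"
    and g: "\<And>i e. i \<in> Ob J \<Longrightarrow> e \<in> ed i \<Longrightarrow> g i e = g' i e"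
begin

lemma ev_cong:
  assumes i: "i \<in> Ob J" and w: "gpath (F0 W i) (ed i) (ea i) x w y"
  shows "ev Y p g i x w = ev Y p' g' i x w"
proof -
  have x: "x \<in> Obj (F0 W i)"
    using gpath_Obj[OF W_category[OF i] is_graph_map_id w] ea_Arr[OF i] by blast
  have "peval (points Y (X i)) (g i) a w = peval (points Y (X i)) (g' i) a w" for a
    by (rule peval_cong) (use gpath_edges[OF w] g[OF i] in auto)
  then show ?thesis
    unfolding ev_def p[OF i x] .
qed

lemma arr_of_cong: "i \<in> Ob J \<Longrightarrow> a \<in> Arr (F0 W i) \<Longrightarrow> arr_of Y p g i a = arr_of Y p' g' i a"
  unfolding arr_of_def by (rule ev_cong[OF _ word_gpath(1)[OF W_category W_presents]])

text \<open>\<open>p\<close> and \<open>g\<close> are total functions, but universal properties fix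
  them only at objects and generators of the weight. The relations read no other values, so data
  that agree there have the same relations.\<close>

lemma relations_cong: "relations Y p g = relations Y p' g'"
  unfolding relations_def
  using p g ea_Dom_Cod ev_cong[OF _ rels_gpath(1)] ev_cong[OF _ rels_gpath(2)] functorD(1)[OF W1_functor(1)]
    arr_of_cong[OF _ functorD(2)[OF W1_functor(1) ea_Arr]]
    arr_of_cong[OF _ conjunct1[OF W2_simps(2)[OF _ _ presents_arr[OF J_category J_presents]]]]
  by (intro arg_cong2[where f="(\<union>)"] image_cong refl) (auto simp: split_beta)

end

text \<open>The classifying graph has as objects the coproduct of a copy of \<open>X i\<close> for
  each object of \<open>W i\<close>, with 2-naturality imposed. Its arrows are the coproduct of a
  copy of \<open>mor (F0 D i)\<close> for each object and a copy of \<open>X i\<close> for each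
  generator. Graph morphisms out of it are precocones, and freeness turns them into
  functors.\<close>

lemma free_precocone_exists:
  assumes copr: "has_finite_coproducts E"
    and adj: "has_left_adjoint (underlying_cat (Cat E)) (Gph E) forgetful"
  obtains C p g where "internal_category E C" "precocone C p g"
    "\<And>Y p' g'. internal_category E Y \<Longrightarrow> precocone Y p' g' \<Longrightarrow>
       \<exists>!H. internal_functor E C Y H \<and> (\<forall>i \<in> Ob J. \<forall>x \<in> Obj (F0 W i). push H p i x = p' i x) \<and>
         (\<forall>i \<in> Ob J. \<forall>e \<in> ed i. snd H \<bullet> g i e = g' i e)"
proof -
  define V where "V = (SIGMA i:Ob J. Obj (F0 W i))"
  define Ed where "Ed = (SIGMA i:Ob J. ed i)"
  have V [simp]: "(i, x) \<in> V \<longleftrightarrow> i \<in> Ob J \<and> x \<in> Obj (F0 W i)" for i x by (simp add: V_def)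
  have Ed [simp]: "(i, e) \<in> Ed \<longleftrightarrow> i \<in> Ob J \<and> e \<in> ed i" for i e by (simp add: Ed_def)
  have fin: "finite V" "finite Ed"
    using J_finite W_presentable finite_presentation(1)[OF W_presentable]
    unfolding V_def Ed_def by (auto simp: finitely_presentable_def)
  note DC = D_category
  obtain A \<iota> where A: "is_coproduct E V (\<lambda>(i, x). X i) A \<iota>"
    by (rule finite_coproduct_exists[OF copr fin(1), of "\<lambda>(i, x). X i"]) (use DC in auto)
  have \<iota>: "\<iota> (i, x) \<in> Arr E" "Dom E (\<iota> (i, x)) = X i" "Cod E (\<iota> (i, x)) = A" if "i \<in> Ob J" "x \<in> Obj (F0 W i)" for i x
    using is_coproductD(2-4)[OF A, of "(i, x)"] that by auto
  \<comment> \<open>2-naturality on objects. The pairs have domains \<open>X j\<close> with varying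
    \<open>j\<close>, so a joint coequaliser is needed.\<close>
  define S where "S = (\<lambda>(i, j, f, x). (\<iota> (j, Wo i j f x), \<iota> (i, x) \<bullet> fst (F1 D j i f))) `
        (SIGMA i:Ob J. SIGMA j:Ob J. Obj (Hom J j i) \<times> Obj (F0 W i))"
  have finS: "finite S"
    using J_finite W_presentable J_presentable unfolding S_def
    by (auto simp: finitely_presentable_def intro!: finite_imageI finite_SigmaI)
  have Dfun: "fst (F1 D j i f) \<in> Arr E" "Dom E (fst (F1 D j i f)) = X j" "Cod E (fst (F1 D j i f)) = X i"
    if "i \<in> Ob J" "j \<in> Ob J" "f \<in> Obj (Hom J j i)" for i j f
    using internal_functorD[OF D_functor[OF that(2,1,3)] DC[OF that(2)] DC[OF that(1)]] by simp_all
  have Wobj: "Wo i j f x \<in> Obj (F0 W j)"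
    if "i \<in> Ob J" "j \<in> Ob J" "f \<in> Obj (Hom J j i)" "x \<in> Obj (F0 W i)" for i j f x
    using functorD(1)[OF W1_functor(1)[OF that(1-3)] that(4)] .
  have Suv: "u \<in> Arr E \<and> v \<in> Arr E \<and> Dom E u = Dom E v \<and> Cod E u = A \<and> Cod E v = A" if "(u, v) \<in> S" for u v
    using that Dfun Wobj \<iota> unfolding S_def by auto
  have coeqs: "has_coequalisers E"
    using stable unfolding has_pullback_stable_coequalisers_def by (rule conjunct1)
  obtain q where q: "is_epi E q" "Dom E q = A" "\<And>u v. (u, v) \<in> S \<Longrightarrow> q \<bullet> u = q \<bullet> v"
    "\<And>k. k \<in> Arr E \<Longrightarrow> Dom E k = A \<Longrightarrow> (\<And>u v. (u, v) \<in> S \<Longrightarrow> k \<bullet> u = k \<bullet> v) \<Longrightarrow>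
       \<exists>h \<in> hom E (Cod E q) (Cod E k). h \<bullet> q = k"
    by (rule joint_coequaliser_exists[OF cat coeqs is_coproductD(1)[OF A] finS Suv]; (assumption | (rule that; blast)))
  have [simp]: "q \<in> Arr E" "Dom E q = A"
    using q(1,2) by (auto simp: is_epi_def)
  define \<phi> where "\<phi> i x = q \<bullet> \<iota> (i, x)" for i x
  have \<phi>: "\<phi> i x \<in> Arr E" "Dom E (\<phi> i x) = X i" "Cod E (\<phi> i x) = Cod E q" if "i \<in> Ob J" "x \<in> Obj (F0 W i)" for i x
    using that \<iota> by (simp_all add: \<phi>_def)
  have \<phi>_Wo: "\<phi> j (Wo i j f x) = \<phi> i x \<bullet> fst (F1 D j i f)"
    if "i \<in> Ob J" "j \<in> Ob J" "f \<in> Obj (Hom J j i)" "x \<in> Obj (F0 W i)" for i j f x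
  proof -
    have "(\<iota> (j, Wo i j f x), \<iota> (i, x) \<bullet> fst (F1 D j i f)) \<in> S"
      unfolding S_def by (rule image_eqI[of _ _ "(i, j, f, x)"]) (use that in auto)
    then show ?thesis
      using q(3) \<iota>[OF that(1,4)] Dfun[OF that(1-3)] by (simp add: \<phi>_def)
  qed
  have [simp]: "Inl k \<in> V <+> Ed \<longleftrightarrow> k \<in> V" "Inr l \<in> V <+> Ed \<longleftrightarrow> l \<in> Ed" for k l
    by auto
  \<comment> \<open>The left summands carry the arrow parts of the \<open>p i x\<close>. On the
    right, a component \<open>g i e\<close> is an arrow from \<open>X i\<close> to
    \<open>mor Y\<close>, so \<open>X i\<close> itself becomes a summand of the object of
    arrows.\<close>
  define B where "B = case_sum (\<lambda>(i, x :: 'w). mor (F0 D i)) (\<lambda>(i, e :: nat). X i)"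
  have Bobj: "k \<in> V <+> Ed \<Longrightarrow> B k \<in> Obj E" for k
    using DC by (auto simp: B_def)
  obtain M \<kappa> where M: "is_coproduct E (V <+> Ed) B M \<kappa>"
    by (rule finite_coproduct_exists[OF copr finite_Plus[OF fin], of B]) (use Bobj in blast)+
  have \<kappa>l: "\<kappa> (Inl (i, x)) \<in> Arr E" "Dom E (\<kappa> (Inl (i, x))) = mor (F0 D i)" "Cod E (\<kappa> (Inl (i, x))) = M"
    if "i \<in> Ob J" "x \<in> Obj (F0 W i)" for i x
    using is_coproductD(2-4)[OF M, of "Inl (i, x)"] that by (auto simp: B_def)
  have \<kappa>r: "\<kappa> (Inr (i, e)) \<in> Arr E" "Dom E (\<kappa> (Inr (i, e))) = X i" "Cod E (\<kappa> (Inr (i, e))) = M"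
    if "i \<in> Ob J" "e \<in> ed i" for i e
    using is_coproductD(2-4)[OF M, of "Inr (i, e)"] that by (auto simp: B_def)
  have M_factor: "\<exists>h \<in> hom E M Z. (\<forall>i \<in> Ob J. \<forall>x \<in> Obj (F0 W i). h \<bullet> \<kappa> (Inl (i, x)) = a i x) \<and>
      (\<forall>i \<in> Ob J. \<forall>e \<in> ed i. h \<bullet> \<kappa> (Inr (i, e)) = b i e)"
    if "Z \<in> Obj E" "\<And>i x. i \<in> Ob J \<Longrightarrow> x \<in> Obj (F0 W i) \<Longrightarrow> a i x \<in> hom E (mor (F0 D i)) Z"
      "\<And>i e. i \<in> Ob J \<Longrightarrow> e \<in> ed i \<Longrightarrow> b i e \<in> hom E (X i) Z" for Z a b
  proof -
    have "k \<in> V <+> Ed \<Longrightarrow> case_sum (\<lambda>(i, x). a i x) (\<lambda>(i, e). b i e) k \<in> hom E (B k) Z" for k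
      using that(2,3) by (auto simp: B_def)
    from coproduct_factor[OF M that(1) this]
    obtain h where "h \<in> Arr E" "Dom E h = M" "Cod E h = Z"
      "\<And>k. k \<in> V <+> Ed \<Longrightarrow> h \<bullet> \<kappa> k = case_sum (\<lambda>(i, x). a i x) (\<lambda>(i, e). b i e) k"
      by blast
    then show ?thesis
      by (intro bexI[of _ h]) auto
  qed
  have M_eqI: "h = k"
    if "h \<in> Arr E" "k \<in> Arr E" "Dom E h = M" "Dom E k = M" "Cod E h = Cod E k"
      "\<And>i x. i \<in> Ob J \<Longrightarrow> x \<in> Obj (F0 W i) \<Longrightarrow> h \<bullet> \<kappa> (Inl (i, x)) = k \<bullet> \<kappa> (Inl (i, x))"
      "\<And>i e. i \<in> Ob J \<Longrightarrow> e \<in> ed i \<Longrightarrow> h \<bullet> \<kappa> (Inr (i, e)) = k \<bullet> \<kappa> (Inr (i, e))" for h k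
    by (rule coproduct_eqI[OF cat M that(1-5)]) (use that(6,7) in auto)
  have G0 [simp]: "Cod E q \<in> Obj E" "M \<in> Obj E"
    using is_coproductD(1)[OF M] by simp_all
  obtain s where s: "s \<in> Arr E" "Dom E s = M" "Cod E s = Cod E q"
    "\<And>i x. i \<in> Ob J \<Longrightarrow> x \<in> Obj (F0 W i) \<Longrightarrow> s \<bullet> \<kappa> (Inl (i, x)) = \<phi> i x \<bullet> src (F0 D i)"
    "\<And>i e. i \<in> Ob J \<Longrightarrow> e \<in> ed i \<Longrightarrow> s \<bullet> \<kappa> (Inr (i, e)) = \<phi> i (Dom (F0 W i) (ea i e))"
    using M_factor[of "Cod E q" "\<lambda>i x. \<phi> i x \<bullet> src (F0 D i)" "\<lambda>i e. \<phi> i (Dom (F0 W i) (ea i e))"]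
      \<phi> DC ea_Dom_Cod by auto
  obtain t where t: "t \<in> Arr E" "Dom E t = M" "Cod E t = Cod E q"
    "\<And>i x. i \<in> Ob J \<Longrightarrow> x \<in> Obj (F0 W i) \<Longrightarrow> t \<bullet> \<kappa> (Inl (i, x)) = \<phi> i x \<bullet> tgt (F0 D i)"
    "\<And>i e. i \<in> Ob J \<Longrightarrow> e \<in> ed i \<Longrightarrow> t \<bullet> \<kappa> (Inr (i, e)) = \<phi> i (Cod (F0 W i) (ea i e))"
    using M_factor[of "Cod E q" "\<lambda>i x. \<phi> i x \<bullet> tgt (F0 D i)" "\<lambda>i e. \<phi> i (Cod (F0 W i) (ea i e))"]
      \<phi> DC ea_Dom_Cod by auto
  define G where "G = \<lparr>ob = Cod E q, mor = M, src = s, tgt = t\<rparr>"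
  have G: "internal_graph E G"
    unfolding internal_graph_def using s t by (simp add: G_def)
  obtain C \<eta> where C [simp]: "internal_category E C" and \<eta>: "graph_morphism E G (igraph.truncate C) \<eta>"
    and univ: "\<And>Y g. internal_category E Y \<Longrightarrow> graph_morphism E G (igraph.truncate Y) g \<Longrightarrow>
       \<exists>!H. internal_functor E C Y H \<and> fst H \<bullet> fst \<eta> = fst g \<and> snd H \<bullet> snd \<eta> = snd g"
    by (rule free_category_exists[OF adj G]) (rule that; assumption)
  have \<eta>' [simp]: "fst \<eta> \<in> Arr E" "snd \<eta> \<in> Arr E" "Dom E (fst \<eta>) = Cod E q" "Dom E (snd \<eta>) = M" "Cod E (fst \<eta>) = ob C"
    "Cod E (snd \<eta>) = mor C" and \<eta>s: "src C \<bullet> snd \<eta> = fst \<eta> \<bullet> s" "tgt C \<bullet> snd \<eta> = fst \<eta> \<bullet> t"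
    using \<eta> by (auto simp: graph_morphism_def G_def split: prod.splits)
  define p where "p i x = (fst \<eta> \<bullet> \<phi> i x, snd \<eta> \<bullet> \<kappa> (Inl (i, x)))" for i x
  define g where "g i e = snd \<eta> \<bullet> \<kappa> (Inr (i, e))" for i e
  have "precocone C p g"
    unfolding precocone_def
  proof (intro conjI ballI)
    fix i x
    assume ix: "i \<in> Ob J" "x \<in> Obj (F0 W i)"
    note [simp] = \<kappa>l[OF ix] \<phi>[OF ix] s(1-4) t(1-4) D_category[OF ix(1)] ix
    show "graph_morphism E (F0 D i) C (p i x)"
      using reassoc[OF \<eta>s(1), of "\<kappa> (Inl (i, x))"] reassoc[OF \<eta>s(2), of "\<kappa> (Inl (i, x))"]
      by (simp add: graph_morphism_def p_def)
    fix j f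
    assume jf: "j \<in> Ob J" "f \<in> Obj (Hom J j i)"
    show "fst (p j (Wo i j f x)) = fst (p i x) \<bullet> fst (F1 D j i f)"
      using \<phi>_Wo[OF ix(1) jf ix(2)] Dfun[OF ix(1) jf] by (simp add: p_def)
  next
    fix i e
    assume ie: "i \<in> Ob J" "e \<in> ed i"
    note [simp] = \<kappa>r[OF ie] s(1-3,5) t(1-3,5) ie
    show "g i e \<in> hom E (X i) (mor C)" "src C \<bullet> g i e = fst (p i (Dom (F0 W i) (ea i e)))"
      "tgt C \<bullet> g i e = fst (p i (Cod (F0 W i) (ea i e)))"
      using reassoc[OF \<eta>s(1), of "\<kappa> (Inr (i, e))"] reassoc[OF \<eta>s(2), of "\<kappa> (Inr (i, e))"]
      by (simp_all add: g_def p_def)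
  qed
  moreover have "\<exists>!H. internal_functor E C Y H \<and> (\<forall>i \<in> Ob J. \<forall>x \<in> Obj (F0 W i). push H p i x = p' i x) \<and>
         (\<forall>i \<in> Ob J. \<forall>e \<in> ed i. snd H \<bullet> g i e = g' i e)"
    if Y [simp]: "internal_category E Y" and pre: "precocone Y p' g'" for Y p' g'
  proof -
    note P = precocone_p[OF Y pre] and Gg = precocone_g[OF Y pre]
    have "k \<in> V \<Longrightarrow> (\<lambda>(i, x). fst (p' i x)) k \<in> hom E ((\<lambda>(i, x). X i) k) (ob Y)" for k
      using P(1,3,4) by (cases k) simp
    from coproduct_factor[OF A internal_category_simps(1)[OF Y] this]
    obtain k where k: "k \<in> Arr E" "Dom E k = A" "Cod E k = ob Y" and
      "\<And>ix. ix \<in> V \<Longrightarrow> k \<bullet> \<iota> ix = (\<lambda>(i, x). fst (p' i x)) ix"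
      by blast
    then have k\<iota>: "k \<bullet> \<iota> (i, x) = fst (p' i x)" if "i \<in> Ob J" "x \<in> Obj (F0 W i)" for i x
      using that by auto
    have "k \<bullet> u = k \<bullet> v" if "(u, v) \<in> S" for u v
    proof -
      obtain i j f x where *: "i \<in> Ob J" "j \<in> Ob J" "f \<in> Obj (Hom J j i)" "x \<in> Obj (F0 W i)"
        "u = \<iota> (j, Wo i j f x)" "v = \<iota> (i, x) \<bullet> fst (F1 D j i f)"
        using \<open>(u, v) \<in> S\<close> unfolding S_def by auto
      show ?thesis
        unfolding *(5,6) using k \<iota>[OF *(1,4)] Dfun[OF *(1-3)] k\<iota>[OF *(2) Wobj[OF *(1-4)]]
          reassoc[OF k\<iota>[OF *(1,4)], of "fst (F1 D j i f)"] precocone_Wo[OF Y pre *(1-4)] by simp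
    qed
    from q(4)[OF k(1,2) this]
    obtain h0 where h0: "h0 \<in> Arr E" "Dom E h0 = Cod E q" "Cod E h0 = ob Y" "h0 \<bullet> q = k"
      using k(3) by auto
    have h0\<phi>: "h0 \<bullet> \<phi> i x = fst (p' i x)" if "i \<in> Ob J" "x \<in> Obj (F0 W i)" for i x
      using reassoc[OF h0(4), of "\<iota> (i, x)"] that k\<iota> h0 \<iota> by (simp add: \<phi>_def)
    obtain h1 where h1: "h1 \<in> Arr E" "Dom E h1 = M" "Cod E h1 = mor Y"
      "\<And>i x. i \<in> Ob J \<Longrightarrow> x \<in> Obj (F0 W i) \<Longrightarrow> h1 \<bullet> \<kappa> (Inl (i, x)) = snd (p' i x)"
      "\<And>i e. i \<in> Ob J \<Longrightarrow> e \<in> ed i \<Longrightarrow> h1 \<bullet> \<kappa> (Inr (i, e)) = g' i e"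
      using M_factor[of "mor Y" "\<lambda>i x. snd (p' i x)" g'] P Gg by auto
    have h0\<phi>z: "h0 \<bullet> \<phi> i x \<bullet> z = fst (p' i x) \<bullet> z"
      if "i \<in> Ob J" "x \<in> Obj (F0 W i)" "z \<in> Arr E" "Cod E z = X i" for i x z
      using reassoc[OF h0\<phi>[OF that(1,2)], of z] that h0 \<phi> by simp
    have "src Y \<bullet> h1 = h0 \<bullet> s"
      by (rule M_eqI) (use h0 h1 s P Gg h0\<phi> h0\<phi>z \<phi> \<kappa>l \<kappa>r DC ea_Dom_Cod in simp_all)
    moreover have "tgt Y \<bullet> h1 = h0 \<bullet> t"
      by (rule M_eqI) (use h0 h1 t P Gg h0\<phi> h0\<phi>z \<phi> \<kappa>l \<kappa>r DC ea_Dom_Cod in simp_all)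
    ultimately have gm: "graph_morphism E G (igraph.truncate Y) (h0, h1)"
      using h0 h1 by (simp add: graph_morphism_def G_def)
    obtain H where H: "internal_functor E C Y H" "fst H \<bullet> fst \<eta> = h0" "snd H \<bullet> snd \<eta> = h1"
      using ex1_implies_ex[OF univ[OF Y gm]] by auto
    have Hu: "K = H" if "internal_functor E C Y K" "fst K \<bullet> fst \<eta> = h0" "snd K \<bullet> snd \<eta> = h1" for K
      by (rule ex1_unique[OF univ[OF Y gm]]) (use that H in simp_all)
    note HD = internal_functorD[OF H(1) C Y]
    show ?thesis
    proof (rule ex1I[of _ H])
      have "push H p i x = p' i x" if ix: "i \<in> Ob J" "x \<in> Obj (F0 W i)" for i x
        using reassoc[OF H(2), of "\<phi> i x"] reassoc[OF H(3), of "\<kappa> (Inl (i, x))"] HD(1-6) \<phi>[OF ix] \<kappa>l[OF ix] h0\<phi>[OF ix] h1(4)[OF ix]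
        by (simp add: prod_eq_iff p_def)
      moreover have "snd H \<bullet> g i e = g' i e" if ie: "i \<in> Ob J" "e \<in> ed i" for i e
        using reassoc[OF H(3), of "\<kappa> (Inr (i, e))"] HD(1-6) \<kappa>r[OF ie] h1(5)[OF ie] by (simp add: g_def)
      ultimately show "internal_functor E C Y H \<and> (\<forall>i \<in> Ob J. \<forall>x \<in> Obj (F0 W i). push H p i x = p' i x) \<and>
         (\<forall>i \<in> Ob J. \<forall>e \<in> ed i. snd H \<bullet> g i e = g' i e)"
        using H by blast
    next
      fix K
      assume K: "internal_functor E C Y K \<and> (\<forall>i \<in> Ob J. \<forall>x \<in> Obj (F0 W i). push K p i x = p' i x) \<and>
         (\<forall>i \<in> Ob J. \<forall>e \<in> ed i. snd K \<bullet> g i e = g' i e)"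
      note KD = internal_functorD[OF conjunct1[OF K] C Y]
      have Kp: "fst K \<bullet> fst \<eta> \<bullet> \<phi> i x = fst (p' i x)" "snd K \<bullet> snd \<eta> \<bullet> \<kappa> (Inl (i, x)) = snd (p' i x)"
        if "i \<in> Ob J" "x \<in> Obj (F0 W i)" for i x
      proof -
        have "push K p i x = p' i x" using K that by blast
        then show "fst K \<bullet> fst \<eta> \<bullet> \<phi> i x = fst (p' i x)" "snd K \<bullet> snd \<eta> \<bullet> \<kappa> (Inl (i, x)) = snd (p' i x)"
          by (auto simp: p_def prod_eq_iff)
      qed
      have Kg: "snd K \<bullet> snd \<eta> \<bullet> \<kappa> (Inr (i, e)) = g' i e" if "i \<in> Ob J" "e \<in> ed i" for i e
        using K that by (simp add: g_def)
      \<comment> \<open>Uniqueness on objects is tested on the summands of \<open>A\<close> and then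
        passed through the epimorphism \<open>q\<close>.\<close>
      have K\<iota>: "((fst K \<bullet> fst \<eta>) \<bullet> q) \<bullet> \<iota> ix = k \<bullet> \<iota> ix" if "ix \<in> V" for ix
        using that Kp(1) KD(1-6) \<iota> k\<iota> by (cases ix) (simp add: \<phi>_def)
      have "(fst K \<bullet> fst \<eta>) \<bullet> q = h0 \<bullet> q"
        unfolding h0(4) by (rule coproduct_eqI[OF cat A _ _ _ _ _ K\<iota>]) (use KD(1-6) k in simp_all)
      then have "fst K \<bullet> fst \<eta> = h0"
        by (rule is_epiD[OF q(1)]) (use KD(1-6) h0 in simp_all)
      moreover have "snd K \<bullet> snd \<eta> = h1"
        by (rule M_eqI) (use KD(1-6) h1 Kp Kg \<kappa>l \<kappa>r in simp_all)
      ultimately show "K = H"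
        using Hu K by blast
    qed
  qed
  ultimately show ?thesis
    using that C by blast
qed

text \<open>The clauses of \<open>cocone\<close> are not checked for \<open>H\<close> one by one.
  Equations in \<open>Y\<close> are preserved by \<open>H\<close>, so the pushed generating data
  satisfy the relations; they generate a cocone, and its components are those of \<open>t\<close>
  followed by \<open>H\<close>.\<close>

lemma cocone_push:
  assumes Y [simp]: "internal_category E Y" and Z [simp]: "internal_category E Z" and c: "cocone Y p t"
    and H: "internal_functor E Y Z H"
  shows "cocone Z (push H p) (\<lambda>i a. snd H \<bullet> t i a)"
proof -
  note pre = precocone_of_cocone[OF Y c]
  have "identifies H (relations Y p (\<lambda>i e. t i (ea i e)))"
    using pre(2) unfolding identifies_def by auto
  then have rel: "\<forall>(r, s) \<in> relations Z (push H p) (\<lambda>i e. snd H \<bullet> t i (ea i e)). r = s"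
    using identifies_relations[OF Y Z pre(1) H] by simp
  have c': "cocone Z (push H p) (arr_of Z (push H p) (\<lambda>i e. snd H \<bullet> t i (ea i e)))"
    by (rule cocone_of_precocone(1)[OF Z precocone_push[OF Y Z pre(1) H] rel])
  have "arr_of Z (push H p) (\<lambda>i e. snd H \<bullet> t i (ea i e)) i a = snd H \<bullet> t i a" if "i \<in> Ob J" "a \<in> Arr (F0 W i)" for i a
    using arr_of_push[OF Y Z pre(1) H that] arr_of_cocone[OF Y c that] by simp
  note eq = this
  note eqs = eq category_simps[OF W_category] functorD(2)[OF W1_functor(1)] W2_simps(2)
  show ?thesis
  proof (rule coconeI, goal_cases)
    case (7 i j \<alpha> x)
    then show ?case using coconeD(7)[OF c' 7] eq[OF 7(2) conjunct1[OF W2_simps(2)[OF 7]]] by simp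
  qed (use coconeD[OF c'] eqs in auto)
qed

text \<open>Universality for 1-cells only; \<open>universal_two_cell\<close> derives from it the
  property for 2-cells.\<close>

definition is_universal :: "('o, 'a) icat \<Rightarrow> ('i \<Rightarrow> 'w \<Rightarrow> 'a \<times> 'a) \<Rightarrow> ('i \<Rightarrow> 'v \<Rightarrow> 'a) \<Rightarrow> bool" where
  "is_universal L p t \<longleftrightarrow> internal_category E L \<and> cocone L p t \<and>
     (\<forall>Y p' t'. internal_category E Y \<longrightarrow> cocone Y p' t' \<longrightarrow>
       (\<exists>!u. internal_functor E L Y u \<and> (\<forall>i \<in> Ob J. \<forall>x \<in> Obj (F0 W i). push u p i x = p' i x) \<and>
         (\<forall>i \<in> Ob J. \<forall>a \<in> Arr (F0 W i). snd u \<bullet> t i a = t' i a)))"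

lemma universal_cocone_exists:
  assumes copr: "has_finite_coproducts E"
    and adj: "has_left_adjoint (underlying_cat (Cat E)) (Gph E) forgetful"
  obtains L p t where "is_universal L p t"
proof -
  obtain C p g where C [simp]: "internal_category E C" and pre: "precocone C p g"
    and univ: "\<And>Y p' g'. internal_category E Y \<Longrightarrow> precocone Y p' g' \<Longrightarrow>
       \<exists>!H. internal_functor E C Y H \<and> (\<forall>i \<in> Ob J. \<forall>x \<in> Obj (F0 W i). push H p i x = p' i x) \<and>
         (\<forall>i \<in> Ob J. \<forall>e \<in> ed i. snd H \<bullet> g i e = g' i e)"
    by (rule free_precocone_exists[OF copr adj]) (rule that; assumption)
  have par: "parallel C r s" if "(r, s) \<in> relations C p g" for r s
    using relations_parallel[OF C pre] that by auto
  obtain L q where Lq: "is_quotient C (relations C p g) L q"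
    by (rule quotient_by_finite_relation[OF finite_relations C par])
  note L [simp] = is_quotientD(1)[OF Lq] and q = is_quotientD(2)[OF Lq]
  note qD = internal_functorD[OF q C L]
  define p1 where "p1 = push q p"
  define g1 where "g1 = (\<lambda>i e. snd q \<bullet> g i e)"
  define t1 where "t1 = arr_of L p1 g1"
  have pre1: "precocone L p1 g1"
    unfolding p1_def g1_def by (rule precocone_push[OF C L pre q])
  have rel1: "\<forall>(r, s) \<in> relations L p1 g1. r = s"
    using is_quotientD(3)[OF Lq] unfolding identifies_relations[OF C L pre q] p1_def g1_def .
  have coc: "cocone L p1 t1" and gen: "\<And>i e. i \<in> Ob J \<Longrightarrow> e \<in> ed i \<Longrightarrow> t1 i (ea i e) = g1 i e"
    using cocone_of_precocone[OF L pre1 rel1] by (auto simp: t1_def)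
  have ex1: "\<exists>!u. internal_functor E L Y u \<and> (\<forall>i \<in> Ob J. \<forall>x \<in> Obj (F0 W i). push u p1 i x = p' i x) \<and>
         (\<forall>i \<in> Ob J. \<forall>a \<in> Arr (F0 W i). snd u \<bullet> t1 i a = t' i a)"
    if Y [simp]: "internal_category E Y" and c: "cocone Y p' t'" for Y p' t'
  proof -
    note pre' = precocone_of_cocone[OF Y c]
    obtain H where H: "internal_functor E C Y H" "\<And>i x. i \<in> Ob J \<Longrightarrow> x \<in> Obj (F0 W i) \<Longrightarrow> push H p i x = p' i x"
      "\<And>i e. i \<in> Ob J \<Longrightarrow> e \<in> ed i \<Longrightarrow> snd H \<bullet> g i e = t' i (ea i e)"
      and Hu: "\<And>K. internal_functor E C Y K \<Longrightarrow> (\<And>i x. i \<in> Ob J \<Longrightarrow> x \<in> Obj (F0 W i) \<Longrightarrow> push K p i x = p' i x) \<Longrightarrow>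
        (\<And>i e. i \<in> Ob J \<Longrightarrow> e \<in> ed i \<Longrightarrow> snd K \<bullet> g i e = t' i (ea i e)) \<Longrightarrow> K = H"
    proof -
      obtain H where "internal_functor E C Y H \<and> (\<forall>i \<in> Ob J. \<forall>x \<in> Obj (F0 W i). push H p i x = p' i x) \<and>
         (\<forall>i \<in> Ob J. \<forall>e \<in> ed i. snd H \<bullet> g i e = t' i (ea i e))"
        using univ[OF Y pre'(1)] by (rule ex1E)
      then show ?thesis
        using ex1_unique[OF univ[OF Y pre'(1)]] by (intro that[of H]) simp_all
    qed
    have "\<forall>(r, s) \<in> relations Y (push H p) (\<lambda>i e. snd H \<bullet> g i e). r = s"
      using pre'(2) relations_cong[of "push H p" p' "\<lambda>i e. snd H \<bullet> g i e" "\<lambda>i e. t' i (ea i e)"] H(2,3) by simp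
    then have idH: "identifies H (relations C p g)"
      unfolding identifies_relations[OF C Y pre H(1)] .
    obtain u where u: "internal_functor E L Y u" "fst u \<bullet> fst q = fst H" "snd u \<bullet> snd q = snd H"
      and uu: "\<And>u'. internal_functor E L Y u' \<Longrightarrow> fst u' \<bullet> fst q = fst H \<Longrightarrow> snd u' \<bullet> snd q = snd H \<Longrightarrow> u' = u"
      by (rule ex1E[OF is_quotient_factor[OF Lq Y H(1) idH]]) blast
    have push_comp: "push u' p1 i x = push (fst u' \<bullet> fst q, snd u' \<bullet> snd q) p i x"
      if "internal_functor E L Y u'" "i \<in> Ob J" "x \<in> Obj (F0 W i)" for u' i x
      using internal_functorD(1-6)[OF that(1) L Y] precocone_p[OF C pre that(2,3)] qD(1-6) by (simp add: push_def p1_def)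
    have g_comp: "snd u' \<bullet> g1 i e = (snd u' \<bullet> snd q) \<bullet> g i e"
      if "internal_functor E L Y u'" "i \<in> Ob J" "e \<in> ed i" for u' i e
      using internal_functorD(1-6)[OF that(1) L Y] precocone_g[OF C pre that(2,3)] qD(1-6) by (simp add: g1_def)
    show ?thesis
    proof (rule ex1I[of _ u])
      have pu: "push u p1 i x = p' i x" if "i \<in> Ob J" "x \<in> Obj (F0 W i)" for i x
        unfolding push_comp[OF u(1) that] u(2,3) using H(2)[OF that] by simp
      have gu: "snd u \<bullet> g1 i e = t' i (ea i e)" if "i \<in> Ob J" "e \<in> ed i" for i e
        unfolding g_comp[OF u(1) that] u(3) using H(3)[OF that] .
      \<comment> \<open>Both sides are \<open>arr_of\<close> for generating data that agree at
        objects and generators, so the agreement extends to every arrow of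
        \<open>W i\<close>.\<close>
      have "snd u \<bullet> t1 i a = t' i a" if "i \<in> Ob J" "a \<in> Arr (F0 W i)" for i a
        unfolding t1_def arr_of_push[OF L Y pre1 u(1) that, symmetric]
        using arr_of_cong[OF pu gu that] arr_of_cocone[OF Y c that] by simp
      then show "internal_functor E L Y u \<and> (\<forall>i \<in> Ob J. \<forall>x \<in> Obj (F0 W i). push u p1 i x = p' i x) \<and>
         (\<forall>i \<in> Ob J. \<forall>a \<in> Arr (F0 W i). snd u \<bullet> t1 i a = t' i a)"
        using u(1) pu by blast
    next
      fix u'
      assume u': "internal_functor E L Y u' \<and> (\<forall>i \<in> Ob J. \<forall>x \<in> Obj (F0 W i). push u' p1 i x = p' i x) \<and>
         (\<forall>i \<in> Ob J. \<forall>a \<in> Arr (F0 W i). snd u' \<bullet> t1 i a = t' i a)"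
      \<comment> \<open>Uniqueness is used twice: the composite with \<open>q\<close> is determined
        by the generating data, and \<open>u'\<close> is determined by that composite.\<close>
      have "(fst u' \<bullet> fst q, snd u' \<bullet> snd q) = H"
      proof (rule Hu)
        show "internal_functor E C Y (fst u' \<bullet> fst q, snd u' \<bullet> snd q)"
          using internal_functor_comp[OF q conjunct1[OF u'] C L Y] .
        show "push (fst u' \<bullet> fst q, snd u' \<bullet> snd q) p i x = p' i x" if "i \<in> Ob J" "x \<in> Obj (F0 W i)" for i x
          using push_comp[OF conjunct1[OF u'] that] u' that by simp
        show "snd (fst u' \<bullet> fst q, snd u' \<bullet> snd q) \<bullet> g i e = t' i (ea i e)" if "i \<in> Ob J" "e \<in> ed i" for i e
        proof -
          have "snd u' \<bullet> t1 i (ea i e) = t' i (ea i e)"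
            using u' ea_Arr[OF that] that(1) by blast
          then show ?thesis
            using g_comp[OF conjunct1[OF u'] that] gen[OF that] by simp
        qed
      qed
      then show "u' = u"
        using uu[of u'] u' by auto
    qed
  qed
  have "is_universal L p1 t1"
    unfolding is_universal_def by (intro conjI allI impI L coc ex1)
  then show ?thesis by (rule that)
qed

end

section \<open>Two-cells out of the universal cocone\<close>

context category_with_pullbacks
begin

text \<open>A horizontal composite with an identity 2-cell contains a unit of \<open>Y\<close> as a
  factor. Cancelling it leaves precomposition, the form in which 2-cells are handled below.\<close>

lemma whisker_right:
  assumes A: "internal_category E A" and B: "internal_category E B" and Y: "internal_category E Y"
    and n: "internal_nat_trans E B Y F s G" and f: "internal_functor E A B f"
  shows "comp2 (Cat E) A B Y (F, s, G) (id2 (Cat E) A B f) =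
      ((fst F \<bullet> fst f, snd F \<bullet> snd f), s \<bullet> fst f, (fst G \<bullet> fst f, snd G \<bullet> snd f))"
  using internal_nat_transD[OF n B Y] internal_functorD[OF f A B] internal_functorD[OF internal_nat_transD(1)[OF n B Y] B Y] assms
  by (simp add: id2_def)

lemma whisker_left:
  assumes A: "internal_category E A" and B: "internal_category E B" and Y: "internal_category E Y"
    and n: "internal_nat_trans E A B F s G" and g: "internal_functor E B Y g"
  shows "comp2 (Cat E) A B Y (id2 (Cat E) B Y g) (F, s, G) =
      ((fst g \<bullet> fst F, snd g \<bullet> snd F), snd g \<bullet> s, (fst g \<bullet> fst G, snd g \<bullet> snd G))"
proof -
  note nD = internal_nat_transD[OF n A B]
  have "tgt Y \<bullet> snd g \<bullet> s = fst g \<bullet> fst G"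
    using nD internal_functorD[OF g B Y] by simp
  then show ?thesis
    using nD internal_functorD[OF g B Y] internal_functorD[OF nD(2) A B] assms
    by (simp add: id2_def)
qed

lemma internal_nat_trans_id:
  assumes A: "internal_category E A" and B: "internal_category E B" and F: "internal_functor E A B F"
  shows "internal_nat_trans E A B F (unt B \<bullet> fst F) F"
  using internal_functorD[OF F A B] A B by (intro internal_nat_transI[OF F F]) simp_all

lemma internal_nat_trans_comp:
  assumes A [simp]: "internal_category E A" and B [simp]: "internal_category E B"
    and s: "internal_nat_trans E A B F s G" and t: "internal_nat_trans E A B G t H"
  shows "internal_nat_trans E A B F (icomp E B s t) H" and "composable B s t"
proof -
  note sD = internal_nat_transD[OF s A B] and tD = internal_nat_transD[OF t A B]
  note [simp] = sD(3-9) tD(3-9) internal_functorD[OF sD(1) A B] internal_functorD[OF sD(2) A B] internal_functorD[OF tD(2) A B]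
  show c: "composable B s t"
    by (simp add: composable_def)
  have cs: "composable B (s \<bullet> src A) (t \<bullet> src A)" "composable B (s \<bullet> tgt A) (t \<bullet> tgt A)"
    "composable B (t \<bullet> src A) (snd H)" "composable B (snd G) (t \<bullet> tgt A)" "composable B (s \<bullet> src A) (snd G)"
    "composable B (snd F) (s \<bullet> tgt A)"
    by (simp_all add: composable_def)
  have eq: "icomp E B (s \<bullet> src A) (snd G) = icomp E B (snd F) (s \<bullet> tgt A)"
    "icomp E B (t \<bullet> src A) (snd H) = icomp E B (snd G) (t \<bullet> tgt A)"
    using sD(10)[of "Ide E (mor A)"] tD(10)[of "Ide E (mor A)"] by simp_all
  have "icomp E B (icomp E B s t \<bullet> src A) (snd H) = icomp E B (s \<bullet> src A) (icomp E B (snd G) (t \<bullet> tgt A))"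
    using c cs by (simp add: icomp_comp icomp_assoc flip: eq(2))
  also have "\<dots> = icomp E B (icomp E B (s \<bullet> src A) (snd G)) (t \<bullet> tgt A)"
    by (rule icomp_assoc[OF B cs(5,4), symmetric])
  also have "\<dots> = icomp E B (snd F) (icomp E B s t \<bullet> tgt A)"
    unfolding eq(1) using c cs by (simp add: icomp_comp icomp_assoc)
  finally have "icomp E B (icomp E B s t \<bullet> src A) (snd H) = icomp E B (snd F) (icomp E B s t \<bullet> tgt A)" .
  then show "internal_nat_trans E A B F (icomp E B s t) H"
    using c by (intro internal_nat_transI[OF sD(1) tD(2)]) simp_all
qed

lemma category_ifun_cat:
  assumes A: "internal_category E A" and B: "internal_category E B"
  shows "category (ifun_cat E A B)"
proof (rule categoryI, goal_cases)
  case (1 f)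
  then show ?case
    using internal_nat_transD(1,2)[OF _ A B] by (cases f) auto
next
  case (2 a)
  then show ?case using internal_nat_trans_id[OF A B] by simp
next
  case (3 f g)
  then show ?case
    using internal_nat_trans_comp(1)[OF A B] by (cases f; cases g) auto
next
  case (4 f)
  obtain F t G where [simp]: "f = (F, t, G)" by (cases f)
  have t: "internal_nat_trans E A B F t G" using 4 by simp
  show ?case
    using internal_nat_transD[OF t A B] A B by simp
next
  case (5 f g h)
  obtain F r G where [simp]: "f = (F, r, G)" by (cases f)
  obtain G' s H where [simp]: "g = (G', s, H)" by (cases g)
  obtain H' t K where [simp]: "h = (H', t, K)" by (cases h)
  have *: "internal_nat_trans E A B F r G" "internal_nat_trans E A B G s H" "internal_nat_trans E A B H t K"
    using 5 by auto
  show ?case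
    using internal_nat_trans_comp(2)[OF A B *(1,2)] internal_nat_trans_comp(2)[OF A B *(2,3)] B
    by (simp add: icomp_assoc)
qed

end

section \<open>Modifications between cocones\<close>

context weighted_diagram
begin

text \<open>The 2-dimensional counterpart of \<open>cocone\<close>; \<open>modification_iff\<close>
  identifies it with the modifications in the definition of a weighted colimit.\<close>

definition cocone_modification ::
  "('o, 'a) icat \<Rightarrow> ('i \<Rightarrow> 'w \<Rightarrow> 'a \<times> 'a) \<Rightarrow> ('i \<Rightarrow> 'v \<Rightarrow> 'a) \<Rightarrow> ('i \<Rightarrow> 'w \<Rightarrow> 'a) \<Rightarrow>
   ('i \<Rightarrow> 'w \<Rightarrow> 'a \<times> 'a) \<Rightarrow> ('i \<Rightarrow> 'v \<Rightarrow> 'a) \<Rightarrow> bool" where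
  "cocone_modification Y p t n p' t' \<longleftrightarrow>
     (\<forall>i \<in> Ob J. \<forall>x \<in> Obj (F0 W i). internal_nat_trans E (F0 D i) Y (p i x) (n i x) (p' i x)) \<and>
     (\<forall>i \<in> Ob J. \<forall>a \<in> Arr (F0 W i).
        icomp E Y (t i a) (n i (Cod (F0 W i) a)) = icomp E Y (n i (Dom (F0 W i) a)) (t' i a)) \<and>
     (\<forall>i \<in> Ob J. \<forall>j \<in> Ob J. \<forall>f \<in> Obj (Hom J j i). \<forall>x \<in> Obj (F0 W i).
        n j (Wo i j f x) = n i x \<bullet> fst (F1 D j i f))"

lemma cocone_modificationD:
  assumes "cocone_modification Y p t n p' t'"
  shows "i \<in> Ob J \<Longrightarrow> x \<in> Obj (F0 W i) \<Longrightarrow> internal_nat_trans E (F0 D i) Y (p i x) (n i x) (p' i x)"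
    and "i \<in> Ob J \<Longrightarrow> a \<in> Arr (F0 W i) \<Longrightarrow>
        icomp E Y (t i a) (n i (Cod (F0 W i) a)) = icomp E Y (n i (Dom (F0 W i) a)) (t' i a)"
    and "i \<in> Ob J \<Longrightarrow> j \<in> Ob J \<Longrightarrow> f \<in> Obj (Hom J j i) \<Longrightarrow> x \<in> Obj (F0 W i) \<Longrightarrow>
        n j (Wo i j f x) = n i x \<bullet> fst (F1 D j i f)"
  using assms unfolding cocone_modification_def by simp_all

text \<open>The power property at all indices at once: a modification between cocones with vertex
  \<open>Y\<close> is a cocone whose vertex is the arrow category of \<open>Y\<close>. Naturality in
  \<open>D i\<close> makes each \<open>n i x\<close> a functor into that category, naturality in
  \<open>W i\<close> makes each \<open>?\<theta> i a\<close> a commutative square, and the remaining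
  clauses hold because they hold for the sides.\<close>

lemma cocone_into_arrow_icat:
  assumes Y [simp]: "internal_category E Y" and c: "cocone Y p t" and c': "cocone Y p' t'"
    and m: "cocone_modification Y p t n p' t'"
  shows "cocone (arrow_icat Y)
      (\<lambda>i x. (n i x, sq Y (n i x \<bullet> src (F0 D i)) (snd (p' i x)) (snd (p i x)) (n i x \<bullet> tgt (F0 D i))))
      (\<lambda>i a. sq Y (n i (Dom (F0 W i) a)) (t' i a) (t i a) (n i (Cod (F0 W i) a)))"
    (is "cocone ?B ?P ?\<theta>")
    and "i \<in> Ob J \<Longrightarrow> a \<in> Arr (F0 W i) \<Longrightarrow> commutes Y (n i (Dom (F0 W i) a)) (t' i a) (t i a) (n i (Cod (F0 W i) a))"
proof -
  note mD = cocone_modificationD[OF m]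
  note B = internal_category_arrow[OF Y]
  have u: "commutes Y (Ide E (mor Y)) (unt Y \<bullet> tgt Y) (unt Y \<bullet> src Y) (Ide E (mor Y))"
    using commutes_unt[of Y "Ide E (mor Y)"] by simp
  have P: "commutes Y (n i x \<bullet> src (F0 D i)) (snd (p' i x)) (snd (p i x)) (n i x \<bullet> tgt (F0 D i))"
    "internal_functor E (F0 D i) ?B (?P i x)" if "i \<in> Ob J" "x \<in> Obj (F0 W i)" for i x
    using functor_into_arrow_icat[OF D_category[OF that(1)] Y mD(1)[OF that]] by simp_all
  have com: "commutes Y (n i (Dom (F0 W i) a)) (t' i a) (t i a) (n i (Cod (F0 W i) a))"
    if i: "i \<in> Ob J" and a: "a \<in> Arr (F0 W i)" for i a
    using mD(2)[OF i a] internal_nat_transD[OF coconeD(2)[OF c i a] D_category[OF i] Y]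
      internal_nat_transD[OF coconeD(2)[OF c' i a] D_category[OF i] Y]
      internal_nat_transD[OF mD(1)[OF i category_simps(1)[OF W_category[OF i] a]] D_category[OF i] Y]
      internal_nat_transD[OF mD(1)[OF i category_simps(2)[OF W_category[OF i] a]] D_category[OF i] Y]
    by (simp add: commutes_def composable_def)
  then show "i \<in> Ob J \<Longrightarrow> a \<in> Arr (F0 W i) \<Longrightarrow> commutes Y (n i (Dom (F0 W i) a)) (t' i a) (t i a) (n i (Cod (F0 W i) a))" .
  show "cocone ?B ?P ?\<theta>"
  proof (rule coconeI)
    fix i x assume "i \<in> Ob J" "x \<in> Obj (F0 W i)"
    then show "internal_functor E (F0 D i) ?B (?P i x)" by (rule P(2))
  next
    fix i a
    assume i: "i \<in> Ob J" and a: "a \<in> Arr (F0 W i)"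
    let ?x = "Dom (F0 W i) a" and ?y = "Cod (F0 W i) a" and ?s = "src (F0 D i)" and ?r = "tgt (F0 D i)"
    have xy: "?x \<in> Obj (F0 W i)" "?y \<in> Obj (F0 W i)"
      using category_simps(1,2)[OF W_category[OF i] a] .
    note [simp] = D_category[OF i]
    note tD = internal_nat_transD[OF coconeD(2)[OF c i a] D_category[OF i] Y]
      and tD' = internal_nat_transD[OF coconeD(2)[OF c' i a] D_category[OF i] Y]
      and nx = internal_nat_transD[OF mD(1)[OF i xy(1)] D_category[OF i] Y]
      and ny = internal_nat_transD[OF mD(1)[OF i xy(2)] D_category[OF i] Y]
    note [simp] = tD(3-9) tD'(3-9) nx(3-9) ny(3-9) com[OF i a] P(1)[OF i xy(1)] P(1)[OF i xy(2)]
    have cz: "sq Y (n i ?x) (t' i a) (t i a) (n i ?y) \<bullet> z = sq Y (n i ?x \<bullet> z) (t' i a \<bullet> z) (t i a \<bullet> z) (n i ?y \<bullet> z)"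
      "commutes Y (n i ?x \<bullet> z) (t' i a \<bullet> z) (t i a \<bullet> z) (n i ?y \<bullet> z)"
      if "z \<in> Arr E" "Cod E z = X i" for z
      using that sq_comp[OF Y com[OF i a]] commutes_comp[OF Y com[OF i a]] by simp_all
    have "composable ?B (?\<theta> i a \<bullet> ?s) (snd (?P i ?y))" "composable ?B (snd (?P i ?x)) (?\<theta> i a \<bullet> ?r)"
      by (simp_all add: composable_def cz)
    moreover have "icomp E Y (t i a \<bullet> ?s) (snd (p i ?y)) = icomp E Y (snd (p i ?x)) (t i a \<bullet> ?r)"
      "icomp E Y (t' i a \<bullet> ?s) (snd (p' i ?y)) = icomp E Y (snd (p' i ?x)) (t' i a \<bullet> ?r)"
      using tD(10)[of "Ide E (mor (F0 D i))"] tD'(10)[of "Ide E (mor (F0 D i))"]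
        internal_functorD(2,5)[OF tD(1) D_category[OF i] Y] internal_functorD(2,5)[OF tD(2) D_category[OF i] Y]
        internal_functorD(2,5)[OF tD'(1) D_category[OF i] Y] internal_functorD(2,5)[OF tD'(2) D_category[OF i] Y] by simp_all
    ultimately have "icomp E ?B (?\<theta> i a \<bullet> ?s) (snd (?P i ?y)) = icomp E ?B (snd (?P i ?x)) (?\<theta> i a \<bullet> ?r)"
      by (simp add: icomp_arrow sq_mul_def cz)
    then show "internal_nat_trans E (F0 D i) ?B (?P i ?x) (?\<theta> i a) (?P i ?y)"
      using P(2)[OF i xy(1)] P(2)[OF i xy(2)] by (intro internal_nat_transI) simp_all
  next
    fix i x
    assume i: "i \<in> Ob J" and x: "x \<in> Obj (F0 W i)"
    note nx = internal_nat_transD[OF mD(1)[OF i x] D_category[OF i] Y]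
    show "?\<theta> i (Ide (F0 W i) x) = unt ?B \<bullet> fst (?P i x)"
      using nx u by (simp add: sq_comp category_simps[OF W_category[OF i]] x coconeD(3)[OF c i x] coconeD(3)[OF c' i x])
  next
    fix i a b
    assume i: "i \<in> Ob J" and a: "a \<in> Arr (F0 W i)" and b: "b \<in> Arr (F0 W i)" and ab: "Cod (F0 W i) a = Dom (F0 W i) b"
    note Wi = category_simps[OF W_category[OF i]]
    note nx = internal_nat_transD[OF mD(1)[OF i Wi(1)[OF a]] D_category[OF i] Y]
    have "composable ?B (?\<theta> i a) (?\<theta> i b)"
      using com[OF i a] com[OF i b] nx internal_nat_transD(3-5)[OF mD(1)[OF i Wi(1)[OF b]] D_category[OF i] Y] ab
      by (simp add: composable_def)
    then show "?\<theta> i (b \<cdot>\<^bsub>F0 W i\<^esub> a) = icomp E ?B (?\<theta> i a) (?\<theta> i b)"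
      using com[OF i a] com[OF i b] a b ab coconeD(4)[OF c i a b ab] coconeD(4)[OF c' i a b ab]
      by (simp add: icomp_arrow sq_mul_def Wi)
  next
    fix i j f x
    assume i: "i \<in> Ob J" and j: "j \<in> Ob J" and f: "f \<in> Obj (Hom J j i)" and x: "x \<in> Obj (F0 W i)"
    note nx = internal_nat_transD[OF mD(1)[OF i x] D_category[OF i] Y]
    show "?P j (Wo i j f x) = (fst (?P i x) \<bullet> fst (F1 D j i f), snd (?P i x) \<bullet> snd (F1 D j i f))"
      using coconeD(5)[OF c i j f x] coconeD(5)[OF c' i j f x] mD(3)[OF i j f x] P(1)[OF i x] nx(3-5)
        internal_functorD[OF D_functor[OF j i f] D_category[OF j] D_category[OF i]] D_category[OF i] D_category[OF j]
      by (simp add: sq_comp)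
  next
    fix i j f a
    assume i: "i \<in> Ob J" and j: "j \<in> Ob J" and f: "f \<in> Obj (Hom J j i)" and a: "a \<in> Arr (F0 W i)"
    note Wi = category_simps[OF W_category[OF i]]
    note nx = internal_nat_transD[OF mD(1)[OF i Wi(1)[OF a]] D_category[OF i] Y]
    show "?\<theta> j (Wa i j f a) = ?\<theta> i a \<bullet> fst (F1 D j i f)"
      using coconeD(6)[OF c i j f a] coconeD(6)[OF c' i j f a] mD(3)[OF i j f Wi(1)[OF a]] mD(3)[OF i j f Wi(2)[OF a]]
        com[OF i a] nx(3-5) a functorD(3,4)[OF W1_functor(1)[OF i j f] a]
        internal_functorD[OF D_functor[OF j i f] D_category[OF j] D_category[OF i]]
      by (simp add: sq_comp)
  next
    fix i j \<alpha> x
    assume i: "i \<in> Ob J" and j: "j \<in> Ob J" and \<alpha>: "\<alpha> \<in> Arr (Hom J j i)" and x: "x \<in> Obj (F0 W i)"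
    note nx = internal_nat_transD[OF mD(1)[OF i x] D_category[OF i] Y]
    note Jj = category_simps(1,2)[OF J_category[OF j i] \<alpha>]
    show "?\<theta> j (W2 i j \<alpha> x) = snd (?P i x) \<bullet> D2 j i \<alpha>"
      using coconeD(7)[OF c i j \<alpha> x] coconeD(7)[OF c' i j \<alpha> x] mD(3)[OF i j Jj(1) x] mD(3)[OF i j Jj(2) x]
        P(1)[OF i x] nx(3-5) W2_simps(2)[OF i j \<alpha> x] D_category[OF i]
        internal_nat_transD[OF D2_simps(1)[OF j i \<alpha>] D_category[OF j] D_category[OF i]]
      by (simp add: sq_comp)
  qed
qed

text \<open>The universal property for 1-cells is applied with the arrow category of
  \<open>Y\<close> as vertex. It yields a functor \<open>U\<close>, hence a transformation with
  components \<open>fst U\<close>. Its source and target are \<open>u\<close> and \<open>v\<close>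
  by the uniqueness of functors out of \<open>L\<close>.\<close>

lemma universal_two_cell:
  assumes univ: "is_universal L p t" and Y [simp]: "internal_category E Y"
    and u: "internal_functor E L Y u" and v: "internal_functor E L Y v"
    and m: "cocone_modification Y (push u p) (\<lambda>i a. snd u \<bullet> t i a) n (push v p) (\<lambda>i a. snd v \<bullet> t i a)"
  shows "\<exists>!\<tau>. internal_nat_trans E L Y u \<tau> v \<and> (\<forall>i \<in> Ob J. \<forall>x \<in> Obj (F0 W i). \<tau> \<bullet> fst (p i x) = n i x)"
proof -
  have L [simp]: "internal_category E L" and cL: "cocone L p t"
    and ex1: "internal_category E Z \<Longrightarrow> cocone Z p' t' \<Longrightarrow>
       \<exists>!u. internal_functor E L Z u \<and> (\<forall>i \<in> Ob J. \<forall>x \<in> Obj (F0 W i). push u p i x = p' i x) \<and>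
         (\<forall>i \<in> Ob J. \<forall>a \<in> Arr (F0 W i). snd u \<bullet> t i a = t' i a)" for Z p' t'
    using univ unfolding is_universal_def by blast+
  let ?B = "arrow_icat Y"
  have B [simp]: "internal_category E ?B"
    by (rule internal_category_arrow) simp
  note mD = cocone_modificationD[OF m]
  note cu = cocone_push[OF L Y cL u] and cv = cocone_push[OF L Y cL v]
  define P where "P i x = (n i x, sq Y (n i x \<bullet> src (F0 D i)) (snd (push v p i x)) (snd (push u p i x)) (n i x \<bullet> tgt (F0 D i)))" for i x
  define \<theta> where "\<theta> i a = sq Y (n i (Dom (F0 W i) a)) (snd v \<bullet> t i a) (snd u \<bullet> t i a) (n i (Cod (F0 W i) a))" for i a
  have cB: "cocone ?B P \<theta>"
    using cocone_into_arrow_icat(1)[OF Y cu cv m] unfolding P_def \<theta>_def .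
  have com: "commutes Y (n i (Dom (F0 W i) a)) (snd v \<bullet> t i a) (snd u \<bullet> t i a) (n i (Cod (F0 W i) a))"
    if "i \<in> Ob J" "a \<in> Arr (F0 W i)" for i a
    using cocone_into_arrow_icat(2)[OF Y cu cv m that] .
  have Pcom: "commutes Y (n i x \<bullet> src (F0 D i)) (snd v \<bullet> snd (p i x)) (snd u \<bullet> snd (p i x)) (n i x \<bullet> tgt (F0 D i))"
    if "i \<in> Ob J" "x \<in> Obj (F0 W i)" for i x
    using functor_into_arrow_icat(2)[OF D_category[OF that(1)] Y mD(1)[OF that]] by simp
  obtain U where U: "internal_functor E L ?B U" "\<And>i x. i \<in> Ob J \<Longrightarrow> x \<in> Obj (F0 W i) \<Longrightarrow> push U p i x = P i x"
    "\<And>i a. i \<in> Ob J \<Longrightarrow> a \<in> Arr (F0 W i) \<Longrightarrow> snd U \<bullet> t i a = \<theta> i a"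
    using ex1_implies_ex[OF ex1[OF B cB]] by auto
  note UD = internal_functorD[OF U(1) L B]
  have Un: "fst U \<bullet> fst (p i x) = n i x" "snd U \<bullet> snd (p i x) = snd (P i x)" if "i \<in> Ob J" "x \<in> Obj (F0 W i)" for i x
    using U(2)[OF that] by (auto simp: push_def P_def)
  note pD = internal_functorD[OF coconeD(1)[OF cL] D_category L]
  note tD = internal_nat_transD[OF coconeD(2)[OF cL] D_category L]
  note nD = internal_nat_transD[OF mD(1) D_category Y]
  \<comment> \<open>\<open>F\<close> and \<open>G\<close> are the source and target of the
    transformation encoded by \<open>U\<close>. They induce the same cocones as \<open>u\<close> and
    \<open>v\<close>, so they equal them.\<close>
  define F where "F = (src Y \<bullet> fst U, sqf Y \<bullet> snd U)"
  define G where "G = (tgt Y \<bullet> fst U, sqg Y \<bullet> snd U)"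
  have nt: "internal_nat_trans E L Y F (fst U) G"
    unfolding F_def G_def by (rule nat_trans_of_functor_into_arrow_icat[OF L Y U(1)])
  have U' [simp]: "fst U \<in> Arr E" "snd U \<in> Arr E" "Dom E (fst U) = ob L" "Dom E (snd U) = mor L" "Cod E (fst U) = mor Y"
    "Cod E (snd U) = squares Y"
    using UD(1-6) by simp_all
  have "F = u"
  proof (rule ex1_unique[OF ex1[OF Y cu]])
    have "push F p i x = push u p i x" if "i \<in> Ob J" "x \<in> Obj (F0 W i)" for i x
      using Un[OF that] pD(1-6)[OF that that(1)] Pcom[OF that] nD(3-7)[OF that that(1)]
      by (simp add: push_def F_def P_def)
    moreover have "snd F \<bullet> t i a = snd u \<bullet> t i a" if "i \<in> Ob J" "a \<in> Arr (F0 W i)" for i a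
      using U(3)[OF that] com[OF that] tD(3-5)[OF that that(1)] by (simp add: F_def \<theta>_def)
    ultimately show "internal_functor E L Y F \<and> (\<forall>i \<in> Ob J. \<forall>x \<in> Obj (F0 W i). push F p i x = push u p i x) \<and>
         (\<forall>i \<in> Ob J. \<forall>a \<in> Arr (F0 W i). snd F \<bullet> t i a = snd u \<bullet> t i a)"
      using internal_nat_transD(1)[OF nt L Y] by blast
  qed (use u in simp)
  moreover have "G = v"
  proof (rule ex1_unique[OF ex1[OF Y cv]])
    have "push G p i x = push v p i x" if "i \<in> Ob J" "x \<in> Obj (F0 W i)" for i x
      using Un[OF that] pD(1-6)[OF that that(1)] Pcom[OF that] nD(3-7)[OF that that(1)]
      by (simp add: push_def G_def P_def)
    moreover have "snd G \<bullet> t i a = snd v \<bullet> t i a" if "i \<in> Ob J" "a \<in> Arr (F0 W i)" for i a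
      using U(3)[OF that] com[OF that] tD(3-5)[OF that that(1)] by (simp add: G_def \<theta>_def)
    ultimately show "internal_functor E L Y G \<and> (\<forall>i \<in> Ob J. \<forall>x \<in> Obj (F0 W i). push G p i x = push v p i x) \<and>
         (\<forall>i \<in> Ob J. \<forall>a \<in> Arr (F0 W i). snd G \<bullet> t i a = snd v \<bullet> t i a)"
      using internal_nat_transD(2)[OF nt L Y] by blast
  qed (use v in simp)
  ultimately have nU: "internal_nat_trans E L Y u (fst U) v"
    using nt by simp
  show ?thesis
  proof (rule ex1I[of _ "fst U"])
    show "internal_nat_trans E L Y u (fst U) v \<and> (\<forall>i \<in> Ob J. \<forall>x \<in> Obj (F0 W i). fst U \<bullet> fst (p i x) = n i x)"
      using nU Un(1) by blast
    fix \<tau>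
    assume \<tau>: "internal_nat_trans E L Y u \<tau> v \<and> (\<forall>i \<in> Ob J. \<forall>x \<in> Obj (F0 W i). \<tau> \<bullet> fst (p i x) = n i x)"
    then have \<tau>n: "\<tau> \<bullet> fst (p i x) = n i x" if "i \<in> Ob J" "x \<in> Obj (F0 W i)" for i x
      using that by blast
    note \<tau>D = internal_nat_transD[OF conjunct1[OF \<tau>] L Y]
    note f = functor_into_arrow_icat[OF L Y conjunct1[OF \<tau>]]
    \<comment> \<open>Any competitor \<open>\<tau>\<close> is encoded as a functor into the arrow
      category as well; it induces the same cocone as \<open>U\<close>, so the two functors
      coincide.\<close>
    define V where "V = (\<tau>, sq Y (\<tau> \<bullet> src L) (snd v) (snd u) (\<tau> \<bullet> tgt L))"
    have "V = U"
    proof (rule ex1_unique[OF ex1[OF B cB]])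
      have "push V p i x = P i x" if "i \<in> Ob J" "x \<in> Obj (F0 W i)" for i x
        using \<tau>n[OF that] reassoc[OF \<tau>n[OF that], of "src (F0 D i)"] reassoc[OF \<tau>n[OF that], of "tgt (F0 D i)"]
          pD(1-8)[OF that that(1)] \<tau>D(3-5) f(2) D_category[OF that(1)]
        by (simp add: push_def V_def P_def sq_comp)
      moreover have "snd V \<bullet> t i a = \<theta> i a" if "i \<in> Ob J" "a \<in> Arr (F0 W i)" for i a
        using \<tau>n[OF that(1) category_simps(1)[OF W_category[OF that(1)] that(2)]]
          \<tau>n[OF that(1) category_simps(2)[OF W_category[OF that(1)] that(2)]]
          tD(3-7)[OF that that(1)] \<tau>D(3-5) f(2)
        by (simp add: V_def \<theta>_def sq_comp)
      ultimately show "internal_functor E L ?B V \<and> (\<forall>i \<in> Ob J. \<forall>x \<in> Obj (F0 W i). push V p i x = P i x) \<and>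
         (\<forall>i \<in> Ob J. \<forall>a \<in> Arr (F0 W i). snd V \<bullet> t i a = \<theta> i a)"
        using f(1) unfolding V_def by blast
    qed (use U in auto)
    then show "\<tau> = fst U"
      by (auto simp: V_def)
  qed
qed

end

section \<open>Components of 2-natural transformations and modifications\<close>

lemma restrict_eq_iff: "(\<lambda>x \<in> A. f x) = (\<lambda>x \<in> A. g x) \<longleftrightarrow> (\<forall>x \<in> A. f x = g x)"
  by (auto simp: fun_eq_iff restrict_def)

lemma comp_func_eq_iff:
  "comp_func C G F = comp_func C G' F' \<longleftrightarrow>
     (\<forall>x \<in> Obj C. fo G (fo F x) = fo G' (fo F' x)) \<and> (\<forall>f \<in> Arr C. fa G (fa F f) = fa G' (fa F' f))"
  by (simp add: comp_func_def restrict_eq_iff)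

lemma hcomp_eq_iff:
  "hcomp A C (G, \<beta>, G') (F, \<alpha>, F') = hcomp A D (K, \<delta>, K') (H, \<gamma>, H') \<longleftrightarrow>
     comp_func A G F = comp_func A K H \<and> comp_func A G' F' = comp_func A K' H' \<and>
     (\<forall>x \<in> Obj A. \<beta> (fo F' x) \<cdot>\<^bsub>C\<^esub> fa G (\<alpha> x) = \<delta> (fo H' x) \<cdot>\<^bsub>D\<^esub> fa K (\<gamma> x))"
  by (auto simp: hcomp_def restrict_eq_iff)

lemma fun_cat_simps:
  "F \<in> Obj (fun_cat C D) \<longleftrightarrow> is_functor C D F \<and> fo F \<in> extensional (Obj C) \<and> fa F \<in> extensional (Arr C)"
  "(F, t, G) \<in> Arr (fun_cat C D) \<longleftrightarrow> F \<in> Obj (fun_cat C D) \<and> G \<in> Obj (fun_cat C D) \<and>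
     is_nat_trans C D F G t \<and> t \<in> extensional (Obj C)"
  "Dom (fun_cat C D) \<alpha> = fst \<alpha>" "Cod (fun_cat C D) \<alpha> = snd (snd \<alpha>)"
  "Ide (fun_cat C D) F = (F, (\<lambda>x \<in> Obj C. Ide D (fo F x)), F)"
  "\<beta> \<cdot>\<^bsub>fun_cat C D\<^esub> \<alpha> = (fst \<alpha>, (\<lambda>x \<in> Obj C. fst (snd \<beta>) x \<cdot>\<^bsub>D\<^esub> fst (snd \<alpha>) x), snd (snd \<beta>))"
  by (auto simp: fun_cat_def Let_def split: prod.splits)

lemma op2_simps [simp]: "Ob (op2 J) = Ob J" "Hom (op2 J) i j = Hom J j i"
  by (simp_all add: op2_def)

context weighted_diagram
begin

abbreviation homs :: "('o, 'a) icat \<Rightarrow> ('i, 'f, 'd, 'a \<times> 'a, ('a \<times> 'a) \<times> 'a \<times> ('a \<times> 'a)) catvalued" where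
  "homs Y \<equiv> hom_into J (Cat E) D Y"

definition precomp :: "'a \<times> 'a \<Rightarrow> 'a \<times> 'a \<Rightarrow> 'a \<times> 'a" where
  "precomp g f = (fst g \<bullet> fst f, snd g \<bullet> snd f)"

lemma hom_into_F0 [simp]: "F0 (homs Y) i = ifun_cat E (F0 D i) Y"
  by (simp add: hom_into_def Let_def)

lemma hom_into_F1:
  assumes Y: "internal_category E Y" and ij: "i \<in> Ob J" "j \<in> Ob J" "f \<in> Obj (Hom J j i)"
  shows "internal_functor E (F0 D i) Y g \<Longrightarrow> fo (F1 (homs Y) i j f) g = precomp g (F1 D j i f)"
    and "internal_nat_trans E (F0 D i) Y F s G \<Longrightarrow>
      fa (F1 (homs Y) i j f) (F, s, G) = (precomp F (F1 D j i f), s \<bullet> fst (F1 D j i f), precomp G (F1 D j i f))"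
  using whisker_right[OF D_category[OF ij(2)] D_category[OF ij(1)] Y _ D_functor[OF ij(2,1,3)]]
  by (simp_all add: hom_into_def Let_def precomp_def del: Cat_simps(5))

lemma hom_into_F2:
  assumes Y: "internal_category E Y" and ij: "i \<in> Ob J" "j \<in> Ob J" and \<alpha>: "\<alpha> \<in> Arr (Hom J j i)"
  obtains m where "F2 (homs Y) i j \<alpha> = (F1 (homs Y) i j (Dom (Hom J j i) \<alpha>), m, F1 (homs Y) i j (Cod (Hom J j i) \<alpha>))"
    "\<And>g. internal_functor E (F0 D i) Y g \<Longrightarrow> m g =
        (precomp g (F1 D j i (Dom (Hom J j i) \<alpha>)), snd g \<bullet> D2 j i \<alpha>, precomp g (F1 D j i (Cod (Hom J j i) \<alpha>)))"
proof -
  let ?m = "fst (snd (F2 (homs Y) i j \<alpha>))"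
  have F2: "F2 (homs Y) i j \<alpha> = (F1 (homs Y) i j (Dom (Hom J j i) \<alpha>), ?m, F1 (homs Y) i j (Cod (Hom J j i) \<alpha>))"
    by (simp add: hom_into_def Let_def)
  have "?m g = comp2 (Cat E) (F0 D j) (F0 D i) Y (id2 (Cat E) (F0 D i) Y g) (F2 D j i \<alpha>)"
    if "internal_functor E (F0 D i) Y g" for g
    using that by (simp add: hom_into_def Let_def del: Cat_simps(5))
  then have "?m g = (precomp g (F1 D j i (Dom (Hom J j i) \<alpha>)), snd g \<bullet> D2 j i \<alpha>, precomp g (F1 D j i (Cod (Hom J j i) \<alpha>)))"
    if "internal_functor E (F0 D i) Y g" for g
    using whisker_left[OF D_category[OF ij(2)] D_category[OF ij(1)] Y D2_simps(1)[OF ij(2,1) \<alpha>] that] that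
      D2_simps(2)[OF ij(2,1) \<alpha>, symmetric] by (simp add: precomp_def del: Cat_simps(5))
  with F2 show ?thesis by (rule that)
qed

text \<open>Packs components into the extensional form demanded by \<open>two_nat\<close>. The
  2-cells of \<open>Cat E\<close> carry their source and target, hence the triples; extensionality
  makes equality of the packed families equality of components.\<close>

definition as_two_nat :: "('i \<Rightarrow> 'w \<Rightarrow> 'a \<times> 'a) \<Rightarrow> ('i \<Rightarrow> 'v \<Rightarrow> 'a) \<Rightarrow>
    'i \<Rightarrow> ('w, 'v, 'a \<times> 'a, ('a \<times> 'a) \<times> 'a \<times> ('a \<times> 'a)) func" where
  "as_two_nat p t = (\<lambda>i \<in> Ob J. \<lparr>fo = (\<lambda>x \<in> Obj (F0 W i). p i x),
     fa = (\<lambda>a \<in> Arr (F0 W i). (p i (Dom (F0 W i) a), t i a, p i (Cod (F0 W i) a)))\<rparr>)"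

lemma as_two_nat_simps [simp]:
  "i \<in> Ob J \<Longrightarrow> x \<in> Obj (F0 W i) \<Longrightarrow> fo (as_two_nat p t i) x = p i x"
  "i \<in> Ob J \<Longrightarrow> a \<in> Arr (F0 W i) \<Longrightarrow> fa (as_two_nat p t i) a = (p i (Dom (F0 W i) a), t i a, p i (Cod (F0 W i) a))"
  by (simp_all add: as_two_nat_def)

lemma as_two_nat_extensional: "as_two_nat p t \<in> extensional (Ob J)"
  unfolding as_two_nat_def by (rule restrict_extensional)

lemma as_two_nat_eq_iff:
  "as_two_nat p t = as_two_nat p' t' \<longleftrightarrow> (\<forall>i \<in> Ob J. \<forall>x \<in> Obj (F0 W i). p i x = p' i x) \<and> (\<forall>i \<in> Ob J. \<forall>a \<in> Arr (F0 W i). t i a = t' i a)"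
  unfolding as_two_nat_def restrict_eq_iff using category_simps(1,2)[OF W_category] by (auto simp: restrict_eq_iff)

context
  fixes Y :: "('o, 'a) icat" and T :: "'i \<Rightarrow> ('w, 'v, 'a \<times> 'a, ('a \<times> 'a) \<times> 'a \<times> ('a \<times> 'a)) func"
    and p :: "'i \<Rightarrow> 'w \<Rightarrow> 'a \<times> 'a" and t :: "'i \<Rightarrow> 'v \<Rightarrow> 'a"
  assumes Y [simp]: "internal_category E Y" and T_ext: "T \<in> extensional (Ob J)"
    and T: "\<And>i. i \<in> Ob J \<Longrightarrow> T i \<in> Obj (fun_cat (F0 W i) (ifun_cat E (F0 D i) Y))"
    and p: "\<And>i x. i \<in> Ob J \<Longrightarrow> x \<in> Obj (F0 W i) \<Longrightarrow> fo (T i) x = p i x"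
    and t: "\<And>i a. i \<in> Ob J \<Longrightarrow> a \<in> Arr (F0 W i) \<Longrightarrow> fst (snd (fa (T i) a)) = t i a"
begin

lemma T_functor: "i \<in> Ob J \<Longrightarrow> is_functor (F0 W i) (ifun_cat E (F0 D i) Y) (T i)"
  using T by (simp add: fun_cat_simps)

lemma T_fa:
  assumes i: "i \<in> Ob J" and a: "a \<in> Arr (F0 W i)"
  shows "fa (T i) a = (p i (Dom (F0 W i) a), t i a, p i (Cod (F0 W i) a))"
    and "internal_nat_trans E (F0 D i) Y (p i (Dom (F0 W i) a)) (t i a) (p i (Cod (F0 W i) a))"
proof -
  note F = functorD[OF T_functor[OF i]]
  show *: "fa (T i) a = (p i (Dom (F0 W i) a), t i a, p i (Cod (F0 W i) a))"
    using F(3,4)[OF a] t[OF i a] p[OF i category_simps(1)[OF W_category[OF i] a]] p[OF i category_simps(2)[OF W_category[OF i] a]]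
    by (simp add: prod_eq_iff)
  show "internal_nat_trans E (F0 D i) Y (p i (Dom (F0 W i) a)) (t i a) (p i (Cod (F0 W i) a))"
    using F(2)[OF a] unfolding * by simp
qed

lemma p_functor: "i \<in> Ob J \<Longrightarrow> x \<in> Obj (F0 W i) \<Longrightarrow> internal_functor E (F0 D i) Y (p i x)"
  using functorD(1)[OF T_functor] p by simp

lemma T_eq_mk: "T = as_two_nat p t"
proof (rule ext)
  fix i
  show "T i = as_two_nat p t i"
  proof (cases "i \<in> Ob J")
    case True
    then have "fo (T i) \<in> extensional (Obj (F0 W i))" "fa (T i) \<in> extensional (Arr (F0 W i))"
      using T by (simp_all add: fun_cat_simps)
    then have "fo (T i) = (\<lambda>x \<in> Obj (F0 W i). p i x)"
      "fa (T i) = (\<lambda>a \<in> Arr (F0 W i). (p i (Dom (F0 W i) a), t i a, p i (Cod (F0 W i) a)))"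
      using True p T_fa(1) by (auto intro!: extensionalityI)
    then show ?thesis
      using True by (simp add: as_two_nat_def)
  qed (use T_ext in \<open>auto simp: as_two_nat_def extensional_def\<close>)
qed

text \<open>At an arrow, equality of 2-cells also compares their ends; these equations are instances
  of the condition on objects, so only the one between components is new.\<close>

lemma two_nat_1cell_iff:
  assumes i: "i \<in> Ob J" and j: "j \<in> Ob J" and f: "f \<in> Obj (Hom J j i)"
  shows "comp_func (F0 W i) (T j) (F1 W i j f) = comp_func (F0 W i) (F1 (homs Y) i j f) (T i) \<longleftrightarrow>
     (\<forall>x \<in> Obj (F0 W i). p j (Wo i j f x) = precomp (p i x) (F1 D j i f)) \<and>
     (\<forall>a \<in> Arr (F0 W i). t j (Wa i j f a) = t i a \<bullet> fst (F1 D j i f))"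
proof -
  note F = functorD[OF W1_functor(1)[OF i j f]]
  have 1: "fo (T j) (Wo i j f x) = fo (F1 (homs Y) i j f) (fo (T i) x) \<longleftrightarrow> p j (Wo i j f x) = precomp (p i x) (F1 D j i f)"
    if "x \<in> Obj (F0 W i)" for x
    using that p[OF i that] p[OF j F(1)[OF that]] hom_into_F1(1)[OF Y i j f p_functor[OF i that]] by simp
  have 2: "fa (T j) (Wa i j f a) = fa (F1 (homs Y) i j f) (fa (T i) a) \<longleftrightarrow>
      p j (Wo i j f (Dom (F0 W i) a)) = precomp (p i (Dom (F0 W i) a)) (F1 D j i f) \<and>
      t j (Wa i j f a) = t i a \<bullet> fst (F1 D j i f) \<and>
      p j (Wo i j f (Cod (F0 W i) a)) = precomp (p i (Cod (F0 W i) a)) (F1 D j i f)"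
    if a: "a \<in> Arr (F0 W i)" for a
    unfolding T_fa(1)[OF i a] T_fa(1)[OF j F(2)[OF a]] hom_into_F1(2)[OF Y i j f T_fa(2)[OF i a]] F(3)[OF a] F(4)[OF a] by simp
  show ?thesis
    unfolding comp_func_eq_iff using 1 2 category_simps(1,2)[OF W_category[OF i]] by blast
qed

text \<open>The outer functors of the two composites agree by the condition on 1-cells, assumed as
  \<open>nat\<close>. In the middle, each identity 2-cell contributes a unit of \<open>Y\<close>;
  cancelling these units leaves the equation between components.\<close>

lemma two_nat_2cell_iff:
  assumes i: "i \<in> Ob J" and j: "j \<in> Ob J" and \<alpha>: "\<alpha> \<in> Arr (Hom J j i)"
    and nat: "\<And>f. f \<in> Obj (Hom J j i) \<Longrightarrow> comp_func (F0 W i) (T j) (F1 W i j f) = comp_func (F0 W i) (F1 (homs Y) i j f) (T i)"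
  shows "hcomp (F0 W i) (F0 (homs Y) j) (Ide (fun_cat (F0 W j) (F0 (homs Y) j)) (T j)) (F2 W i j \<alpha>) =
      hcomp (F0 W i) (F0 (homs Y) j) (F2 (homs Y) i j \<alpha>) (Ide (fun_cat (F0 W i) (F0 (homs Y) i)) (T i)) \<longleftrightarrow>
     (\<forall>x \<in> Obj (F0 W i). t j (W2 i j \<alpha> x) = snd (p i x) \<bullet> D2 j i \<alpha>)"
proof -
  let ?f = "Dom (Hom J j i) \<alpha>" and ?g = "Cod (Hom J j i) \<alpha>"
  have fg: "?f \<in> Obj (Hom J j i)" "?g \<in> Obj (Hom J j i)"
    using category_simps(1,2)[OF J_category[OF j i] \<alpha>] .
  obtain m where m: "F2 (homs Y) i j \<alpha> = (F1 (homs Y) i j ?f, m, F1 (homs Y) i j ?g)"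
    "\<And>g. internal_functor E (F0 D i) Y g \<Longrightarrow> m g = (precomp g (F1 D j i ?f), snd g \<bullet> D2 j i \<alpha>, precomp g (F1 D j i ?g))"
    using hom_into_F2[OF Y i j \<alpha>] by metis
  obtain w where F2W: "F2 W i j \<alpha> = (F1 W i j ?f, w, F1 W i j ?g)"
    using W2_simps(1)[OF i j \<alpha>] by metis
  then have w: "w = W2 i j \<alpha>"
    by simp
  have "(\<lambda>y \<in> Obj (F0 W j). Ide (ifun_cat E (F0 D j) Y) (fo (T j) y)) (Wo i j ?g x) \<cdot>\<^bsub>ifun_cat E (F0 D j) Y\<^esub>
      fa (T j) (W2 i j \<alpha> x) = m (fo (T i) x) \<cdot>\<^bsub>ifun_cat E (F0 D j) Y\<^esub>
      fa (F1 (homs Y) i j ?f) ((\<lambda>y \<in> Obj (F0 W i). Ide (ifun_cat E (F0 D i) Y) (fo (T i) y)) x) \<longleftrightarrow>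
     t j (W2 i j \<alpha> x) = snd (p i x) \<bullet> D2 j i \<alpha>" if x: "x \<in> Obj (F0 W i)" for x
  proof -
    note w = W2_simps(2)[OF i j \<alpha> x]
    have xg: "Wo i j ?g x \<in> Obj (F0 W j)" "Wo i j ?f x \<in> Obj (F0 W j)"
      using functorD(1)[OF W1_functor(1)[OF i j fg(2)] x] functorD(1)[OF W1_functor(1)[OF i j fg(1)] x] .
    note tj = T_fa[OF j conjunct1[OF w]]
    note P = internal_functorD[OF p_functor[OF i x] D_category[OF i] Y]
    note n = internal_nat_transD[OF tj(2) D_category[OF j] Y]
    note \<delta> = internal_nat_transD[OF D2_simps(1)[OF j i \<alpha>] D_category[OF j] D_category[OF i]]
    have pf: "p j (Wo i j ?f x) = precomp (p i x) (F1 D j i ?f)" "p j (Wo i j ?g x) = precomp (p i x) (F1 D j i ?g)"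
      using nat[OF fg(1)] nat[OF fg(2)] x unfolding two_nat_1cell_iff[OF i j fg(1)] two_nat_1cell_iff[OF i j fg(2)] by auto
    have "icomp E Y (t j (W2 i j \<alpha> x)) (unt Y \<bullet> fst (p j (Wo i j ?g x))) = t j (W2 i j \<alpha> x)"
      using n w by simp
    moreover have "icomp E Y ((unt Y \<bullet> fst (p i x)) \<bullet> fst (F1 D j i ?f)) (snd (p i x) \<bullet> D2 j i \<alpha>) = snd (p i x) \<bullet> D2 j i \<alpha>"
      using P \<delta> internal_functorD[OF \<delta>(1) D_category[OF j] D_category[OF i]] by simp
    ultimately show ?thesis
      using x xg w tj(1) p[OF i x] p[OF j xg(1)] m(2)[OF p_functor[OF i x]] pf
        hom_into_F1(2)[OF Y i j fg(1) internal_nat_trans_id[OF D_category[OF i] Y p_functor[OF i x]]] by simp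
  qed
  then show ?thesis
    unfolding m(1) F2W w[symmetric] fun_cat_simps(5) hom_into_F0 hcomp_eq_iff
    using nat[OF fg(1)] nat[OF fg(2)] by simp
qed

text \<open>\<open>T\<close> and its components are related by equations rather than one being
  defined from the other, so the result serves twice: to read components off a given 2-natural
  transformation, and to pack a cocone into one.\<close>

lemma two_nat_iff_cocone: "two_nat (op2 J) W (homs Y) T \<longleftrightarrow> cocone Y p t"
proof
  assume tn: "two_nat (op2 J) W (homs Y) T"
  have f: "comp_func (F0 W i) (T j) (F1 W i j f) = comp_func (F0 W i) (F1 (homs Y) i j f) (T i)"
    if "i \<in> Ob J" "j \<in> Ob J" "f \<in> Obj (Hom J j i)" for i j f
    using tn that unfolding two_nat_def by simp
  have \<alpha>: "hcomp (F0 W i) (F0 (homs Y) j) (Ide (fun_cat (F0 W j) (F0 (homs Y) j)) (T j)) (F2 W i j \<alpha>) =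
      hcomp (F0 W i) (F0 (homs Y) j) (F2 (homs Y) i j \<alpha>) (Ide (fun_cat (F0 W i) (F0 (homs Y) i)) (T i))"
    if "i \<in> Ob J" "j \<in> Ob J" "\<alpha> \<in> Arr (Hom J j i)" for i j \<alpha>
    using tn that unfolding two_nat_def by simp
  show "cocone Y p t"
  proof (rule coconeI)
    fix i x
    assume ix: "i \<in> Ob J" "x \<in> Obj (F0 W i)"
    show "internal_functor E (F0 D i) Y (p i x)" by (rule p_functor[OF ix])
    show "t i (Ide (F0 W i) x) = unt Y \<bullet> fst (p i x)"
      using functorD(5)[OF T_functor[OF ix(1)] ix(2)] t[OF ix(1), of "Ide (F0 W i) x"] p[OF ix]
        category_simps(3)[OF W_category[OF ix(1)] ix(2)] by simp
  next
    fix i a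
    assume ia: "i \<in> Ob J" "a \<in> Arr (F0 W i)"
    then show "internal_nat_trans E (F0 D i) Y (p i (Dom (F0 W i) a)) (t i a) (p i (Cod (F0 W i) a))" by (rule T_fa(2))
    fix b
    assume b: "b \<in> Arr (F0 W i)" "Cod (F0 W i) a = Dom (F0 W i) b"
    show "t i (b \<cdot>\<^bsub>F0 W i\<^esub> a) = icomp E Y (t i a) (t i b)"
      using functorD(6)[OF T_functor[OF ia(1)] ia(2) b] t[OF ia(1), of "b \<cdot>\<^bsub>F0 W i\<^esub> a"] t[OF ia] t[OF ia(1) b(1)]
        category_simps(6)[OF W_category[OF ia(1)] ia(2) b] by simp
  qed (use two_nat_1cell_iff f two_nat_2cell_iff[OF _ _ _ f] \<alpha> in \<open>simp_all add: precomp_def\<close>)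
next
  assume c: "cocone Y p t"
  have f: "comp_func (F0 W i) (T j) (F1 W i j f) = comp_func (F0 W i) (F1 (homs Y) i j f) (T i)"
    if "i \<in> Ob J" "j \<in> Ob J" "f \<in> Obj (Hom J j i)" for i j f
    unfolding two_nat_1cell_iff[OF that] using coconeD(5,6)[OF c that] by (simp add: precomp_def)
  have \<alpha>: "hcomp (F0 W i) (F0 (homs Y) j) (Ide (fun_cat (F0 W j) (F0 (homs Y) j)) (T j)) (F2 W i j \<alpha>) =
      hcomp (F0 W i) (F0 (homs Y) j) (F2 (homs Y) i j \<alpha>) (Ide (fun_cat (F0 W i) (F0 (homs Y) i)) (T i))"
    if "i \<in> Ob J" "j \<in> Ob J" "\<alpha> \<in> Arr (Hom J j i)" for i j \<alpha>
    using two_nat_2cell_iff[OF that f[OF that(1,2)]] coconeD(7)[OF c that] by simp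
  show "two_nat (op2 J) W (homs Y) T"
    unfolding two_nat_def using T_ext T f \<alpha> by simp
qed

end

lemma two_nat_components:
  assumes Y: "internal_category E Y" and T: "two_nat (op2 J) W (homs Y) T"
  obtains p t where "cocone Y p t" "T = as_two_nat p t"
proof -
  have "T \<in> extensional (Ob J)" "\<And>i. i \<in> Ob J \<Longrightarrow> T i \<in> Obj (fun_cat (F0 W i) (ifun_cat E (F0 D i) Y))"
    using T unfolding two_nat_def by simp_all
  note * = two_nat_iff_cocone[OF Y this refl refl] T_eq_mk[OF Y this refl refl]
  show ?thesis
    by (rule that[OF iffD1[OF *(1) T] *(2)])
qed

lemma as_two_nat_Obj:
  assumes Y: "internal_category E Y" and c: "cocone Y p t" and i: "i \<in> Ob J"
  shows "as_two_nat p t i \<in> Obj (fun_cat (F0 W i) (ifun_cat E (F0 D i) Y))"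
proof -
  note Wi = category_simps[OF W_category[OF i]]
  have "is_functor (F0 W i) (ifun_cat E (F0 D i) Y) (as_two_nat p t i)"
    by (rule functorI) (use coconeD(1-4)[OF c i] in \<open>simp_all add: Wi i\<close>)
  then show ?thesis
    using i by (simp add: fun_cat_simps as_two_nat_def)
qed

lemma two_nat_mk:
  assumes Y: "internal_category E Y" and c: "cocone Y p t"
  shows "two_nat (op2 J) W (homs Y) (as_two_nat p t)"
  by (rule iffD2[OF two_nat_iff_cocone[OF Y as_two_nat_extensional as_two_nat_Obj[OF Y c]] c]) simp_all

section \<open>Modifications in components\<close>

definition as_modification :: "('i \<Rightarrow> 'w \<Rightarrow> 'a \<times> 'a) \<Rightarrow> ('i \<Rightarrow> 'v \<Rightarrow> 'a) \<Rightarrow> ('i \<Rightarrow> 'w \<Rightarrow> 'a) \<Rightarrow>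
    ('i \<Rightarrow> 'w \<Rightarrow> 'a \<times> 'a) \<Rightarrow> ('i \<Rightarrow> 'v \<Rightarrow> 'a) \<Rightarrow>
    'i \<Rightarrow> ('w, 'v, 'a \<times> 'a, ('a \<times> 'a) \<times> 'a \<times> ('a \<times> 'a)) ntrans" where
  "as_modification p t n p' t' = (\<lambda>i \<in> Ob J. (as_two_nat p t i, (\<lambda>x \<in> Obj (F0 W i). (p i x, n i x, p' i x)), as_two_nat p' t' i))"

lemma as_modification_eqD: "as_modification p t n p' t' = as_modification q s m q' s' \<Longrightarrow> i \<in> Ob J \<Longrightarrow> x \<in> Obj (F0 W i) \<Longrightarrow> n i x = m i x"
  unfolding as_modification_def restrict_eq_iff by (auto simp: restrict_eq_iff)

lemma as_modification_cong: "(\<And>i x. i \<in> Ob J \<Longrightarrow> x \<in> Obj (F0 W i) \<Longrightarrow> n i x = m i x) \<Longrightarrow> as_modification p t n p' t' = as_modification p t m p' t'"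
  unfolding as_modification_def restrict_eq_iff by (auto simp: restrict_eq_iff)

context
  fixes Y p t p' t'
  assumes Y [simp]: "internal_category E Y" and c: "cocone Y p t" and c': "cocone Y p' t'"
begin

lemma as_modification_hom_iff:
  assumes i: "i \<in> Ob J"
  shows "as_modification p t n p' t' i \<in> hom (fun_cat (F0 W i) (ifun_cat E (F0 D i) Y)) (as_two_nat p t i) (as_two_nat p' t' i) \<longleftrightarrow>
     (\<forall>x \<in> Obj (F0 W i). internal_nat_trans E (F0 D i) Y (p i x) (n i x) (p' i x)) \<and>
     (\<forall>a \<in> Arr (F0 W i). icomp E Y (t i a) (n i (Cod (F0 W i) a)) = icomp E Y (n i (Dom (F0 W i) a)) (t' i a))"
  using as_two_nat_Obj[OF Y c i] as_two_nat_Obj[OF Y c' i] i category_simps(1,2)[OF W_category[OF i]]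
  by (simp add: as_modification_def fun_cat_simps is_nat_trans_def)

text \<open>As for 2-natural transformations, whiskering with identity 2-cells only adds units of
  \<open>Y\<close>. The ends agree because both cocones are 2-natural.\<close>

lemma as_modification_1cell_iff:
  assumes i: "i \<in> Ob J" and j: "j \<in> Ob J" and f: "f \<in> Obj (Hom J j i)"
    and n: "\<And>i x. i \<in> Ob J \<Longrightarrow> x \<in> Obj (F0 W i) \<Longrightarrow> internal_nat_trans E (F0 D i) Y (p i x) (n i x) (p' i x)"
  shows "hcomp (F0 W i) (F0 (homs Y) j) (as_modification p t n p' t' j) (Ide (fun_cat (F0 W i) (F0 W j)) (F1 W i j f)) =
      hcomp (F0 W i) (F0 (homs Y) j) (Ide (fun_cat (F0 (homs Y) i) (F0 (homs Y) j)) (F1 (homs Y) i j f)) (as_modification p t n p' t' i) \<longleftrightarrow>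
    (\<forall>x \<in> Obj (F0 W i). n j (Wo i j f x) = n i x \<bullet> fst (F1 D j i f))"
proof -
  have nat: "comp_func (F0 W i) (as_two_nat p t j) (F1 W i j f) = comp_func (F0 W i) (F1 (homs Y) i j f) (as_two_nat p t i)"
    "comp_func (F0 W i) (as_two_nat p' t' j) (F1 W i j f) = comp_func (F0 W i) (F1 (homs Y) i j f) (as_two_nat p' t' i)"
    using two_nat_mk[OF Y c] two_nat_mk[OF Y c'] i j f unfolding two_nat_def by simp_all
  have "(\<lambda>x \<in> Obj (F0 W j). (p j x, n j x, p' j x)) (Wo i j f x) \<cdot>\<^bsub>ifun_cat E (F0 D j) Y\<^esub>
      fa (as_two_nat p t j) ((\<lambda>y \<in> Obj (F0 W i). Ide (F0 W j) (Wo i j f y)) x) =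
     (\<lambda>g \<in> Obj (ifun_cat E (F0 D i) Y). Ide (ifun_cat E (F0 D j) Y) (fo (F1 (homs Y) i j f) g)) (fo (as_two_nat p' t' i) x)
      \<cdot>\<^bsub>ifun_cat E (F0 D j) Y\<^esub> fa (F1 (homs Y) i j f) ((\<lambda>x \<in> Obj (F0 W i). (p i x, n i x, p' i x)) x) \<longleftrightarrow>
     n j (Wo i j f x) = n i x \<bullet> fst (F1 D j i f)" if x: "x \<in> Obj (F0 W i)" for x
  proof -
    have x': "Wo i j f x \<in> Obj (F0 W j)"
      using functorD(1)[OF W1_functor(1)[OF i j f] x] .
    note Wj = category_simps(3-5)[OF W_category[OF j] x']
    note ni = internal_nat_transD[OF n[OF i x] D_category[OF i] Y]
    note nj = internal_nat_transD[OF n[OF j x'] D_category[OF j] Y]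
    note F = internal_functorD[OF D_functor[OF j i f] D_category[OF j] D_category[OF i]]
    note P = internal_functorD[OF ni(2) D_category[OF i] Y]
    have "icomp E Y (unt Y \<bullet> fst (p j (Wo i j f x))) (n j (Wo i j f x)) = n j (Wo i j f x)"
      using nj by simp
    moreover have "icomp E Y (n i x \<bullet> fst (F1 D j i f)) (unt Y \<bullet> fst (p' i x) \<bullet> fst (F1 D j i f)) = n i x \<bullet> fst (F1 D j i f)"
      using ni F P by simp
    moreover have "p j (Wo i j f x) = precomp (p i x) (F1 D j i f)" "p' j (Wo i j f x) = precomp (p' i x) (F1 D j i f)"
      using coconeD(5)[OF c i j f x] coconeD(5)[OF c' i j f x] by (simp_all add: precomp_def)
    ultimately show ?thesis
      using x x' i j Wj coconeD(3)[OF c j x'] hom_into_F1(2)[OF Y i j f n[OF i x]] hom_into_F1(1)[OF Y i j f ni(2)] ni(2)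
      by (simp add: precomp_def)
  qed
  then show ?thesis
    using nat i j by (simp add: as_modification_def fun_cat_simps(5) hcomp_eq_iff del: ifun_cat_simps)
qed

lemma modification_iff:
  "modification (op2 J) W (homs Y) (as_two_nat p t) (as_two_nat p' t') (as_modification p t n p' t') \<longleftrightarrow> cocone_modification Y p t n p' t'"
proof -
  let ?m = "as_modification p t n p' t'"
  have ext: "?m \<in> extensional (Ob J)"
    unfolding as_modification_def by (rule restrict_extensional)
  show ?thesis
  proof
    assume m: "modification (op2 J) W (homs Y) (as_two_nat p t) (as_two_nat p' t') ?m"
    have "?m i \<in> hom (fun_cat (F0 W i) (ifun_cat E (F0 D i) Y)) (as_two_nat p t i) (as_two_nat p' t' i)" if "i \<in> Ob J" for i
      using m that unfolding modification_def by (simp del: hom_iff)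
    note hom = this
    have n: "internal_nat_trans E (F0 D i) Y (p i x) (n i x) (p' i x)" if "i \<in> Ob J" "x \<in> Obj (F0 W i)" for i x
      using iffD1[OF as_modification_hom_iff hom] that by blast
    moreover have "icomp E Y (t i a) (n i (Cod (F0 W i) a)) = icomp E Y (n i (Dom (F0 W i) a)) (t' i a)"
        if "i \<in> Ob J" "a \<in> Arr (F0 W i)" for i a
      using iffD1[OF as_modification_hom_iff hom] that by blast
    moreover have "n j (Wo i j f x) = n i x \<bullet> fst (F1 D j i f)"
      if "i \<in> Ob J" "j \<in> Ob J" "f \<in> Obj (Hom J j i)" "x \<in> Obj (F0 W i)" for i j f x
      using as_modification_1cell_iff[OF that(1-3) n] m that unfolding modification_def by simp
    ultimately show "cocone_modification Y p t n p' t'"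
      unfolding cocone_modification_def by simp
  next
    assume m: "cocone_modification Y p t n p' t'"
    note mD = cocone_modificationD[OF m]
    have "?m i \<in> hom (fun_cat (F0 W i) (ifun_cat E (F0 D i) Y)) (as_two_nat p t i) (as_two_nat p' t' i)" if "i \<in> Ob J" for i
      using as_modification_hom_iff[OF that] mD(1,2)[OF that] by blast
    then show "modification (op2 J) W (homs Y) (as_two_nat p t) (as_two_nat p' t') ?m"
      unfolding modification_def using ext as_modification_1cell_iff[OF _ _ _ mD(1)] mD(3) by (simp del: hom_iff)
  qed
qed

lemma modification_components:
  assumes m: "modification (op2 J) W (homs Y) (as_two_nat p t) (as_two_nat p' t') m"
  obtains n where "m = as_modification p t n p' t'"
proof -
  \<comment> \<open>Two layers are peeled off: \<open>m i\<close> is a triple whose middle part is a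
    family of 2-cells of \<open>Cat E\<close>, and each of these is again a triple with the actual
    component in the middle.\<close>
  define n where "n i x = fst (snd (fst (snd (m i)) x))" for i x
  have "m i = as_modification p t n p' t' i" if i: "i \<in> Ob J" for i
  proof -
    have "m i \<in> hom (fun_cat (F0 W i) (ifun_cat E (F0 D i) Y)) (as_two_nat p t i) (as_two_nat p' t' i)"
      using m i unfolding modification_def by simp
    then obtain s where s: "m i = (as_two_nat p t i, s, as_two_nat p' t' i)" "s \<in> extensional (Obj (F0 W i))"
      "is_nat_trans (F0 W i) (ifun_cat E (F0 D i) Y) (as_two_nat p t i) (as_two_nat p' t' i) s"
      by (cases "m i") (auto simp: fun_cat_simps)
    have "s x = (p i x, n i x, p' i x)" if "x \<in> Obj (F0 W i)" for x
      using s(1,3) that i by (auto simp: is_nat_trans_def n_def prod_eq_iff)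
    then have "s = (\<lambda>x \<in> Obj (F0 W i). (p i x, n i x, p' i x))"
      using s(2) by (auto intro!: extensionalityI)
    then show ?thesis
      using s(1) i by (simp add: as_modification_def)
  qed
  moreover have "m \<in> extensional (Ob J)"
    using m unfolding modification_def by simp
  ultimately have "m = as_modification p t n p' t'"
    by (intro extensionalityI[of _ "Ob J"]) (simp_all add: as_modification_def)
  then show ?thesis by (rule that)
qed

end

end

section \<open>The weighted colimit\<close>

lemma two_nat_cat_simps:
  "T \<in> Obj (two_nat_cat S W H) \<longleftrightarrow> two_nat S W H T"
  "(T, m, T') \<in> Arr (two_nat_cat S W H) \<longleftrightarrow> two_nat S W H T \<and> two_nat S W H T' \<and> modification S W H T T' m"
  "Dom (two_nat_cat S W H) \<alpha> = fst \<alpha>" "Cod (two_nat_cat S W H) \<alpha> = snd (snd \<alpha>)"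
  "Ide (two_nat_cat S W H) T = (T, (\<lambda>i \<in> Ob S. Ide (fun_cat (F0 W i) (F0 H i)) (T i)), T)"
  "(T', n, T'') \<cdot>\<^bsub>two_nat_cat S W H\<^esub> (T, m, T1) = (T, (\<lambda>i \<in> Ob S. n i \<cdot>\<^bsub>fun_cat (F0 W i) (F0 H i)\<^esub> m i), T'')"
  by (auto simp: two_nat_cat_def split: prod.splits)

context weighted_diagram
begin

context
  fixes L p t
  assumes univ: "is_universal L p t"
begin

lemma L_category [simp]: "internal_category E L" and cocone_L: "cocone L p t"
  using univ unfolding is_universal_def by blast+

lemma universal_ex1: "internal_category E Z \<Longrightarrow> cocone Z p' t' \<Longrightarrow>
    \<exists>!u. internal_functor E L Z u \<and> (\<forall>i \<in> Ob J. \<forall>x \<in> Obj (F0 W i). push u p i x = p' i x) \<and>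
      (\<forall>i \<in> Ob J. \<forall>a \<in> Arr (F0 W i). snd u \<bullet> t i a = t' i a)"
  using univ unfolding is_universal_def by blast

context
  fixes Y
  assumes Y [simp]: "internal_category E Y"
begin

abbreviation post where
  "post \<equiv> post_cocone J W (Cat E) D L (as_two_nat p t) Y"

abbreviation two_nat_of where
  "two_nat_of u \<equiv> as_two_nat (push u p) (\<lambda>i a. snd u \<bullet> t i a)"

abbreviation modification_of where
  "modification_of u \<tau> v \<equiv> as_modification (push u p) (\<lambda>i a. snd u \<bullet> t i a) (\<lambda>i x. \<tau> \<bullet> fst (p i x)) (push v p) (\<lambda>i a. snd v \<bullet> t i a)"

lemma cocone_post: "internal_functor E L Y u \<Longrightarrow> cocone Y (push u p) (\<lambda>i a. snd u \<bullet> t i a)"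
  by (rule cocone_push[OF L_category Y cocone_L])

lemma post_fo:
  assumes u: "internal_functor E L Y u"
  shows "fo post u = two_nat_of u"
proof -
  have "comp2 (Cat E) (F0 D i) L Y (id2 (Cat E) L Y u) (fa (as_two_nat p t i) a) =
      (push u p i (Dom (F0 W i) a), snd u \<bullet> t i a, push u p i (Cod (F0 W i) a))" if "i \<in> Ob J" "a \<in> Arr (F0 W i)" for i a
    using whisker_left[OF D_category[OF that(1)] L_category Y coconeD(2)[OF cocone_L that] u] that
    by (simp add: push_def del: Cat_simps(5))
  then show ?thesis
    using u by (simp add: post_cocone_def Let_def as_two_nat_def[of "push u p"] push_def restrict_eq_iff del: Cat_simps(5) cong: restrict_cong)
qed

lemma post_fa:
  assumes \<tau>: "internal_nat_trans E L Y u \<tau> v"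
  shows "fa post (u, \<tau>, v) = (two_nat_of u, modification_of u \<tau> v, two_nat_of v)"
proof -
  note uv = internal_nat_transD(1,2)[OF \<tau> L_category Y]
  \<comment> \<open>A copy of the local function of that name in \<open>post_cocone\<close>; naming
    it lets \<open>post_fo\<close> rewrite both ends of the image 2-cell.\<close>
  define po where "po w = (\<lambda>i \<in> Ob J. \<lparr>fo = \<lambda>x \<in> Obj (F0 W i). comp1 (Cat E) (F0 D i) L Y w (fo (as_two_nat p t i) x),
      fa = \<lambda>a \<in> Arr (F0 W i). comp2 (Cat E) (F0 D i) L Y (id2 (Cat E) L Y w) (fa (as_two_nat p t i) a)\<rparr>)" for w
  have po: "po w = two_nat_of w" if "internal_functor E L Y w" for w
    using post_fo[OF that] that by (simp add: post_cocone_def Let_def po_def del: Cat_simps(4,5))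
  have "fa post (u, \<tau>, v) = (po u, (\<lambda>i \<in> Ob J. (po u i,
      (\<lambda>x \<in> Obj (F0 W i). comp2 (Cat E) (F0 D i) L Y (u, \<tau>, v) (id2 (Cat E) (F0 D i) L (fo (as_two_nat p t i) x))), po v i)), po v)"
    using \<tau> by (simp add: post_cocone_def Let_def po_def del: Cat_simps(4,5) as_two_nat_simps cong: if_cong)
  moreover have "comp2 (Cat E) (F0 D i) L Y (u, \<tau>, v) (id2 (Cat E) (F0 D i) L (fo (as_two_nat p t i) x)) =
      (push u p i x, \<tau> \<bullet> fst (p i x), push v p i x)" if "i \<in> Ob J" "x \<in> Obj (F0 W i)" for i x
    using whisker_right[OF D_category[OF that(1)] L_category Y \<tau> coconeD(1)[OF cocone_L that]] that
    by (simp add: push_def del: Cat_simps(5))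
  ultimately show ?thesis
    by (simp add: po[OF uv(1)] po[OF uv(2)] as_modification_def restrict_eq_iff del: Cat_simps(4,5) as_two_nat_simps cong: restrict_cong)
qed

text \<open>Naturality of \<open>\<tau>\<close> is used at two generalised arrows of
  \<open>L\<close>: at \<open>snd (p i x)\<close> it gives naturality over \<open>D i\<close>, and
  at \<open>t i a\<close> it gives naturality over \<open>W i\<close>.\<close>

lemma cocone_modification_post:
  assumes \<tau>: "internal_nat_trans E L Y u \<tau> v"
  shows "cocone_modification Y (push u p) (\<lambda>i a. snd u \<bullet> t i a) (\<lambda>i x. \<tau> \<bullet> fst (p i x)) (push v p) (\<lambda>i a. snd v \<bullet> t i a)"
  unfolding cocone_modification_def
proof (intro conjI ballI)
  note \<tau>D = internal_nat_transD[OF \<tau> L_category Y]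
  note uD = internal_functorD[OF \<tau>D(1) L_category Y] and vD = internal_functorD[OF \<tau>D(2) L_category Y]
  note cu = cocone_post[OF \<tau>D(1)] and cv = cocone_post[OF \<tau>D(2)]
  {
    fix i x
    assume i: "i \<in> Ob J" and x: "x \<in> Obj (F0 W i)"
    note P = internal_functorD[OF coconeD(1)[OF cocone_L i x] D_category[OF i] L_category]
    show "internal_nat_trans E (F0 D i) Y (push u p i x) (\<tau> \<bullet> fst (p i x)) (push v p i x)"
      using \<tau>D(3-9) \<tau>D(10)[of "snd (p i x)"] P(1-8) D_category[OF i]
      by (intro internal_nat_transI coconeD(1)[OF cu i x] coconeD(1)[OF cv i x]) simp_all
    fix j f
    assume j: "j \<in> Ob J" and f: "f \<in> Obj (Hom J j i)"
    show "\<tau> \<bullet> fst (p j (Wo i j f x)) = (\<tau> \<bullet> fst (p i x)) \<bullet> fst (F1 D j i f)"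
      using coconeD(5)[OF cocone_L i j f x] P(1-4) \<tau>D(3-5) internal_functorD(1-4)[OF D_functor[OF j i f] D_category[OF j] D_category[OF i]]
      by simp
  next
    fix i a
    assume i: "i \<in> Ob J" and a: "a \<in> Arr (F0 W i)"
    note tD = internal_nat_transD[OF coconeD(2)[OF cocone_L i a] D_category[OF i] L_category]
    show "icomp E Y (snd u \<bullet> t i a) (\<tau> \<bullet> fst (p i (Cod (F0 W i) a))) = icomp E Y (\<tau> \<bullet> fst (p i (Dom (F0 W i) a))) (snd v \<bullet> t i a)"
      using \<tau>D(10)[of "t i a"] tD(3-7) by simp
  }
qed

lemma modification_post:
  assumes \<tau>: "internal_nat_trans E L Y u \<tau> v"
  shows "modification (op2 J) W (homs Y) (two_nat_of u) (two_nat_of v) (modification_of u \<tau> v)"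
  using modification_iff[OF Y cocone_post[OF internal_nat_transD(1)[OF \<tau> L_category Y]] cocone_post[OF internal_nat_transD(2)[OF \<tau> L_category Y]]]
    cocone_modification_post[OF \<tau>] by blast

lemma functor_post: "is_functor (ifun_cat E L Y) (two_nat_cat (op2 J) W (homs Y)) post"
proof (rule functorI)
  show "u \<in> Obj (ifun_cat E L Y) \<Longrightarrow> fo post u \<in> Obj (two_nat_cat (op2 J) W (homs Y))" for u
    by (simp add: post_fo two_nat_cat_simps two_nat_mk cocone_post)
next
  fix \<alpha>
  assume \<alpha>: "\<alpha> \<in> Arr (ifun_cat E L Y)"
  obtain u \<tau> v where [simp]: "\<alpha> = (u, \<tau>, v)" by (cases \<alpha>)
  have \<tau>: "internal_nat_trans E L Y u \<tau> v" using \<alpha> by simp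
  note uv = internal_nat_transD(1,2)[OF \<tau> L_category Y]
  show "fa post \<alpha> \<in> Arr (two_nat_cat (op2 J) W (homs Y)) \<and> Dom (two_nat_cat (op2 J) W (homs Y)) (fa post \<alpha>) = fo post (Dom (ifun_cat E L Y) \<alpha>) \<and>
      Cod (two_nat_cat (op2 J) W (homs Y)) (fa post \<alpha>) = fo post (Cod (ifun_cat E L Y) \<alpha>)"
    using uv by (simp add: post_fa[OF \<tau>] post_fo two_nat_cat_simps two_nat_mk cocone_post modification_post[OF \<tau>])
next
  fix u
  assume "u \<in> Obj (ifun_cat E L Y)"
  then have u: "internal_functor E L Y u" by simp
  have "(unt Y \<bullet> fst u) \<bullet> fst (p i x) = unt Y \<bullet> fst (push u p i x)" if "i \<in> Ob J" "x \<in> Obj (F0 W i)" for i x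
    using internal_functorD(1-4)[OF u L_category Y] internal_functorD(1-4)[OF coconeD(1)[OF cocone_L that] D_category[OF that(1)] L_category] by simp
  then have "modification_of u (unt Y \<bullet> fst u) u = (\<lambda>i \<in> Ob J. Ide (fun_cat (F0 W i) (ifun_cat E (F0 D i) Y)) (two_nat_of u i))"
    by (simp add: as_modification_def fun_cat_simps(5) restrict_eq_iff cong: restrict_cong)
  then show "fa post (Ide (ifun_cat E L Y) u) = Ide (two_nat_cat (op2 J) W (homs Y)) (fo post u)"
    using internal_nat_trans_id[OF L_category Y u] by (simp add: post_fa post_fo[OF u] two_nat_cat_simps)
next
  fix \<alpha> \<beta>
  assume ab: "\<alpha> \<in> Arr (ifun_cat E L Y)" "\<beta> \<in> Arr (ifun_cat E L Y)" "Cod (ifun_cat E L Y) \<alpha> = Dom (ifun_cat E L Y) \<beta>"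
  obtain u \<tau> v where [simp]: "\<alpha> = (u, \<tau>, v)" by (cases \<alpha>)
  obtain v' \<sigma> w where [simp]: "\<beta> = (v', \<sigma>, w)" by (cases \<beta>)
  have [simp]: "v' = v" and \<tau>: "internal_nat_trans E L Y u \<tau> v" and \<sigma>: "internal_nat_trans E L Y v \<sigma> w" using ab by simp_all
  note \<tau>\<sigma> = internal_nat_trans_comp[OF L_category Y \<tau> \<sigma>]
  have "icomp E Y \<tau> \<sigma> \<bullet> fst (p i x) = icomp E Y (\<tau> \<bullet> fst (p i x)) (\<sigma> \<bullet> fst (p i x))" if "i \<in> Ob J" "x \<in> Obj (F0 W i)" for i x
    using internal_nat_transD(3-5)[OF \<tau> L_category Y] internal_functorD(1-4)[OF coconeD(1)[OF cocone_L that] D_category[OF that(1)] L_category] \<tau>\<sigma>(2)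
    by (simp add: icomp_comp)
  then have "modification_of u (icomp E Y \<tau> \<sigma>) w =
      (\<lambda>i \<in> Ob J. modification_of v \<sigma> w i \<cdot>\<^bsub>fun_cat (F0 W i) (ifun_cat E (F0 D i) Y)\<^esub> modification_of u \<tau> v i)"
    by (simp add: as_modification_def fun_cat_simps(6) restrict_eq_iff cong: restrict_cong)
  then show "fa post (\<beta> \<cdot>\<^bsub>ifun_cat E L Y\<^esub> \<alpha>) = fa post \<beta> \<cdot>\<^bsub>two_nat_cat (op2 J) W (homs Y)\<^esub> fa post \<alpha>"
    by (simp add: post_fa \<tau> \<sigma> \<tau>\<sigma>(1) two_nat_cat_simps)
qed

lemma two_nat_of_inj:
  assumes u: "internal_functor E L Y u" and v: "internal_functor E L Y v" and eq: "two_nat_of u = two_nat_of v"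
  shows "u = v"
  by (rule ex1_unique[OF universal_ex1[OF Y cocone_post[OF v]]]) (use u v eq in \<open>simp_all add: as_two_nat_eq_iff\<close>)

lemma two_nat_of_surj:
  assumes "two_nat (op2 J) W (homs Y) T"
  obtains u where "internal_functor E L Y u" "T = two_nat_of u"
proof -
  obtain p' t' where c: "cocone Y p' t'" and T: "T = as_two_nat p' t'"
    using two_nat_components[OF Y assms] .
  obtain u where "internal_functor E L Y u" "\<forall>i \<in> Ob J. \<forall>x \<in> Obj (F0 W i). push u p i x = p' i x"
    "\<forall>i \<in> Ob J. \<forall>a \<in> Arr (F0 W i). snd u \<bullet> t i a = t' i a"
    using ex1_implies_ex[OF universal_ex1[OF Y c]] by blast
  then show ?thesis
    using that[of u] T by (simp add: as_two_nat_eq_iff)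
qed

text \<open>Bijectivity on objects is the universal property for 1-cells, and bijectivity on arrows
  is \<open>universal_two_cell\<close>. Surjectivity also uses that every 2-natural transformation
  and every modification is given by its components.\<close>

lemma isomorphism_post: "is_isomorphism (ifun_cat E L Y) (two_nat_cat (op2 J) W (homs Y)) post"
proof (rule is_isomorphismI[OF functor_post category_ifun_cat[OF L_category Y]])
  show "bij_betw (fo post) (Obj (ifun_cat E L Y)) (Obj (two_nat_cat (op2 J) W (homs Y)))"
    unfolding bij_betw_def
  proof
    show "inj_on (fo post) (Obj (ifun_cat E L Y))"
      by (rule inj_onI) (simp add: post_fo two_nat_of_inj)
    show "fo post ` Obj (ifun_cat E L Y) = Obj (two_nat_cat (op2 J) W (homs Y))"
    proof
      show "fo post ` Obj (ifun_cat E L Y) \<subseteq> Obj (two_nat_cat (op2 J) W (homs Y))"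
        using functorD(1)[OF functor_post] by blast
      show "Obj (two_nat_cat (op2 J) W (homs Y)) \<subseteq> fo post ` Obj (ifun_cat E L Y)"
      proof
        fix T
        assume "T \<in> Obj (two_nat_cat (op2 J) W (homs Y))"
        then obtain u where "internal_functor E L Y u" "T = two_nat_of u"
          using two_nat_of_surj unfolding two_nat_cat_simps by blast
        then show "T \<in> fo post ` Obj (ifun_cat E L Y)"
          by (intro image_eqI[of _ _ u]) (simp_all add: post_fo)
      qed
    qed
  qed
  show "bij_betw (fa post) (Arr (ifun_cat E L Y)) (Arr (two_nat_cat (op2 J) W (homs Y)))"
    unfolding bij_betw_def
  proof
    show "inj_on (fa post) (Arr (ifun_cat E L Y))"
    proof (rule inj_onI)
      fix \<alpha> \<beta>
      assume ab: "\<alpha> \<in> Arr (ifun_cat E L Y)" "\<beta> \<in> Arr (ifun_cat E L Y)" and eq: "fa post \<alpha> = fa post \<beta>"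
      obtain u \<tau> v where [simp]: "\<alpha> = (u, \<tau>, v)" by (cases \<alpha>)
      obtain u' \<sigma> v' where [simp]: "\<beta> = (u', \<sigma>, v')" by (cases \<beta>)
      have \<tau>: "internal_nat_trans E L Y u \<tau> v" and \<sigma>: "internal_nat_trans E L Y u' \<sigma> v'" using ab by simp_all
      note uv = internal_nat_transD(1,2)[OF \<tau> L_category Y] internal_nat_transD(1,2)[OF \<sigma> L_category Y]
      have eqs: "two_nat_of u = two_nat_of u'" "modification_of u \<tau> v = modification_of u' \<sigma> v'" "two_nat_of v = two_nat_of v'"
        using eq by (simp_all add: post_fa[OF \<tau>] post_fa[OF \<sigma>])
      \<comment> \<open>The ends of the two 2-cells must be identified first:
        \<open>universal_two_cell\<close> compares only transformations between the same two
        functors.\<close>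
      have [simp]: "u' = u" "v' = v"
        using two_nat_of_inj uv eqs by metis+
      have "\<sigma> \<bullet> fst (p i x) = \<tau> \<bullet> fst (p i x)" if "i \<in> Ob J" "x \<in> Obj (F0 W i)" for i x
        using as_modification_eqD[OF eqs(2) that] by simp
      then have "\<sigma> = \<tau>"
        by (intro ex1_unique[OF universal_two_cell[OF univ Y uv(1,2) cocone_modification_post[OF \<tau>]]])
          (use \<tau> \<sigma> in simp_all)
      then show "\<alpha> = \<beta>" by simp
    qed
    show "fa post ` Arr (ifun_cat E L Y) = Arr (two_nat_cat (op2 J) W (homs Y))"
    proof
      show "fa post ` Arr (ifun_cat E L Y) \<subseteq> Arr (two_nat_cat (op2 J) W (homs Y))"
        using functorD(2)[OF functor_post] by blast
      show "Arr (two_nat_cat (op2 J) W (homs Y)) \<subseteq> fa post ` Arr (ifun_cat E L Y)"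
      proof
        fix \<gamma>
        assume \<gamma>: "\<gamma> \<in> Arr (two_nat_cat (op2 J) W (homs Y))"
        obtain T m T' where [simp]: "\<gamma> = (T, m, T')" by (cases \<gamma>)
        have T: "two_nat (op2 J) W (homs Y) T" "two_nat (op2 J) W (homs Y) T'" and m: "modification (op2 J) W (homs Y) T T' m"
          using \<gamma> by (simp_all add: two_nat_cat_simps)
        obtain u where u: "internal_functor E L Y u" "T = two_nat_of u" using two_nat_of_surj[OF T(1)] .
        obtain v where v: "internal_functor E L Y v" "T' = two_nat_of v" using two_nat_of_surj[OF T(2)] .
        note cu = cocone_post[OF u(1)] and cv = cocone_post[OF v(1)]
        obtain n where n: "m = as_modification (push u p) (\<lambda>i a. snd u \<bullet> t i a) n (push v p) (\<lambda>i a. snd v \<bullet> t i a)"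
          using modification_components[OF Y cu cv] m unfolding u(2) v(2) by blast
        have "cocone_modification Y (push u p) (\<lambda>i a. snd u \<bullet> t i a) n (push v p) (\<lambda>i a. snd v \<bullet> t i a)"
          using m modification_iff[OF Y cu cv] unfolding u(2) v(2) n by blast
        then obtain \<tau> where \<tau>: "internal_nat_trans E L Y u \<tau> v"
          "\<forall>i \<in> Ob J. \<forall>x \<in> Obj (F0 W i). \<tau> \<bullet> fst (p i x) = n i x"
          using ex1_implies_ex[OF universal_two_cell[OF univ Y u(1) v(1)]] by blast
        have "m = modification_of u \<tau> v"
          unfolding n by (rule as_modification_cong) (use \<tau>(2) in simp)
        then show "\<gamma> \<in> fa post ` Arr (ifun_cat E L Y)"
          using \<tau>(1) u v by (intro image_eqI[of _ _ "(u, \<tau>, v)"]) (simp_all add: post_fa)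
      qed
    qed
  qed
qed (auto simp: two_nat_cat_def)

end

lemma weighted_colimit: "is_weighted_colimit J W (Cat E) D L (as_two_nat p t)"
  unfolding is_weighted_colimit_def using two_nat_mk[OF L_category cocone_L] isomorphism_post by simp

end

end

theorem theorem5p2:
  fixes E :: "('o, 'a) cat"
  assumes "category E"
    and "extensive E"
    and "has_pullbacks E"
    and "has_pullback_stable_coequalisers E"
    and "has_left_adjoint (underlying_cat (Cat E)) (Gph E) forgetful"
  shows "has_finite_2colimits TYPE('i \<times> 'f \<times> 'd \<times> 'w \<times> 'v) (Cat E)"
  unfolding has_finite_2colimits_def
proof (intro allI impI)
  fix J :: "('i, 'f, 'd) twocat" and W :: "('i, 'f, 'd, 'w, 'v) catvalued" and D
  assume "finite_weight J W" and "two_functor J (Cat E) D"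
  then interpret weighted_diagram E J W D
    using assms(1,3,4) by unfold_locales
  have "has_finite_coproducts E"
    using assms(2) unfolding extensive_def by (rule conjunct1)
  then obtain L p t where "is_universal L p t"
    by (rule universal_cocone_exists[OF _ assms(5)])
  then show "\<exists>L l. is_weighted_colimit J W (Cat E) D L l"
    using weighted_colimit by blast
qed
end
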